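(* Let $d,s\in\mathbb N$, $2<q,\sigma<\infty$, $l>0$, and for $j=1,\dots,s$ let $r_j>0$, $q\le p_j\le\infty$, $1\le\theta_j\le\infty$, $\alpha_j:=r_j-l$. Put $\overline r_j=(r_j,\dots,r_j)\in\mathbb R^d$, $\overline l=(l,\dots,l)\in\mathbb R^d$. Suppose that $\alpha_s>0$ and that $$\alpha_1<\alpha_2<\dots<\alpha_s,\qquad \alpha_1-\tfrac1{p_1}>\alpha_2-\tfrac1{p_2}>\dots>\alpha_s-\tfrac1{p_s}.$$ In the case $1\le\theta_s<\sigma$ assume also that $\alpha_s\ne\frac{\omega_{\theta_s,\sigma}}2$. Set $$\alpha_*=\alpha_s,\qquad \beta_*=\begin{cases}\alpha_*+\frac1\sigma-\frac1{\max\{\theta_s,2\}}&\text{if }\alpha_s>\frac{\omega_{\theta_s,\sigma}}2,\\[2pt] \frac{2\alpha_*}{\sigma}&\text{if }\alpha_s<\frac{\omega_{\theta_s,\sigma}}2.\end{cases}$$ Then there are constants $0<c\le C<\infty$ depending only on $\mathfrak Z=(d,s,r_1,\dots,r_s,l,q,\sigma,p_1,\dots,p_s,\theta_1,\dots,\theta_s)$ such that for all integers $n\ge2$ $$c\,n^{-\alpha_*}(\log n)^{(d-1)\beta_*}\le d_n\Bigl(\bigcap_{j=1}^sSB^{\overline r_j}_{p_j,\theta_j}(\mathbb T^d),\,B^{\overline l}_{q,\sigma}(\mathbb T^d)\Bigr)\le C\,n^{-\alpha_*}(\log n)^{(d-1)\beta_*}.$$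
   Context: Notation: $\mathbb N=\{1,2,\dots\}$, $\mathbb Z_+=\{0,1,2,\dots\}$, $1/\infty:=0$, $\log:=\log_2$. Besov spaces. $\mathbb T^d=[0,2\pi]^d$ with the endpoints of each interval glued; $(\cdot,\cdot)$ is the standard inner product on $\mathbb R^d$; $f\in L_1(\mathbb T^d)$ has Fourier series $\sum_{\overline k\in\mathbb Z^d}c_{\overline k}(f)e^{i(\overline k,\cdot)}$. Fix an infinitely smooth $\eta_0:\mathbb R\to[0,1]$ equal to $1$ on $[-1,1]$ and to $0$ outside $[-3/2,3/2]$; for $k\in\mathbb N$ let $\eta_k(t)=\eta_0(2^{-k}t)-\eta_0(2^{-k+1}t)$. For $\overline m=(m_1,\dots,m_d)\in\mathbb Z_+^d$ let $\eta_{\overline m}(\overline\xi)=\prod_{j=1}^d\eta_{m_j}(\xi_j)$ and $\Delta_{\overline m}f=\sum_{\overline k\in\mathbb Z^d}\eta_{\overline m}(\overline k)c_{\overline k}(f)e^{i(\overline k,\cdot)}$. For $\overline r\in(0,\infty)^d$, $1\le p,\theta\le\infty$, $x\in L_p(\mathbb T^d)$ let $\|x\|_{B^{\overline r}_{p,\theta}(\mathbb T^d)}=\bigl\|\{2^{(\overline m,\overline r)}\|\Delta_{\overline m}x\|_{L_p(\mathbb T^d)}\}_{\overline m\in\mathbb Z_+^d}\bigr\|_{l_\theta}$; $B^{\overline r}_{p,\theta}(\mathbb T^d)$ is the normed space of $x\in L_p(\mathbb T^d)$ with finite norm, and $SB^{\overline r}_{p,\theta}(\mathbb T^d)$ is its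 unit ball. Kolmogorov width: for a set $M$, a normed space $X$ and $n\in\mathbb Z_+$, $d_n(M,X)=\inf_{L}\sup_{x\in M}\inf_{y\in L}\|x-y\|_X$, where $L$ ranges over the linear subspaces of $X$ of dimension at most $n$; $\|z\|_X=+\infty$ if $z\notin X$. For $2<q<\infty$, $1\le p\le\infty$: $\omega_{p,q}=0$ if $p>q$, $\omega_{p,q}=\frac{1/p-1/q}{1/2-1/q}$ if $2<p\le q$, $\omega_{p,q}=1$ if $1\le p\le2$ (and $\omega_{\theta,\sigma}$ is given by the same formula with $(p,q)$ replaced by $(\theta,\sigma)$). *)

theory Defs
  imports
    "HOL-Analysis.Analysis"
    "HOL-Probability.Essential_Supremum"
    "HOL-Library.Function_Algebras"
begin

section \<open>Exponents and norms\<close>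

text \<open>Exponents \<open>p \<in> [1,\<infinity>]\<close> are extended nonnegative reals. Since \<open>inverse top = 0\<close> in
  \<^typ>\<open>ennreal\<close>, the following realises the convention \<open>1/\<infinity> = 0\<close>.\<close>

definition recip :: "ennreal \<Rightarrow> real" where
  "recip p = enn2real (inverse p)"

definition ennreal_powr :: "ennreal \<Rightarrow> real \<Rightarrow> ennreal" where
  "ennreal_powr a t = (if a = top then top else ennreal (enn2real a powr t))"

text \<open>The (possibly infinite) \<open>L\<^sub>p\<close>-norm of a nonnegative function. It is used both for Lebesgue
  measure on the torus and, with \<open>M = count_space UNIV\<close>, for the sequence norms \<open>l\<^sub>\<theta>\<close>.\<close>

definition enn_Lp_norm :: "'a measure \<Rightarrow> ennreal \<Rightarrow> ('a \<Rightarrow> ennreal) \<Rightarrow> ennreal" where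
  "enn_Lp_norm M p g =
     (if p = top then esssup M g
      else ennreal_powr (\<integral>\<^sup>+x. ennreal_powr (g x) (enn2real p) \<partial>M) (recip p))"

abbreviation enn_lseq_norm :: "ennreal \<Rightarrow> ('a \<Rightarrow> ennreal) \<Rightarrow> ennreal" where
  "enn_lseq_norm \<theta> a \<equiv> enn_Lp_norm (count_space UNIV) \<theta> a"

lemma enn_lseq_norm_top: "enn_lseq_norm top a = (SUP m. a m)"
proof -
  have "Limsup (ae_filter (count_space UNIV)) a = (SUP m. a m)"
  proof (rule antisym)
    show "Limsup (ae_filter (count_space UNIV)) a \<le> (SUP m. a m)"
      by (rule Limsup_bounded) (auto intro: SUP_upper)
    have "(SUP m. a m) \<le> Sup (a ` Collect P)"
      if "eventually P (ae_filter (count_space UNIV))" for P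
      using that by (auto simp: AE_count_space intro!: SUP_mono)
    then show "(SUP m. a m) \<le> Limsup (ae_filter (count_space UNIV)) a"
      unfolding Limsup_def by (auto intro!: INF_greatest)
  qed
  then show ?thesis by (simp add: enn_Lp_norm_def esssup_def)
qed


section \<open>Functions on the torus\<close>

text \<open>The dimension \<open>d\<close> is \<open>CARD('d)\<close>. A function on the torus is represented by a function
  on \<open>\<real>\<^sup>d\<close> of which only the values on the cube \<open>[0,2\<pi>]\<^sup>d\<close> matter. We work with
  representatives instead of classes modulo null sets, so the norms below are seminorms on functions;
  this changes neither norms nor widths.\<close>

definition torus_measure :: "(real ^ 'd) measure" where
  "torus_measure = lebesgue_on (cbox 0 (\<chi> i. 2 * pi))"

definition torus_Lp_norm :: "ennreal \<Rightarrow> (real ^ 'd \<Rightarrow> complex) \<Rightarrow> ennreal" where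
  "torus_Lp_norm p f = enn_Lp_norm torus_measure p (\<lambda>x. ennreal (norm (f x)))"

definition torus_Lp :: "ennreal \<Rightarrow> (real ^ 'd \<Rightarrow> complex) set" where
  "torus_Lp p = {f. f \<in> borel_measurable torus_measure \<and> torus_Lp_norm p f < top}"

definition real_vec :: "int ^ 'd \<Rightarrow> real ^ 'd" where
  "real_vec k = (\<chi> j. real_of_int (k $ j))"

definition fourier_coeff :: "(real ^ 'd \<Rightarrow> complex) \<Rightarrow> int ^ 'd \<Rightarrow> complex" where
  "fourier_coeff f k =
     (\<integral>x. f x * cis (- (real_vec k \<bullet> x)) \<partial>torus_measure) / of_real ((2 * pi) ^ CARD('d))"


section \<open>Besov spaces\<close>

definition smooth_cutoff :: "(real \<Rightarrow> real) \<Rightarrow> bool" where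
  "smooth_cutoff \<eta>0 \<longleftrightarrow>
     (\<forall>n. (deriv ^^ n) \<eta>0 differentiable_on UNIV) \<and>
     (\<forall>t. \<eta>0 t \<in> {0..1}) \<and>
     (\<forall>t\<in>{-1..1}. \<eta>0 t = 1) \<and>
     (\<forall>t. t \<notin> {-3/2..3/2} \<longrightarrow> \<eta>0 t = 0)"

definition eta :: "(real \<Rightarrow> real) \<Rightarrow> nat \<Rightarrow> real \<Rightarrow> real" where
  "eta \<eta>0 k t =
     (if k = 0 then \<eta>0 t
      else \<eta>0 (2 powr (- real k) * t) - \<eta>0 (2 powr (- real k + 1) * t))"

definition eta_vec :: "(real \<Rightarrow> real) \<Rightarrow> nat ^ 'd \<Rightarrow> real ^ 'd \<Rightarrow> real" where
  "eta_vec \<eta>0 m \<xi> = (\<Prod>j\<in>UNIV. eta \<eta>0 (m $ j) (\<xi> $ j))"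

text \<open>The sum over the frequencies \<open>k\<close> has only finitely many nonzero terms.\<close>

definition Delta ::
    "(real \<Rightarrow> real) \<Rightarrow> nat ^ 'd \<Rightarrow> (real ^ 'd \<Rightarrow> complex) \<Rightarrow> real ^ 'd \<Rightarrow> complex" where
  "Delta \<eta>0 m f x =
     (\<Sum>\<^sub>\<infinity>k\<in>UNIV. of_real (eta_vec \<eta>0 m (real_vec k)) * fourier_coeff f k * cis (real_vec k \<bullet> x))"

text \<open>The norm takes the value \<open>top\<close> exactly at the functions that do not belong to the space,
  in particular at those outside \<open>L\<^sub>p\<close>.\<close>

definition besov_norm ::
    "(real \<Rightarrow> real) \<Rightarrow> real ^ 'd \<Rightarrow> ennreal \<Rightarrow> ennreal \<Rightarrow> (real ^ 'd \<Rightarrow> complex) \<Rightarrow> ennreal" where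
  "besov_norm \<eta>0 r p \<theta> x =
     (if x \<in> torus_Lp p
      then enn_lseq_norm \<theta>
             (\<lambda>m. ennreal (2 powr (\<Sum>j\<in>UNIV. real (m $ j) * r $ j)) * torus_Lp_norm p (Delta \<eta>0 m x))
      else top)"

definition besov_ball ::
    "(real \<Rightarrow> real) \<Rightarrow> real ^ 'd \<Rightarrow> ennreal \<Rightarrow> ennreal \<Rightarrow> (real ^ 'd \<Rightarrow> complex) set" where
  "besov_ball \<eta>0 r p \<theta> = {x. besov_norm \<eta>0 r p \<theta> x \<le> 1}"


section \<open>Kolmogorov widths\<close>

text \<open>The space \<open>X\<close> is given by its norm \<open>N\<close> on an ambient vector space, as \<open>X = {y. N y < top}\<close>.
  ``Dimension at most \<open>n\<close>'' is expressed by a spanning set of at most \<open>n\<close> vectors, because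
  \<^const>\<open>vector_space.dim\<close> is 0 on infinite-dimensional spaces.\<close>

definition kolmogorov_width ::
    "('k::field \<Rightarrow> 'v \<Rightarrow> 'v::ab_group_add) \<Rightarrow> ('v \<Rightarrow> ennreal) \<Rightarrow> 'v set \<Rightarrow> nat \<Rightarrow> ennreal" where
  "kolmogorov_width smul N M n =
     (INF L \<in> {L. module.subspace smul L \<and> L \<subseteq> {y. N y < top} \<and>
                  (\<exists>B. finite B \<and> card B \<le> n \<and> module.span smul B = L)}.
        SUP x\<in>M. INF y\<in>L. N (x - y))"

definition fun_scale :: "complex \<Rightarrow> ('a \<Rightarrow> complex) \<Rightarrow> 'a \<Rightarrow> complex" where
  "fun_scale c f = (\<lambda>x. c * f x)"

lemma vector_space_fun_scale: "vector_space fun_scale"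
  by unfold_locales (auto simp: fun_scale_def fun_eq_iff algebra_simps)

definition besov_width ::
    "(real \<Rightarrow> real) \<Rightarrow> real ^ 'd \<Rightarrow> ennreal \<Rightarrow> ennreal \<Rightarrow> (real ^ 'd \<Rightarrow> complex) set \<Rightarrow> nat \<Rightarrow> ennreal" where
  "besov_width \<eta>0 l q \<sigma> M n = kolmogorov_width fun_scale (besov_norm \<eta>0 l q \<sigma>) M n"


section \<open>The exponents in the order estimate\<close>

definition omega :: "ennreal \<Rightarrow> real \<Rightarrow> real" where
  "omega p q =
     (if p > ennreal q then 0
      else if p > 2 then (recip p - 1 / q) / (1 / 2 - 1 / q)
      else 1)"

text \<open>The borderline case \<open>\<alpha> = omega \<theta> \<sigma> / 2\<close> is excluded wherever this is used.\<close>

definition beta_exponent :: "real \<Rightarrow> ennreal \<Rightarrow> real \<Rightarrow> real" where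
  "beta_exponent \<alpha> \<theta> \<sigma> =
     (if \<alpha> > omega \<theta> \<sigma> / 2 then \<alpha> + 1 / \<sigma> - recip (max \<theta> 2) else 2 * \<alpha> / \<sigma>)"

end

theory Submission
  imports Defs
begin

text \<open>Since \<open>q \<le> p\<^sub>j\<close> and \<open>r\<^sub>j \<le> r\<^sub>s\<close>, only the condition with \<open>j = s\<close> matters. It bounds the
  weighted \<open>L\<^sub>q\<close> norms of the blocks \<open>\<Delta>\<^sub>m x\<close>. There are about \<open>j\<close> to the power \<open>d - 1\<close> blocks of level
  \<open>m\<^sub>1 + \<dots> + m\<^sub>d = j\<close>, and each of them has about \<open>2\<close> to the power \<open>j\<close> frequencies.

  Upper bound: the frequencies of low level are kept. In a range of critical levels, the blocks in
  which \<open>x\<close> exceeds a threshold are approximated and the others are dropped; the threshold balances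
  the two errors. The approximation rests on Gluskin's observation that \<open>n\<close> random sign vectors
  approximate the Euclidean unit ball in a given norm up to a multiple of \<open>1/n\<close> times the mean norm of
  their sum. For \<open>\<theta>\<^sub>s \<ge> \<sigma>\<close> dropping the high levels is already optimal.

  Lower bound: Rudin--Shapiro polynomials have flat modulus, so that their norms in all \<open>L\<^sub>p\<close> are
  comparable. Placed in single blocks or in all blocks of a level simultaneously, and averaged over
  shifts, they force every good approximating space to have a large dimension, because the squared
  projections onto it add up to at most its dimension.\<close>

section \<open>Averages over signs\<close>

text \<open>The number \<omega> and the two regimes come from one computation. On level j, n vectors
  leave the error factor X = sqrt (2^j / n) (j+1)^((d-1)/\<sigma>) relative to the Euclidean norm.
  Balancing approximated against dropped blocks turns X into X^\<omega>, so level j contributes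
  2^(-\<alpha> j) X^\<omega>, which for fixed n behaves like 2^((\<omega>/2 - \<alpha>) j) up to
  powers of j. For \<alpha> > \<omega>/2 the lowest levels that are not kept dominate, where 2^j
  j^(d-1) is of order n. For \<alpha> < \<omega>/2 the highest ones do, up to where X is about 1,
  that is where 2^j j^(2(d-1)/\<sigma>) is of order n; beyond it dropping is better. These two
  levels give the two values of \<beta>. The obstacle is that the blocks above the threshold depend
  on the function, whereas a width admits one subspace for all functions. Hence the sign vectors
  approximate the whole Euclidean ball of a level, and the selected blocks enter only through their
  Euclidean norm.\<close>

text \<open>A subset \<open>A\<close> of a finite set \<open>I\<close> encodes the sign vector that is \<open>1\<close> on \<open>A\<close> and \<open>-1\<close> on
  \<open>I - A\<close>.\<close>

definition sgn_of :: "'a set \<Rightarrow> 'a \<Rightarrow> real" where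
  "sgn_of A k = (if k \<in> A then 1 else -1)"

text \<open>The expectation for independent uniform signs on \<open>I\<close>, written as a finite
  sum so that no probability space is needed. \<open>lin\<close> below is the Rademacher sum with
  coefficients \<open>z\<close>.\<close>

definition avg :: "'a set \<Rightarrow> ('a set \<Rightarrow> real) \<Rightarrow> real" where
  "avg I F = (\<Sum>A\<in>Pow I. F A) / 2 ^ card I"

definition lin :: "'a set \<Rightarrow> ('a \<Rightarrow> real) \<Rightarrow> 'a set \<Rightarrow> real" where
  "lin I z A = (\<Sum>k\<in>I. sgn_of A k * z k)"

lemma avg_empty [simp]: "avg {} F = F {}"
  by (simp add: avg_def)

lemma avg_insert:
  assumes "finite I" "a \<notin> I"
  shows "avg (insert a I) F = (avg I F + avg I (\<lambda>A. F (insert a A))) / 2"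
proof -
  have inj: "inj_on (insert a) (Pow I)" using assms by (auto simp: inj_on_def)
  have "(\<Sum>A\<in>Pow (insert a I). F A) = (\<Sum>A\<in>Pow I. F A) + (\<Sum>A\<in>insert a ` Pow I. F A)"
    using assms by (subst Pow_insert, subst sum.union_disjoint) auto
  also have "(\<Sum>A\<in>insert a ` Pow I. F A) = (\<Sum>A\<in>Pow I. F (insert a A))"
    using inj by (simp add: sum.reindex)
  finally show ?thesis using assms by (simp add: avg_def field_simps)
qed

lemma avg_mono: "(\<And>A. A \<subseteq> I \<Longrightarrow> F A \<le> G A) \<Longrightarrow> avg I F \<le> avg I G"
  unfolding avg_def by (intro divide_right_mono sum_mono) auto

lemma avg_cong: "(\<And>A. A \<subseteq> I \<Longrightarrow> F A = G A) \<Longrightarrow> avg I F = avg I G"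
  unfolding avg_def by (auto intro!: arg_cong[where f = "\<lambda>x. x / _"] sum.cong)

lemma avg_add: "avg I (\<lambda>A. F A + G A) = avg I F + avg I G"
  by (simp add: avg_def sum.distrib add_divide_distrib)

lemma avg_cmult: "avg I (\<lambda>A. c * F A) = c * avg I F"
  by (simp add: avg_def sum_distrib_left[symmetric])

lemma avg_diff: "avg I (\<lambda>A. F A - G A) = avg I F - avg I G"
  by (simp add: avg_def sum_subtractf diff_divide_distrib)

lemma avg_const [simp]: "finite I \<Longrightarrow> avg I (\<lambda>_. c) = c"
  by (simp add: avg_def card_Pow)

lemma avg_Compl: "avg I (\<lambda>A. F (I - A)) = avg I F"
  unfolding avg_def
  by (rule arg_cong[where f = "\<lambda>x. x / _"],
      rule sum.reindex_bij_witness[where i = "\<lambda>A. I - A" and j = "\<lambda>A. I - A"]) auto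

lemma lin_Compl: "A \<subseteq> I \<Longrightarrow> lin I z (I - A) = - lin I z A"
  unfolding lin_def sum_negf[symmetric] by (rule sum.cong) (auto simp: sgn_of_def)

text \<open>Conditioning on the sign at \<open>a\<close>, which takes both values with weight 1/2.
  With \<phi> a power or the exponential function this is the induction step of the moment bounds
  that follow.\<close>

lemma avg_lin_insert:
  assumes "finite I" "a \<notin> I"
  shows "avg (insert a I) (\<lambda>A. \<phi> (lin (insert a I) z A))
    = avg I (\<lambda>A. (\<phi> (lin I z A - z a) + \<phi> (lin I z A + z a)) / 2)"
proof -
  have 1: "lin (insert a I) z A = lin I z A - z a" if "A \<subseteq> I" for A
    using that assms by (auto simp: lin_def sgn_of_def)
  have "lin I z (insert a A) = lin I z A" for A
    unfolding lin_def by (rule sum.cong) (use assms in \<open>auto simp: sgn_of_def\<close>)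
  then have 2: "lin (insert a I) z (insert a A) = lin I z A + z a" for A
    using assms by (simp add: lin_def sgn_of_def)
  have "avg (insert a I) (\<lambda>A. \<phi> (lin (insert a I) z A))
     = (avg I (\<lambda>A. \<phi> (lin I z A - z a)) + avg I (\<lambda>A. \<phi> (lin I z A + z a))) / 2"
    unfolding avg_insert[OF assms] by (simp add: 2, rule avg_cong) (simp add: 1)
  also have "\<dots> = avg I (\<lambda>A. (1/2) * (\<phi> (lin I z A - z a) + \<phi> (lin I z A + z a)))"
    by (simp only: avg_cmult avg_add)
  finally show ?thesis by simp
qed

lemma avg_lin_square: "finite I \<Longrightarrow> avg I (\<lambda>A. (lin I z A)\<^sup>2) = (\<Sum>k\<in>I. (z k)\<^sup>2)"
proof (induction I rule: finite_induct)
  case empty show ?case by (simp add: lin_def)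
next
  case (insert a I)
  have "avg (insert a I) (\<lambda>A. (lin (insert a I) z A)\<^sup>2) = avg I (\<lambda>A. (lin I z A)\<^sup>2 + (z a)\<^sup>2)"
    unfolding avg_lin_insert[OF insert(1,2), of "\<lambda>x. x\<^sup>2"]
    by (rule avg_cong) (simp add: power2_eq_square algebra_simps)
  then show ?case using insert by (simp add: avg_add)
qed

lemma avg_lin_fourth: "finite I \<Longrightarrow> avg I (\<lambda>A. (lin I z A) ^ 4) \<le> 3 * (\<Sum>k\<in>I. (z k)\<^sup>2)\<^sup>2"
proof (induction I rule: finite_induct)
  case empty show ?case by (simp add: lin_def)
next
  case (insert a I)
  let ?S = "\<Sum>k\<in>I. (z k)\<^sup>2"
  have "avg (insert a I) (\<lambda>A. (lin (insert a I) z A) ^ 4)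
    = avg I (\<lambda>A. (lin I z A) ^ 4 + (6 * (z a)\<^sup>2 * (lin I z A)\<^sup>2 + (z a) ^ 4))"
    unfolding avg_lin_insert[OF insert(1,2), of "\<lambda>x. x ^ 4"]
    by (rule avg_cong) (simp add: power2_eq_square power4_eq_xxxx algebra_simps)
  also have "\<dots> = avg I (\<lambda>A. (lin I z A) ^ 4) + (6 * (z a)\<^sup>2 * ?S + (z a) ^ 4)"
    using insert by (simp add: avg_add avg_cmult avg_lin_square)
  also have "\<dots> \<le> 3 * ?S\<^sup>2 + (6 * (z a)\<^sup>2 * ?S + (z a) ^ 4)" using insert by simp
  also have "\<dots> \<le> 3 * ?S\<^sup>2 + (6 * (z a)\<^sup>2 * ?S + 3 * ((z a)\<^sup>2)\<^sup>2)"
    by (simp add: power_even_eq[symmetric] flip: power_mult)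
  also have "\<dots> = 3 * (?S + (z a)\<^sup>2)\<^sup>2"
    by (simp add: power2_eq_square algebra_simps)
  finally show ?case using insert by (simp add: algebra_simps)
qed

section \<open>Exponential moments and Khinchine's inequalities\<close>

lemma exp_sums: "(\<lambda>n. x ^ n / fact n) sums exp x" for x :: real
proof -
  have "(\<lambda>n. x ^ n /\<^sub>R fact n) = (\<lambda>n. x ^ n / fact n)" by (simp add: fun_eq_iff divide_inverse)
  then show ?thesis using exp_converges[of x] by simp
qed

text \<open>The left side is exp y * cosh c, and cosh c is at most exp (c^2/2) term by term in the
  power series because 2^n n! is at most (2n)!. This makes sign sums subgaussian.\<close>

lemma exp_sum_le: "(exp (y - c) + exp (y + c)) / 2 \<le> exp y * exp (c\<^sup>2 / 2)" for y c :: real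
proof -
  have "cosh c \<le> exp (c\<^sup>2 / 2)"
  proof -
    have s1: "(\<lambda>n. c ^ (2*n) / fact (2*n)) sums cosh c"
    proof -
      have "(\<lambda>n. if even n then c ^ n /\<^sub>R fact n else 0) sums cosh c" by (rule cosh_converges)
      then have "(\<lambda>n. (\<lambda>n. if even n then c ^ n /\<^sub>R fact n else 0) (2*n)) sums cosh c"
        by (subst sums_mono_reindex[of "\<lambda>n. 2*n"]) (auto simp: strict_mono_def image_iff elim!: evenE)
      then show ?thesis by (simp add: divide_inverse mult.commute)
    qed
    have s2: "(\<lambda>n. (c\<^sup>2/2) ^ n / fact n) sums exp (c\<^sup>2/2)"
      by (rule exp_sums)
    have f: "(2::real) ^ n * fact n \<le> fact (2*n)" for n
    proof (induction n)
      case (Suc n)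
      have "(2::real) ^ Suc n * fact (Suc n) = (2 * real (Suc n)) * (2 ^ n * fact n)" by simp
      also have "\<dots> \<le> (2 * real (Suc n)) * fact (2*n)" using Suc by (intro mult_left_mono) auto
      also have "\<dots> \<le> (2 * real (Suc n)) * ((2 * real n + 1) * fact (2*n))"
        by (intro mult_left_mono) auto
      also have "\<dots> = fact (2 * Suc n)" by (simp add: algebra_simps)
      finally show ?case .
    qed simp
    show ?thesis
    proof (rule sums_le[OF _ s1 s2])
      fix n
      have "c ^ (2*n) / fact (2*n) \<le> c ^ (2*n) / (2 ^ n * fact n)"
        by (intro divide_left_mono f) (auto simp: power_mult)
      then show "c ^ (2*n) / fact (2*n) \<le> (c\<^sup>2/2) ^ n / fact n"
        unfolding power_mult[of c 2 n] power_divide divide_divide_eq_left by (simp add: mult.commute)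
    qed
  qed
  moreover have "(exp (y - c) + exp (y + c)) / 2 = exp y * cosh c"
    by (simp add: cosh_def exp_add exp_diff exp_minus field_simps)
  ultimately show ?thesis by simp
qed

lemma avg_exp_lin: "finite I \<Longrightarrow> avg I (\<lambda>A. exp (lin I z A)) \<le> exp ((\<Sum>k\<in>I. (z k)\<^sup>2) / 2)"
proof (induction I rule: finite_induct)
  case empty show ?case by (simp add: lin_def)
next
  case (insert a I)
  have "avg (insert a I) (\<lambda>A. exp (lin (insert a I) z A))
      \<le> avg I (\<lambda>A. exp ((z a)\<^sup>2/2) * exp (lin I z A))"
    unfolding avg_lin_insert[OF insert(1,2), of exp]
    by (rule avg_mono) (use exp_sum_le in \<open>simp add: mult.commute\<close>)
  also have "\<dots> \<le> exp ((z a)\<^sup>2/2) * exp ((\<Sum>k\<in>I. (z k)\<^sup>2) / 2)"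
    unfolding avg_cmult by (intro mult_left_mono insert) auto
  finally show ?case using insert by (simp add: exp_add[symmetric] add_divide_distrib)
qed

text \<open>Khinchine's lower bound for the first moment. Pointwise |y| dominates a combination of
  y^2 and y^4 scaled by powers of s, whose means are s^2 exactly and at most 3 s^4; what remains is
  5/9 s.\<close>

lemma avg_abs_lin_ge:
  assumes "finite I"
  shows "avg I (\<lambda>A. \<bar>lin I z A\<bar>) \<ge> sqrt (\<Sum>k\<in>I. (z k)\<^sup>2) / 2"
proof -
  define S where "S = (\<Sum>k\<in>I. (z k)\<^sup>2)"
  define s where "s = sqrt S"
  have S0: "S \<ge> 0" unfolding S_def by (intro sum_nonneg) auto
  show ?thesis
  proof (cases "S = 0")
    case True
    have "avg I (\<lambda>_. 0) \<le> avg I (\<lambda>A. \<bar>lin I z A\<bar>)" by (rule avg_mono) simp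
    then show ?thesis using True S_def assms by simp
  next
    case False
    then have s: "s > 0" "s\<^sup>2 = S" using S0 by (auto simp: s_def)
    \<comment> \<open>4/27 is the least possible coefficient: it is the maximum of (t - 1) / t^3,
      attained at t = 3/2, which is the double root of the polynomial below.\<close>
    have ineq: "t\<^sup>2 - 4/27 * t ^ 4 \<le> t" if "t \<ge> 0" for t :: real
    proof -
      have "0 \<le> t * ((1 - 2*t/3)\<^sup>2 * (1 + t/3))" using that by simp
      also have "\<dots> = t - t\<^sup>2 + 4/27 * t ^ 4"
        by (simp add: power2_eq_square power4_eq_xxxx field_simps)
      finally show ?thesis by simp
    qed
    have "avg I (\<lambda>A. (1/s) * (lin I z A)\<^sup>2 - (4/27/s^3) * (lin I z A)^4) \<le> avg I (\<lambda>A. \<bar>lin I z A\<bar>)"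
    proof (rule avg_mono)
      fix A
      define y where "y = \<bar>lin I z A\<bar>"
      have "s * ((y/s)\<^sup>2 - 4/27 * (y/s) ^ 4) \<le> s * (y/s)"
        using s by (intro mult_left_mono ineq) (auto simp: y_def)
      moreover have "s * ((y/s)\<^sup>2 - 4/27 * (y/s) ^ 4) = (1/s) * y\<^sup>2 - (4/27/s^3) * y^4"
        using s(1) by (simp add: power_divide right_diff_distrib power2_eq_square power3_eq_cube power4_eq_xxxx)
      ultimately have "(1/s) * y\<^sup>2 - (4/27/s^3) * y^4 \<le> y" using s(1) by simp
      then show "(1/s) * (lin I z A)\<^sup>2 - (4/27/s^3) * (lin I z A)^4 \<le> \<bar>lin I z A\<bar>"
        by (simp add: y_def)
    qed
    moreover have "avg I (\<lambda>A. (1/s) * (lin I z A)\<^sup>2 - (4/27/s^3) * (lin I z A)^4)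
      = S/s - (4/27/s^3) * avg I (\<lambda>A. (lin I z A)^4)"
      unfolding avg_diff avg_cmult using avg_lin_square[OF assms, of z] by (simp add: S_def)
    moreover have "(4/27/s^3) * avg I (\<lambda>A. (lin I z A)^4) \<le> (4/27/s^3) * (3 * S\<^sup>2)"
      using avg_lin_fourth[OF assms, of z] s by (intro mult_left_mono) (auto simp: S_def)
    moreover have "S/s = s" "(4/27/s^3) * (3 * S\<^sup>2) = 4/9 * s"
      using s(1) by (simp_all add: s(2)[symmetric] power2_eq_square power3_eq_cube)
    ultimately have "5/9 * s \<le> avg I (\<lambda>A. \<bar>lin I z A\<bar>)" by simp
    then have "s / 2 \<le> avg I (\<lambda>A. \<bar>lin I z A\<bar>)" using s(1) by linarith
    then show ?thesis by (simp add: s_def S_def)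
  qed
qed

section \<open>Several independent sign vectors\<close>

fun avgs :: "'a set \<Rightarrow> nat \<Rightarrow> ('a set list \<Rightarrow> real) \<Rightarrow> real" where
  "avgs I 0 F = F []"
| "avgs I (Suc n) F = avg I (\<lambda>A. avgs I n (\<lambda>As. F (A # As)))"

definition rows :: "'a set \<Rightarrow> nat \<Rightarrow> 'a set list set" where
  "rows I n = {As. length As = n \<and> set As \<subseteq> Pow I}"

lemma rows_Cons: "A \<subseteq> I \<Longrightarrow> As \<in> rows I n \<Longrightarrow> A # As \<in> rows I (Suc n)"
  by (auto simp: rows_def)

lemma avgs_mono: "(\<And>As. As \<in> rows I n \<Longrightarrow> F As \<le> G As) \<Longrightarrow> avgs I n F \<le> avgs I n G"
proof (induction n arbitrary: F G)
  case 0 then show ?case by (simp add: rows_def)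
next
  case (Suc n)
  show ?case unfolding avgs.simps
    by (intro avg_mono Suc.IH Suc.prems rows_Cons)
qed

lemma avgs_cong: "(\<And>As. As \<in> rows I n \<Longrightarrow> F As = G As) \<Longrightarrow> avgs I n F = avgs I n G"
  by (intro antisym avgs_mono) auto

lemma avgs_add: "avgs I n (\<lambda>A. F A + G A) = avgs I n F + avgs I n G"
  by (induction n arbitrary: F G) (simp_all add: avg_add)

lemma avgs_cmult: "avgs I n (\<lambda>A. c * F A) = c * avgs I n F"
  by (induction n arbitrary: F) (simp_all add: avg_cmult)

lemma avgs_const [simp]: "finite I \<Longrightarrow> avgs I n (\<lambda>_. c) = c"
  by (induction n) simp_all

lemma avgs_sum: "finite J \<Longrightarrow> avgs I n (\<lambda>A. \<Sum>j\<in>J. F j A) = (\<Sum>j\<in>J. avgs I n (F j))"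
proof (induction J rule: finite_induct)
  case empty show ?case using avgs_cmult[of I n 0 "\<lambda>_. 0"] by simp
qed (simp add: avgs_add)

text \<open>The probabilistic method: there are finitely many outcomes, and the mean cannot lie
  below their minimum.\<close>

lemma avgs_exists_le:
  assumes "finite I" shows "\<exists>As\<in>rows I n. F As \<le> avgs I n F"
proof (rule ccontr)
  assume "\<not> ?thesis"
  then have gt: "\<And>As. As \<in> rows I n \<Longrightarrow> avgs I n F < F As" by force
  have fin: "finite (rows I n)"
    using assms finite_lists_length_eq[of "Pow I" n] by (simp add: rows_def conj_commute)
  have "replicate n {} \<in> rows I n" by (auto simp: rows_def)
  then have ne: "F ` rows I n \<noteq> {}" by auto
  define m where "m = Min (F ` rows I n)"
  have "m \<in> F ` rows I n" unfolding m_def using fin ne by (intro Min_in) auto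
  then have "avgs I n F < m" using gt by auto
  moreover have "avgs I n (\<lambda>_. m) \<le> avgs I n F"
    by (rule avgs_mono) (use fin in \<open>auto simp: m_def\<close>)
  ultimately show False using assms by simp
qed

lemma avg_avgs_commute:
  "avg I (\<lambda>A. avgs I n (\<lambda>As. F A As)) = avgs I n (\<lambda>As. avg I (\<lambda>A. F A As))"
proof (induction n arbitrary: F)
  case (Suc n)
  have sw: "avg I (\<lambda>A. avg I (\<lambda>B. G A B)) = avg I (\<lambda>B. avg I (\<lambda>A. G A B))" for G :: "'a set \<Rightarrow> 'a set \<Rightarrow> real"
    by (simp add: avg_def sum_divide_distrib[symmetric]) (subst sum.swap, simp)
  show ?case unfolding avgs.simps by (subst sw) (simp add: Suc.IH)
qed simp

lemma avgs_exp_lin: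
  assumes "finite I"
  shows "avgs I n (\<lambda>As. exp (\<Sum>A\<leftarrow>As. lin I z A)) \<le> exp (real n * (\<Sum>k\<in>I. (z k)\<^sup>2) / 2)"
proof (induction n)
  case (Suc n)
  let ?S = "\<Sum>k\<in>I. (z k)\<^sup>2"
  have "avgs I (Suc n) (\<lambda>As. exp (\<Sum>A\<leftarrow>As. lin I z A))
    = avg I (\<lambda>A. avgs I n (\<lambda>As. exp (\<Sum>A\<leftarrow>As. lin I z A)) * exp (lin I z A))"
    by (simp add: exp_add avgs_cmult mult.commute)
  also have "\<dots> = avgs I n (\<lambda>As. exp (\<Sum>A\<leftarrow>As. lin I z A)) * avg I (\<lambda>A. exp (lin I z A))"
    by (simp add: avg_cmult)
  also have "\<dots> \<le> exp (real n * ?S / 2) * exp (?S / 2)"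
  proof (intro mult_mono Suc avg_exp_lin assms)
    have "avg I (\<lambda>A. 0) \<le> avg I (\<lambda>A. exp (lin I z A))" by (rule avg_mono) simp
    then show "0 \<le> avg I (\<lambda>A. exp (lin I z A))" using assms by simp
  qed simp
  also have "\<dots> = exp (real (Suc n) * ?S / 2)"
    by (simp add: exp_add[symmetric] field_simps)
  finally show ?case .
qed simp

lemma powr_le_exp: "\<exists>C>0. \<forall>y\<ge>0. y powr \<rho> \<le> C * exp (y::real)" if "\<rho> \<ge> 0"
proof (intro exI[of _ "fact (nat \<lceil>\<rho>\<rceil>) :: real"] conjI allI impI)
  fix y :: real assume y: "y \<ge> 0"
  define k where "k = nat \<lceil>\<rho>\<rceil>"
  have k: "\<rho> \<le> real k" unfolding k_def by linarith
  have e: "y ^ k / fact k \<le> exp y"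
  proof -
    note exp_sums[of y]
    then have "sum (\<lambda>n. y ^ n / fact n) {k} \<le> exp y"
      by (metis (no_types, lifting) divide_nonneg_nonneg fact_ge_zero finite.emptyI finite_insert sum_le_suminf sums_summable sums_unique y zero_le_power)
    then show ?thesis by simp
  qed
  show "y powr \<rho> \<le> fact (nat \<lceil>\<rho>\<rceil>) * exp y"
  proof (cases "y \<ge> 1")
    case True
    then have "y powr \<rho> \<le> y powr real k" using k by (intro powr_mono) auto
    also have "\<dots> = y ^ k" using True by (simp add: powr_realpow)
    also have "\<dots> \<le> fact k * exp y" using e by (simp add: field_simps)
    finally show ?thesis by (simp add: k_def)
  next
    case False
    then have "y powr \<rho> \<le> 1" using y that by (cases "y = 0") (auto simp: powr_le1)
    also have "1 \<le> fact k * exp y" using mult_mono[of 1 "fact k :: real" 1 "exp y"] y by (simp add: fact_ge_1)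
    finally show ?thesis by (simp add: k_def)
  qed
qed simp

text \<open>Khinchine's upper bound for all signs of the n vectors at once, with a constant
  depending on \<rho> alone. After division by sqrt Q the power is dominated by an exponential of
  the absolute value, hence by the exponentials of the sum and of its negative, and both have mean
  at most exp (1/2).\<close>

lemma avgs_powr_lin:
  assumes "\<rho> \<ge> 0"
  shows "\<exists>C>0. \<forall>(I::'a set) n z. finite I \<longrightarrow>
    avgs I n (\<lambda>As. \<bar>\<Sum>A\<leftarrow>As. lin I z A\<bar> powr \<rho>) \<le> C * (real n * (\<Sum>k\<in>I. (z k)\<^sup>2)) powr (\<rho>/2)"
proof -
  obtain C where C: "C > 0" "\<And>y. y \<ge> 0 \<Longrightarrow> y powr \<rho> \<le> C * exp (y::real)"
    using powr_le_exp[OF assms] by blast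
  have "avgs I n (\<lambda>As. \<bar>\<Sum>A\<leftarrow>As. lin I z A\<bar> powr \<rho>)
      \<le> (2 * C * exp (1/2)) * (real n * (\<Sum>k\<in>I. (z k)\<^sup>2)) powr (\<rho>/2)"
    if fin: "finite I" for I :: "'a set" and n z
  proof -
    define Q where "Q = real n * (\<Sum>k\<in>I. (z k)\<^sup>2)"
    have Q0: "Q \<ge> 0" unfolding Q_def by (intro mult_nonneg_nonneg sum_nonneg) auto
    show ?thesis
    proof (cases "Q = 0")
      case True
      have "(\<Sum>A\<leftarrow>As. lin I z A) = 0" if "As \<in> rows I n" for As
      proof (cases "n = 0")
        case True then show ?thesis using that by (simp add: rows_def)
      next
        case False
        then have "(\<Sum>k\<in>I. (z k)\<^sup>2) = 0" using True by (simp add: Q_def)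
        then have "\<forall>k\<in>I. z k = 0" using fin by (simp add: sum_nonneg_eq_0_iff)
        then have "lin I z A = 0" for A by (simp add: lin_def)
        then show ?thesis by simp
      qed
      then have "avgs I n (\<lambda>As. \<bar>\<Sum>A\<leftarrow>As. lin I z A\<bar> powr \<rho>) = avgs I n (\<lambda>_. 0)"
        by (intro avgs_cong) simp
      then show ?thesis using fin by (simp add: C(1) less_imp_le)
    next
      case False
      define t where "t = 1 / sqrt Q"
      have t: "t > 0" "t\<^sup>2 * Q = 1" "1/t = Q powr (1/2)"
        using False Q0 by (simp_all add: t_def powr_half_sqrt power_divide)
      have lz: "(\<Sum>A\<leftarrow>As. lin I (\<lambda>k. c * z k) A) = c * (\<Sum>A\<leftarrow>As. lin I z A)" for c As
        by (induction As) (simp_all add: lin_def sum_distrib_left algebra_simps)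
      have "avgs I n (\<lambda>As. \<bar>\<Sum>A\<leftarrow>As. lin I z A\<bar> powr \<rho>)
        \<le> avgs I n (\<lambda>As. C * (1/t) powr \<rho> * (exp (\<Sum>A\<leftarrow>As. lin I (\<lambda>k. t * z k) A)
                                 + exp (\<Sum>A\<leftarrow>As. lin I (\<lambda>k. (-t) * z k) A)))"
      proof (rule avgs_mono)
        fix As
        let ?y = "\<Sum>A\<leftarrow>As. lin I z A"
        have "\<bar>?y\<bar> powr \<rho> = (1/t) powr \<rho> * (t * \<bar>?y\<bar>) powr \<rho>"
          using t(1) by (simp flip: powr_mult)
        also have "\<dots> \<le> (1/t) powr \<rho> * (C * exp (t * \<bar>?y\<bar>))"
          using t by (intro mult_left_mono C) auto
        also have "exp (t * \<bar>?y\<bar>) \<le> exp (t * ?y) + exp ((-t) * ?y)"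
          by (cases "?y \<ge> 0") auto
        finally show "\<bar>?y\<bar> powr \<rho> \<le> C * (1/t) powr \<rho> * (exp (\<Sum>A\<leftarrow>As. lin I (\<lambda>k. t * z k) A)
                                 + exp (\<Sum>A\<leftarrow>As. lin I (\<lambda>k. (-t) * z k) A))"
          using C(1) unfolding lz by (simp add: mult_left_mono mult.assoc mult.left_commute)
      qed
      also have "\<dots> = C * (1/t) powr \<rho> * (avgs I n (\<lambda>As. exp (\<Sum>A\<leftarrow>As. lin I (\<lambda>k. t * z k) A))
                 + avgs I n (\<lambda>As. exp (\<Sum>A\<leftarrow>As. lin I (\<lambda>k. (-t) * z k) A)))"
        by (simp only: avgs_cmult avgs_add)
      also have "\<dots> \<le> C * (1/t) powr \<rho> * (exp (1/2) + exp (1/2))"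
      proof -
        have "real n * (\<Sum>k\<in>I. (c * z k)\<^sup>2) / 2 = c\<^sup>2 * Q / 2" for c
          by (simp add: Q_def power_mult_distrib sum_distrib_left[symmetric])
        then have "avgs I n (\<lambda>As. exp (\<Sum>A\<leftarrow>As. lin I (\<lambda>k. c * z k) A)) \<le> exp (c\<^sup>2 * Q / 2)" for c
          using avgs_exp_lin[OF fin, of n "\<lambda>k. c * z k"] by simp
        from this[of t] this[of "-t"] show ?thesis
          using C(1) t by (intro mult_left_mono add_mono) auto
      qed
      also have "(1/t) powr \<rho> = Q powr (\<rho>/2)" unfolding t(3) by (simp add: powr_powr)
      finally show ?thesis by (simp add: Q_def algebra_simps)
    qed
  qed
  then show ?thesis using C(1) by (intro exI[of _ "2 * C * exp (1/2)"]) auto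
qed

section \<open>Kolmogorov widths of Euclidean balls\<close>

text \<open>Whichever sign attains |t x|, the point x is charged to the supremum with that sign and
  y to the other one; this is allowed because -|t y| is at most t y and at most -t y.\<close>

lemma SUP_abs_contraction:
  fixes a t :: "'b \<Rightarrow> real"
  assumes "K \<noteq> {}" "bdd_above ((\<lambda>z. a z + t z) ` K)" "bdd_above ((\<lambda>z. a z - t z) ` K)"
  shows "(SUP z\<in>K. a z + \<bar>t z\<bar>) + (SUP z\<in>K. a z - \<bar>t z\<bar>) \<le> (SUP z\<in>K. a z + t z) + (SUP z\<in>K. a z - t z)"
proof -
  let ?R = "(SUP z\<in>K. a z + t z) + (SUP z\<in>K. a z - t z)"
  have up: "a z + t z \<le> (SUP z\<in>K. a z + t z)" "a z - t z \<le> (SUP z\<in>K. a z - t z)" if "z \<in> K" for z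
    using that assms by (auto intro: cSUP_upper)
  have pair: "(a x + \<bar>t x\<bar>) + (a y - \<bar>t y\<bar>) \<le> ?R" if "x \<in> K" "y \<in> K" for x y
    using up[OF that(1)] up[OF that(2)] by linarith
  have "(SUP z\<in>K. a z + \<bar>t z\<bar>) \<le> ?R - (a y - \<bar>t y\<bar>)" if "y \<in> K" for y
    using assms(1) pair that by (intro cSUP_least) (auto simp: algebra_simps)
  then have "(SUP z\<in>K. a z - \<bar>t z\<bar>) \<le> ?R - (SUP z\<in>K. a z + \<bar>t z\<bar>)"
    using assms(1) by (intro cSUP_least) (auto simp: algebra_simps)
  then show ?thesis by simp
qed

lemma lin_bounded:
  assumes "\<And>k. k \<in> I \<Longrightarrow> \<bar>z k\<bar> \<le> R"
  shows "\<bar>lin I z A\<bar> \<le> real (card I) * R"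
proof -
  have "\<bar>lin I z A\<bar> \<le> (\<Sum>k\<in>I. \<bar>z k\<bar>)"
    unfolding lin_def by (rule order_trans[OF sum_abs]) (auto intro!: sum_mono simp: sgn_of_def abs_mult)
  also have "\<dots> \<le> real (card I) * R" using assms by (intro sum_bounded_above) auto
  finally show ?thesis .
qed

text \<open>Symmetrisation followed by the contraction principle for the absolute value.\<close>

lemma avg_SUP_deviation:
  assumes fin: "finite I" and K: "K \<noteq> {}" and a: "\<And>z. z \<in> K \<Longrightarrow> a z \<le> Ra"
    and R: "\<And>z k. z \<in> K \<Longrightarrow> k \<in> I \<Longrightarrow> \<bar>z k\<bar> \<le> R"
  shows "avg I (\<lambda>A. SUP z\<in>K. a z + (avg I (\<lambda>B. \<bar>lin I z B\<bar>) - \<bar>lin I z A\<bar>))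
    \<le> avg I (\<lambda>A. SUP z\<in>K. a z + 2 * lin I z A)"
proof -
  define T where "T = real (card I) * R"
  have lb: "\<bar>lin I z A\<bar> \<le> T" if "z \<in> K" for z A
    unfolding T_def by (rule lin_bounded) (rule R[OF that])
  have bdd: "bdd_above ((\<lambda>z. a z + g z) ` K)" if "\<And>z. z \<in> K \<Longrightarrow> g z \<le> 2 * T" for g
    by (rule bdd_aboveI2[where M = "Ra + 2 * T"]) (use a that in \<open>auto intro: add_mono\<close>)
  let ?P = "\<lambda>A. SUP z\<in>K. a z + 2 * \<bar>lin I z A\<bar>" and ?M = "\<lambda>A. SUP z\<in>K. a z - 2 * \<bar>lin I z A\<bar>"
  let ?Q = "\<lambda>A. SUP z\<in>K. a z + 2 * lin I z A"
  have bP: "bdd_above ((\<lambda>z. a z + 2 * \<bar>lin I z A\<bar>) ` K)" for A using lb by (intro bdd) auto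
  have bM: "bdd_above ((\<lambda>z. a z - 2 * \<bar>lin I z A\<bar>) ` K)" for A
  proof -
    have "- 2 * \<bar>lin I z A\<bar> \<le> 2 * T" if "z \<in> K" for z using lb[OF that, of A] by linarith
    then show ?thesis using bdd[of "\<lambda>z. - 2 * \<bar>lin I z A\<bar>"] by simp
  qed
  have bQ: "bdd_above ((\<lambda>z. a z + 2 * lin I z A) ` K)" for A using lb by (intro bdd) (auto simp: abs_le_iff)
  have bQ': "bdd_above ((\<lambda>z. a z - 2 * lin I z A) ` K)" for A
  proof -
    have "- 2 * lin I z A \<le> 2 * T" if "z \<in> K" for z using lb[OF that, of A] by linarith
    then show ?thesis using bdd[of "\<lambda>z. - 2 * lin I z A"] by simp
  qed
  \<comment> \<open>The mean over \<open>B\<close> plays the part of an independent copy. Splitting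
    \<open>a z\<close> into two halves lets the supremum be taken in each term separately.\<close>
  have step1: "(SUP z\<in>K. a z + (avg I (\<lambda>B. \<bar>lin I z B\<bar>) - \<bar>lin I z A\<bar>)) \<le> (1/2) * avg I ?P + (1/2) * ?M A" for A
  proof (rule cSUP_least[OF K])
    fix z assume z: "z \<in> K"
    have "a z + (avg I (\<lambda>B. \<bar>lin I z B\<bar>) - \<bar>lin I z A\<bar>)
       = (1/2) * avg I (\<lambda>B. a z + 2 * \<bar>lin I z B\<bar>) + (1/2) * (a z - 2 * \<bar>lin I z A\<bar>)"
      using fin by (simp add: avg_add avg_cmult field_simps)
    also have "\<dots> \<le> (1/2) * avg I ?P + (1/2) * ?M A"
      using z bP bM by (intro add_mono mult_left_mono avg_mono cSUP_upper) auto
    finally show "a z + (avg I (\<lambda>B. \<bar>lin I z B\<bar>) - \<bar>lin I z A\<bar>) \<le> (1/2) * avg I ?P + (1/2) * ?M A" .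
  qed
  have "avg I (\<lambda>A. SUP z\<in>K. a z + (avg I (\<lambda>B. \<bar>lin I z B\<bar>) - \<bar>lin I z A\<bar>))
     \<le> avg I (\<lambda>A. (1/2) * avg I ?P + (1/2) * ?M A)" by (rule avg_mono) (rule step1)
  also have "\<dots> = avg I (\<lambda>A. (1/2) * (?P A + ?M A))"
    unfolding distrib_left avg_add avg_cmult using fin by simp
  also have "\<dots> \<le> avg I (\<lambda>A. (1/2) * (?Q A + (SUP z\<in>K. a z - 2 * lin I z A)))"
    using SUP_abs_contraction[OF K bQ bQ'] by (intro avg_mono mult_left_mono) (simp_all add: abs_mult)
  \<comment> \<open>Passing to the complement of \<open>A\<close> flips all signs, so both suprema
    have the same mean.\<close>
  also have "\<dots> = (1/2) * avg I ?Q + (1/2) * avg I (\<lambda>A. ?Q (I - A))"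
    unfolding distrib_left avg_add avg_cmult
    by (rule arg_cong2[where f = "(+)"], rule refl, rule arg_cong[where f = "\<lambda>x. 1/2 * x"], rule avg_cong)
       (simp add: lin_Compl)
  also have "\<dots> = avg I ?Q" unfolding avg_Compl[of I ?Q] by simp
  finally show ?thesis .
qed

text \<open>The vectors are exchanged one at a time. The terms of all other vectors are absorbed in
  the offset \<open>a\<close>, which is why the bound for one vector admits an arbitrary offset
  bounded above on \<open>K\<close>.\<close>

lemma avgs_SUP_deviation:
  assumes fin: "finite I" and K: "K \<noteq> {}" and a: "\<And>z. z \<in> K \<Longrightarrow> a z \<le> Ra"
    and R: "\<And>z k. z \<in> K \<Longrightarrow> k \<in> I \<Longrightarrow> \<bar>z k\<bar> \<le> R"
  shows "avgs I n (\<lambda>As. SUP z\<in>K. a z + (\<Sum>A\<leftarrow>As. avg I (\<lambda>B. \<bar>lin I z B\<bar>) - \<bar>lin I z A\<bar>))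
    \<le> avgs I n (\<lambda>As. SUP z\<in>K. a z + 2 * (\<Sum>A\<leftarrow>As. lin I z A))"
  using a
proof (induction n arbitrary: a Ra)
  case 0 then show ?case by simp
next
  case (Suc n)
  define T where "T = real (card I) * R"
  have lb: "\<bar>lin I z A\<bar> \<le> T" if "z \<in> K" for z A
    unfolding T_def by (rule lin_bounded) (rule R[OF that])
  have mu: "avg I (\<lambda>B. \<bar>lin I z B\<bar>) \<le> T" if "z \<in> K" for z
    using avg_mono[of I "\<lambda>B. \<bar>lin I z B\<bar>" "\<lambda>_. T"] lb[OF that] fin by simp
  have b1: "a z + (avg I (\<lambda>B. \<bar>lin I z B\<bar>) - \<bar>lin I z A\<bar>) \<le> Ra + T" if "z \<in> K" for z A
    using Suc.prems[OF that] mu[OF that] by (intro add_mono) auto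
  have ls: "(\<Sum>A\<leftarrow>As. lin I z A) \<le> real (length As) * T" if "z \<in> K" for z As
  proof (induction As)
    case (Cons A As)
    have "lin I z A \<le> T" using lb[OF that, of A] by simp
    then show ?case using Cons by (simp add: algebra_simps)
  qed simp
  have "avgs I (Suc n) (\<lambda>As. SUP z\<in>K. a z + (\<Sum>A\<leftarrow>As. avg I (\<lambda>B. \<bar>lin I z B\<bar>) - \<bar>lin I z A\<bar>))
    = avg I (\<lambda>A. avgs I n (\<lambda>As. SUP z\<in>K. (a z + (avg I (\<lambda>B. \<bar>lin I z B\<bar>) - \<bar>lin I z A\<bar>)) +
         (\<Sum>A\<leftarrow>As. avg I (\<lambda>B. \<bar>lin I z B\<bar>) - \<bar>lin I z A\<bar>)))"
    by (simp add: add.assoc)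
  also have "\<dots> \<le> avg I (\<lambda>A. avgs I n (\<lambda>As. SUP z\<in>K. (a z + (avg I (\<lambda>B. \<bar>lin I z B\<bar>) - \<bar>lin I z A\<bar>)) +
         2 * (\<Sum>A\<leftarrow>As. lin I z A)))"
    by (rule avg_mono, rule Suc.IH[where Ra = "Ra + T"]) (rule b1)
  also have "\<dots> = avgs I n (\<lambda>As. avg I (\<lambda>A. SUP z\<in>K. (a z + 2 * (\<Sum>A\<leftarrow>As. lin I z A)) +
         (avg I (\<lambda>B. \<bar>lin I z B\<bar>) - \<bar>lin I z A\<bar>)))"
    by (subst avg_avgs_commute) (simp add: algebra_simps)
  also have "\<dots> \<le> avgs I n (\<lambda>As. avg I (\<lambda>A. SUP z\<in>K. (a z + 2 * (\<Sum>A\<leftarrow>As. lin I z A)) + 2 * lin I z A))"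
  proof (rule avgs_mono)
    fix As
    have h: "a z + 2 * (\<Sum>A\<leftarrow>As. lin I z A) \<le> Ra + 2 * (real (length As) * T)" if "z \<in> K" for z
      using Suc.prems[OF that] ls[OF that, of As] by simp
    show "avg I (\<lambda>A. SUP z\<in>K. (a z + 2 * (\<Sum>A\<leftarrow>As. lin I z A)) +
         (avg I (\<lambda>B. \<bar>lin I z B\<bar>) - \<bar>lin I z A\<bar>))
      \<le> avg I (\<lambda>A. SUP z\<in>K. (a z + 2 * (\<Sum>A\<leftarrow>As. lin I z A)) + 2 * lin I z A)"
      by (rule avg_SUP_deviation[where Ra = "Ra + 2 * (real (length As) * T)" and R = R]) (use fin K R h in auto)
  qed
  also have "\<dots> = avgs I (Suc n) (\<lambda>As. SUP z\<in>K. a z + 2 * (\<Sum>A\<leftarrow>As. lin I z A))"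
    by (subst avg_avgs_commute[symmetric]) (simp add: algebra_simps)
  finally show ?case .
qed

text \<open>Separation of a point from a bounded convex set at positive Euclidean distance; a near-minimiser
  of the distance replaces the nearest point, so no compactness is needed.\<close>

lemma separate_point:
  fixes C :: "('a \<Rightarrow> real) set"
  assumes ne: "C \<noteq> {}"
    and conv: "\<And>u w t. u \<in> C \<Longrightarrow> w \<in> C \<Longrightarrow> 0 \<le> t \<Longrightarrow> t \<le> 1 \<Longrightarrow> (\<lambda>k. u k + t * (w k - u k)) \<in> C"
    and bnd: "\<And>u w. u \<in> C \<Longrightarrow> w \<in> C \<Longrightarrow> (\<Sum>k\<in>I. (w k - u k)\<^sup>2) \<le> R"
    and rho: "\<rho> > 0" "\<And>u. u \<in> C \<Longrightarrow> \<rho> \<le> (\<Sum>k\<in>I. (v k - u k)\<^sup>2)"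
  shows "\<exists>z. \<forall>u\<in>C. (\<Sum>k\<in>I. z k * u k) \<le> (\<Sum>k\<in>I. z k * v k) - \<rho> / 2"
proof -
  let ?D = "\<lambda>u. \<Sum>k\<in>I. (v k - u k)\<^sup>2"
  define m where "m = (INF u\<in>C. ?D u)"
  have bb: "bdd_below (?D ` C)" by (rule bdd_belowI2[where m = \<rho>]) (rule rho)
  have m: "\<rho> \<le> m" unfolding m_def using ne rho(2) by (intro cINF_greatest) auto
  have mle: "m \<le> ?D u" if "u \<in> C" for u unfolding m_def by (rule cINF_lower[OF bb that])
  have R0: "R \<ge> 0"
  proof -
    obtain u where "u \<in> C" using ne by auto
    from bnd[OF this this] show ?thesis by simp
  qed
  \<comment> \<open>The step \<open>g\<close> from \<open>c0\<close> towards \<open>c\<close> is so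
    short that the quadratic term costs at most \<rho>/2 after division by g; the tolerance
    \<open>e\<close> of the near-minimiser costs another \<rho>/2.\<close>
  define g where "g = min 1 (\<rho> / (2 * R + 1))"
  have g: "g > 0" "g \<le> 1" using rho R0 by (auto simp: g_def)
  have gR: "g * R \<le> \<rho> / 2"
  proof -
    have "g * R \<le> \<rho> / (2 * R + 1) * R" unfolding g_def by (rule mult_right_mono) (use R0 in auto)
    also have "\<dots> \<le> \<rho> / 2" using rho(1) R0 by (simp add: field_simps)
    finally show ?thesis .
  qed
  define e where "e = g * \<rho> / 2"
  have "e > 0" using g rho by (simp add: e_def)
  then have "(INF u\<in>C. ?D u) < m + e" by (simp add: m_def)
  then obtain c0 where c0: "c0 \<in> C" "?D c0 < m + e" using cINF_less_iff[OF ne bb] by auto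
  define z where "z = (\<lambda>k. v k - c0 k)"
  have main: "(\<Sum>k\<in>I. z k * (c k - c0 k)) \<le> \<rho> / 2" if c: "c \<in> C" for c
  proof -
    have "m \<le> ?D (\<lambda>k. c0 k + g * (c k - c0 k))" using g by (intro mle conv c c0) auto
    also have "\<dots> = ?D c0 - 2 * g * (\<Sum>k\<in>I. z k * (c k - c0 k)) + g\<^sup>2 * (\<Sum>k\<in>I. (c k - c0 k)\<^sup>2)"
      unfolding sum_distrib_left sum_subtractf[symmetric] sum.distrib[symmetric]
      by (rule sum.cong) (auto simp: z_def power2_eq_square algebra_simps)
    also have "\<dots> \<le> (m + e) - 2 * g * (\<Sum>k\<in>I. z k * (c k - c0 k)) + g\<^sup>2 * R"
      using c0 bnd[OF c0(1) c] g by (intro add_mono diff_mono mult_left_mono) auto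
    finally have "g * (2 * (\<Sum>k\<in>I. z k * (c k - c0 k))) \<le> g * (\<rho> / 2 + g * R)"
      by (simp add: e_def power2_eq_square algebra_simps)
    then have "2 * (\<Sum>k\<in>I. z k * (c k - c0 k)) \<le> \<rho> / 2 + g * R" using g by simp
    then show ?thesis using gR by simp
  qed
  have "(\<Sum>k\<in>I. z k * u k) \<le> (\<Sum>k\<in>I. z k * v k) - \<rho> / 2" if u: "u \<in> C" for u
  proof -
    have "(\<Sum>k\<in>I. z k * v k) - (\<Sum>k\<in>I. z k * c0 k) = ?D c0"
      unfolding sum_subtractf[symmetric] by (rule sum.cong) (auto simp: z_def power2_eq_square algebra_simps)
    moreover have "\<rho> \<le> ?D c0" by (rule rho(2)[OF c0(1)])
    moreover have "(\<Sum>k\<in>I. z k * u k) - (\<Sum>k\<in>I. z k * c0 k) \<le> \<rho> / 2"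
      using main[OF u] by (simp add: right_diff_distrib sum_subtractf)
    ultimately show ?thesis by linarith
  qed
  then show ?thesis by blast
qed

section \<open>Seminorms and the approximation of the Euclidean ball\<close>

definition l2 :: "'a set \<Rightarrow> ('a \<Rightarrow> real) \<Rightarrow> real" where
  "l2 I v = sqrt (\<Sum>k\<in>I. (v k)\<^sup>2)"

lemma l2_L2_set: "l2 I v = L2_set v I"
  by (simp add: l2_def L2_set_def)

lemma l2_triangle: "l2 I (\<lambda>k. u k + v k) \<le> l2 I u + l2 I v"
  unfolding l2_L2_set by (rule L2_set_triangle_ineq)

lemma l2_scale: "l2 I (\<lambda>k. c * v k) = \<bar>c\<bar> * l2 I v"
  by (simp add: l2_def power_mult_distrib sum_distrib_left[symmetric] real_sqrt_mult)

lemma l2_nonneg [simp]: "0 \<le> l2 I v"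
  by (simp add: l2_def sum_nonneg)

lemma abs_le_l2: "finite I \<Longrightarrow> k \<in> I \<Longrightarrow> \<bar>v k\<bar> \<le> l2 I v"
proof -
  assume "finite I" "k \<in> I"
  then have "(v k)\<^sup>2 \<le> (\<Sum>k\<in>I. (v k)\<^sup>2)" by (intro member_le_sum) auto
  then show ?thesis unfolding l2_def by (metis real_sqrt_abs real_sqrt_le_iff)
qed

lemma inner_le_l2: "(\<Sum>k\<in>I. u k * v k) \<le> l2 I u * l2 I v"
  unfolding l2_L2_set
  by (rule order_trans[OF _ L2_set_mult_ineq]) (auto intro!: sum_mono simp: abs_mult[symmetric])

text \<open>Vectors over \<open>I\<close> are represented by total functions, and the last clause
  makes \<open>N\<close> blind to their values off \<open>I\<close>.\<close>

definition seminorm_on :: "'a set \<Rightarrow> (('a \<Rightarrow> real) \<Rightarrow> real) \<Rightarrow> bool" where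
  "seminorm_on I N \<longleftrightarrow> (\<forall>u v. N (\<lambda>k. u k + v k) \<le> N u + N v) \<and> (\<forall>c u. N (\<lambda>k. c * u k) = \<bar>c\<bar> * N u)
     \<and> (\<forall>u v. (\<forall>k\<in>I. u k = v k) \<longrightarrow> N u = N v)"

lemma seminorm_onD:
  assumes "seminorm_on I N"
  shows "N (\<lambda>k. u k + v k) \<le> N u + N v" "N (\<lambda>k. c * u k) = \<bar>c\<bar> * N u"
  using assms unfolding seminorm_on_def by (blast, blast)

lemma seminorm_on_cong: "seminorm_on I N \<Longrightarrow> (\<And>k. k \<in> I \<Longrightarrow> u k = v k) \<Longrightarrow> N u = N v"
  unfolding seminorm_on_def by blast

lemma seminorm_on_nonneg: assumes "seminorm_on I N" shows "N u \<ge> 0"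
proof -
  have "N (\<lambda>k. u k + (-1) * u k) \<le> N u + N (\<lambda>k. (-1) * u k)"
    and "N (\<lambda>k. (-1) * u k) = \<bar>-1\<bar> * N u" and "N (\<lambda>k. 0 * u k) = \<bar>0\<bar> * N u"
    by (rule seminorm_onD[OF assms])+
  then show ?thesis by simp
qed

lemma seminorm_on_le_l2:
  fixes I :: "'a set"
  assumes fin: "finite I" and N: "seminorm_on I N"
  shows "\<exists>M\<ge>0. \<forall>u. N u \<le> M * l2 I u"
proof -
  define e where "e = (\<lambda>(j::'a) k. if k = j then 1 else 0 :: real)"
  have tri: "N (\<lambda>k. u k + v k) \<le> N u + N v" and sc: "N (\<lambda>k. c * u k) = \<bar>c\<bar> * N u" for u v c
    by (rule seminorm_onD[OF N])+
  have N0: "N (\<lambda>k. 0) = 0" using sc[of 0 "\<lambda>_. 0"] by simp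
  have sum: "N (\<lambda>k. \<Sum>j\<in>J. u j * e j k) \<le> (\<Sum>j\<in>J. \<bar>u j\<bar> * N (e j))" if "finite J" for J u
    using that
  proof (induction J rule: finite_induct)
    case (insert j J)
    have "N (\<lambda>k. \<Sum>j\<in>insert j J. u j * e j k) = N (\<lambda>k. u j * e j k + (\<Sum>j\<in>J. u j * e j k))"
      using insert by simp
    also have "\<dots> \<le> \<bar>u j\<bar> * N (e j) + (\<Sum>j\<in>J. \<bar>u j\<bar> * N (e j))"
      using tri[of "\<lambda>k. u j * e j k" "\<lambda>k. \<Sum>j\<in>J. u j * e j k"] insert sc[of "u j" "e j"] by simp
    finally show ?case using insert by simp
  qed (simp add: N0)
  have "N u \<le> (\<Sum>j\<in>I. N (e j)) * l2 I u" for u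
  proof -
    have "N u = N (\<lambda>k. \<Sum>j\<in>I. u j * e j k)"
    proof -
      have "\<forall>k\<in>I. u k = (\<Sum>j\<in>I. u j * e j k)" using fin by (simp add: e_def if_distrib cong: if_cong)
      then show ?thesis by (intro seminorm_on_cong[OF N]) blast
    qed
    also have "\<dots> \<le> (\<Sum>j\<in>I. \<bar>u j\<bar> * N (e j))" by (rule sum[OF fin])
    also have "\<dots> \<le> (\<Sum>j\<in>I. l2 I u * N (e j))"
      using fin by (intro sum_mono mult_right_mono abs_le_l2 seminorm_on_nonneg[OF N]) auto
    finally show ?thesis unfolding sum_distrib_left[symmetric] by (simp only: mult.commute)
  qed
  moreover have "(\<Sum>j\<in>I. N (e j)) \<ge> 0" by (intro sum_nonneg seminorm_on_nonneg[OF N])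
  ultimately show ?thesis by blast
qed

lemma sum_list_abs_bound:
  assumes "As \<in> rows I n"
  shows "\<bar>\<Sum>A\<leftarrow>As. sgn_of A k\<bar> \<le> real n"
proof -
  have "\<bar>\<Sum>A\<leftarrow>As. sgn_of A k\<bar> \<le> real (length As)" for As :: "'a set list"
    by (induction As) (auto simp: sgn_of_def)
  from this[of As] show ?thesis using assms by (simp add: rows_def)
qed

lemma lin_sum_list: "(\<Sum>A\<leftarrow>As. lin I z A) = (\<Sum>k\<in>I. z k * (\<Sum>A\<leftarrow>As. sgn_of A k))"
  by (induction As) (simp_all add: lin_def sum.distrib[symmetric] algebra_simps)

text \<open>If some v of length at most n kept a positive distance from the convex set
  \<open>C\<close>, a functional \<open>z\<close> would separate them. Scaled into the dual ball it
  obeys the deviation bound: the sum of |lin z| over the n sign vectors falls short of n times its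
  mean by at most 4E, and by Khinchine the mean is at least half the length of \<open>z\<close>. So
  \<open>z\<close> takes values on \<open>C\<close> that are too large for a separation from
  v.\<close>

lemma Euclidean_ball_approx:
  fixes I :: "'a set"
  assumes fin: "finite I" and N: "seminorm_on I N" and n: "n \<ge> 1"
    and E: "avgs I n (\<lambda>As. N (\<lambda>k. \<Sum>A\<leftarrow>As. sgn_of A k)) \<le> E" and E0: "E > 0"
  shows "\<exists>As\<in>rows I n. \<forall>v. l2 I v \<le> 1 \<longrightarrow>
    (\<exists>c. N (\<lambda>k. v k - (\<Sum>i<n. c i * sgn_of (As ! i) k)) \<le> 9 * E / real n)"
proof -
  \<comment> \<open>Adding a small multiple of the Euclidean norm turns the seminorm into a norm on
    vectors over \<open>I\<close>; this bounds \<open>C\<close> and makes the scaling into the dual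
    ball possible. The weight is chosen so that the mean norm of the sum of the sign vectors grows
    by at most E.\<close>
  define ka where "ka = E / (1 + real n * sqrt (card I))"
  have d0: "1 + real n * sqrt (card I) > 0" by (simp add: add_pos_nonneg)
  have ka: "ka > 0" using E0 d0 by (simp add: ka_def)
  define M where "M = (\<lambda>u. N u + ka * l2 I u)"
  have tri: "N (\<lambda>k. u k + v k) \<le> N u + N v" and sc: "N (\<lambda>k. c * u k) = \<bar>c\<bar> * N u" for u v c
    by (rule seminorm_onD[OF N])+
  have N0: "N u \<ge> 0" for u by (rule seminorm_on_nonneg[OF N])
  have Mtri: "M (\<lambda>k. u k + v k) \<le> M u + M v" for u v
    using tri[of u v] mult_left_mono[OF l2_triangle[of I u v], of ka] ka by (simp add: M_def algebra_simps)
  have Msc: "M (\<lambda>k. c * u k) = \<bar>c\<bar> * M u" for c u by (simp add: M_def sc l2_scale algebra_simps)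
  have Mge: "ka * l2 I u \<le> M u" "N u \<le> M u" "0 \<le> M u" for u using N0 ka by (auto simp: M_def)
  have EM: "avgs I n (\<lambda>As. M (\<lambda>k. \<Sum>A\<leftarrow>As. sgn_of A k)) \<le> 2 * E"
  proof -
    have "avgs I n (\<lambda>As. l2 I (\<lambda>k. \<Sum>A\<leftarrow>As. sgn_of A k)) \<le> avgs I n (\<lambda>_. real n * sqrt (card I))"
    proof (rule avgs_mono)
      fix As assume As: "As \<in> rows I n"
      have "(\<Sum>A\<leftarrow>As. sgn_of A k)\<^sup>2 \<le> (real n)\<^sup>2" for k
        using sum_list_abs_bound[OF As, of k] by (metis abs_le_square_iff abs_of_nat)
      then have "(\<Sum>k\<in>I. (\<Sum>A\<leftarrow>As. sgn_of A k)\<^sup>2) \<le> real (card I) * (real n)\<^sup>2"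
        by (intro sum_bounded_above) auto
      then have "l2 I (\<lambda>k. \<Sum>A\<leftarrow>As. sgn_of A k) \<le> sqrt (real (card I) * (real n)\<^sup>2)"
        unfolding l2_def by (rule real_sqrt_le_mono)
      then show "l2 I (\<lambda>k. \<Sum>A\<leftarrow>As. sgn_of A k) \<le> real n * sqrt (card I)"
        by (simp add: real_sqrt_mult mult.commute)
    qed
    then have l: "avgs I n (\<lambda>As. l2 I (\<lambda>k. \<Sum>A\<leftarrow>As. sgn_of A k)) \<le> real n * sqrt (card I)" using fin by simp
    have "ka * (real n * sqrt (card I)) \<le> E"
      using d0 E0 by (simp add: ka_def field_simps)
    moreover have "ka * avgs I n (\<lambda>As. l2 I (\<lambda>k. \<Sum>A\<leftarrow>As. sgn_of A k)) \<le> ka * (real n * sqrt (card I))"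
      using mult_left_mono[OF l, of ka] ka by simp
    ultimately show ?thesis unfolding M_def avgs_add avgs_cmult
      using E by linarith
  qed
  \<comment> \<open>The dual unit ball of \<open>M\<close>: suprema over it of sums of
    \<open>lin\<close> are bounded by \<open>M\<close> of the summed sign vectors.\<close>
  define K where "K = {z :: 'a \<Rightarrow> real. \<forall>b. (\<Sum>k\<in>I. z k * b k) \<le> M b}"
  have K0: "(\<lambda>_. 0) \<in> K" using Mge by (simp add: K_def)
  then have Kne: "K \<noteq> {}" by blast
  obtain MM where MM: "MM \<ge> 0" "\<And>u. N u \<le> MM * l2 I u" using seminorm_on_le_l2[OF fin N] by blast
  have KR: "\<bar>z k\<bar> \<le> MM + ka" if z: "z \<in> K" and k: "k \<in> I" for z k
  proof -
    define b where "b = (\<lambda>j. if j = k then sgn (z k) else 0)"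
    have "(b j)\<^sup>2 = (if j = k then (sgn (z k))\<^sup>2 else 0)" for j by (simp add: b_def)
    then have "l2 I b \<le> 1" using fin k by (simp add: l2_def sgn_if)
    then have "MM * l2 I b \<le> MM" "ka * l2 I b \<le> ka"
      using ka MM(1) mult_left_mono[of "l2 I b" 1] by fastforce+
    then have "M b \<le> MM + ka" unfolding M_def using MM(2)[of b] by linarith
    moreover have "(\<Sum>j\<in>I. z j * b j) = \<bar>z k\<bar>" using fin k
      by (simp add: b_def if_distrib cong: if_cong) (simp add: abs_sgn)
    moreover have "(\<Sum>j\<in>I. z j * b j) \<le> M b" using z by (simp add: K_def)
    ultimately show ?thesis by simp
  qed
  let ?mu = "\<lambda>z. avg I (\<lambda>B. \<bar>lin I z B\<bar>)"
  let ?F = "\<lambda>As. SUP z\<in>K. 0 + (\<Sum>A\<leftarrow>As. ?mu z - \<bar>lin I z A\<bar>)"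
  have "avgs I n ?F \<le> avgs I n (\<lambda>As. SUP z\<in>K. 0 + 2 * (\<Sum>A\<leftarrow>As. lin I z A))"
    by (rule avgs_SUP_deviation[where Ra = 0 and R = "MM + ka"]) (use Kne fin KR in auto)
  also have "\<dots> \<le> avgs I n (\<lambda>As. 2 * M (\<lambda>k. \<Sum>A\<leftarrow>As. sgn_of A k))"
  proof (rule avgs_mono)
    fix As
    show "(SUP z\<in>K. 0 + 2 * (\<Sum>A\<leftarrow>As. lin I z A)) \<le> 2 * M (\<lambda>k. \<Sum>A\<leftarrow>As. sgn_of A k)"
      using Kne by (intro cSUP_least) (auto simp: lin_sum_list K_def)
  qed
  also have "\<dots> \<le> 4 * E" unfolding avgs_cmult using EM by simp
  finally have "avgs I n ?F \<le> 4 * E" .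
  then obtain As where As: "As \<in> rows I n" "?F As \<le> 4 * E"
    using avgs_exists_le[OF fin, of n ?F] by force
  have len: "length As = n" using As by (simp add: rows_def)
  have muT: "?mu z \<le> real (card I) * (MM + ka)" if "z \<in> K" for z
    using avg_mono[of I "\<lambda>B. \<bar>lin I z B\<bar>" "\<lambda>_. real (card I) * (MM + ka)"]
      lin_bounded[of I z "MM + ka"] KR[OF that] fin by simp
  have dev: "real n * ?mu z - (\<Sum>A\<leftarrow>As. \<bar>lin I z A\<bar>) \<le> 4 * E" if z: "z \<in> K" for z
  proof -
    have eq: "(\<Sum>A\<leftarrow>As. ?mu z - \<bar>lin I z A\<bar>) = real n * ?mu z - (\<Sum>A\<leftarrow>As. \<bar>lin I z A\<bar>)" for z
      by (simp add: sum_list_subtractf sum_list_triv len)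
    have pos: "0 \<le> (\<Sum>A\<leftarrow>As. \<bar>lin I z A\<bar>)" for z by (rule sum_list_nonneg) auto
    have "bdd_above ((\<lambda>z. 0 + (\<Sum>A\<leftarrow>As. ?mu z - \<bar>lin I z A\<bar>)) ` K)"
    proof (rule bdd_aboveI2[where M = "real n * (real (card I) * (MM + ka))"])
      fix z assume "z \<in> K"
      then show "0 + (\<Sum>A\<leftarrow>As. ?mu z - \<bar>lin I z A\<bar>) \<le> real n * (real (card I) * (MM + ka))"
        using mult_left_mono[OF muT, of z "real n"] pos[of z] unfolding eq by simp
    qed
    from cSUP_upper[OF z this] show ?thesis using As(2) eq[of z] by linarith
  qed
  \<comment> \<open>Coefficients up to 2 compensate the factor 1/2 in Khinchine's inequality, and
    the radius 8E is twice the deviation 4E; with these values the sums \<open>L\<close> cancel in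
    the final contradiction.\<close>
  define T where "T = 8 * E"
  define C where "C = {u. \<exists>c b. (\<forall>i<n. \<bar>c i\<bar> \<le> 2) \<and> M b \<le> T \<and> u = (\<lambda>k. (\<Sum>i<n. c i * sgn_of (As ! i) k) + b k)}"
  have M0: "M (\<lambda>_. 0) = 0" using Msc[of 0 "\<lambda>_. 0"] by simp
  have C1: "C \<noteq> {}" using M0 E0 by (auto simp: C_def T_def intro!: exI[of _ "\<lambda>_. 0"])
  have C2: "(\<lambda>k. u k + t * (w k - u k)) \<in> C" if u: "u \<in> C" and w: "w \<in> C" and t: "0 \<le> t" "t \<le> 1" for u w t
  proof -
    obtain c b where u': "\<forall>i<n. \<bar>c i\<bar> \<le> 2" "M b \<le> T" "u = (\<lambda>k. (\<Sum>i<n. c i * sgn_of (As ! i) k) + b k)"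
      using u by (auto simp: C_def)
    obtain c' b' where w': "\<forall>i<n. \<bar>c' i\<bar> \<le> 2" "M b' \<le> T" "w = (\<lambda>k. (\<Sum>i<n. c' i * sgn_of (As ! i) k) + b' k)"
      using w by (auto simp: C_def)
    let ?c = "\<lambda>i. (1 - t) * c i + t * c' i" and ?b = "\<lambda>k. (1 - t) * b k + t * b' k"
    have "\<bar>?c i\<bar> \<le> 2" if "i < n" for i
    proof -
      have "\<bar>?c i\<bar> \<le> (1 - t) * \<bar>c i\<bar> + t * \<bar>c' i\<bar>"
        using abs_triangle_ineq[of "(1 - t) * c i" "t * c' i"] t by (simp add: abs_mult)
      also have "\<dots> \<le> (1 - t) * 2 + t * 2" using u' w' that t by (intro add_mono mult_left_mono) auto
      finally show ?thesis by simp
    qed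
    moreover have "M ?b \<le> T"
    proof -
      have "M ?b \<le> (1 - t) * M b + t * M b'"
        using Mtri[of "\<lambda>k. (1 - t) * b k" "\<lambda>k. t * b' k"] Msc[of "1 - t" b] Msc[of t b'] t by simp
      also have "\<dots> \<le> (1 - t) * T + t * T" using u' w' t by (intro add_mono mult_left_mono) auto
      finally show ?thesis by (simp add: algebra_simps)
    qed
    moreover have "(\<lambda>k. u k + t * (w k - u k)) = (\<lambda>k. (\<Sum>i<n. ?c i * sgn_of (As ! i) k) + ?b k)"
      by (simp add: u' w' fun_eq_iff algebra_simps sum.distrib sum_distrib_left sum_subtractf)
    ultimately show ?thesis unfolding C_def
      by (intro CollectI exI[of _ ?c] exI[of _ ?b] conjI) auto
  qed
  have l2s: "l2 I (\<lambda>k. \<Sum>i<n. c i * sgn_of (As ! i) k) \<le> real n * (2 * sqrt (card I))"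
    if "\<forall>i<n. \<bar>c i\<bar> \<le> 2" for c
  proof -
    have "l2 I (\<lambda>k. \<Sum>i<j. c i * sgn_of (As ! i) k) \<le> real j * (2 * sqrt (card I))" if "j \<le> n" for j
      using that
    proof (induction j)
      case 0 then show ?case by (simp add: l2_def)
    next
      case (Suc j)
      have "l2 I (\<lambda>k. c j * sgn_of (As ! j) k) = \<bar>c j\<bar> * sqrt (card I)"
      proof -
        have "(sgn_of A k)\<^sup>2 = 1" for A and k :: 'a by (simp add: sgn_of_def)
        then show ?thesis unfolding l2_scale by (simp add: l2_def)
      qed
      also have "\<dots> \<le> 2 * sqrt (card I)"
        using \<open>\<forall>i<n. \<bar>c i\<bar> \<le> 2\<close> Suc by (intro mult_right_mono) auto
      finally show ?case
        using l2_triangle[of I "\<lambda>k. \<Sum>i<j. c i * sgn_of (As ! i) k" "\<lambda>k. c j * sgn_of (As ! j) k"] Suc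
        by (simp add: algebra_simps)
    qed
    then show ?thesis by blast
  qed
  define R where "R = real n * (2 * sqrt (card I)) + T / ka"
  have C3: "l2 I u \<le> R" if u: "u \<in> C" for u
  proof -
    obtain c b where u': "\<forall>i<n. \<bar>c i\<bar> \<le> 2" "M b \<le> T" "u = (\<lambda>k. (\<Sum>i<n. c i * sgn_of (As ! i) k) + b k)"
      using u by (auto simp: C_def)
    have "ka * l2 I b \<le> T" using Mge(1)[of b] u' by simp
    then have "l2 I b \<le> T / ka" using ka by (simp add: field_simps)
    then show ?thesis using l2_triangle[of I "\<lambda>k. \<Sum>i<n. c i * sgn_of (As ! i) k" b] l2s[OF u'(1)] u'(3)
      by (simp add: R_def)
  qed
  have C4: "(\<Sum>k\<in>I. (w k - u k)\<^sup>2) \<le> (2 * R)\<^sup>2" if "u \<in> C" "w \<in> C" for u w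
  proof -
    have "l2 I (\<lambda>k. w k + (-1) * u k) \<le> 2 * R"
      using l2_triangle[of I w "\<lambda>k. (-1) * u k"] l2_scale[of I "-1" u] C3[OF that(1)] C3[OF that(2)] by simp
    then have "sqrt (\<Sum>k\<in>I. (w k - u k)\<^sup>2) \<le> 2 * R" by (simp add: l2_def)
    then show ?thesis using real_sqrt_le_iff sqrt_le_D by blast
  qed
  have dense: "\<exists>u\<in>C. (\<Sum>k\<in>I. (v k - u k)\<^sup>2) < \<rho>" if v: "l2 I v \<le> real n" and rho: "\<rho> > 0" for v \<rho>
  proof (rule ccontr)
    assume "\<not> ?thesis"
    then have "\<And>u. u \<in> C \<Longrightarrow> \<rho> \<le> (\<Sum>k\<in>I. (v k - u k)\<^sup>2)" by force
    from separate_point[of C I, OF C1 C2 C4 rho this] obtain z where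
      z: "\<And>u. u \<in> C \<Longrightarrow> (\<Sum>k\<in>I. z k * u k) \<le> (\<Sum>k\<in>I. z k * v k) - \<rho> / 2" by blast
    define L where "L = (\<Sum>i<n. \<bar>lin I z (As ! i)\<bar>)"
    have L: "L = (\<Sum>A\<leftarrow>As. \<bar>lin I z A\<bar>)"
      by (simp add: L_def sum_list_sum_nth len atLeast0LessThan)
    define s where "s = ((\<Sum>k\<in>I. z k * v k) - \<rho> / 2 - 2 * L) / T"
    have T0: "T > 0" using E0 by (simp add: T_def)
    have bs: "(\<Sum>k\<in>I. z k * b k) \<le> s * T" if b: "M b \<le> T" for b
    proof -
      let ?c = "\<lambda>i. 2 * sgn (lin I z (As ! i))"
      have "(\<lambda>k. (\<Sum>i<n. ?c i * sgn_of (As ! i) k) + b k) \<in> C"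
        unfolding C_def using b by (intro CollectI exI[of _ ?c] exI[of _ b]) (auto simp: sgn_if)
      from z[OF this] have "(\<Sum>k\<in>I. z k * ((\<Sum>i<n. ?c i * sgn_of (As ! i) k) + b k)) \<le> (\<Sum>k\<in>I. z k * v k) - \<rho> / 2" .
      moreover have "(\<Sum>k\<in>I. z k * (\<Sum>i<n. ?c i * sgn_of (As ! i) k)) = 2 * L"
      proof -
        have "(\<Sum>k\<in>I. z k * (\<Sum>i<n. ?c i * sgn_of (As ! i) k)) = (\<Sum>i<n. ?c i * lin I z (As ! i))"
          unfolding lin_def sum_distrib_left by (subst sum.swap) (simp add: algebra_simps)
        also have "\<dots> = 2 * L" unfolding L_def sum_distrib_left
          by (rule sum.cong) (auto simp: sgn_if)
        finally show ?thesis .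
      qed
      ultimately show ?thesis using T0 by (simp add: s_def distrib_left sum.distrib)
    qed
    have s_nonneg: "s * T \<ge> 0" using bs[of "\<lambda>_. 0"] M0 T0 by simp
    have scale: "(\<Sum>k\<in>I. z k * b k) \<le> s * M b" if Mb: "M b > 0" for b
    proof -
      have "M (\<lambda>k. (T / M b) * b k) \<le> T" unfolding Msc using Mb T0 by simp
      from bs[OF this] have "(T / M b) * (\<Sum>k\<in>I. z k * b k) \<le> s * T"
        by (simp add: sum_distrib_left algebra_simps)
      then have "T * (\<Sum>k\<in>I. z k * b k) \<le> T * (s * M b)" using Mb by (simp add: field_simps)
      then show ?thesis using T0 by simp
    qed
    have scale': "(\<Sum>k\<in>I. z k * b k) \<le> s * M b" for b
    proof (cases "M b > 0")
      case False
      then have "M b = 0" using Mge(3)[of b] by simp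
      then have "l2 I b \<le> 0" using Mge(1)[of b] ka by (simp add: mult_le_0_iff)
      then have "\<forall>k\<in>I. b k = 0" using abs_le_l2[OF fin, of _ b] by fastforce
      then show ?thesis using \<open>M b = 0\<close> by simp
    qed (rule scale)
    have zv: "(\<Sum>k\<in>I. z k * v k) \<ge> \<rho> / 2"
      using z[of "\<lambda>_. 0"] bs[of "\<lambda>_. 0"] C1 M0 T0
      by (smt (verit) L_def s_nonneg s_def abs_ge_zero divide_nonneg_pos nonzero_eq_divide_eq sum_nonneg)
    have spos: "s > 0"
    proof (rule ccontr)
      assume "\<not> s > 0"
      then have "s = 0" using s_nonneg T0 by (simp add: zero_le_mult_iff)
      then show False using scale'[of v] zv rho by simp
    qed
    have zK: "(\<lambda>k. z k / s) \<in> K"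
    proof -
      have "(\<Sum>k\<in>I. z k / s * b k) \<le> M b" for b
      proof -
        have "(\<Sum>k\<in>I. z k / s * b k) = (\<Sum>k\<in>I. z k * b k) / s" by (simp add: sum_divide_distrib)
        also have "\<dots> \<le> M b" using scale'[of b] spos by (simp add: field_simps)
        finally show ?thesis .
      qed
      then show ?thesis by (simp add: K_def)
    qed
    have linz: "lin I (\<lambda>k. z k / s) A = lin I z A / s" for A
      by (simp add: lin_def sum_divide_distrib)
    have "real n * ?mu (\<lambda>k. z k / s) - (\<Sum>A\<leftarrow>As. \<bar>lin I (\<lambda>k. z k / s) A\<bar>) \<le> 4 * E" by (rule dev[OF zK])
    moreover have "(\<Sum>A\<leftarrow>As. \<bar>lin I (\<lambda>k. z k / s) A\<bar>) = L / s"
      unfolding L linz using spos by (induction As) (auto simp: abs_divide add_divide_distrib)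
    moreover have "?mu (\<lambda>k. z k / s) = ?mu z / s"
      unfolding linz using spos avg_cmult[of I "1/s" "\<lambda>B. \<bar>lin I z B\<bar>"] by (simp add: abs_divide)
    ultimately have "(real n * ?mu z - L) / s \<le> 4 * E" by (simp add: diff_divide_distrib)
    then have "real n * ?mu z - L \<le> 4 * E * s" using spos by (simp add: field_simps)
    moreover have "l2 I z / 2 \<le> ?mu z" using avg_abs_lin_ge[OF fin, of z] by (simp add: l2_def)
    then have "real n * (l2 I z / 2) \<le> real n * ?mu z" by (rule mult_left_mono) simp
    moreover have "s * T = (\<Sum>k\<in>I. z k * v k) - \<rho> / 2 - 2 * L" using T0 by (simp add: s_def)
    then have "4 * E * s = ((\<Sum>k\<in>I. z k * v k) - \<rho> / 2 - 2 * L) / 2" by (simp add: T_def field_simps)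
    moreover have "(\<Sum>k\<in>I. z k * v k) \<le> real n * l2 I z"
      using inner_le_l2[of z v I] mult_left_mono[OF v, of "l2 I z"] by (simp add: mult.commute)
    ultimately show False using rho by (simp add: field_simps)
  qed
  \<comment> \<open>The set \<open>C\<close> is only dense in the ball of radius n. The tolerance
    \<rho> is such that the leftover costs E in the seminorm, which together with the radius 8E
    gives 9E.\<close>
  have "\<exists>c. N (\<lambda>k. v k - (\<Sum>i<n. c i * sgn_of (As ! i) k)) \<le> 9 * E / real n" if v: "l2 I v \<le> 1" for v
  proof -
    define \<rho> where "\<rho> = (E / (MM + 1))\<^sup>2"
    have rho: "\<rho> > 0" using E0 MM by (simp add: \<rho>_def)
    have nv: "l2 I (\<lambda>k. real n * v k) \<le> real n" unfolding l2_scale using mult_left_mono[OF v, of "real n"] by simp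
    obtain u where u: "u \<in> C" "(\<Sum>k\<in>I. (real n * v k - u k)\<^sup>2) < \<rho>" using dense[OF nv rho] by blast
    obtain c b where u': "M b \<le> T" "u = (\<lambda>k. (\<Sum>i<n. c i * sgn_of (As ! i) k) + b k)"
      using u(1) by (auto simp: C_def)
    have "l2 I (\<lambda>k. real n * v k - u k) \<le> sqrt \<rho>" unfolding l2_def using u(2) by (intro real_sqrt_le_mono) simp
    also have "\<dots> = E / (MM + 1)" using E0 MM(1) by (simp add: \<rho>_def)
    finally have "N (\<lambda>k. real n * v k - u k) \<le> MM * (E / (MM + 1))"
      using MM(2)[of "\<lambda>k. real n * v k - u k"] mult_left_mono[of "l2 I (\<lambda>k. real n * v k - u k)" "E / (MM + 1)" MM] MM(1)
      by linarith
    also have "\<dots> \<le> E" using MM(1) E0 by (simp add: field_simps)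
    finally have r1: "N (\<lambda>k. real n * v k - u k) \<le> E" .
    have r2: "N b \<le> 8 * E" using u' Mge(2)[of b] by (simp add: T_def)
    have "N (\<lambda>k. (real n * v k - u k) + b k) \<le> 9 * E"
      using tri[of "\<lambda>k. real n * v k - u k" b] r1 r2 by simp
    then have "\<bar>1 / real n\<bar> * N (\<lambda>k. (real n * v k - u k) + b k) \<le> 9 * E / real n"
      using n by (simp add: field_simps)
    moreover have "\<bar>1 / real n\<bar> * N (\<lambda>k. (real n * v k - u k) + b k)
      = N (\<lambda>k. v k - (\<Sum>i<n. (c i / real n) * sgn_of (As ! i) k))"
      unfolding sc[symmetric] using n
      by (intro arg_cong[where f = N]) (simp add: u' fun_eq_iff field_simps flip: sum_divide_distrib)
    ultimately have "N (\<lambda>k. v k - (\<Sum>i<n. (c i / real n) * sgn_of (As ! i) k)) \<le> 9 * E / real n" by simp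
    then show ?thesis by (intro exI[of _ "\<lambda>i. c i / real n"])
  qed
  then show ?thesis using As(1) by blast
qed

section \<open>Minkowski's inequality\<close>

text \<open>Convexity of the power at the points u/t and v/(1-t). Integrated with t the share of the
  first norm in the sum of both norms, it yields Minkowski's inequality without Hoelder's.\<close>

lemma add_powr_le:
  fixes u v t q :: real
  assumes u: "u \<ge> 0" and v: "v \<ge> 0" and t: "0 < t" "t < 1" and q: "q \<ge> 1"
  shows "(u + v) powr q \<le> t powr (1 - q) * u powr q + (1 - t) powr (1 - q) * v powr q"
proof -
  have ge1: "1 \<le> s powr (1 - q)" if "0 < s" "s < 1" for s :: real
  proof -
    have "1 powr (1 - q) \<le> s powr (1 - q)" using that q by (intro powr_mono2') auto
    then show ?thesis by simp
  qed
  show ?thesis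
  proof (cases "u = 0 \<or> v = 0")
    case True
    then show ?thesis
    proof
      assume "u = 0"
      then show ?thesis using ge1[of "1 - t"] t v q mult_right_mono[of 1 "(1 - t) powr (1 - q)" "v powr q"] by simp
    next
      assume "v = 0"
      then show ?thesis using ge1[of t] t u q mult_right_mono[of 1 "t powr (1 - q)" "u powr q"] by simp
    qed
  next
    case False
    then have pos: "u > 0" "v > 0" using u v by auto
    have "((1 - t) *\<^sub>R (v / (1 - t)) + t *\<^sub>R (u / t)) powr q
        \<le> (1 - t) * (v / (1 - t)) powr q + t * (u / t) powr q"
      using pos t by (intro convex_onD[OF powr_convex[OF q]]) auto
    moreover have "(1 - t) *\<^sub>R (v / (1 - t)) + t *\<^sub>R (u / t) = u + v" using t by simp
    moreover have "s * (w / s) powr q = s powr (1 - q) * w powr q" if "s > 0" "w > 0" for s w :: real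
      using that by (simp add: powr_divide powr_diff)
    ultimately show ?thesis using pos t by (simp add: add.commute)
  qed
qed

lemma Minkowski_integral:
  fixes f g :: "'a \<Rightarrow> complex"
  assumes q: "q \<ge> 1" and [measurable]: "f \<in> borel_measurable M" "g \<in> borel_measurable M"
    and f: "integrable M (\<lambda>x. norm (f x) powr q)" and g: "integrable M (\<lambda>x. norm (g x) powr q)"
    and fg: "integrable M (\<lambda>x. norm (f x + g x) powr q)"
  shows "(\<integral>x. norm (f x + g x) powr q \<partial>M) powr (1/q)
    \<le> (\<integral>x. norm (f x) powr q \<partial>M) powr (1/q) + (\<integral>x. norm (g x) powr q \<partial>M) powr (1/q)"
proof -
  let ?I = "\<lambda>h :: 'a \<Rightarrow> complex. \<integral>x. norm (h x) powr q \<partial>M"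
  have zero: "AE x in M. h x = 0"
    if "?I h = 0" "integrable M (\<lambda>x. norm (h x) powr q)" for h :: "'a \<Rightarrow> complex"
    using that by (subst (asm) integral_nonneg_eq_0_iff_AE) auto
  define A B where "A = ?I f powr (1/q)" and "B = ?I g powr (1/q)"
  have I0: "?I h \<ge> 0" for h by simp
  show ?thesis
  proof (cases "?I f = 0 \<or> ?I g = 0")
    case True
    then show ?thesis
    proof
      assume z: "?I f = 0"
      have "?I (\<lambda>x. f x + g x) = ?I g"
        by (rule integral_cong_AE) (use zero[OF z f] in auto)
      then show ?thesis by simp
    next
      assume z: "?I g = 0"
      have "?I (\<lambda>x. f x + g x) = ?I f"
        by (rule integral_cong_AE) (use zero[OF z g] in auto)
      then show ?thesis by simp
    qed
  next
    case False
    then have pos: "?I f > 0" "?I g > 0" using I0[of f] I0[of g] by linarith+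
    then have AB: "A > 0" "B > 0" by (simp_all add: A_def B_def)
    define t where "t = A / (A + B)"
    have t: "0 < t" "t < 1" "1 - t = B / (A + B)" using AB by (auto simp: t_def field_simps)
    have IA: "?I f = A powr q" "?I g = B powr q" using pos q by (simp_all add: A_def B_def powr_powr)
    have "?I (\<lambda>x. f x + g x) \<le> (\<integral>x. t powr (1 - q) * norm (f x) powr q + (1 - t) powr (1 - q) * norm (g x) powr q \<partial>M)"
    proof (rule integral_mono[OF fg])
      show "integrable M (\<lambda>x. t powr (1 - q) * norm (f x) powr q + (1 - t) powr (1 - q) * norm (g x) powr q)"
        using f g by auto
      fix x
      have "norm (f x + g x) powr q \<le> (norm (f x) + norm (g x)) powr q"
        using q by (intro powr_mono2 norm_triangle_ineq) auto
      also have "\<dots> \<le> t powr (1 - q) * norm (f x) powr q + (1 - t) powr (1 - q) * norm (g x) powr q"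
        using t q by (intro add_powr_le) auto
      finally show "norm (f x + g x) powr q \<le> t powr (1 - q) * norm (f x) powr q + (1 - t) powr (1 - q) * norm (g x) powr q" .
    qed
    also have "\<dots> = t powr (1 - q) * A powr q + (1 - t) powr (1 - q) * B powr q"
      using f g by (simp add: IA)
    also have "\<dots> = (A + B) powr q"
    proof -
      have "(C / (A + B)) powr (1 - q) * C powr q = (A + B) powr (q - 1) * C" if "C > 0" for C
        using that AB by (simp add: powr_divide powr_diff)
      then have "t powr (1 - q) * A powr q + (1 - t) powr (1 - q) * B powr q = (A + B) powr (q - 1) * (A + B)"
        unfolding t(3) unfolding t_def using AB by (simp add: distrib_left)
      also have "\<dots> = (A + B) powr q" using AB by (simp add: powr_mult_base[symmetric] powr_diff)
      finally show ?thesis .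
    qed
    finally have "?I (\<lambda>x. f x + g x) powr (1/q) \<le> ((A + B) powr q) powr (1/q)"
      using q by (intro powr_mono2) auto
    then show ?thesis using AB q by (simp add: powr_powr A_def B_def)
  qed
qed

lemma Minkowski_sum:
  fixes a b :: "'i \<Rightarrow> real"
  assumes "finite F" "q \<ge> 1" "\<And>i. i \<in> F \<Longrightarrow> a i \<ge> 0" "\<And>i. i \<in> F \<Longrightarrow> b i \<ge> 0"
  shows "(\<Sum>i\<in>F. (a i + b i) powr q) powr (1/q)
    \<le> (\<Sum>i\<in>F. a i powr q) powr (1/q) + (\<Sum>i\<in>F. b i powr q) powr (1/q)"
proof -
  have int: "integrable (count_space F) h" for h :: "'i \<Rightarrow> real"
    using assms(1) by (rule integrable_count_space)
  have "(\<integral>i. norm (complex_of_real (a i) + complex_of_real (b i)) powr q \<partial>count_space F) powr (1/q)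
    \<le> (\<integral>i. norm (complex_of_real (a i)) powr q \<partial>count_space F) powr (1/q)
      + (\<integral>i. norm (complex_of_real (b i)) powr q \<partial>count_space F) powr (1/q)"
    by (rule Minkowski_integral) (use assms(2) int in auto)
  moreover have "(\<Sum>i\<in>F. norm (complex_of_real (a i) + complex_of_real (b i)) powr q) = (\<Sum>i\<in>F. (a i + b i) powr q)"
    using assms(3,4) by (intro sum.cong) (auto simp flip: of_real_add)
  moreover have "(\<Sum>i\<in>F. \<bar>a i\<bar> powr q) = (\<Sum>i\<in>F. a i powr q)" "(\<Sum>i\<in>F. \<bar>b i\<bar> powr q) = (\<Sum>i\<in>F. b i powr q)"
    using assms(3,4) by (auto intro!: sum.cong)
  ultimately show ?thesis using assms(1) by (simp add: lebesgue_integral_count_space_finite)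
qed


section \<open>Trigonometric polynomials\<close>

abbreviation cube :: "(real ^ 'd) set" where
  "cube \<equiv> cbox 0 (\<chi> i. 2 * pi)"

definition periodic :: "(real ^ 'd \<Rightarrow> 'b) \<Rightarrow> bool" where
  "periodic f \<longleftrightarrow> (\<forall>x j. f (x + axis j (2 * pi)) = f x)"

lemma continuous_integrable_torus:
  fixes f :: "real ^ 'd \<Rightarrow> 'b::euclidean_space"
  assumes "continuous_on UNIV f"
  shows "integrable torus_measure f" "integral\<^sup>L torus_measure f = integral cube f"
proof -
  show 1: "integrable torus_measure f" unfolding torus_measure_def
    by (rule continuous_imp_integrable) (rule continuous_on_subset[OF assms], simp)
  show "integral\<^sup>L torus_measure f = integral cube f"
    using 1 unfolding torus_measure_def by (rule lebesgue_integral_eq_integral) simp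
qed

lemma continuous_measurable_torus:
  fixes f :: "real ^ 'd \<Rightarrow> 'b::euclidean_space"
  assumes "continuous_on UNIV f"
  shows "f \<in> borel_measurable torus_measure"
  using continuous_integrable_torus(1)[OF assms] by auto

lemma measure_torus: "measure torus_measure (space torus_measure :: (real^'d) set) = (2*pi) ^ CARD('d)"
  "emeasure torus_measure (space torus_measure :: (real^'d) set) < top"
proof -
  have s: "space (torus_measure :: (real^'d) measure) = cube" by (simp add: torus_measure_def)
  have "measure torus_measure (cube :: (real^'d) set) = measure lebesgue (cube :: (real^'d) set)"
    unfolding torus_measure_def by (subst measure_restrict_space) auto
  also have "\<dots> = (\<Prod>i\<in>(UNIV::'d set). 2 * pi)"
    by (subst measure_completion, simp, subst content_cbox_cart) (auto simp: interval_ne_empty_cart)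
  finally show "measure torus_measure (space torus_measure :: (real^'d) set) = (2*pi) ^ CARD('d)" by (simp add: s)
  show "emeasure torus_measure (space torus_measure :: (real^'d) set) < top"
    unfolding s unfolding torus_measure_def by (subst emeasure_restrict_space) (auto simp: emeasure_lborel_cbox_eq)
qed

lemma torus_const: "(\<integral>x. c \<partial>(torus_measure :: (real^'d) measure)) = (2*pi) ^ CARD('d) *\<^sub>R (c :: 'b :: {banach, second_countable_topology})"
  by (simp add: measure_torus)

text \<open>The shifted cube is cut at the hyperplane where coordinate \<open>j\<close> equals 2 pi.
  By periodicity the part beyond it can be moved back, where it completes the remaining slab to the
  original cube.\<close>

lemma integral_cube_shift:
  fixes f :: "real ^ 'd \<Rightarrow> 'b::euclidean_space"
  assumes cont: "continuous_on UNIV f" and per: "periodic f" and t: "0 \<le> t" "t \<le> 2 * pi"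
  shows "integral cube (\<lambda>x. f (x + axis j t)) = integral cube f"
proof -
  let ?b = "(\<chi> i. 2 * pi) :: real ^ 'd"
  let ?u = "(\<chi> i. if i = j then t else 2 * pi) :: real ^ 'd"
  let ?e = "axis j 1 :: real ^ 'd"
  have int: "f integrable_on cbox a b" for a b
    by (rule integrable_continuous) (rule continuous_on_subset[OF cont], simp)
  have e: "?e \<in> Basis" by (simp add: axis_in_Basis_iff)
  have ax: "axis j s $ i = (if i = j then s else 0)" for s i by (simp add: axis_def)
  have ip: "x \<bullet> ?e = x $ j" for x :: "real ^ 'd" by (simp add: inner_axis)
  have "integral cube (\<lambda>x. f (x + axis j t)) = integral (cbox (axis j t) (?b + axis j t)) f"
    using integral_shift_cbox[of "axis j t" "axis j t" "?b + axis j t" f] by simp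
  also have "\<dots> = integral (cbox (axis j t) (?b + axis j t) \<inter> {x. x \<bullet> ?e \<le> 2 * pi}) f
       + integral (cbox (axis j t) (?b + axis j t) \<inter> {x. x \<bullet> ?e \<ge> 2 * pi}) f"
    by (rule integral_split[OF int e])
  also have "cbox (axis j t) (?b + axis j t) \<inter> {x. x \<bullet> ?e \<le> 2 * pi} = cube \<inter> {x. x \<bullet> ?e \<ge> t}"
    unfolding ip using t by (auto simp: mem_box_cart ax split: if_splits) (smt (verit))+
  also have "cbox (axis j t) (?b + axis j t) \<inter> {x. x \<bullet> ?e \<ge> 2 * pi} = cbox (axis j (2*pi)) (?u + axis j (2*pi))"
    unfolding ip using t by (auto simp: mem_box_cart ax split: if_splits) (smt (verit))+
  also have "integral (cbox (axis j (2*pi)) (?u + axis j (2*pi))) f = integral (cbox 0 ?u) (\<lambda>x. f (x + axis j (2*pi)))"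
    using integral_shift_cbox[of "axis j (2*pi)" "axis j (2*pi)" "?u + axis j (2*pi)" f] by simp
  also have "(\<lambda>x. f (x + axis j (2*pi))) = f" using per by (auto simp: periodic_def)
  also have "cbox 0 ?u = cube \<inter> {x. x \<bullet> ?e \<le> t}"
    unfolding ip using t by (auto simp: mem_box_cart split: if_splits) (smt (verit))+
  also have "integral (cube \<inter> {x. x \<bullet> ?e \<ge> t}) f + integral (cube \<inter> {x. x \<bullet> ?e \<le> t}) f = integral cube f"
    using integral_split[OF int e, of 0 ?b t] by simp
  finally show ?thesis .
qed

lemma torus_shift:
  fixes f :: "real ^ 'd \<Rightarrow> 'b::euclidean_space"
  assumes "continuous_on UNIV f" "periodic f" "0 \<le> t" "t \<le> 2 * pi"
  shows "(\<integral>x. f (x + axis j t) \<partial>torus_measure) = (\<integral>x. f x \<partial>torus_measure)"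
proof -
  have c: "continuous_on UNIV (\<lambda>x. f (x + axis j t))"
    by (rule continuous_on_compose2[OF assms(1)]) (auto intro!: continuous_intros)
  show ?thesis using integral_cube_shift[OF assms] continuous_integrable_torus(2)[OF assms(1)]
    continuous_integrable_torus(2)[OF c] by simp
qed

definition trig :: "(int ^ 'd) set \<Rightarrow> (int ^ 'd \<Rightarrow> complex) \<Rightarrow> real ^ 'd \<Rightarrow> complex" where
  "trig S c x = (\<Sum>k\<in>S. c k * cis (real_vec k \<bullet> x))"

lemma real_vec_axis: "real_vec k \<bullet> axis j t = of_int (k $ j) * t"
  by (simp add: inner_axis real_vec_def)

lemma cis_add_axis: "cis (real_vec k \<bullet> (x + axis j t)) = cis (real_vec k \<bullet> x) * cis (of_int (k $ j) * t)"
  by (simp add: inner_add_right real_vec_axis cis_mult)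

lemma cis_int_2pi: "cis (of_int n * (2 * pi)) = 1"
proof -
  have "of_int n * (2 * pi) = 2 * pi * of_int n" by simp
  then show ?thesis by (simp only: cis_multiple_2pi Ints_of_int)
qed

lemma periodic_cis: "periodic (\<lambda>x. cis (real_vec k \<bullet> x))"
  unfolding periodic_def cis_add_axis cis_int_2pi by simp

lemma periodic_trig: "periodic (trig S c)"
  unfolding periodic_def trig_def cis_add_axis cis_int_2pi by simp

lemma continuous_cis_inner [continuous_intros]: "continuous_on A (\<lambda>x. cis (real_vec k \<bullet> x))"
  unfolding cis_conv_exp by (intro continuous_intros)

lemma continuous_trig [continuous_intros]: "continuous_on A (trig S c)"
  unfolding trig_def[abs_def] by (intro continuous_intros)

text \<open>A shift by pi / |k_j| in a coordinate with k_j different from 0 multiplies the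
  exponential by -1 but leaves the integral unchanged.\<close>

lemma integral_cis:
  "(\<integral>x. cis (real_vec k \<bullet> x) \<partial>(torus_measure :: (real^'d) measure))
    = (if k = 0 then of_real ((2*pi) ^ CARD('d)) else 0)"
proof (cases "k = 0")
  case True
  then have "real_vec k = (0 :: real ^ 'd)" by (simp add: real_vec_def vec_eq_iff)
  then have "(\<lambda>x :: real^'d. cis (real_vec k \<bullet> x)) = (\<lambda>_. 1)" by simp
  then show ?thesis using True torus_const[where 'd = 'd, of "1::complex"] by (simp add: scaleR_conv_of_real)
next
  case False
  then obtain j where j: "k $ j \<noteq> 0" by (auto simp: vec_eq_iff)
  define t where "t = pi / \<bar>of_int (k $ j)\<bar>"
  have "1 \<le> \<bar>k $ j\<bar>" using j by linarith
  then have k1: "1 \<le> \<bar>real_of_int (k $ j)\<bar>" by linarith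
  have t: "0 \<le> t" "t \<le> 2 * pi"
  proof -
    show "0 \<le> t" by (simp add: t_def)
    have "t \<le> pi" unfolding t_def using k1 by (simp add: divide_le_eq)
    then show "t \<le> 2 * pi" using pi_gt_zero by linarith
  qed
  let ?f = "\<lambda>x :: real^'d. cis (real_vec k \<bullet> x)"
  have c: "continuous_on UNIV ?f" by (intro continuous_intros)
  have "cis (of_int (k $ j) * t) = -1"
  proof (cases "k $ j > 0")
    case True then show ?thesis by (simp add: t_def)
  next
    case False
    then have "of_int (k $ j) * t = - pi" using j by (simp add: t_def field_simps)
    then show ?thesis by (simp add: complex_eq_iff)
  qed
  moreover have "(\<integral>x. ?f (x + axis j t) \<partial>torus_measure) = (\<integral>x. ?f x \<partial>torus_measure)"
    by (rule torus_shift[OF c periodic_cis t])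
  ultimately have "(\<integral>x. ?f x \<partial>torus_measure) * (-1) = (\<integral>x. ?f x \<partial>torus_measure)"
    unfolding cis_add_axis using continuous_integrable_torus(1)[OF c] by simp
  then show ?thesis using False by (simp add: neg_equal_zero)
qed

lemma real_vec_diff: "real_vec (k - k') = real_vec k - real_vec k'"
  by (simp add: real_vec_def vec_eq_iff)

lemma fourier_coeff_trig:
  fixes S :: "(int ^ 'd) set"
  assumes "finite S"
  shows "fourier_coeff (trig S c) k = (if k \<in> S then c k else 0)"
proof -
  have "(\<integral>x. trig S c x * cis (- (real_vec k \<bullet> x)) \<partial>torus_measure)
    = (\<integral>x. (\<Sum>k'\<in>S. c k' * cis (real_vec (k' - k) \<bullet> x)) \<partial>torus_measure)"
    by (intro arg_cong[where f = "integral\<^sup>L torus_measure"])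
       (simp add: trig_def fun_eq_iff sum_distrib_right mult.assoc cis_mult real_vec_diff inner_diff_left)
  also have "\<dots> = (\<Sum>k'\<in>S. c k' * (\<integral>x. cis (real_vec (k' - k) \<bullet> x) \<partial>torus_measure))"
    by (subst Bochner_Integration.integral_sum)
       (auto intro!: integrable_mult_right continuous_integrable_torus continuous_intros)
  also have "\<dots> = (\<Sum>k'\<in>S. if k' = k then c k * of_real ((2*pi) ^ CARD('d)) else 0)"
    unfolding integral_cis by (intro sum.cong) auto
  also have "\<dots> = (if k \<in> S then c k * of_real ((2*pi) ^ CARD('d)) else 0)"
    using assms by simp
  finally show ?thesis unfolding fourier_coeff_def by simp
qed

lemma cis_diff: "cis (a - b) = cis a * cnj (cis b)"
  by (simp add: cis_cnj cis_mult)

lemma parseval_trig: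
  fixes S :: "(int ^ 'd) set"
  assumes "finite S"
  shows "(\<integral>x. (norm (trig S c x))\<^sup>2 \<partial>torus_measure) = (2*pi) ^ CARD('d) * (\<Sum>k\<in>S. (norm (c k))\<^sup>2)"
proof -
  let ?w = "\<lambda>k x. c k * cis (real_vec k \<bullet> x)"
  have int: "integrable torus_measure (\<lambda>x. ?w k x * cnj (?w k' x))" for k k'
    by (intro continuous_integrable_torus continuous_intros)
  have e: "complex_of_real ((norm (trig S c x))\<^sup>2) = (\<Sum>k\<in>S. \<Sum>k'\<in>S. ?w k x * cnj (?w k' x))" for x
    unfolding complex_norm_square trig_def cnj_sum sum_product by simp
  have i1: "(\<integral>x. ?w k x * cnj (?w k' x) \<partial>torus_measure)
      = (if k' = k then of_real ((2*pi) ^ CARD('d) * (norm (c k))\<^sup>2) else 0)" for k k'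
  proof -
    have "(\<integral>x. ?w k x * cnj (?w k' x) \<partial>torus_measure)
      = (\<integral>x. (c k * cnj (c k')) * cis (real_vec (k - k') \<bullet> x) \<partial>torus_measure)"
      by (intro arg_cong[where f = "integral\<^sup>L torus_measure"])
         (simp add: fun_eq_iff real_vec_diff inner_diff_left cis_diff algebra_simps)
    also have "\<dots> = (if k' = k then of_real ((2*pi) ^ CARD('d) * (norm (c k))\<^sup>2) else 0)"
      by (auto simp: integral_cis complex_norm_square simp del: of_real_power)
    finally show ?thesis .
  qed
  have "complex_of_real (\<integral>x. (norm (trig S c x))\<^sup>2 \<partial>torus_measure)
    = (\<integral>x. (\<Sum>k\<in>S. \<Sum>k'\<in>S. ?w k x * cnj (?w k' x)) \<partial>torus_measure)"
    unfolding integral_complex_of_real[symmetric] e ..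
  also have "\<dots> = (\<Sum>k\<in>S. \<Sum>k'\<in>S. (\<integral>x. ?w k x * cnj (?w k' x) \<partial>torus_measure))"
    by (subst Bochner_Integration.integral_sum, intro Bochner_Integration.integrable_sum int)
       (intro sum.cong refl Bochner_Integration.integral_sum int)
  also have "\<dots> = of_real ((2*pi) ^ CARD('d) * (\<Sum>k\<in>S. (norm (c k))\<^sup>2))"
    unfolding i1 using assms by (simp add: sum_distrib_left)
  finally show ?thesis unfolding of_real_eq_iff .
qed


section \<open>Lebesgue norms on the torus\<close>

text \<open>A real-valued norm for calculations. The integral has the default value 0 when it
  diverges, so inequalities between norms of different functions assume continuity.\<close>

definition Lnorm :: "real \<Rightarrow> (real ^ 'd \<Rightarrow> complex) \<Rightarrow> real" where
  "Lnorm q f = (\<integral>x. norm (f x) powr q \<partial>torus_measure) powr (1/q)"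

lemma Lnorm_nonneg [simp]: "Lnorm q f \<ge> 0"
  by (simp add: Lnorm_def)

lemma integrable_powr_torus:
  fixes f :: "real ^ 'd \<Rightarrow> complex"
  assumes "continuous_on UNIV f" "q > 0"
  shows "integrable torus_measure (\<lambda>x. norm (f x) powr q)"
  using assms by (intro continuous_integrable_torus continuous_intros continuous_on_powr') auto

lemma Lnorm_powr: "q > 0 \<Longrightarrow> Lnorm q f powr q = (\<integral>x. norm (f x) powr q \<partial>torus_measure)"
  by (simp add: Lnorm_def powr_powr)

lemma Lnorm_triangle:
  assumes "continuous_on UNIV f" "continuous_on UNIV g" "q \<ge> 1"
  shows "Lnorm q (\<lambda>x. f x + g x) \<le> Lnorm q f + Lnorm q g"
  unfolding Lnorm_def using assms
  by (intro Minkowski_integral integrable_powr_torus continuous_measurable_torus continuous_intros) auto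

lemma Lnorm_scale: "q > 0 \<Longrightarrow> Lnorm q (\<lambda>x. c * f x) = norm c * Lnorm q f"
  by (simp add: Lnorm_def norm_mult powr_mult powr_powr)

lemma Lnorm_zero [simp]: "Lnorm q (\<lambda>x. 0) = 0"
  by (simp add: Lnorm_def)

lemma Lnorm_sum:
  assumes "finite J" "\<And>j. j \<in> J \<Longrightarrow> continuous_on UNIV (f j)" "q \<ge> 1"
  shows "Lnorm q (\<lambda>x. \<Sum>j\<in>J. f j x) \<le> (\<Sum>j\<in>J. Lnorm q (f j))"
  using assms(1,2)
proof (induction J rule: finite_induct)
  case (insert j J)
  have "Lnorm q (\<lambda>x. f j x + (\<Sum>j\<in>J. f j x)) \<le> Lnorm q (f j) + Lnorm q (\<lambda>x. \<Sum>j\<in>J. f j x)"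
    by (rule Lnorm_triangle) (use insert assms(3) in \<open>auto intro!: continuous_intros\<close>)
  then show ?case using insert by simp
qed simp

lemma Lnorm_shift:
  assumes "continuous_on UNIV f" "periodic f" "0 \<le> t" "t \<le> 2 * pi" "q > 0"
  shows "Lnorm q (\<lambda>x. f (x + axis j t)) = Lnorm q f"
proof -
  have "(\<integral>x. norm (f (x + axis j t)) powr q \<partial>torus_measure) = (\<integral>x. norm (f x) powr q \<partial>torus_measure)"
  proof (rule torus_shift[of "\<lambda>x. norm (f x) powr q"])
    show "continuous_on UNIV (\<lambda>x. norm (f x) powr q)"
      using assms by (intro continuous_intros continuous_on_powr') auto
    show "periodic (\<lambda>x. norm (f x) powr q)" using assms(2) by (simp add: periodic_def)
  qed (use assms in auto)
  then show ?thesis by (simp add: Lnorm_def)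
qed

lemma two_pi_power_ge_1: "1 \<le> (2 * pi) ^ n"
  using pi_gt3 by (intro one_le_power) simp

lemma Lnorm_2: "finite S \<Longrightarrow> (Lnorm 2 (trig S c))\<^sup>2 = (2*pi) ^ CARD('d) * (\<Sum>k\<in>S. (norm (c k))\<^sup>2)"
  for S :: "(int ^ 'd) set"
proof -
  assume "finite S"
  have "(Lnorm 2 (trig S c))\<^sup>2 = (\<integral>x. norm (trig S c x) powr 2 \<partial>torus_measure)"
    using Lnorm_powr[of 2 "trig S c"] by (cases "Lnorm 2 (trig S c) = 0") (auto simp flip: powr_numeral)
  also have "\<dots> = (\<integral>x. (norm (trig S c x))\<^sup>2 \<partial>torus_measure)"
    by (intro Bochner_Integration.integral_cong refl) (auto simp: powr_numeral)
  finally show ?thesis using parseval_trig[OF \<open>finite S\<close>, of c] by simp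
qed

text \<open>A substitute for Hoelder's inequality: applied to quotients by the expected size, it
  compares means of different orders up to a constant factor.\<close>

lemma powr_le_one_plus: "u \<ge> 0 \<Longrightarrow> 0 < q \<Longrightarrow> q \<le> p \<Longrightarrow> u powr q \<le> 1 + u powr p" for u :: real
proof (cases "u \<le> 1")
  case True
  assume "u \<ge> 0" "0 < q"
  then have "u powr q \<le> 1" using True by (cases "u = 0") (auto simp: powr_le1)
  then show ?thesis by (smt (verit) powr_ge_zero)
next
  case False
  assume "q \<le> p"
  then have "u powr q \<le> u powr p" using False by (intro powr_mono) auto
  then show ?thesis by simp
qed

text \<open>Replacing M^(1/q) by M keeps later constants free of the exponent q.\<close>

lemma powr_mean_bound:
  fixes M B q :: real
  assumes "0 \<le> B" "q \<ge> 1" "0 \<le> I" "I \<le> M * B powr q" "M \<ge> 1"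
  shows "I powr (1/q) \<le> M * B"
proof -
  have "I powr (1/q) \<le> (M * B powr q) powr (1/q)" using assms by (intro powr_mono2) auto
  also have "\<dots> = M powr (1/q) * B" using assms by (simp add: powr_mult powr_powr)
  also have "\<dots> \<le> M powr 1 * B" using assms by (intro mult_right_mono powr_mono) auto
  finally show ?thesis using assms by simp
qed

lemma Lnorm_mono:
  fixes f :: "real ^ 'd \<Rightarrow> complex"
  assumes f: "continuous_on UNIV f" and q: "1 \<le> q" "q \<le> p"
  shows "Lnorm q f \<le> ((2*pi) ^ CARD('d) + 1) * Lnorm p f"
proof (cases "Lnorm p f = 0")
  case True
  then have "(\<integral>x. norm (f x) powr p \<partial>torus_measure) = 0" by (simp add: Lnorm_def)
  then have ae: "AE x in torus_measure. norm (f x) powr p = 0"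
    using integrable_powr_torus[OF f] q by (subst (asm) integral_nonneg_eq_0_iff_AE) auto
  have "(\<integral>x. norm (f x) powr q \<partial>torus_measure) = (\<integral>x. 0 \<partial>(torus_measure :: (real^'d) measure))"
    by (rule integral_cong_AE) (use continuous_measurable_torus[OF f] ae in \<open>auto elim: eventually_mono\<close>)
  then show ?thesis using True by (simp add: Lnorm_def)
next
  case False
  define B where "B = Lnorm p f"
  have B: "B > 0" using False Lnorm_nonneg[of p f] unfolding B_def by linarith
  have "(\<integral>x. norm (f x) powr q \<partial>torus_measure)
     \<le> (\<integral>x. B powr q * (1 + B powr (-p) * norm (f x) powr p) \<partial>(torus_measure :: (real^'d) measure))"
  proof (rule integral_mono)
    show "integrable torus_measure (\<lambda>x. norm (f x) powr q)" using q by (intro integrable_powr_torus f) auto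
    show "integrable torus_measure (\<lambda>x. B powr q * (1 + B powr (-p) * norm (f x) powr p))"
      using f q by (intro continuous_integrable_torus continuous_intros continuous_on_powr') auto
    fix x
    have "(norm (f x) / B) powr q \<le> 1 + (norm (f x) / B) powr p"
      using B q by (intro powr_le_one_plus) auto
    then have "B powr q * (norm (f x) / B) powr q \<le> B powr q * (1 + (norm (f x) / B) powr p)"
      by (intro mult_left_mono) auto
    then show "norm (f x) powr q \<le> B powr q * (1 + B powr (-p) * norm (f x) powr p)"
      using B by (simp add: powr_divide powr_minus_divide)
  qed
  also have "\<dots> = B powr q * ((2*pi) ^ CARD('d) + B powr (-p) * B powr p)"
  proof -
    have "integrable (torus_measure :: (real^'d) measure) (\<lambda>x. 1::real)"
      by (intro continuous_integrable_torus continuous_intros)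
    then show ?thesis
      using integrable_powr_torus[OF f, of p] q torus_const[where 'd = 'd, of "1::real"]
      by (simp add: B_def Lnorm_powr)
  qed
  also have "\<dots> = ((2*pi) ^ CARD('d) + 1) * B powr q"
    using B by (simp add: powr_minus)
  finally show ?thesis unfolding Lnorm_def[of q f] B_def[symmetric]
    using B q two_pi_power_ge_1[of "CARD('d)"] by (intro powr_mean_bound) auto
qed

section \<open>Comparison with the extended-valued norms\<close>

lemma ennreal_powr_ennreal: "a \<ge> 0 \<Longrightarrow> ennreal_powr (ennreal a) t = ennreal (a powr t)"
  by (simp add: ennreal_powr_def)

lemma recip_ennreal: "q > 0 \<Longrightarrow> recip (ennreal q) = 1 / q"
  by (simp add: recip_def inverse_ennreal divide_inverse)

lemma torus_Lp_norm_Lnorm: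
  assumes f: "integrable torus_measure (\<lambda>x. norm (f x) powr q)" and q: "q > 0"
  shows "torus_Lp_norm (ennreal q) f = ennreal (Lnorm q f)"
proof -
  have "(\<integral>\<^sup>+x. ennreal_powr (ennreal (norm (f x))) q \<partial>torus_measure) = ennreal (\<integral>x. norm (f x) powr q \<partial>torus_measure)"
    using f by (simp add: ennreal_powr_ennreal nn_integral_eq_integral)
  then show ?thesis using q
    by (simp add: torus_Lp_norm_def enn_Lp_norm_def ennreal_powr_ennreal recip_ennreal Lnorm_def)
qed

lemma torus_Lp_norm_continuous:
  "continuous_on UNIV f \<Longrightarrow> q > 0 \<Longrightarrow> torus_Lp_norm (ennreal q) f = ennreal (Lnorm q f)"
  by (intro torus_Lp_norm_Lnorm integrable_powr_torus)

lemma torus_Lp_iff: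
  assumes q: "q > 0"
  shows "f \<in> torus_Lp (ennreal q) \<longleftrightarrow> f \<in> borel_measurable torus_measure \<and> integrable torus_measure (\<lambda>x. norm (f x) powr q)"
proof (cases "f \<in> borel_measurable torus_measure")
  case [measurable]: True
  have "torus_Lp_norm (ennreal q) f < top \<longleftrightarrow> (\<integral>\<^sup>+x. ennreal (norm (f x) powr q) \<partial>torus_measure) < top"
    using q by (auto simp: torus_Lp_norm_def enn_Lp_norm_def ennreal_powr_ennreal ennreal_powr_def top.not_eq_extremum)
  also have "\<dots> \<longleftrightarrow> integrable torus_measure (\<lambda>x. norm (f x) powr q)"
    by (subst integrable_iff_bounded) auto
  finally show ?thesis by (simp add: torus_Lp_def)
qed (simp add: torus_Lp_def)

lemma ennreal_ge_cases:
  assumes "ennreal q \<le> p" "q > 0"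
  obtains "p = top" | p' where "p = ennreal p'" "q \<le> p'"
  using assms by (cases p) auto

lemma torus_Lp_mono:
  fixes f :: "real ^ 'd \<Rightarrow> complex"
  assumes f: "f \<in> torus_Lp p" and p: "ennreal q \<le> p" and q: "q > 0"
  shows "f \<in> torus_Lp (ennreal q)"
proof -
  have [measurable]: "f \<in> borel_measurable torus_measure" using f by (simp add: torus_Lp_def)
  interpret finite_measure "torus_measure :: (real ^ 'd) measure"
    by standard (use measure_torus(2)[where 'd = 'd] in auto)
  have "integrable torus_measure (\<lambda>x. norm (f x) powr q)"
  proof (rule ennreal_ge_cases[OF p q])
    assume p: "p = top"
    define B where "B = esssup torus_measure (\<lambda>x. ennreal (norm (f x)))"
    have "B < top" using f p by (simp add: torus_Lp_def torus_Lp_norm_def enn_Lp_norm_def B_def)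
    then obtain b where b: "B = ennreal b" "b \<ge> 0" by (cases B) auto
    have "AE x in torus_measure. ennreal (norm (f x)) \<le> B" unfolding B_def by (rule esssup_AE)
    then have "AE x in torus_measure. norm (f x) \<le> b" using b by simp
    then have "AE x in torus_measure. norm (norm (f x) powr q) \<le> b powr q"
      using q by (auto elim!: eventually_mono intro!: powr_mono2)
    then show ?thesis by (intro integrable_const_bound) auto
  next
    fix p' assume p': "p = ennreal p'" "q \<le> p'"
    then have "integrable torus_measure (\<lambda>x. 1 + norm (f x) powr p')"
      using f q torus_Lp_iff[of p' f] by simp
    then show ?thesis
    proof (rule Bochner_Integration.integrable_bound)
      show "AE x in torus_measure. norm (norm (f x) powr q) \<le> norm (1 + norm (f x) powr p')"
        using q p' by (intro AE_I2) (auto intro!: powr_le_one_plus)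
    qed auto
  qed
  then show ?thesis using q by (simp add: torus_Lp_iff)
qed

lemma torus_Lp_integrable:
  fixes f :: "real ^ 'd \<Rightarrow> complex"
  assumes "f \<in> torus_Lp (ennreal q)" "q \<ge> 1"
  shows "integrable torus_measure f"
proof -
  have "f \<in> torus_Lp (ennreal 1)" using assms by (intro torus_Lp_mono[OF assms(1)]) (auto simp: ennreal_leI)
  then have [measurable]: "f \<in> borel_measurable torus_measure"
    and "integrable torus_measure (\<lambda>x. norm (f x) powr 1)" using torus_Lp_iff[of 1 f] by auto
  then have "integrable torus_measure (\<lambda>x. norm (f x))" by simp
  then show ?thesis by (subst (asm) integrable_norm_iff) auto
qed

lemma continuous_torus_Lp: "continuous_on UNIV f \<Longrightarrow> q > 0 \<Longrightarrow> f \<in> torus_Lp (ennreal q)"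
  by (simp add: torus_Lp_iff continuous_measurable_torus integrable_powr_torus)

lemma torus_Lp_bounded:
  fixes f :: "real ^ 'd \<Rightarrow> complex"
  assumes f: "continuous_on UNIV f" and B: "\<And>x. norm (f x) \<le> B" and p: "1 \<le> p"
  shows "torus_Lp_norm p f \<le> ennreal ((2*pi) ^ CARD('d) * B)" "f \<in> torus_Lp p"
proof -
  have B0: "B \<ge> 0" using B[of 0] norm_ge_zero[of "f 0"] by linarith
  have m [measurable]: "f \<in> borel_measurable torus_measure" by (rule continuous_measurable_torus[OF f])
  have "ennreal 1 \<le> p" using p by simp
  then show *: "torus_Lp_norm p f \<le> ennreal ((2*pi) ^ CARD('d) * B)"
  proof (rule ennreal_ge_cases)
    assume "p = top"
    then have "torus_Lp_norm p f = esssup torus_measure (\<lambda>x. ennreal (norm (f x)))"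
      by (simp add: torus_Lp_norm_def enn_Lp_norm_def)
    also have "\<dots> \<le> ennreal B" using B by (intro esssup_I) (auto intro!: ennreal_leI)
    also have "\<dots> \<le> ennreal ((2*pi) ^ CARD('d) * B)"
      using mult_right_mono[OF two_pi_power_ge_1[of "CARD('d)"] B0] by (intro ennreal_leI) simp
    finally show ?thesis .
  next
    fix p' assume p': "p = ennreal p'" "1 \<le> p'"
    have "(\<integral>x. norm (f x) powr p' \<partial>torus_measure) \<le> (\<integral>x. B powr p' \<partial>(torus_measure :: (real^'d) measure))"
      using p' B by (intro integral_mono integrable_powr_torus f continuous_integrable_torus continuous_intros powr_mono2) auto
    then have "(\<integral>x. norm (f x) powr p' \<partial>torus_measure) \<le> (2*pi) ^ CARD('d) * B powr p'"
      by (simp add: measure_torus)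
    then have "Lnorm p' f \<le> (2*pi) ^ CARD('d) * B" unfolding Lnorm_def
      using p' B0 two_pi_power_ge_1 by (intro powr_mean_bound) auto
    then show ?thesis using p' torus_Lp_norm_continuous[OF f, of p'] by (simp add: ennreal_leI)
  qed simp
  show "f \<in> torus_Lp p" using m le_less_trans[OF *] by (simp add: torus_Lp_def)
qed

lemma Lnorm_le_of_torus_Lp_norm:
  fixes f :: "real ^ 'd \<Rightarrow> complex"
  assumes f: "continuous_on UNIV f" and p: "ennreal q \<le> p" and q: "q \<ge> 1"
    and B: "torus_Lp_norm p f \<le> ennreal B" "B \<ge> 0"
  shows "Lnorm q f \<le> ((2*pi) ^ CARD('d) + 1) * B"
proof (rule ennreal_ge_cases[OF p])
  assume p: "p = top"
  have [measurable]: "f \<in> borel_measurable torus_measure" by (rule continuous_measurable_torus[OF f])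
  have "esssup torus_measure (\<lambda>x. ennreal (norm (f x))) \<le> ennreal B"
    using B p by (simp add: torus_Lp_norm_def enn_Lp_norm_def)
  moreover have "AE x in torus_measure. ennreal (norm (f x)) \<le> esssup torus_measure (\<lambda>x. ennreal (norm (f x)))"
    by (rule esssup_AE)
  ultimately have "AE x in torus_measure. norm (f x) \<le> B" using B by (auto elim!: eventually_mono dest: order_trans)
  then have ae: "AE x in torus_measure. norm (f x) powr q \<le> B powr q"
    using q by (auto elim!: eventually_mono intro!: powr_mono2)
  have "(\<integral>x. norm (f x) powr q \<partial>torus_measure) \<le> (\<integral>x. B powr q \<partial>(torus_measure :: (real^'d) measure))"
    using ae q f by (intro integral_mono_AE integrable_powr_torus continuous_integrable_torus continuous_intros) auto
  then have "(\<integral>x. norm (f x) powr q \<partial>torus_measure) \<le> (2*pi) ^ CARD('d) * B powr q"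
    by (simp add: measure_torus)
  also have "\<dots> \<le> ((2*pi) ^ CARD('d) + 1) * B powr q" by (intro mult_right_mono) auto
  finally show ?thesis unfolding Lnorm_def using B q two_pi_power_ge_1[of "CARD('d)"]
    by (intro powr_mean_bound) auto
next
  fix p' assume p': "p = ennreal p'" "q \<le> p'"
  then have "Lnorm p' f \<le> B" using B torus_Lp_norm_continuous[OF f, of p'] q by simp
  then have "((2*pi) ^ CARD('d) + 1) * Lnorm p' f \<le> ((2*pi) ^ CARD('d) + 1) * B"
    by (intro mult_left_mono) (auto intro: add_nonneg_nonneg)
  then show ?thesis using Lnorm_mono[OF f q p'(2)] by linarith
qed (use q in simp)

section \<open>The dyadic decomposition\<close>

lemma sum_inverse_squares_le: "(\<Sum>a=1..n. 1 / (real a)\<^sup>2) \<le> 2"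
proof -
  have "(\<Sum>a=1..n. 1 / (real a)\<^sup>2) \<le> 2 - 1 / real n" if "n \<ge> 1" for n
    using that
  proof (induction n rule: dec_induct)
    case (step n)
    have "1 / (real (Suc n))\<^sup>2 \<le> 1 / real n - 1 / real (Suc n)"
    proof -
      have "1 / real n - 1 / real (Suc n) = 1 / (real n * real (Suc n))"
        using step by (simp add: divide_simps)
      moreover have "1 / (real (Suc n))\<^sup>2 \<le> 1 / (real n * real (Suc n))"
        unfolding power2_eq_square using step by (intro divide_left_mono mult_right_mono) auto
      ultimately show ?thesis by simp
    qed
    then show ?case using step by simp
  qed simp
  from this[of n] show ?thesis by (cases "n = 0") (auto intro: order_trans)
qed

lemma sum_roots_of_unity:
  fixes h :: int and A :: nat
  assumes h: "\<bar>h\<bar> < int A"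
  shows "(\<Sum>a<A. cis (2 * pi * real a / real A * of_int h)) = (if h = 0 then of_nat A else 0)"
proof (cases "h = 0")
  case False
  have A: "A > 0" using h by simp
  define t where "t = 2 * pi / real A * of_int h"
  have t2: "t / 2 = pi * (of_int h / real A)" by (simp add: t_def)
  have q: "\<bar>of_int h / real A\<bar> < 1" using h A by (simp add: abs_divide)
  have sin0: "sin (pi * x) \<noteq> 0" if "0 < x" "x < 1" for x
    using sin_gt_zero[of "pi * x"] that by simp
  have "sin (t / 2) \<noteq> 0"
  proof (cases "h > 0")
    case True
    then have "0 < of_int h / real A" using A by simp
    moreover have "of_int h / real A < 1" using q by linarith
    ultimately show ?thesis unfolding t2 by (rule sin0)
  next
    case F: False
    then have "of_int h / real A < 0" using A False by (simp add: divide_less_0_iff)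
    then have "0 < - (of_int h / real A)" by simp
    moreover have "- (of_int h / real A) < 1" using q by linarith
    ultimately have "sin (pi * - (of_int h / real A)) \<noteq> 0" by (rule sin0)
    then show ?thesis unfolding t2 mult_minus_right sin_minus by simp
  qed
  moreover have "cos t = 1 - 2 * (sin (t / 2))\<^sup>2" using cos_double_sin[of "t / 2"] by simp
  ultimately have "cos t \<noteq> 1" by simp
  then have ne: "cis t \<noteq> 1" by (auto simp: complex_eq_iff)
  have pw: "cis (2 * pi * real a / real A * of_int h) = cis t ^ a" for a
    unfolding Complex.DeMoivre t_def by (rule arg_cong[where f = cis]) simp
  have "cis t ^ A = 1"
  proof -
    have "cis t ^ A = cis (2 * pi * of_int h)" unfolding Complex.DeMoivre t_def using A by simp
    also have "\<dots> = 1" by (rule cis_multiple_2pi) simp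
    finally show ?thesis .
  qed
  then show ?thesis using ne False unfolding pw by (simp add: sum_gp_strict)
qed simp

lemma sin_ge_half: "0 \<le> x \<Longrightarrow> x \<le> pi / 2 \<Longrightarrow> x / 2 \<le> sin x"
proof -
  assume x: "0 \<le> x" "x \<le> pi / 2"
  have ax: "sin x \<ge> x - x ^ 3 / 6"
  proof (cases "x = 0")
    case False
    then have "x > 0" using x by simp
    then obtain t where "sin x = (\<Sum>m<4. sin_coeff m * x ^ m) + sin (t + 1/2 * real (4::nat) * pi) / fact 4 * x ^ 4" "0 < t" "t < x"
      using Maclaurin_sin_expansion3[of 4 x] by auto
    moreover have "(\<Sum>m<4. sin_coeff m * x ^ m) = x - x ^ 3 / 6"
    proof -
      have "{..<4::nat} = {0, 1, 2, 3}" by auto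
      then show ?thesis by (simp add: sin_coeff_def fact_numeral)
    qed
    moreover have "sin (t + 1/2 * real (4::nat) * pi) \<ge> 0"
    proof -
      have "sin (t + 1/2 * real (4::nat) * pi) = sin t" using sin_periodic[of t] by simp
      moreover have "t < pi" using \<open>t < x\<close> x pi_gt_zero by linarith
      ultimately show ?thesis using sin_gt_zero[of t] \<open>0 < t\<close> by simp
    qed
    ultimately show ?thesis by simp
  qed simp
  \<comment> \<open>1.6 exceeds pi/2 and its square is below 3, so the cubic term is at most half of
    the linear one.\<close>
  have "x < 1.6" using x pi_approx by simp
  then have "x * x \<le> 1.6 * 1.6" using x by (intro mult_mono) auto
  then have "x * (x * x) \<le> x * 3" using x by (intro mult_left_mono) auto
  then have "x ^ 3 / 6 \<le> x / 2" by (simp add: power3_eq_cube)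
  then show ?thesis using ax by simp
qed

text \<open>Beyond the middle the sine is reflected, so that the distance to the nearer end of the
  period counts.\<close>

lemma sin_pi_frac_ge:
  assumes "a > 0" "a < A"
  shows "real (min a (A - a)) / real A \<le> sin (pi * real a / real A)"
proof -
  have le: "real b / real A \<le> sin (pi * real b / real A)" if "b > 0" "2 * b \<le> A" for b
  proof -
    have A: "real A > 0" using that by simp
    have "real b / real A \<le> (pi * real b / real A) / 2"
      using that A pi_gt3 by (simp add: field_simps)
    also have "\<dots> \<le> sin (pi * real b / real A)"
    proof (rule sin_ge_half)
      have "2 * real b \<le> real A" using that by linarith
      then show "pi * real b / real A \<le> pi / 2" using A pi_gt_zero by (simp add: field_simps)
    qed simp
    finally show ?thesis .
  qed
  show ?thesis
  proof (cases "2 * a \<le> A")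
    case True
    then show ?thesis using le[of a] assms by simp
  next
    case False
    have A: "real A > 0" using assms by simp
    have "pi * real (A - a) / real A = pi - pi * real a / real A"
      using assms A by (simp add: of_nat_diff field_simps)
    then have "sin (pi * real (A - a) / real A) = sin (pi * real a / real A)" by simp
    then show ?thesis using le[of "A - a"] False assms by simp
  qed
qed

section \<open>The cutoff functions in one variable\<close>

locale cutoff =
  fixes \<eta>0 :: "real \<Rightarrow> real"
  assumes cutoff: "smooth_cutoff \<eta>0"
begin

abbreviation \<eta> :: "nat \<Rightarrow> real \<Rightarrow> real" where "\<eta> \<equiv> eta \<eta>0"

lemma eta0_range: "0 \<le> \<eta>0 t" "\<eta>0 t \<le> 1"
  and eta0_one: "\<bar>t\<bar> \<le> 1 \<Longrightarrow> \<eta>0 t = 1"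
  using cutoff by (auto simp: smooth_cutoff_def abs_le_iff)

lemma eta0_zero: "\<bar>t\<bar> > 3/2 \<Longrightarrow> \<eta>0 t = 0"
proof -
  assume "\<bar>t\<bar> > 3/2"
  then have "t \<notin> {-3/2..3/2}" by auto
  then show ?thesis using cutoff unfolding smooth_cutoff_def by blast
qed

lemma eta_alt: "\<eta> k t = (if k = 0 then \<eta>0 t else \<eta>0 (t / 2 ^ k) - \<eta>0 (2 * t / 2 ^ k))"
proof -
  have "2 powr (- real k) = 1 / 2 ^ k" by (simp add: powr_minus powr_realpow divide_inverse)
  moreover have "2 powr (- real k + 1) = 2 / 2 ^ k" by (simp add: powr_diff powr_realpow)
  ultimately show ?thesis by (simp add: eta_def)
qed

lemma abs_eta_le: "\<bar>\<eta> k t\<bar> \<le> 1"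
  using eta0_range unfolding eta_alt by (auto simp: abs_le_iff) (smt (verit))+

lemma eta_nonzero:
  assumes "\<eta> k t \<noteq> 0"
  shows "\<bar>t\<bar> \<le> 3/2 * 2 ^ k" "k \<ge> 1 \<Longrightarrow> 2 ^ k < 2 * \<bar>t\<bar>"
proof -
  have p: "(0::real) < 2 ^ k" by simp
  show "\<bar>t\<bar> \<le> 3/2 * 2 ^ k"
  proof (rule ccontr)
    assume a: "\<not> ?thesis"
    then have 1: "\<bar>t / 2 ^ k\<bar> > 3/2" using p by (simp add: abs_divide field_simps)
    then have 2: "\<bar>2 * t / 2 ^ k\<bar> > 3/2" by (simp add: abs_mult abs_divide)
    have "k = 0 \<Longrightarrow> \<bar>t\<bar> > 3/2" using a by simp
    then show False using assms eta0_zero[OF 1] eta0_zero[OF 2] eta0_zero[of t] by (auto simp: eta_alt split: if_splits)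
  qed
  assume k: "k \<ge> 1"
  show "2 ^ k < 2 * \<bar>t\<bar>"
  proof (rule ccontr)
    assume a: "\<not> ?thesis"
    then have 2: "\<bar>2 * t / 2 ^ k\<bar> \<le> 1" using p by (simp add: abs_divide abs_mult field_simps)
    then have 1: "\<bar>t / 2 ^ k\<bar> \<le> 1" by (simp add: abs_mult abs_divide)
    show False using assms k eta0_one[OF 1] eta0_one[OF 2] by (simp add: eta_alt)
  qed
qed

text \<open>The support of index k ends at 3/2 * 2^k, while that of k' starts at 2^k' / 2, which for
  k' = k + 2 is already 2 * 2^k.\<close>

lemma eta_near:
  assumes "\<eta> k t \<noteq> 0" "\<eta> k' t \<noteq> 0"
  shows "k' \<le> k + 1"
proof (rule ccontr)
  assume "\<not> ?thesis"
  then have "k' \<ge> 1" "k + 2 \<le> k'" by auto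
  then have "(2::real) ^ (k + 2) \<le> 2 ^ k'" by (intro power_increasing) auto
  then show False using eta_nonzero(1)[OF assms(1)] eta_nonzero(2)[OF assms(2) \<open>k' \<ge> 1\<close>] by simp
qed

lemma sum_eta: "(\<Sum>k\<le>K. \<eta> k t) = \<eta>0 (t / 2 ^ K)"
  by (induction K) (auto simp: eta_alt)

lemma sum_eta_one:
  assumes "\<bar>t\<bar> \<le> 2 ^ K"
  shows "(\<Sum>k\<le>K. \<eta> k t) = 1"
  unfolding sum_eta by (rule eta0_one) (use assms in \<open>simp add: abs_divide\<close>)

text \<open>On this interval the outer cutoff is still 1 and the inner one already 0, so a single
  index sees it. The test polynomials of the lower bounds are placed here, where their own block
  acts as the identity.\<close>

lemma eta_one:
  assumes k: "k \<ge> 1" and t: "3/4 * 2 ^ k < \<bar>t\<bar>" "\<bar>t\<bar> \<le> 2 ^ k"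
  shows "\<eta> k t = 1" and "k' \<noteq> k \<Longrightarrow> \<eta> k' t = 0"
proof -
  have p: "(0::real) < 2 ^ k" by simp
  have 1: "\<bar>t / 2 ^ k\<bar> \<le> 1" using t p by (simp add: abs_divide field_simps)
  have 2: "\<bar>2 * t / 2 ^ k\<bar> > 3/2" using t p by (simp add: abs_divide abs_mult field_simps)
  show "\<eta> k t = 1" using k eta0_one[OF 1] eta0_zero[OF 2] by (simp add: eta_alt)
  assume k': "k' \<noteq> k"
  show "\<eta> k' t = 0"
  proof (rule ccontr)
    assume n: "\<eta> k' t \<noteq> 0"
    show False
    proof (cases "k' < k")
      case True
      then have "(2::real) ^ Suc k' \<le> 2 ^ k" by (intro power_increasing) auto
      then show False using eta_nonzero(1)[OF n] t by simp
    next
      case False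
      then have "Suc k \<le> k'" using k' by simp
      then have "(2::real) ^ Suc k \<le> 2 ^ k'" by (intro power_increasing) auto
      then show False using eta_nonzero(2)[OF n] t False k by simp
    qed
  qed
qed

text \<open>The second derivative is continuous and vanishes for |t| > 2, hence it is bounded; the
  mean value theorem applied to \<eta>0 and to its derivative does the rest. The bound is the source
  of the kernel decay below.\<close>

lemma eta0_second_difference:
  "\<exists>S>0. \<forall>t h. \<bar>\<eta>0 (t + h) - 2 * \<eta>0 t + \<eta>0 (t - h)\<bar> \<le> S * h\<^sup>2"
proof -
  let ?g = "deriv \<eta>0" and ?g2 = "deriv (deriv \<eta>0)"
  have d: "(deriv ^^ n) \<eta>0 differentiable_on UNIV" for n using cutoff by (auto simp: smooth_cutoff_def)
  have D0: "(\<eta>0 has_real_derivative ?g t) (at t)" for t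
    using d[of 0] by (auto simp: differentiable_on_def real_differentiable_def DERIV_deriv_iff_real_differentiable)
  have D1: "(?g has_real_derivative ?g2 t) (at t)" for t
    using d[of 1] by (auto simp: differentiable_on_def real_differentiable_def DERIV_deriv_iff_real_differentiable)
  have "continuous_on UNIV ?g2"
    using differentiable_imp_continuous_on[OF d[of 2]] by (simp add: numeral_2_eq_2)
  then have "compact (?g2 ` {-2..2})"
    by (intro compact_continuous_image) (auto intro: continuous_on_subset)
  then obtain S0 where S0: "\<And>t. t \<in> {-2..2} \<Longrightarrow> \<bar>?g2 t\<bar> \<le> S0"
    using compact_imp_bounded[THEN bounded_imp_bdd_above] bounded_iff[of "?g2 ` {-2..2}"] compact_imp_bounded
    by (metis image_eqI real_norm_def)
  have zero: "?g2 t = 0" if t: "\<bar>t\<bar> > 2" for t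
  proof -
    have op: "open {s::real. \<bar>s\<bar> > 3/2}" by (intro open_Collect_less continuous_intros)
    have g0: "?g s = 0" if "\<bar>s\<bar> > 3/2" for s
    proof -
      have "(\<eta>0 has_real_derivative 0) (at s)"
        by (rule DERIV_cong_ev[THEN iffD2, OF refl _ refl, of _ "\<lambda>_. 0"])
           (use eventually_nhds_in_open[OF op, of s] that eta0_zero in \<open>auto elim!: eventually_mono\<close>)
      then show ?thesis by (rule DERIV_imp_deriv)
    qed
    have "(?g has_real_derivative 0) (at t)"
      by (rule DERIV_cong_ev[THEN iffD2, OF refl _ refl, of _ "\<lambda>_. 0"])
         (use eventually_nhds_in_open[OF op, of t] t g0 in \<open>auto elim!: eventually_mono\<close>)
    then show ?thesis by (rule DERIV_imp_deriv)
  qed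
  define S1 where "S1 = max S0 0 + 1"
  have S1: "\<bar>?g2 t\<bar> \<le> S1" "S1 > 0" for t
    using S0[of t] zero[of t] by (auto simp: S1_def abs_le_iff) (smt (verit, best))+
  have lip: "\<bar>?g x - ?g y\<bar> \<le> S1 * \<bar>x - y\<bar>" for x y
  proof (cases "x = y")
    case False
    have *: "\<bar>?g b - ?g a\<bar> \<le> S1 * \<bar>b - a\<bar>" if ab: "a < b" for a b
    proof -
      obtain z where "?g b - ?g a = (b - a) * ?g2 z" using MVT2[OF ab, of ?g ?g2] D1 by blast
      then show ?thesis using mult_left_mono[OF S1(1)[of z], of "\<bar>b - a\<bar>"] by (simp add: abs_mult mult.commute)
    qed
    show ?thesis using *[of x y] *[of y x] False by (cases "x < y") (auto simp: abs_minus_commute)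
  qed simp
  have main: "\<bar>\<eta>0 (t + h) - 2 * \<eta>0 t + \<eta>0 (t - h)\<bar> \<le> (2 * S1) * h\<^sup>2" if h: "h > 0" for t h
  proof -
    obtain z1 where z1: "t < z1" "z1 < t + h" "\<eta>0 (t + h) - \<eta>0 t = (t + h - t) * ?g z1"
      using MVT2[of t "t + h" \<eta>0 ?g] D0 h by auto
    obtain z2 where z2: "t - h < z2" "z2 < t" "\<eta>0 t - \<eta>0 (t - h) = (t - (t - h)) * ?g z2"
      using MVT2[of "t - h" t \<eta>0 ?g] D0 h by auto
    have "\<eta>0 (t + h) - 2 * \<eta>0 t + \<eta>0 (t - h) = h * (?g z1 - ?g z2)" using z1 z2 by (simp add: algebra_simps)
    then have "\<bar>\<eta>0 (t + h) - 2 * \<eta>0 t + \<eta>0 (t - h)\<bar> = h * \<bar>?g z1 - ?g z2\<bar>" using h by (simp add: abs_mult)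
    also have "\<dots> \<le> h * (S1 * \<bar>z1 - z2\<bar>)" using h by (intro mult_left_mono lip) auto
    also have "\<dots> \<le> h * (S1 * (2 * h))" using h z1 z2 S1(2) by (intro mult_left_mono) auto
    finally show ?thesis by (simp add: power2_eq_square algebra_simps)
  qed
  have "\<bar>\<eta>0 (t + h) - 2 * \<eta>0 t + \<eta>0 (t - h)\<bar> \<le> (2 * S1) * h\<^sup>2" for t h
    using main[of h t] main[of "- h" t] by (cases "h > 0"; cases "h = 0") (auto simp: add.commute algebra_simps)
  then show ?thesis using S1(2) by (intro exI[of _ "2 * S1"]) auto
qed

lemma eta_second_difference:
  "\<exists>S>0. \<forall>k t. \<bar>\<eta> k (t + 1) - 2 * \<eta> k t + \<eta> k (t - 1)\<bar> \<le> S / (2 ^ k)\<^sup>2"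
proof -
  obtain S where S: "S > 0" "\<And>t h. \<bar>\<eta>0 (t + h) - 2 * \<eta>0 t + \<eta>0 (t - h)\<bar> \<le> S * h\<^sup>2"
    using eta0_second_difference by blast
  have "\<bar>\<eta> k (t + 1) - 2 * \<eta> k t + \<eta> k (t - 1)\<bar> \<le> 5 * S / (2 ^ k)\<^sup>2" for k t
  proof (cases "k = 0")
    case True then show ?thesis using S(2)[of t 1] S(1) by (simp add: eta_alt)
  next
    case False
    let ?u = "1 / 2 ^ k :: real"
    have "\<eta> k (t + 1) - 2 * \<eta> k t + \<eta> k (t - 1)
      = (\<eta>0 (t / 2 ^ k + ?u) - 2 * \<eta>0 (t / 2 ^ k) + \<eta>0 (t / 2 ^ k - ?u))
       - (\<eta>0 (2 * t / 2 ^ k + 2 * ?u) - 2 * \<eta>0 (2 * t / 2 ^ k) + \<eta>0 (2 * t / 2 ^ k - 2 * ?u))"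
      using False by (simp add: eta_alt add_divide_distrib diff_divide_distrib distrib_left right_diff_distrib)
    then have "\<bar>\<eta> k (t + 1) - 2 * \<eta> k t + \<eta> k (t - 1)\<bar> \<le> S * ?u\<^sup>2 + S * (2 * ?u)\<^sup>2"
      using S(2)[of "t / 2 ^ k" ?u] S(2)[of "2 * t / 2 ^ k" "2 * ?u"] by linarith
    also have "\<dots> = 5 * S / (2 ^ k)\<^sup>2" by (simp add: power_divide power_mult_distrib)
    finally show ?thesis .
  qed
  then show ?thesis using S(1) by (intro exI[of _ "5 * S"]) auto
qed

text \<open>The discrete Fourier transform of the sampled cutoff on a grid of 8 * 2^\<mu> points.
  The summation range covers the support, and the grid is so fine that frequencies up to 4 * 2^\<mu>
  differ from those of the range by less than the grid size, which excludes aliasing.\<close>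

definition kern :: "nat \<Rightarrow> nat \<Rightarrow> complex" where
  "kern \<mu> a = (\<Sum>k\<in>{-2 * 2 ^ \<mu>..2 * 2 ^ \<mu>::int}.
     of_real (\<eta> \<mu> (of_int k)) * cis (- (2 * pi * real a / real (8 * 2 ^ \<mu>) * of_int k)))"

lemma eta_int_zero: "\<bar>k\<bar> \<ge> 2 * 2 ^ \<mu> \<Longrightarrow> \<eta> \<mu> (of_int k) = 0"
proof (rule ccontr)
  assume k: "\<bar>k\<bar> \<ge> 2 * 2 ^ \<mu>" and "\<eta> \<mu> (of_int k) \<noteq> 0"
  then have "\<bar>real_of_int k\<bar> \<le> 3/2 * 2 ^ \<mu>" using eta_nonzero(1) by blast
  moreover have "real_of_int (2 * 2 ^ \<mu>) \<le> of_int \<bar>k\<bar>" using k by (simp only: of_int_le_iff)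
  moreover have "(0::real) < 2 ^ \<mu>" by simp
  ultimately show False by simp
qed

lemma kern_reproducing:
  assumes k: "\<bar>k\<bar> \<le> 4 * 2 ^ \<mu>"
  shows "(\<Sum>a<8 * 2 ^ \<mu>. kern \<mu> a * cis (2 * pi * real a / real (8 * 2 ^ \<mu>) * of_int k))
    = of_nat (8 * 2 ^ \<mu>) * of_real (\<eta> \<mu> (of_int k))"
proof -
  let ?A = "8 * 2 ^ \<mu> :: nat" and ?R = "{-2 * 2 ^ \<mu>..2 * 2 ^ \<mu>::int}"
  have "(\<Sum>a<?A. kern \<mu> a * cis (2 * pi * real a / real ?A * of_int k))
    = (\<Sum>a<?A. \<Sum>k'\<in>?R. of_real (\<eta> \<mu> (of_int k')) * cis (2 * pi * real a / real ?A * of_int (k - k')))"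
  proof (intro sum.cong refl)
    fix a
    have c: "cis (2 * pi * real a / real ?A * of_int (k - k')) =
       cis (- (2 * pi * real a / real ?A * of_int k')) * cis (2 * pi * real a / real ?A * of_int k)" for k'
    proof -
      have "x * of_int (k - k') = - (x * of_int k') + x * of_int k" for x :: real
        by (simp add: algebra_simps)
      then show ?thesis unfolding cis_mult by (rule arg_cong)
    qed
    show "kern \<mu> a * cis (2 * pi * real a / real ?A * of_int k)
      = (\<Sum>k'\<in>?R. of_real (\<eta> \<mu> (of_int k')) * cis (2 * pi * real a / real ?A * of_int (k - k')))"
      unfolding kern_def sum_distrib_right c by (simp add: mult.assoc)
  qed
  also have "\<dots> = (\<Sum>k'\<in>?R. of_real (\<eta> \<mu> (of_int k')) * (\<Sum>a<?A. cis (2 * pi * real a / real ?A * of_int (k - k'))))"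
    by (subst sum.swap) (simp add: sum_distrib_left)
  also have "\<dots> = (\<Sum>k'\<in>?R. if k' = k then of_nat ?A * of_real (\<eta> \<mu> (of_int k)) else 0)"
  proof (intro sum.cong refl)
    fix k' assume "k' \<in> ?R"
    then have "\<bar>k'\<bar> \<le> 2 * 2 ^ \<mu>" by auto
    moreover have "(0::int) < 2 ^ \<mu>" by simp
    ultimately have "\<bar>k - k'\<bar> < 8 * 2 ^ \<mu>" using k by linarith
    then have "\<bar>k - k'\<bar> < int ?A" by simp
    from sum_roots_of_unity[OF this] show "of_real (\<eta> \<mu> (of_int k')) * (\<Sum>a<?A. cis (2 * pi * real a / real ?A * of_int (k - k')))
      = (if k' = k then of_nat ?A * of_real (\<eta> \<mu> (of_int k)) else 0)" by simp
  qed
  also have "\<dots> = (if k \<in> ?R then of_nat ?A * of_real (\<eta> \<mu> (of_int k)) else 0)" by simp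
  also have "\<dots> = of_nat ?A * of_real (\<eta> \<mu> (of_int k))"
    using eta_int_zero[of \<mu> k] by auto
  finally show ?thesis .
qed

text \<open>Summing by parts twice bounds the kernel at \<open>a\<close> by a multiple of 2^\<mu>
  over the squared distance of \<open>a\<close> to 0 modulo the grid size. These bounds are
  summable, so the mean over the grid is bounded uniformly in \<mu>.\<close>

lemma kern_bound:
  "\<exists>C>0. \<forall>\<mu>. (\<Sum>a<8 * 2 ^ \<mu>. norm (kern \<mu> a)) \<le> C * real (8 * 2 ^ \<mu>)"
proof -
  obtain S where S: "S > 0" "\<And>k t. \<bar>\<eta> k (t + 1) - 2 * \<eta> k t + \<eta> k (t - 1)\<bar> \<le> S / (2 ^ k)\<^sup>2"
    using eta_second_difference by blast
  have "(\<Sum>a<8 * 2 ^ \<mu>. norm (kern \<mu> a)) \<le> (1 + 720 * S) * real (8 * 2 ^ \<mu>)" for \<mu>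
  proof -
    define B where "B = (2::real) ^ \<mu>"
    have B: "B \<ge> 1" by (simp add: B_def)
    let ?A = "8 * 2 ^ \<mu> :: nat" and ?R = "{-2 * 2 ^ \<mu>..2 * 2 ^ \<mu>::int}"
    have AB: "real ?A = 8 * B" by (simp add: B_def)
    have k1: "norm (kern \<mu> a) \<le> 5 * B" for a
    proof -
      have "norm (kern \<mu> a) \<le> (\<Sum>k\<in>?R. \<bar>\<eta> \<mu> (of_int k)\<bar>)"
        unfolding kern_def by (rule order_trans[OF norm_sum]) (simp add: norm_mult)
      also have "\<dots> \<le> real (card ?R) * 1" by (rule sum_bounded_above) (rule abs_eta_le)
      also have "\<dots> = 4 * B + 1" by (simp add: B_def)
      finally show ?thesis using B by simp
    qed
    \<comment> \<open>The transform of the second difference is the kernel times 2 cos t - 2, and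
      the second difference has at most 9 * 2^\<mu> terms of order 4^(-\<mu>).\<close>
    have k2: "norm (kern \<mu> a) * (2 - 2 * cos (2 * pi * real a / real ?A)) \<le> 9 * S / B" for a
    proof -
      define t where "t = - (2 * pi * real a / real ?A)"
      define h where "h = (\<lambda>k::int. complex_of_real (\<eta> \<mu> (of_int k)))"
      define w where "w = (\<lambda>k::int. cis (t * of_int k))"
      \<comment> \<open>The range is widened by two on either side so that shifting the index by one
        loses no nonzero term.\<close>
      let ?Q = "{-2 * 2 ^ \<mu> - 2..2 * 2 ^ \<mu> + 2::int}"
      have h0: "h k = 0" if "\<bar>k\<bar> \<ge> 2 * 2 ^ \<mu>" for k using eta_int_zero[OF that] by (simp add: h_def)
      have kern: "kern \<mu> a = (\<Sum>k\<in>?R. h k * w k)"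
        unfolding kern_def h_def w_def t_def by (simp add: mult_ac)
      have sh: "(\<Sum>k\<in>?Q. h (k + s) * w k) = cis (- t * of_int s) * kern \<mu> a" if s: "\<bar>s\<bar> \<le> 1" for s
      proof -
        have "(\<Sum>k\<in>?Q. h (k + s) * w k) = (\<Sum>k\<in>{-2 * 2 ^ \<mu> - 2 + s..2 * 2 ^ \<mu> + 2 + s}. h k * w (k - s))"
          by (rule sum.reindex_bij_witness[where i = "\<lambda>k. k - s" and j = "\<lambda>k. k + s"]) auto
        also have "\<dots> = (\<Sum>k\<in>?R. h k * w (k - s))"
          by (rule sum.mono_neutral_right) (use s h0 in auto)
        also have "\<dots> = (\<Sum>k\<in>?R. cis (- t * of_int s) * (h k * w k))"
          by (intro sum.cong refl) (simp add: w_def cis_mult algebra_simps)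
        finally show ?thesis unfolding kern sum_distrib_left .
      qed
      have "(\<Sum>k\<in>?Q. (h (k + 1) - 2 * h k + h (k - 1)) * w k)
        = (cis (- t) - 2 + cis t) * kern \<mu> a"
      proof -
        have "(\<Sum>k\<in>?Q. (h (k + 1) - 2 * h k + h (k - 1)) * w k)
          = (\<Sum>k\<in>?Q. h (k + 1) * w k) - 2 * (\<Sum>k\<in>?Q. h (k + 0) * w k) + (\<Sum>k\<in>?Q. h (k + (-1)) * w k)"
          unfolding sum_distrib_left sum_subtractf[symmetric] sum.distrib[symmetric]
          by (intro sum.cong refl) (simp add: algebra_simps)
        then show ?thesis using sh[of 1] sh[of 0] sh[of "-1"] by (simp add: algebra_simps)
      qed
      moreover have "cis (- t) - 2 + cis t = - of_real (2 - 2 * cos t)" by (simp add: complex_eq_iff)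
      moreover have "cos t \<le> 1" by simp
      ultimately have "norm (kern \<mu> a) * (2 - 2 * cos t) = norm (\<Sum>k\<in>?Q. (h (k + 1) - 2 * h k + h (k - 1)) * w k)"
        by (simp add: norm_mult del: of_real_diff of_real_mult)
      also have "\<dots> \<le> (\<Sum>k\<in>?Q. norm (h (k + 1) - 2 * h k + h (k - 1)))"
        by (rule order_trans[OF norm_sum]) (simp add: norm_mult w_def)
      also have "\<dots> \<le> real (card ?Q) * (S / (2 ^ \<mu>)\<^sup>2)"
      proof (rule sum_bounded_above)
        fix k
        have "h (k + 1) - 2 * h k + h (k - 1) = of_real (\<eta> \<mu> (of_int k + 1) - 2 * \<eta> \<mu> (of_int k) + \<eta> \<mu> (of_int k - 1))"
          by (simp add: h_def)
        then show "norm (h (k + 1) - 2 * h k + h (k - 1)) \<le> S / (2 ^ \<mu>)\<^sup>2"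
          using S(2)[of \<mu> "of_int k"] by (simp only: norm_of_real real_norm_def)
      qed
      also have "\<dots> \<le> (9 * B) * (S / B\<^sup>2)"
        unfolding B_def[symmetric] using S(1) B by (intro mult_right_mono) (auto simp: B_def)
      also have "\<dots> = 9 * S / B" using B by (simp add: power2_eq_square)
      finally show ?thesis by (simp add: t_def)
    qed
    \<comment> \<open>The factor 2 - 2 cos is four times a squared sine, bounded below by the
      squared relative distance of \<open>a\<close> to the nearer end of the grid. Adding the bounds
      for both ends avoids the minimum in the summation.\<close>
    have k3: "norm (kern \<mu> a) \<le> 144 * S * B * (1 / (real a)\<^sup>2 + 1 / (real (?A - a))\<^sup>2)"
      if a: "a \<in> {1..<?A}" for a
    proof -
      define m where "m = min a (?A - a)"
      have m: "m \<ge> 1" using a by (auto simp: m_def)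
      have "real m / real ?A \<le> sin (pi * real a / real ?A)" unfolding m_def using a by (intro sin_pi_frac_ge) auto
      then have "(real m / real ?A)\<^sup>2 \<le> (sin (pi * real a / real ?A))\<^sup>2" by (intro power_mono) auto
      also have "4 * \<dots> = 2 - 2 * cos (2 * pi * real a / real ?A)"
        using cos_double_sin[of "pi * real a / real ?A"] by (simp add: mult.assoc)
      finally have c: "4 * (real m / real ?A)\<^sup>2 \<le> 2 - 2 * cos (2 * pi * real a / real ?A)" by simp
      have "norm (kern \<mu> a) * (4 * (real m / real ?A)\<^sup>2) \<le> 9 * S / B"
        using mult_left_mono[OF c, of "norm (kern \<mu> a)"] k2[of a] by simp
      then have "norm (kern \<mu> a) * (real m)\<^sup>2 \<le> 144 * S * B"
        using B unfolding AB by (simp add: power_divide field_simps power2_eq_square)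
      then have "norm (kern \<mu> a) \<le> 144 * S * B * (1 / (real m)\<^sup>2)"
        using m by (simp add: field_simps)
      also have "1 / (real m)\<^sup>2 \<le> 1 / (real a)\<^sup>2 + 1 / (real (?A - a))\<^sup>2"
        unfolding m_def by (cases "a \<le> ?A - a") (auto simp: min_def)
      finally show ?thesis using S(1) B by (simp add: mult_left_mono)
    qed
    have "(\<Sum>a<?A. norm (kern \<mu> a)) = norm (kern \<mu> 0) + (\<Sum>a=1..<?A. norm (kern \<mu> a))"
      using sum.atLeast_Suc_lessThan[of 0 ?A "\<lambda>a. norm (kern \<mu> a)"] by (simp add: atLeast0LessThan)
    also have "\<dots> \<le> 5 * B + (\<Sum>a=1..<?A. 144 * S * B * (1 / (real a)\<^sup>2 + 1 / (real (?A - a))\<^sup>2))"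
      by (intro add_mono k1 sum_mono k3)
    also have "\<dots> = 5 * B + 144 * S * B * ((\<Sum>a=1..<?A. 1 / (real a)\<^sup>2) + (\<Sum>a=1..<?A. 1 / (real (?A - a))\<^sup>2))"
      by (simp only: sum_distrib_left sum.distrib[symmetric])
    also have "(\<Sum>a=1..<?A. 1 / (real (?A - a))\<^sup>2) = (\<Sum>a=1..<?A. 1 / (real a)\<^sup>2)"
      by (rule sum.reindex_bij_witness[where i = "\<lambda>a. ?A - a" and j = "\<lambda>a. ?A - a"]) auto
    also have "5 * B + 144 * S * B * ((\<Sum>a=1..<?A. 1 / (real a)\<^sup>2) + (\<Sum>a=1..<?A. 1 / (real a)\<^sup>2))
       \<le> 5 * B + 144 * S * B * (2 + 2)"
    proof -
      have "(\<Sum>a=1..<?A. 1 / (real a)\<^sup>2) \<le> (\<Sum>a=1..?A. 1 / (real a)\<^sup>2)" by (rule sum_mono2) auto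
      also have "\<dots> \<le> 2" by (rule sum_inverse_squares_le)
      finally show ?thesis using S(1) B by (intro add_mono mult_left_mono) auto
    qed
    also have "\<dots> \<le> (1 + 720 * S) * real ?A" unfolding AB using S(1) B by (simp add: algebra_simps)
    finally show ?thesis .
  qed
  then show ?thesis using S(1) by (intro exI[of _ "1 + 720 * S"]) auto
qed

text \<open>For spectra bounded by 4 * 2^\<mu> in coordinate \<open>j\<close> the multiplier is a
  combination of translates in that direction, with weights \<open>kern\<close> divided by the grid
  size. Translates have equal norms, so the mean modulus of the kernel bounds the operator for all q
  at once.\<close>

lemma coordinate_multiplier:
  "\<exists>C\<ge>1. \<forall>q (S :: (int ^ 'd) set) c j \<mu>. q \<ge> 1 \<longrightarrow> finite S \<longrightarrow> (\<forall>k\<in>S. \<bar>k $ j\<bar> \<le> 4 * 2 ^ \<mu>) \<longrightarrow>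
     Lnorm q (trig S (\<lambda>k. of_real (\<eta> \<mu> (of_int (k $ j))) * c k)) \<le> C * Lnorm q (trig S c)"
proof -
  obtain C where C: "C > 0" "\<And>\<mu>. (\<Sum>a<8 * 2 ^ \<mu>. norm (kern \<mu> a)) \<le> C * real (8 * 2 ^ \<mu>)"
    using kern_bound by blast
  have "Lnorm q (trig S (\<lambda>k. of_real (\<eta> \<mu> (of_int (k $ j))) * c k)) \<le> (C + 1) * Lnorm q (trig S c)"
    if q: "q \<ge> 1" and fin: "finite S" and S: "\<forall>k\<in>S. \<bar>k $ j\<bar> \<le> 4 * 2 ^ \<mu>"
    for q and S :: "(int ^ 'd) set" and c j \<mu>
  proof -
    let ?A = "8 * 2 ^ \<mu> :: nat"
    have A: "real ?A > 0" by simp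
    let ?t = "\<lambda>a. 2 * pi * real a / real ?A"
    let ?g = "\<lambda>a x. kern \<mu> a / of_nat ?A * trig S c (x + axis j (?t a))"
    have "trig S (\<lambda>k. of_real (\<eta> \<mu> (of_int (k $ j))) * c k) x = (\<Sum>a<?A. ?g a x)" for x
    proof -
      have "(\<Sum>a<?A. ?g a x) = (\<Sum>k\<in>S. c k * cis (real_vec k \<bullet> x) *
         ((\<Sum>a<?A. kern \<mu> a * cis (?t a * of_int (k $ j))) / of_nat ?A))"
        unfolding trig_def cis_add_axis sum_distrib_left sum_divide_distrib
        by (subst sum.swap) (intro sum.cong refl, simp add: mult_ac)
      also have "\<dots> = (\<Sum>k\<in>S. c k * cis (real_vec k \<bullet> x) * of_real (\<eta> \<mu> (of_int (k $ j))))"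
        using S by (intro sum.cong refl, subst kern_reproducing) auto
      finally show ?thesis by (simp add: trig_def mult_ac)
    qed
    then have "trig S (\<lambda>k. of_real (\<eta> \<mu> (of_int (k $ j))) * c k) = (\<lambda>x. \<Sum>a<?A. ?g a x)" by auto
    then have "Lnorm q (trig S (\<lambda>k. of_real (\<eta> \<mu> (of_int (k $ j))) * c k)) = Lnorm q (\<lambda>x. \<Sum>a<?A. ?g a x)"
      by (simp only:)
    also have "\<dots> \<le> (\<Sum>a<?A. Lnorm q (?g a))"
      by (rule Lnorm_sum) (use q in \<open>auto intro!: continuous_intros continuous_on_compose2[OF continuous_trig]\<close>)
    also have "\<dots> = (\<Sum>a<?A. norm (kern \<mu> a) / real ?A * Lnorm q (trig S c))"
    proof (rule sum.cong[OF refl])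
      fix a assume "a \<in> {..<?A}"
      then have "real a < real ?A" by (simp only: of_nat_less_iff lessThan_iff)
      then have t: "0 \<le> ?t a" "?t a \<le> 2 * pi" using A by (auto simp: field_simps)
      have "Lnorm q (?g a) = norm (kern \<mu> a / of_nat ?A) * Lnorm q (\<lambda>x. trig S c (x + axis j (?t a)))"
        using q by (intro Lnorm_scale) auto
      also have "Lnorm q (\<lambda>x. trig S c (x + axis j (?t a))) = Lnorm q (trig S c)"
        using q by (intro Lnorm_shift continuous_trig periodic_trig t) auto
      finally show "Lnorm q (?g a) = norm (kern \<mu> a) / real ?A * Lnorm q (trig S c)" by (simp add: norm_divide norm_power)
    qed
    also have "\<dots> = (\<Sum>a<?A. norm (kern \<mu> a)) / real ?A * Lnorm q (trig S c)"
      by (simp only: sum_divide_distrib sum_distrib_right)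
    also have "\<dots> \<le> (C + 1) * Lnorm q (trig S c)"
    proof (rule mult_right_mono)
      have "(\<Sum>a<?A. norm (kern \<mu> a)) \<le> (C + 1) * real ?A" unfolding distrib_right using C(2)[of \<mu>] A by linarith
      then show "(\<Sum>a<?A. norm (kern \<mu> a)) / real ?A \<le> C + 1" using A by (simp only: pos_divide_le_eq)
    qed simp
    finally show ?thesis .
  qed
  then show ?thesis using C(1) by (intro exI[of _ "C + 1"]) auto
qed

end

section \<open>Frequency boxes and neighbouring blocks\<close>

lemma bij_betw_vec_PiE: "bij_betw (\<lambda>g. \<chi> j. g j) (PiE UNIV I) {k :: 'a ^ 'd. \<forall>j. k $ j \<in> I j}"
  by (rule bij_betwI[where g = "\<lambda>k. vec_nth k"]) (auto simp: vec_eq_iff PiE_def)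

lemma finite_vec_set: "(\<And>j. finite (I j)) \<Longrightarrow> finite {k :: 'a ^ 'd. \<forall>j. k $ j \<in> I j}"
  using bij_betw_finite[OF bij_betw_vec_PiE[of I]] finite_PiE[of UNIV I] by simp

lemma card_vec_set: "(\<And>j. finite (I j)) \<Longrightarrow> card {k :: 'a ^ 'd. \<forall>j. k $ j \<in> I j} = (\<Prod>j\<in>UNIV. card (I j))"
  using bij_betw_same_card[OF bij_betw_vec_PiE[of I]] by (simp add: card_PiE)

definition level :: "nat ^ 'd \<Rightarrow> nat" where
  "level m = (\<Sum>j\<in>UNIV. m $ j)"

text \<open>Contains the support of the multiplier of block \<open>m\<close>; the factor 2 in place
  of 3/2 keeps the end points integral.\<close>

definition box :: "nat ^ 'd \<Rightarrow> (int ^ 'd) set" where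
  "box m = {k. \<forall>j. k $ j \<in> {-2 * 2 ^ (m $ j)..2 * 2 ^ (m $ j)}}"

text \<open>The blocks whose multipliers can overlap that of \<open>m\<close>. Truncated subtraction
  starts the interval at 0 where \<open>m $ j = 0\<close>.\<close>

definition near :: "nat ^ 'd \<Rightarrow> (nat ^ 'd) set" where
  "near m = {m'. \<forall>j. m' $ j \<in> {m $ j - 1..m $ j + 1}}"

lemma finite_box [simp]: "finite (box m)"
  unfolding box_def by (rule finite_vec_set) simp

lemma finite_near [simp]: "finite (near m)"
  unfolding near_def by (rule finite_vec_set) simp

lemma near_iff: "m' \<in> near m \<longleftrightarrow> (\<forall>j. m' $ j \<le> m $ j + 1 \<and> m $ j \<le> m' $ j + 1)"
  by (auto simp: near_def) (metis Suc_le_mono Suc_pred diff_Suc_1 le_SucI le_diff_conv le_numeral_extra(3) One_nat_def add.commute plus_1_eq_Suc)+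

lemma near_sym: "m' \<in> near m \<longleftrightarrow> m \<in> near m'"
  by (auto simp: near_iff)

lemma card_near: "card (near (m :: nat ^ 'd)) \<le> 3 ^ CARD('d)"
proof -
  have "card (near m) = (\<Prod>j\<in>(UNIV::'d set). card {m $ j - 1..m $ j + 1})"
    unfolding near_def by (rule card_vec_set) simp
  also have "\<dots> \<le> (\<Prod>j\<in>(UNIV::'d set). 3)" by (intro prod_mono) auto
  finally show ?thesis by simp
qed

lemma card_box: "real (card (box (m :: nat ^ 'd))) \<le> 5 ^ CARD('d) * 2 ^ level m"
proof -
  have "card (box m) = (\<Prod>j\<in>(UNIV::'d set). card {-2 * 2 ^ (m $ j)..2 * 2 ^ (m $ j) :: int})"
    unfolding box_def by (rule card_vec_set) simp
  also have "real \<dots> = (\<Prod>j\<in>(UNIV::'d set). real (card {-2 * 2 ^ (m $ j)..2 * 2 ^ (m $ j) :: int}))" by simp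
  also have "\<dots> \<le> (\<Prod>j\<in>(UNIV::'d set). 5 * 2 ^ (m $ j))"
  proof (intro prod_mono conjI)
    fix j
    have "real (card {-2 * 2 ^ (m $ j)..2 * 2 ^ (m $ j) :: int}) = 4 * 2 ^ (m $ j) + 1" by (simp add: nat_add_distrib nat_mult_distrib nat_power_eq)
    also have "\<dots> \<le> 5 * 2 ^ (m $ j)" by simp
    finally show "real (card {-2 * 2 ^ (m $ j)..2 * 2 ^ (m $ j) :: int}) \<le> 5 * 2 ^ (m $ j)" .
  qed simp
  also have "\<dots> = 5 ^ CARD('d) * 2 ^ level m" by (simp add: prod.distrib level_def power_sum)
  finally show ?thesis .
qed

lemma level_near: "m' \<in> near m \<Longrightarrow> level (m' :: nat ^ 'd) \<le> level m + CARD('d)"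
proof -
  assume "m' \<in> near m"
  then have "level m' \<le> (\<Sum>j\<in>UNIV. m $ j + 1)" unfolding level_def near_iff by (intro sum_mono) auto
  then show ?thesis by (simp only: level_def sum.distrib) simp
qed

lemma trig_support:
  assumes "finite S" "finite S'" "\<And>k. (if k \<in> S then c k else 0) = (if k \<in> S' then c' k else 0)"
  shows "trig S c = trig S' c'"
proof
  fix x
  have e: "trig T b x = (\<Sum>k\<in>S \<union> S'. (if k \<in> T then b k else 0) * cis (real_vec k \<bullet> x))"
    if "T \<subseteq> S \<union> S'" for T b
  proof -
    have "trig T b x = (\<Sum>k\<in>T. (if k \<in> T then b k else 0) * cis (real_vec k \<bullet> x))" by (simp add: trig_def)
    also have "\<dots> = (\<Sum>k\<in>S \<union> S'. (if k \<in> T then b k else 0) * cis (real_vec k \<bullet> x))"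
      by (rule sum.mono_neutral_left) (use that assms in auto)
    finally show ?thesis .
  qed
  show "trig S c x = trig S' c' x" using e[of S c] e[of S' c'] assms(3) by simp
qed

lemma trig_eq_zero: "(\<And>k. k \<in> S \<Longrightarrow> c k = 0) \<Longrightarrow> trig S c = (\<lambda>_. 0)"
  by (auto simp: trig_def)

lemma trig_add: "trig S c x + trig S c' x = trig S (\<lambda>k. c k + c' k) x"
  by (simp add: trig_def sum.distrib distrib_right)

lemma trig_sum: "(\<Sum>i\<in>J. trig S (c i) x) = trig S (\<lambda>k. \<Sum>i\<in>J. c i k) x"
  unfolding trig_def by (subst sum.swap) (simp add: sum_distrib_right)

lemma trig_scale: "a * trig S c x = trig S (\<lambda>k. a * c k) x"
  by (simp add: trig_def sum_distrib_left mult.assoc)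

section \<open>The blocks of a function\<close>

context cutoff
begin

definition ev :: "nat ^ 'd \<Rightarrow> int ^ 'd \<Rightarrow> real" where
  "ev m k = (\<Prod>j\<in>UNIV. \<eta> (m $ j) (of_int (k $ j)))"

lemma eta_vec_ev: "eta_vec \<eta>0 m (real_vec k) = ev m k"
  by (simp add: eta_vec_def ev_def real_vec_def)

lemma abs_ev_le: "\<bar>ev m k\<bar> \<le> 1"
  unfolding ev_def abs_prod by (rule prod_le_1) (auto intro: abs_eta_le)

lemma ev_zero: "k \<notin> box m \<Longrightarrow> ev m k = 0"
proof -
  assume "k \<notin> box m"
  then obtain j where "\<not> (- 2 * 2 ^ (m $ j) \<le> k $ j \<and> k $ j \<le> 2 * 2 ^ (m $ j))" by (auto simp: box_def)
  then have "\<bar>k $ j\<bar> \<ge> 2 * 2 ^ (m $ j)" by linarith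
  then have "\<eta> (m $ j) (of_int (k $ j)) = 0" by (rule eta_int_zero)
  then show ?thesis unfolding ev_def by (intro prod_zero) auto
qed

lemma ev_near: "ev m k \<noteq> 0 \<Longrightarrow> ev m' k \<noteq> 0 \<Longrightarrow> m' \<in> near m"
  unfolding near_iff ev_def using eta_near by (metis finite prod_zero_iff iso_tuple_UNIV_I)

text \<open>In each coordinate the cutoffs up to index m_j + 1 sum to 1 on the support of index m_j,
  and those below m_j - 1 vanish there. Expanding the product over the coordinates gives the sum
  over the near blocks.\<close>

lemma sum_ev_near:
  assumes "ev m k \<noteq> 0"
  shows "(\<Sum>m'\<in>near m. ev m' k) = 1"
proof -
  let ?I = "\<lambda>j. {m $ j - 1..m $ j + 1}"
  have nz: "\<eta> (m $ j) (of_int (k $ j)) \<noteq> 0" for j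
    using assms unfolding ev_def by simp
  have one: "(\<Sum>a\<in>?I j. \<eta> a (of_int (k $ j))) = 1" for j
  proof -
    have "\<bar>real_of_int (k $ j)\<bar> \<le> 3/2 * 2 ^ (m $ j)" by (rule eta_nonzero(1)[OF nz])
    also have "\<dots> \<le> 2 ^ (m $ j + 1)" by simp
    finally have "1 = (\<Sum>a\<le>m $ j + 1. \<eta> a (of_int (k $ j)))" by (simp only: sum_eta_one)
    also have "\<dots> = (\<Sum>a\<in>?I j. \<eta> a (of_int (k $ j)))"
    proof (rule sum.mono_neutral_right)
      show "\<forall>a\<in>{..m $ j + 1} - ?I j. \<eta> a (of_int (k $ j)) = 0"
      proof
        fix a assume "a \<in> {..m $ j + 1} - ?I j"
        then have "\<not> m $ j \<le> a + 1" by auto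
        then show "\<eta> a (of_int (k $ j)) = 0" using eta_near[OF _ nz[of j]] by blast
      qed
    qed auto
    finally show ?thesis by simp
  qed
  have "(\<Sum>m'\<in>near m. ev m' k) = (\<Sum>g\<in>PiE UNIV ?I. \<Prod>j\<in>UNIV. \<eta> (g j) (of_int (k $ j)))"
    unfolding near_def by (subst sum.reindex_bij_betw[OF bij_betw_vec_PiE[of ?I], symmetric]) (simp add: ev_def)
  also have "\<dots> = (\<Prod>j\<in>UNIV. \<Sum>a\<in>?I j. \<eta> a (of_int (k $ j)))"
    by (subst prod_sum_PiE) auto
  also have "\<dots> = 1" unfolding one by simp
  finally show ?thesis .
qed

lemma Delta_trig_form: "Delta \<eta>0 m f = trig (box m) (\<lambda>k. of_real (ev m k) * fourier_coeff f k)"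
proof
  fix x
  have "Delta \<eta>0 m f x = (\<Sum>\<^sub>\<infinity>k\<in>box m. of_real (ev m k) * fourier_coeff f k * cis (real_vec k \<bullet> x))"
    unfolding Delta_def eta_vec_ev by (rule infsum_cong_neutral) (auto simp: ev_zero)
  then show "Delta \<eta>0 m f x = trig (box m) (\<lambda>k. of_real (ev m k) * fourier_coeff f k) x"
    by (simp add: trig_def)
qed

lemma Delta_trig: "finite S \<Longrightarrow> Delta \<eta>0 m (trig S c) = trig S (\<lambda>k. of_real (ev m k) * c k)"
  unfolding Delta_trig_form by (rule trig_support) (auto simp: fourier_coeff_trig ev_zero)

lemma continuous_Delta [continuous_intros]: "continuous_on A (Delta \<eta>0 m f)"
  unfolding Delta_trig_form by (rule continuous_trig)

lemma multiplier_bound: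
  "\<exists>C\<ge>1. \<forall>q (S :: (int ^ 'd) set) c m. q \<ge> 1 \<longrightarrow> finite S \<longrightarrow> (\<forall>k\<in>S. \<forall>j. \<bar>k $ j\<bar> \<le> 4 * 2 ^ (m $ j)) \<longrightarrow>
     Lnorm q (trig S (\<lambda>k. of_real (ev m k) * c k)) \<le> C * Lnorm q (trig S c)"
proof -
  obtain C where C: "C \<ge> 1" and mult: "\<And>q (S :: (int ^ 'd) set) c j \<mu>. q \<ge> 1 \<Longrightarrow> finite S \<Longrightarrow>
      (\<forall>k\<in>S. \<bar>k $ j\<bar> \<le> 4 * 2 ^ \<mu>) \<Longrightarrow>
      Lnorm q (trig S (\<lambda>k. of_real (\<eta> \<mu> (of_int (k $ j))) * c k)) \<le> C * Lnorm q (trig S c)"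
    using coordinate_multiplier[where 'd = 'd] by blast
  have step: "Lnorm q (trig S (\<lambda>k. of_real (\<Prod>j\<in>J. \<eta> (m $ j) (of_int (k $ j))) * c k)) \<le> C ^ card J * Lnorm q (trig S c)"
    if q: "q \<ge> 1" and S: "finite S" "\<forall>k\<in>S. \<forall>j. \<bar>k $ j\<bar> \<le> 4 * 2 ^ (m $ j)" and J: "finite J"
    for q and S :: "(int ^ 'd) set" and c m J
    using J
  proof (induction J rule: finite_induct)
    case (insert j J)
    have "Lnorm q (trig S (\<lambda>k. of_real (\<Prod>j\<in>insert j J. \<eta> (m $ j) (of_int (k $ j))) * c k))
      = Lnorm q (trig S (\<lambda>k. of_real (\<eta> (m $ j) (of_int (k $ j))) * (of_real (\<Prod>j\<in>J. \<eta> (m $ j) (of_int (k $ j))) * c k)))"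
      using insert(1,2) by (simp add: mult.assoc)
    also have "\<dots> \<le> C * Lnorm q (trig S (\<lambda>k. of_real (\<Prod>j\<in>J. \<eta> (m $ j) (of_int (k $ j))) * c k))"
      using S q by (intro mult) auto
    also have "\<dots> \<le> C * (C ^ card J * Lnorm q (trig S c))" using C insert by (intro mult_left_mono) auto
    finally show ?case using insert(1,2) by (simp add: mult.assoc)
  qed simp
  have "\<forall>q (S :: (int ^ 'd) set) c m. q \<ge> 1 \<longrightarrow> finite S \<longrightarrow> (\<forall>k\<in>S. \<forall>j. \<bar>k $ j\<bar> \<le> 4 * 2 ^ (m $ j)) \<longrightarrow>
     Lnorm q (trig S (\<lambda>k. of_real (ev m k) * c k)) \<le> C ^ CARD('d) * Lnorm q (trig S c)"
    unfolding ev_def by (intro allI impI step) auto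
  moreover have "C ^ CARD('d) \<ge> 1" using C by simp
  ultimately show ?thesis by blast
qed

lemma Delta_Delta_zero: "m' \<notin> near m \<Longrightarrow> Delta \<eta>0 m' (Delta \<eta>0 m f) = (\<lambda>_. 0)"
  unfolding Delta_trig_form[of m f] Delta_trig[OF finite_box]
  using ev_near by (intro trig_eq_zero) fastforce

lemma Delta_Delta_bound:
  "\<exists>C\<ge>1. \<forall>q (m :: nat ^ 'd) m' f. q \<ge> 1 \<longrightarrow> Lnorm q (Delta \<eta>0 m' (Delta \<eta>0 m f)) \<le> C * Lnorm q (Delta \<eta>0 m f)"
proof -
  obtain C where C: "C \<ge> 1" and mult: "\<And>q (S :: (int ^ 'd) set) c m. q \<ge> 1 \<Longrightarrow> finite S \<Longrightarrow>
     (\<forall>k\<in>S. \<forall>j. \<bar>k $ j\<bar> \<le> 4 * 2 ^ (m $ j)) \<Longrightarrow>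
     Lnorm q (trig S (\<lambda>k. of_real (ev m k) * c k)) \<le> C * Lnorm q (trig S c)"
    using multiplier_bound[where 'd = 'd] by blast
  have "Lnorm q (Delta \<eta>0 m' (Delta \<eta>0 m f)) \<le> C * Lnorm q (Delta \<eta>0 m f)"
    if q: "q \<ge> 1" for q and m m' :: "nat ^ 'd" and f
  proof (cases "m' \<in> near m")
    case False
    then show ?thesis using C unfolding Delta_Delta_zero[OF False] by simp
  next
    case True
    \<comment> \<open>This is where the multiplier bound must reach 4 * 2^(m' $ j): the box of a
      neighbour can extend to 2 * 2^(m' $ j + 1).\<close>
    have "\<forall>k\<in>box m. \<forall>j. \<bar>k $ j\<bar> \<le> 4 * 2 ^ (m' $ j)"
    proof (intro ballI allI)
      fix k j assume "k \<in> box m"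
      then have "- 2 * 2 ^ (m $ j) \<le> k $ j \<and> k $ j \<le> 2 * 2 ^ (m $ j)" by (auto simp: box_def)
      moreover have "(2::int) ^ (m $ j) \<le> 2 ^ (m' $ j + 1)"
        using True by (intro power_increasing) (auto simp: near_iff)
      moreover have "(2::int) ^ (m' $ j + 1) = 2 * 2 ^ (m' $ j)" by simp
      ultimately show "\<bar>k $ j\<bar> \<le> 4 * 2 ^ (m' $ j)" by linarith
    qed
    then show ?thesis unfolding Delta_trig_form[of m f] Delta_trig[OF finite_box]
      by (intro mult q finite_box)
  qed
  then show ?thesis using C by blast
qed

text \<open>Blocks are not projections, but the multipliers of the near blocks add up to 1 on the
  support of this one.\<close>

lemma Delta_reproducing: "Delta \<eta>0 m' f = (\<lambda>x. \<Sum>m\<in>near m'. Delta \<eta>0 m' (Delta \<eta>0 m f) x)"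
proof -
  have 1: "Delta \<eta>0 m' (Delta \<eta>0 m f) = trig (box m') (\<lambda>k. of_real (ev m' k) * of_real (ev m k) * fourier_coeff f k)" for m
    unfolding Delta_trig_form[of m f] Delta_trig[OF finite_box]
    by (rule trig_support) (auto simp: ev_zero)
  have "(\<Sum>m\<in>near m'. of_real (ev m' k) * of_real (ev m k) * fourier_coeff f k)
     = of_real (ev m' k) * fourier_coeff f k" for k
  proof (cases "ev m' k = 0")
    case False
    have "(\<Sum>m\<in>near m'. of_real (ev m' k) * of_real (ev m k) * fourier_coeff f k)
      = of_real (ev m' k * (\<Sum>m\<in>near m'. ev m k)) * fourier_coeff f k"
      by (simp add: sum_distrib_right sum_distrib_left)
    then show ?thesis using sum_ev_near[OF False] by simp
  qed simp
  then show ?thesis unfolding 1 trig_sum Delta_trig_form[of m' f] by simp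
qed

lemma fourier_coeff_linear:
  fixes f g :: "real ^ 'd \<Rightarrow> complex"
  assumes "integrable torus_measure f" "integrable torus_measure g"
  shows "fourier_coeff (\<lambda>x. a * f x + b * g x) k = a * fourier_coeff f k + b * fourier_coeff g k"
proof -
  have int: "integrable torus_measure (\<lambda>x. h x * cis (- (real_vec k \<bullet> x)))"
    if "integrable torus_measure h" for h :: "real ^ 'd \<Rightarrow> complex"
  proof (rule Bochner_Integration.integrable_bound[OF that])
    have "(\<lambda>x :: real ^ 'd. cis (- (real_vec k \<bullet> x))) \<in> borel_measurable torus_measure"
      unfolding cis_conv_exp by (intro continuous_measurable_torus continuous_intros)
    then show "(\<lambda>x. h x * cis (- (real_vec k \<bullet> x))) \<in> borel_measurable torus_measure"
      using that by (intro borel_measurable_times) auto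
  qed (simp add: norm_mult)
  have "(\<lambda>x. (a * f x + b * g x) * cis (- (real_vec k \<bullet> x)))
     = (\<lambda>x. a * (f x * cis (- (real_vec k \<bullet> x))) + b * (g x * cis (- (real_vec k \<bullet> x))))"
    by (simp add: fun_eq_iff algebra_simps)
  then show ?thesis unfolding fourier_coeff_def
    using int[OF assms(1)] int[OF assms(2)] by (simp add: add_divide_distrib)
qed

lemma Delta_linear:
  assumes "integrable torus_measure f" "integrable torus_measure g"
  shows "Delta \<eta>0 m (\<lambda>x. a * f x + b * g x) = (\<lambda>x. a * Delta \<eta>0 m f x + b * Delta \<eta>0 m g x)"
  unfolding Delta_trig_form trig_scale trig_add fourier_coeff_linear[OF assms] by (simp add: algebra_simps)

end

section \<open>Besov norms\<close>

text \<open>An enumeration of the countable index set exhausts it by finite sets, and monotone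
  convergence applies. It reduces the later estimates of sequence norms to finite sums.\<close>

lemma nn_integral_count_space_le_iff:
  fixes f :: "'a::countable \<Rightarrow> ennreal"
  shows "(\<integral>\<^sup>+x. f x \<partial>count_space UNIV) \<le> B \<longleftrightarrow> (\<forall>F. finite F \<longrightarrow> (\<Sum>x\<in>F. f x) \<le> B)"
proof -
  have fin: "(\<Sum>x\<in>F. f x) = (\<integral>\<^sup>+x. f x * indicator F x \<partial>count_space UNIV)" if "finite F" for F
    using nn_integral_count_space_finite[OF that, of f] that
    by (cases "F = UNIV") (auto simp: nn_integral_count_space_indicator[of F f])
  show ?thesis
  proof (intro iffI allI impI)
    fix F :: "'a set" assume "(\<integral>\<^sup>+x. f x \<partial>count_space UNIV) \<le> B" and F: "finite F"
    then show "(\<Sum>x\<in>F. f x) \<le> B" unfolding fin[OF F]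
      by (elim order_trans[rotated]) (intro nn_integral_mono, auto simp: indicator_def)
  next
    assume a: "\<forall>F. finite F \<longrightarrow> (\<Sum>x\<in>F. f x) \<le> B"
    define E where "E n = {x :: 'a. to_nat x < n}" for n
    have E: "finite (E n)" for n
      unfolding E_def using finite_vimageI[of "{..<n}" "to_nat :: 'a \<Rightarrow> nat"] by (simp add: vimage_def lessThan_def)
    have s: "(SUP n. f x * indicator (E n) x) = f x" for x
      by (rule antisym) (auto intro!: SUP_least SUP_upper2[of "Suc (to_nat x)"] simp: indicator_def E_def)
    have "(\<integral>\<^sup>+x. f x \<partial>count_space UNIV) = (\<integral>\<^sup>+x. (SUP n. f x * indicator (E n) x) \<partial>count_space UNIV)" unfolding s ..
    also have "\<dots> = (SUP n. (\<integral>\<^sup>+x. f x * indicator (E n) x \<partial>count_space UNIV))"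
      by (rule nn_integral_monotone_convergence_SUP)
         (auto simp: incseq_def le_fun_def E_def indicator_def)
    also have "\<dots> \<le> B" unfolding fin[OF E, symmetric] using a E by (intro SUP_least) auto
    finally show "(\<integral>\<^sup>+x. f x \<partial>count_space UNIV) \<le> B" .
  qed
qed

lemma ennreal_powr_le_iff:
  assumes "s > 0" "D \<ge> 0"
  shows "ennreal_powr a (1/s) \<le> ennreal D \<longleftrightarrow> a \<le> ennreal (D powr s)"
proof (cases a)
  case (real r)
  have "r powr (1/s) \<le> D \<longleftrightarrow> r \<le> D powr s"
  proof
    assume "r powr (1/s) \<le> D"
    then have "(r powr (1/s)) powr s \<le> D powr s" using assms by (intro powr_mono2) auto
    then show "r \<le> D powr s" using assms real by (simp add: powr_powr)
  next
    assume "r \<le> D powr s"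
    then have "r powr (1/s) \<le> (D powr s) powr (1/s)" using assms real by (intro powr_mono2) auto
    then show "r powr (1/s) \<le> D" using assms by (simp add: powr_powr)
  qed
  then show ?thesis using real assms by (simp add: ennreal_powr_ennreal)
qed (simp add: ennreal_powr_def top_unique)

lemma enn_lseq_norm_le_iff:
  fixes a :: "'i::countable \<Rightarrow> real"
  assumes "s > 0" "D \<ge> 0" "\<And>i. a i \<ge> 0"
  shows "enn_lseq_norm (ennreal s) (\<lambda>i. ennreal (a i)) \<le> ennreal D
    \<longleftrightarrow> (\<forall>F. finite F \<longrightarrow> (\<Sum>i\<in>F. a i powr s) \<le> D powr s)"
proof -
  have "(\<Sum>i\<in>F. ennreal (a i powr s)) = ennreal (\<Sum>i\<in>F. a i powr s)" for F by (simp add: sum_ennreal)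
  moreover have "enn_lseq_norm (ennreal s) (\<lambda>i. ennreal (a i)) \<le> ennreal D
    \<longleftrightarrow> (\<integral>\<^sup>+i. ennreal (a i powr s) \<partial>count_space UNIV) \<le> ennreal (D powr s)"
    using assms by (simp add: enn_Lp_norm_def recip_ennreal ennreal_powr_ennreal ennreal_powr_le_iff)
  ultimately show ?thesis unfolding nn_integral_count_space_le_iff by simp
qed

context cutoff
begin

text \<open>The smoothness vectors have equal components, so the weight of a block depends on its
  level alone.\<close>

definition bl :: "real \<Rightarrow> real \<Rightarrow> nat ^ 'd \<Rightarrow> (real ^ 'd \<Rightarrow> complex) \<Rightarrow> real" where
  "bl r q m f = 2 powr (r * real (level m)) * Lnorm q (Delta \<eta>0 m f)"

lemma bl_nonneg [simp]: "bl r q m f \<ge> 0"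
  by (simp add: bl_def)

lemma weight_eq: "2 powr (\<Sum>j\<in>UNIV. real (m $ j) * (\<chi> i. r) $ j) = 2 powr (r * real (level m))"
  by (simp add: level_def sum_distrib_left mult.commute)

abbreviation bnorm :: "real \<Rightarrow> real \<Rightarrow> real \<Rightarrow> (real ^ 'd \<Rightarrow> complex) \<Rightarrow> ennreal" where
  "bnorm l q \<sigma> \<equiv> besov_norm \<eta>0 (\<chi> i. l) (ennreal q) (ennreal \<sigma>)"

lemma besov_norm_le_iff:
  assumes "q > 0" "\<sigma> > 0" "D \<ge> 0"
  shows "bnorm l q \<sigma> (x :: real ^ 'd \<Rightarrow> complex) \<le> ennreal D \<longleftrightarrow>
    x \<in> torus_Lp (ennreal q) \<and> (\<forall>F. finite F \<longrightarrow> (\<Sum>m\<in>F. bl l q m x powr \<sigma>) \<le> D powr \<sigma>)"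
proof -
  have "(\<lambda>m :: nat ^ 'd. ennreal (2 powr (\<Sum>j\<in>UNIV. real (m $ j) * (\<chi> i. l) $ j)) * torus_Lp_norm (ennreal q) (Delta \<eta>0 m x))
     = (\<lambda>m. ennreal (bl l q m x))"
    unfolding weight_eq by (simp add: bl_def ennreal_mult torus_Lp_norm_continuous[OF continuous_Delta assms(1)])
  then show ?thesis unfolding besov_norm_def
    using enn_lseq_norm_le_iff[of \<sigma> D "\<lambda>m. bl l q m x"] assms by (simp add: top_unique)
qed

end

section \<open>Flat test polynomials\<close>

text \<open>The signs of the Rudin-Shapiro pair: \<open>True\<close> selects the polynomial P,
  \<open>False\<close> its companion Q, and they are continued by P + z^(2^a) Q and P - z^(2^a)
  Q.\<close>

fun rs :: "bool \<Rightarrow> nat \<Rightarrow> nat \<Rightarrow> real" where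
  "rs b 0 i = 1"
| "rs b (Suc a) i = (if i < 2 ^ a then rs True a i else (if b then 1 else -1) * rs False a (i - 2 ^ a))"

lemma abs_rs [simp]: "\<bar>rs b a i\<bar> = 1"
  by (induction b a i rule: rs.induct) (auto simp: abs_mult)

definition rs_poly :: "bool \<Rightarrow> nat \<Rightarrow> complex \<Rightarrow> complex" where
  "rs_poly b a z = (\<Sum>i<2 ^ a. of_real (rs b a i) * z ^ i)"

lemma rs_poly_Suc: "rs_poly b (Suc a) z = rs_poly True a z + (if b then 1 else -1) * z ^ (2 ^ a) * rs_poly False a z"
proof -
  have "rs_poly b (Suc a) z = (\<Sum>i<2 ^ a + 2 ^ a. of_real (rs b (Suc a) i) * z ^ i)"
    by (simp add: rs_poly_def mult_2)
  also have "\<dots> = (\<Sum>i<2 ^ a. of_real (rs b (Suc a) i) * z ^ i) + (\<Sum>i<2 ^ a. of_real (rs b (Suc a) (2 ^ a + i)) * z ^ (2 ^ a + i))"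
    by (simp add: sum.nat_group[symmetric] lessThan_atLeast0 sum.atLeastLessThan_concat[of 0 "2^a" "2^a+2^a", symmetric]
        sum.shift_bounds_nat_ivl[of _ 0 "2^a" "2^a", simplified] add.commute)
  also have "(\<Sum>i<2 ^ a. of_real (rs b (Suc a) i) * z ^ i) = rs_poly True a z"
    by (simp add: rs_poly_def)
  also have "(\<Sum>i<2 ^ a. of_real (rs b (Suc a) (2 ^ a + i)) * z ^ (2 ^ a + i)) = (if b then 1 else -1) * z ^ (2 ^ a) * rs_poly False a z"
    by (simp add: rs_poly_def sum_distrib_left power_add mult_ac sum_negf)
  finally show ?thesis .
qed

text \<open>By the parallelogram law each step doubles the sum of squares, as z^(2^a) has modulus
  1.\<close>

lemma rs_poly_square:
  assumes "norm z = 1"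
  shows "(norm (rs_poly True a z))\<^sup>2 + (norm (rs_poly False a z))\<^sup>2 = 2 ^ Suc a"
proof (induction a)
  case 0 then show ?case by (simp add: rs_poly_def)
next
  case (Suc a)
  have par: "(norm (u + v))\<^sup>2 + (norm (u - v))\<^sup>2 = 2 * ((norm u)\<^sup>2 + (norm v)\<^sup>2)" for u v :: complex
    unfolding cmod_power2 by (simp add: power2_eq_square algebra_simps)
  have "norm (z ^ (2 ^ a) * rs_poly False a z) = norm (rs_poly False a z)"
    using assms by (simp add: norm_mult norm_power)
  then show ?case using Suc par[of "rs_poly True a z" "z ^ (2 ^ a) * rs_poly False a z"]
    by (simp add: rs_poly_Suc)
qed

lemma norm_rs_poly: "norm z = 1 \<Longrightarrow> norm (rs_poly True a z) \<le> sqrt (2 ^ Suc a)"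
  using rs_poly_square[of z a] by (intro real_le_rsqrt) (smt (verit) zero_le_power2)

text \<open>The frequencies of the test polynomial with index \<open>a\<close> lie where the cut-off function of the
  block with index \<open>up a\<close> equals \<open>1\<close> and all the others vanish.\<close>

definition freqs :: "nat ^ 'd \<Rightarrow> (int ^ 'd) set" where
  "freqs a = {k. \<forall>j. k $ j \<in> {3 * 2 ^ (a $ j) + 1..4 * 2 ^ (a $ j)}}"

definition up :: "nat ^ 'd \<Rightarrow> nat ^ 'd" where
  "up a = (\<chi> j. a $ j + 2)"

text \<open>The subtracted term moves the frequencies of \<open>freqs a\<close> to 0, ..., 2^(a $ j)
  - 1 in each coordinate.\<close>

definition rs_coeff :: "nat ^ 'd \<Rightarrow> int ^ 'd \<Rightarrow> complex" where
  "rs_coeff a k = (\<Prod>j\<in>UNIV. of_real (rs True (a $ j) (nat (k $ j - 3 * 2 ^ (a $ j) - 1))))"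

lemma finite_freqs [simp]: "finite (freqs a)"
  unfolding freqs_def by (rule finite_vec_set) simp

lemma card_freqs: "card (freqs (a :: nat ^ 'd)) = 2 ^ level a"
proof -
  have "card (freqs a) = (\<Prod>j\<in>(UNIV::'d set). card {3 * 2 ^ (a $ j) + 1..4 * 2 ^ (a $ j) :: int})"
    unfolding freqs_def by (rule card_vec_set) simp
  also have "\<dots> = (\<Prod>j\<in>(UNIV::'d set). 2 ^ (a $ j))"
    by (intro prod.cong refl) (simp add: nat_power_eq)
  finally show ?thesis by (simp add: level_def power_sum)
qed

lemma inj_up: "inj up"
  by (auto simp: inj_on_def up_def vec_eq_iff)

lemma level_up: "level (up (a :: nat ^ 'd)) = level a + 2 * CARD('d)"
proof -
  have "level (up a) = (\<Sum>j\<in>UNIV. a $ j + 2)" by (simp add: level_def up_def)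
  then show ?thesis unfolding sum.distrib by (simp add: level_def)
qed

lemma norm_rs_coeff [simp]: "norm (rs_coeff a k) = 1"
  by (simp add: rs_coeff_def prod_norm[symmetric])

lemma cis_sum: "cis (\<Sum>j\<in>J. f j) = (\<Prod>j\<in>J. cis (f j))"
  by (induction J rule: infinite_finite_induct) (simp_all add: cis_mult[symmetric])

lemma prod_sqrt: "(\<Prod>j\<in>J. sqrt (f j)) = sqrt (\<Prod>j\<in>J. f j)"
  by (induction J rule: infinite_finite_induct) (simp_all add: real_sqrt_mult)

text \<open>The polynomial factorises over the coordinates. Each factor is a modulated Rudin-Shapiro
  polynomial with 2^(a $ j) terms, so its modulus is at most sqrt 2 times the square root of that
  number.\<close>

lemma norm_trig_freqs: "norm (trig (freqs a) (rs_coeff a) (x :: real ^ 'd)) \<le> sqrt (2 ^ (level a + CARD('d)))"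
proof -
  let ?I = "\<lambda>j. {3 * 2 ^ (a $ j) + 1..4 * 2 ^ (a $ j) :: int}"
  let ?g = "\<lambda>j h. of_real (rs True (a $ j) (nat (h - 3 * 2 ^ (a $ j) - 1))) * cis (of_int h * x $ j)"
  have "trig (freqs a) (rs_coeff a) x = (\<Sum>k\<in>freqs a. \<Prod>j\<in>UNIV. ?g j (k $ j))"
    unfolding trig_def rs_coeff_def inner_vec_def real_vec_def
    by (simp add: cis_sum prod.distrib)
  also have "\<dots> = (\<Sum>g\<in>PiE UNIV ?I. \<Prod>j\<in>UNIV. ?g j (g j))"
    unfolding freqs_def by (subst sum.reindex_bij_betw[OF bij_betw_vec_PiE[of ?I], symmetric]) simp
  also have "\<dots> = (\<Prod>j\<in>UNIV. \<Sum>h\<in>?I j. ?g j h)" by (subst prod_sum_PiE) auto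
  finally have e: "trig (freqs a) (rs_coeff a) x = (\<Prod>j\<in>UNIV. \<Sum>h\<in>?I j. ?g j h)" .
  have one: "norm (\<Sum>h\<in>?I j. ?g j h) \<le> sqrt (2 ^ Suc (a $ j))" for j
  proof -
    let ?s = "3 * 2 ^ (a $ j) + 1 :: int"
    have "(\<Sum>h\<in>?I j. ?g j h) = (\<Sum>i<2 ^ (a $ j). ?g j (int i + ?s))"
    proof (rule sum.reindex_bij_witness[where i = "\<lambda>i. int i + ?s" and j = "\<lambda>h. nat (h - ?s)"])
      fix h assume h: "h \<in> ?I j"
      then have "nat (h - ?s) < nat (2 ^ (a $ j))" by (subst nat_less_eq_zless) auto
      then show "nat (h - ?s) \<in> {..<2 ^ (a $ j)}" by (simp add: nat_power_eq)
    next
      fix i :: nat assume "i \<in> {..<2 ^ (a $ j)}"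
      then have "int i < 2 ^ (a $ j)" by (metis lessThan_iff of_nat_less_iff of_nat_numeral of_nat_power)
      then have "int i + 1 \<le> 2 ^ (a $ j)" by linarith
      then show "int i + ?s \<in> ?I j" unfolding atLeastAtMost_iff by linarith
    qed auto
    also have "\<dots> = cis (of_int ?s * x $ j) * rs_poly True (a $ j) (cis (x $ j))"
      unfolding rs_poly_def sum_distrib_left Complex.DeMoivre
      by (intro sum.cong refl) (simp add: cis_mult algebra_simps)
    finally show ?thesis using norm_rs_poly[of "cis (x $ j)" "a $ j"] by (simp add: norm_mult)
  qed
  have "norm (trig (freqs a) (rs_coeff a) x) \<le> (\<Prod>j\<in>(UNIV::'d set). sqrt (2 ^ Suc (a $ j)))"
    unfolding e prod_norm[symmetric] by (intro prod_mono) (use one in auto)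
  also have "\<dots> = sqrt (\<Prod>j\<in>(UNIV::'d set). 2 ^ Suc (a $ j))" by (rule prod_sqrt)
  also have "(\<Prod>j\<in>(UNIV::'d set). 2 ^ Suc (a $ j)) = (2::real) ^ (level a + CARD('d))"
    by (simp add: level_def power_add power_sum prod.distrib mult.commute)
  finally show ?thesis .
qed

section \<open>Test polynomials in Besov spaces\<close>

context cutoff
begin

text \<open>In every coordinate \<open>freqs a\<close> consists of the integers in the interval of
  \<open>eta_one\<close> with index a $ j + 2.\<close>

lemma ev_freqs:
  assumes "k \<in> freqs a"
  shows "ev (up a) k = 1" "m \<noteq> up a \<Longrightarrow> ev m k = 0"
proof -
  have k: "3 * 2 ^ (a $ j) + 1 \<le> k $ j" "k $ j \<le> 4 * 2 ^ (a $ j)" for j using assms by (auto simp: freqs_def)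
  have kr: "3 / 4 * 2 ^ (up a $ j) < \<bar>real_of_int (k $ j)\<bar>" "\<bar>real_of_int (k $ j)\<bar> \<le> 2 ^ (up a $ j)" for j
  proof -
    have "real_of_int (3 * 2 ^ (a $ j) + 1) \<le> of_int (k $ j)" "of_int (k $ j) \<le> real_of_int (4 * 2 ^ (a $ j))"
      using k[of j] by (simp_all only: of_int_le_iff)
    moreover have "(0::real) \<le> 2 ^ (a $ j)" by simp
    ultimately show "3 / 4 * 2 ^ (up a $ j) < \<bar>real_of_int (k $ j)\<bar>" "\<bar>real_of_int (k $ j)\<bar> \<le> 2 ^ (up a $ j)"
      by (simp_all add: up_def)
  qed
  have one: "up a $ j \<ge> 1" for j by (simp add: up_def)
  show "ev (up a) k = 1" unfolding ev_def using eta_one(1)[OF one kr] by simp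
  assume "m \<noteq> up a"
  then obtain j where "m $ j \<noteq> up a $ j" by (auto simp: vec_eq_iff)
  then have "\<eta> (m $ j) (of_int (k $ j)) = 0" by (rule eta_one(2)[OF one kr])
  then show "ev m k = 0" unfolding ev_def by (intro prod_zero) auto
qed

lemma freqs_disjoint: "a \<noteq> b \<Longrightarrow> freqs a \<inter> freqs b = {}"
  using ev_freqs inj_up by (metis disjoint_iff injD zero_neq_one)

lemma freqs_subset_box: "freqs a \<subseteq> box (up a)"
proof
  fix k assume "k \<in> freqs a"
  then have "ev (up a) k = 1" by (rule ev_freqs)
  then show "k \<in> box (up a)" using ev_zero[of k "up a"] by fastforce
qed

text \<open>Parseval's identity for the block, followed by the comparison of the L_2 norm with the
  L_q norm.\<close>

lemma fourier_le_Lnorm: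
  fixes f :: "real ^ 'd \<Rightarrow> complex"
  assumes q: "q \<ge> 2"
  shows "(\<Sum>k\<in>freqs a. (norm (fourier_coeff f k))\<^sup>2) \<le> (((2*pi) ^ CARD('d) + 1) * Lnorm q (Delta \<eta>0 (up a) f))\<^sup>2"
proof -
  have "(\<Sum>k\<in>freqs a. (norm (fourier_coeff f k))\<^sup>2) = (\<Sum>k\<in>freqs a. (norm (of_real (ev (up a) k) * fourier_coeff f k))\<^sup>2)"
    by (intro sum.cong refl) (simp add: ev_freqs)
  also have "\<dots> \<le> (\<Sum>k\<in>box (up a). (norm (of_real (ev (up a) k) * fourier_coeff f k))\<^sup>2)"
    by (rule sum_mono2) (use freqs_subset_box in auto)
  also have "\<dots> \<le> (2*pi) ^ CARD('d) * (\<Sum>k\<in>box (up a). (norm (of_real (ev (up a) k) * fourier_coeff f k))\<^sup>2)"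
    using mult_right_mono[OF two_pi_power_ge_1[of "CARD('d)"], of "\<Sum>k\<in>box (up a). (norm (of_real (ev (up a) k) * fourier_coeff f k))\<^sup>2"]
    by (simp add: sum_nonneg)
  also have "\<dots> = (Lnorm 2 (Delta \<eta>0 (up a) f))\<^sup>2"
    unfolding Delta_trig_form by (rule Lnorm_2[symmetric]) simp
  also have "\<dots> \<le> (((2*pi) ^ CARD('d) + 1) * Lnorm q (Delta \<eta>0 (up a) f))\<^sup>2"
    using q by (intro power_mono Lnorm_mono continuous_Delta) auto
  finally show ?thesis .
qed

lemma enn_lseq_norm_finite_support:
  fixes g :: "'i::countable \<Rightarrow> ennreal"
  assumes th: "1 \<le> \<theta>" and F: "finite F" "F \<noteq> {}" and T: "T \<ge> 0" "\<And>i. i \<in> F \<Longrightarrow> g i \<le> ennreal T"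
    and z: "\<And>i. i \<notin> F \<Longrightarrow> g i = 0"
  shows "enn_lseq_norm \<theta> g \<le> ennreal (T * real (card F) powr recip \<theta>)"
proof -
  have K: "real (card F) \<ge> 1" using F by (simp add: Suc_leI card_gt_0_iff)
  have "ennreal 1 \<le> \<theta>" using th by simp
  then show ?thesis
  proof (rule ennreal_ge_cases)
    assume "\<theta> = top"
    then have "enn_lseq_norm \<theta> g = (SUP i. g i)" by (simp add: enn_lseq_norm_top)
    also have "\<dots> \<le> ennreal T" using T z by (intro SUP_least) (metis zero_le)
    finally show ?thesis using K \<open>\<theta> = top\<close> by (simp add: recip_def)
  next
    fix t assume t: "\<theta> = ennreal t" "1 \<le> t"
    have "(\<integral>\<^sup>+i. ennreal_powr (g i) t \<partial>count_space UNIV) \<le> ennreal (real (card F) * T powr t)"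
      unfolding nn_integral_count_space_le_iff
    proof (intro allI impI)
      fix G :: "'i set" assume G: "finite G"
      have gi: "ennreal_powr (g i) t \<le> ennreal (T powr t)" if "i \<in> F" for i
      proof -
        have "g i \<noteq> top" using T(2)[OF that] by (auto simp: top_unique)
        then have "enn2real (g i) \<le> T" using T that by (simp add: enn2real_leI)
        then show ?thesis using \<open>g i \<noteq> top\<close> t by (auto simp: ennreal_powr_def intro!: ennreal_leI powr_mono2)
      qed
      have "(\<Sum>i\<in>G. ennreal_powr (g i) t) = (\<Sum>i\<in>G \<inter> F. ennreal_powr (g i) t)"
        by (rule sum.mono_neutral_right) (use G z t in \<open>auto simp: ennreal_powr_def\<close>)
      also have "\<dots> \<le> (\<Sum>i\<in>G \<inter> F. ennreal (T powr t))" by (intro sum_mono gi) auto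
      also have "\<dots> \<le> (\<Sum>i\<in>F. ennreal (T powr t))" by (rule sum_mono2) (use F in auto)
      also have "\<dots> = ennreal (real (card F) * T powr t)" by (subst sum_ennreal) auto
      finally show "(\<Sum>i\<in>G. ennreal_powr (g i) t) \<le> ennreal (real (card F) * T powr t)" .
    qed
    also have "real (card F) * T powr t = (T * real (card F) powr (1/t)) powr t"
      using T t K by (simp add: powr_mult powr_powr)
    finally show ?thesis using t T by (simp add: enn_Lp_norm_def recip_ennreal ennreal_powr_le_iff)
  qed simp
qed

text \<open>Each block \<open>up a\<close> with a in \<open>A\<close> sees exactly one summand and
  all other blocks see nothing, so the sequence norm has card A terms with equal bounds. The uniform
  bound of the polynomials serves all exponents p at once.\<close>

lemma besov_norm_test:
  fixes A :: "(nat ^ 'd) set" and u :: "real ^ 'd"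
  assumes A: "finite A" "A \<noteq> {}" "\<And>a. a \<in> A \<Longrightarrow> level a = j" and p: "1 \<le> p" and th: "1 \<le> \<theta>" and lam: "la \<ge> 0"
  shows "besov_norm \<eta>0 (\<chi> i. r) p \<theta> (\<lambda>x. \<Sum>a\<in>A. of_real la * trig (freqs a) (rs_coeff a) (x + u))
    \<le> ennreal (2 powr (r * real (j + 2 * CARD('d))) * ((2*pi) ^ CARD('d) * (la * sqrt (2 ^ (j + CARD('d)))))
        * real (card A) powr recip \<theta>)"
proof -
  let ?G = "\<lambda>a x. of_real la * trig (freqs a) (rs_coeff a) (x + u)"
  let ?f = "\<lambda>x. \<Sum>a\<in>A. ?G a x"
  let ?B = "la * sqrt (2 ^ (j + CARD('d)))"
  have cont: "continuous_on UNIV (?G a)" for a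
    by (intro continuous_intros continuous_on_compose2[OF continuous_trig]) auto
  have contf: "continuous_on UNIV ?f" by (intro continuous_intros cont)
  have G_bd: "norm (?G a x) \<le> ?B" if "a \<in> A" for a x
    using norm_trig_freqs[of a "x + u"] A(3)[OF that] lam by (simp add: norm_mult mult_left_mono)
  have G_trig': "of_real la * trig (freqs a) (rs_coeff a) (x + u)
      = trig (freqs a) (\<lambda>k. of_real la * rs_coeff a k * cis (real_vec k \<bullet> u)) x" for a x
    by (simp add: trig_def inner_add_right cis_mult[symmetric] sum_distrib_left mult_ac)
  have G_trig: "?G a = trig (freqs a) (\<lambda>k. of_real la * rs_coeff a k * cis (real_vec k \<bullet> u))" for a
    unfolding G_trig' ..
  define U where "U = (\<Union>a\<in>A. freqs a)"
  define b where "b k = (\<Sum>a\<in>A. if k \<in> freqs a then of_real la * rs_coeff a k * cis (real_vec k \<bullet> u) else 0)" for k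
  have finU: "finite U" using A by (auto simp: U_def)
  have bk: "b k = of_real la * rs_coeff a k * cis (real_vec k \<bullet> u)" if "a \<in> A" "k \<in> freqs a" for a k
  proof -
    have "b k = (\<Sum>a'\<in>{a}. if k \<in> freqs a' then of_real la * rs_coeff a' k * cis (real_vec k \<bullet> u) else 0)"
      unfolding b_def using that A(1) freqs_disjoint by (intro sum.mono_neutral_right) auto
    then show ?thesis using that by simp
  qed
  have "?f = (\<lambda>x. \<Sum>a\<in>A. trig U (\<lambda>k. if k \<in> freqs a then of_real la * rs_coeff a k * cis (real_vec k \<bullet> u) else 0) x)"
    unfolding G_trig' by (intro ext sum.cong refl fun_cong[OF trig_support]) (use finU in \<open>auto simp: U_def\<close>)
  then have f_trig: "?f = trig U b" unfolding trig_sum b_def[abs_def] .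
  have D1: "Delta \<eta>0 (up a) ?f = ?G a" if a: "a \<in> A" for a
    unfolding f_trig G_trig Delta_trig[OF finU]
  proof (rule trig_support)
    fix k
    show "(if k \<in> U then of_real (ev (up a) k) * b k else 0) =
      (if k \<in> freqs a then of_real la * rs_coeff a k * cis (real_vec k \<bullet> u) else 0)"
    proof (cases "k \<in> freqs a")
      case True
      then show ?thesis using a by (auto simp: U_def ev_freqs bk)
    next
      case False
      then have "ev (up a) k = 0" if "k \<in> U" using that ev_freqs(2) inj_up unfolding U_def by (metis UN_E injD)
      then show ?thesis using False by auto
    qed
  qed (use finU in auto)
  have D0: "Delta \<eta>0 m ?f = (\<lambda>_. 0)" if m: "m \<notin> up ` A" for m
    unfolding f_trig Delta_trig[OF finU]
    by (rule trig_eq_zero) (use m in \<open>auto simp: U_def intro!: ev_freqs(2)\<close>)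
  have B0: "?B \<ge> 0" using lam by simp
  have mem: "?f \<in> torus_Lp p"
  proof (rule torus_Lp_bounded(2)[OF contf _ p])
    fix x
    have "norm (?f x) \<le> (\<Sum>a\<in>A. norm (?G a x))" by (rule norm_sum)
    also have "\<dots> \<le> real (card A) * ?B" by (rule sum_bounded_above) (rule G_bd)
    finally show "norm (?f x) \<le> real (card A) * ?B" .
  qed
  have zero: "torus_Lp_norm p (\<lambda>_ :: real ^ 'd. 0) = 0"
    using torus_Lp_bounded(1)[of "\<lambda>_ :: real ^ 'd. 0" 0 p] p by simp
  have "enn_lseq_norm \<theta> (\<lambda>m. ennreal (2 powr (\<Sum>j\<in>UNIV. real (m $ j) * (\<chi> i. r) $ j)) * torus_Lp_norm p (Delta \<eta>0 m ?f))
    \<le> ennreal ((2 powr (r * real (j + 2 * CARD('d))) * ((2*pi) ^ CARD('d) * ?B)) * real (card (up ` A)) powr recip \<theta>)"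
  proof (rule enn_lseq_norm_finite_support[OF th])
    fix m assume "m \<in> up ` A"
    then obtain a where a: "a \<in> A" "m = up a" by auto
    have "torus_Lp_norm p (Delta \<eta>0 m ?f) \<le> ennreal ((2*pi) ^ CARD('d) * ?B)"
      unfolding a(2) D1[OF a(1)] using G_bd[OF a(1)] by (intro torus_Lp_bounded(1) cont p)
    then have "ennreal (2 powr (r * real (level m))) * torus_Lp_norm p (Delta \<eta>0 m ?f)
       \<le> ennreal (2 powr (r * real (level m))) * ennreal ((2*pi) ^ CARD('d) * ?B)" by (intro mult_left_mono) auto
    then show "ennreal (2 powr (\<Sum>j\<in>UNIV. real (m $ j) * (\<chi> i. r) $ j)) * torus_Lp_norm p (Delta \<eta>0 m ?f)
      \<le> ennreal (2 powr (r * real (j + 2 * CARD('d))) * ((2*pi) ^ CARD('d) * ?B))"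
      unfolding weight_eq using a A(3)[OF a(1)] B0 by (simp add: level_up ennreal_mult)
  next
    fix m assume "m \<notin> up ` A"
    from D0[OF this] show "ennreal (2 powr (\<Sum>j\<in>UNIV. real (m $ j) * (\<chi> i. r) $ j)) * torus_Lp_norm p (Delta \<eta>0 m ?f) = 0"
      using zero by simp
  qed (use A B0 in auto)
  also have "card (up ` A) = card A" by (rule card_image) (meson inj_on_subset inj_up subset_UNIV)
  finally show ?thesis unfolding besov_norm_def using mem by simp
qed

end

section \<open>Projections in coefficient space\<close>

definition ip :: "'k set \<Rightarrow> ('k \<Rightarrow> complex) \<Rightarrow> ('k \<Rightarrow> complex) \<Rightarrow> complex" where
  "ip S u v = (\<Sum>k\<in>S. u k * cnj (v k))"

lemma ip_cnj: "cnj (ip S u v) = ip S v u"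
  by (simp add: ip_def mult.commute)

lemma ip_linear: "ip S (\<lambda>k. a * u k + b * v k) w = a * ip S u w + b * ip S v w"
  by (simp add: ip_def sum.distrib sum_distrib_left algebra_simps)

lemma ip_sum: "ip S (\<lambda>k. \<Sum>i\<in>J. c i * v i k) w = (\<Sum>i\<in>J. c i * ip S (v i) w)"
  unfolding ip_def sum_distrib_left sum_distrib_right by (subst sum.swap) (simp add: mult.assoc)

lemma ip_sum_right: "ip S w (\<lambda>k. \<Sum>i\<in>J. c i * v i k) = (\<Sum>i\<in>J. cnj (c i) * ip S w (v i))"
proof -
  have "ip S w (\<lambda>k. \<Sum>i\<in>J. c i * v i k) = cnj (ip S (\<lambda>k. \<Sum>i\<in>J. c i * v i k) w)" by (simp add: ip_cnj)
  then show ?thesis unfolding ip_sum by (simp add: ip_cnj)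
qed

lemma ip_cong: "(\<And>k. k \<in> S \<Longrightarrow> u k = u' k) \<Longrightarrow> (\<And>k. k \<in> S \<Longrightarrow> v k = v' k) \<Longrightarrow> ip S u v = ip S u' v'"
  by (simp add: ip_def)

lemma ip_self: "ip S u u = of_real (\<Sum>k\<in>S. (norm (u k))\<^sup>2)"
  by (simp add: ip_def complex_norm_square del: of_real_power)

text \<open>Orthonormalisation; vectors that become dependent are replaced by \<open>0\<close>.\<close>

lemma orthonormal_family:
  fixes w :: "'b \<Rightarrow> 'k \<Rightarrow> complex"
  assumes S: "finite S" and J: "finite J"
  shows "\<exists>e. (\<forall>i l. i \<noteq> l \<longrightarrow> ip S (e i) (e l) = 0) \<and> (\<forall>i. ip S (e i) (e i) = 0 \<and> (\<forall>k\<in>S. e i k = 0) \<or> ip S (e i) (e i) = 1) \<and>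
     (\<forall>y. (\<exists>c. \<forall>k\<in>S. y k = (\<Sum>b\<in>J. c b * w b k)) \<longrightarrow> (\<forall>k\<in>S. y k = (\<Sum>i<card J. ip S y (e i) * e i k))) \<and>
     (\<forall>i\<ge>card J. e i = (\<lambda>_. 0))"
  using J
proof (induction J rule: finite_induct)
  case empty
  show ?case by (rule exI[of _ "\<lambda>_ _. 0"]) (auto simp: ip_def)
next
  case (insert b J)
  let ?n = "card J"
  from insert.IH obtain e where orth: "\<And>i l. i \<noteq> l \<Longrightarrow> ip S (e i) (e l) = 0"
    and unit: "\<And>i. ip S (e i) (e i) = 0 \<and> (\<forall>k\<in>S. e i k = 0) \<or> ip S (e i) (e i) = 1"
    and rep: "\<And>y c. (\<forall>k\<in>S. y k = (\<Sum>b\<in>J. c b * w b k)) \<Longrightarrow> (\<forall>k\<in>S. y k = (\<Sum>i<?n. ip S y (e i) * e i k))"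
    and zero: "\<And>i. i \<ge> ?n \<Longrightarrow> e i = (\<lambda>_. 0)" by blast
  define r where "r k = w b k - (\<Sum>i<?n. ip S (w b) (e i) * e i k)" for k
  have r_alt: "r = (\<lambda>k. 1 * w b k + (-1) * (\<Sum>i<?n. ip S (w b) (e i) * e i k))" by (simp add: r_def fun_eq_iff)
  have r_orth: "ip S r (e l) = 0" if l: "l < ?n" for l
  proof -
    have "ip S r (e l) = ip S (w b) (e l) - (\<Sum>i<?n. ip S (w b) (e i) * ip S (e i) (e l))"
      unfolding r_alt ip_linear ip_sum by simp
    also have "(\<Sum>i<?n. ip S (w b) (e i) * ip S (e i) (e l)) = (\<Sum>i<?n. if i = l then ip S (w b) (e l) * ip S (e l) (e l) else 0)"
      by (intro sum.cong refl) (auto simp: orth)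
    also have "\<dots> = ip S (w b) (e l) * ip S (e l) (e l)" using l by simp
    also have "\<dots> = ip S (w b) (e l)"
    proof -
      have "ip S (w b) (e l) = 0" if "\<forall>k\<in>S. e l k = 0" using that by (simp add: ip_def)
      then show ?thesis using unit[of l] by auto
    qed
    finally show ?thesis by simp
  qed
  define \<nu> where "\<nu> = (\<Sum>k\<in>S. (norm (r k))\<^sup>2)"
  have nu0: "\<nu> \<ge> 0" by (auto simp: \<nu>_def sum_nonneg)
  define en where "en = (if \<nu> = 0 then (\<lambda>_. 0) else (\<lambda>k. of_real (1 / sqrt \<nu>) * r k))"
  have ip_en: "ip S y en = (if \<nu> = 0 then 0 else of_real (1 / sqrt \<nu>) * ip S y r)" for y
    by (auto simp: en_def ip_def sum_distrib_left algebra_simps)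
  have rr: "ip S r r = of_real \<nu>" by (simp add: ip_self \<nu>_def)
  \<comment> \<open>The index \<open>card J\<close> is free, since the members from there on are
    0.\<close>
  define e' where "e' = e(?n := en)"
  have en_orth: "ip S (e l) en = 0" if "l \<noteq> ?n" for l
  proof (cases "l < ?n")
    case True
    then have "ip S (e l) r = 0" using r_orth[OF True] ip_cnj[of S r "e l"] by simp
    then show ?thesis by (simp add: ip_en)
  next
    case False
    then show ?thesis using zero[of l] that by (simp add: ip_def)
  qed
  have en_orth': "ip S en (e l) = 0" if "l \<noteq> ?n" for l
    using en_orth[OF that] ip_cnj[of S "e l" en] by simp
  have en_unit: "ip S en en = 0 \<and> (\<forall>k\<in>S. en k = 0) \<or> ip S en en = 1"
  proof (cases "\<nu> = 0")
    case False
    have "ip S en r = of_real (1 / sqrt \<nu>) * ip S r r"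
      using False by (simp add: en_def ip_def sum_divide_distrib)
    then have "ip S en en = of_real (1 / sqrt \<nu>) * (of_real (1 / sqrt \<nu>) * ip S r r)"
      using False by (simp add: ip_en)
    also have "\<dots> = of_real (1 / sqrt \<nu> * (1 / sqrt \<nu> * \<nu>))" unfolding rr by (simp only: of_real_mult)
    also have "1 / sqrt \<nu> * (1 / sqrt \<nu> * \<nu>) = 1" using False nu0 by (simp add: field_simps)
    finally show ?thesis by simp
  qed (simp add: en_def ip_def)
  have ip_e': "(\<Sum>i<card (insert b J). ip S y (e' i) * e' i k) = (\<Sum>i<?n. ip S y (e i) * e i k) + ip S y en * en k" for y k
    using insert(1,2) by (simp add: e'_def)
  have repJ: "(\<Sum>i<card (insert b J). ip S y (e' i) * e' i k) = y k"
    if y: "\<forall>k\<in>S. y k = (\<Sum>b\<in>J. c b * w b k)" and k: "k \<in> S" for y c k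
  proof -
    have yr: "\<forall>k\<in>S. y k = (\<Sum>i<?n. ip S y (e i) * e i k)" by (rule rep[OF y])
    have "ip S y r = ip S (\<lambda>k. \<Sum>i<?n. ip S y (e i) * e i k) r" using yr by (intro ip_cong) auto
    also have "\<dots> = (\<Sum>i<?n. ip S y (e i) * ip S (e i) r)" by (rule ip_sum)
    also have "\<dots> = 0" using r_orth ip_cnj[of S r] by (intro sum.neutral) (metis complex_cnj_zero lessThan_iff mult_zero_right)
    finally show ?thesis unfolding ip_e' using yr k by (simp add: ip_en)
  qed
  have repb: "(\<Sum>i<card (insert b J). ip S (w b) (e' i) * e' i k) = w b k" if k: "k \<in> S" for k
  proof -
    have "w b = (\<lambda>k. 1 * r k + 1 * (\<Sum>i<?n. ip S (w b) (e i) * e i k))" by (simp add: r_def fun_eq_iff)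
    then have "ip S (w b) r = ip S (\<lambda>k. 1 * r k + 1 * (\<Sum>i<?n. ip S (w b) (e i) * e i k)) r" by (rule arg_cong)
    also have "\<dots> = ip S r r + (\<Sum>i<?n. ip S (w b) (e i) * ip S (e i) r)" unfolding ip_linear ip_sum by simp
    also have "(\<Sum>i<?n. ip S (w b) (e i) * ip S (e i) r) = 0"
      using r_orth ip_cnj[of S r] by (intro sum.neutral) (metis complex_cnj_zero lessThan_iff mult_zero_right)
    finally have wr: "ip S (w b) r = of_real \<nu>" using rr by simp
    have "ip S (w b) en * en k = r k"
    proof (cases "\<nu> = 0")
      case True
      then have "r k = 0" using k S unfolding \<nu>_def by (subst (asm) sum_nonneg_eq_0_iff) auto
      then show ?thesis using True by (simp add: en_def)
    next
      case False
      have "ip S (w b) en * en k = of_real (1 / sqrt \<nu> * \<nu> * (1 / sqrt \<nu>)) * r k"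
      proof -
        have "ip S (w b) en = of_real (1 / sqrt \<nu>) * of_real \<nu>" using False by (simp only: ip_en wr if_False)
        moreover have "en k = of_real (1 / sqrt \<nu>) * r k" using False by (simp only: en_def if_False)
        ultimately show ?thesis by (simp only: of_real_mult mult_ac)
      qed
      also have "1 / sqrt \<nu> * \<nu> * (1 / sqrt \<nu>) = 1" using False nu0 by (simp add: field_simps)
      finally show ?thesis by simp
    qed
    then show ?thesis unfolding ip_e' by (simp add: r_def)
  qed
  show ?case
  proof (intro exI[of _ e'] conjI allI impI)
    show "ip S (e' i) (e' l) = 0" if "i \<noteq> l" for i l
      using that orth en_orth en_orth' by (auto simp: e'_def)
    show "ip S (e' i) (e' i) = 0 \<and> (\<forall>k\<in>S. e' i k = 0) \<or> ip S (e' i) (e' i) = 1" for i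
      using unit en_unit by (auto simp: e'_def)
    show "e' i = (\<lambda>_. 0)" if "i \<ge> card (insert b J)" for i
      using that zero[of i] insert(1,2) by (auto simp: e'_def)
    fix y assume "\<exists>c. \<forall>k\<in>S. y k = (\<Sum>b\<in>insert b J. c b * w b k)"
    then obtain c where c: "\<forall>k\<in>S. y k = (\<Sum>b\<in>insert b J. c b * w b k)" by blast
    define y' where "y' k = (\<Sum>b\<in>J. c b * w b k)" for k
    have yy: "y k = c b * w b k + 1 * y' k" if "k \<in> S" for k using c that insert(1,2) by (simp add: y'_def)
    have ipy: "ip S y v = c b * ip S (w b) v + ip S y' v" for v
    proof -
      have "ip S y v = ip S (\<lambda>k. c b * w b k + 1 * y' k) v" using yy by (intro ip_cong) auto
      then show ?thesis unfolding ip_linear by simp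
    qed
    show "\<forall>k\<in>S. y k = (\<Sum>i<card (insert b J). ip S y (e' i) * e' i k)"
    proof
      fix k assume k: "k \<in> S"
      have "(\<Sum>i<card (insert b J). ip S y (e' i) * e' i k)
        = c b * (\<Sum>i<card (insert b J). ip S (w b) (e' i) * e' i k) + (\<Sum>i<card (insert b J). ip S y' (e' i) * e' i k)"
        unfolding ipy by (simp add: distrib_right sum.distrib sum_distrib_left mult.assoc)
      also have "\<dots> = y k" using repb[OF k] repJ[of y' c k] k yy[OF k] by (simp add: y'_def)
      finally show "y k = (\<Sum>i<card (insert b J). ip S y (e' i) * e' i k)" by simp
    qed
  qed
qed

text \<open>Cauchy-Schwarz within the span: only the projection of \<open>x\<close> onto the span
  enters, and its squared norm is the sum over \<open>i\<close>. The lower bounds integrate this sum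
  over shifts of \<open>x\<close>, after which only the norms of the \<open>e i\<close>
  remain.\<close>

lemma projection_family:
  fixes w :: "'b \<Rightarrow> 'k \<Rightarrow> complex"
  assumes S: "finite S" and J: "finite J"
  shows "\<exists>e. (\<forall>i. (\<Sum>k\<in>S. (norm (e i k))\<^sup>2) \<le> 1) \<and>
     (\<forall>y x. (\<exists>c. \<forall>k\<in>S. y k = (\<Sum>b\<in>J. c b * w b k)) \<longrightarrow>
        (norm (ip S x y))\<^sup>2 \<le> (\<Sum>i<card J. (norm (ip S x (e i)))\<^sup>2) * (\<Sum>k\<in>S. (norm (y k))\<^sup>2))"
proof -
  obtain e where unit: "\<And>i. ip S (e i) (e i) = 0 \<and> (\<forall>k\<in>S. e i k = 0) \<or> ip S (e i) (e i) = 1"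
    and rep: "\<And>y. (\<exists>c. \<forall>k\<in>S. y k = (\<Sum>b\<in>J. c b * w b k)) \<Longrightarrow> (\<forall>k\<in>S. y k = (\<Sum>i<card J. ip S y (e i) * e i k))"
    using orthonormal_family[OF S J, of w] by blast
  have "(\<Sum>k\<in>S. (norm (e i k))\<^sup>2) \<le> 1" for i
  proof -
    have "complex_of_real (\<Sum>k\<in>S. (norm (e i k))\<^sup>2) \<in> {of_real 0, of_real 1}" using unit[of i] unfolding ip_self by auto
    then have "(\<Sum>k\<in>S. (norm (e i k))\<^sup>2) \<in> {0, 1}" unfolding insert_iff of_real_eq_iff by auto
    then show ?thesis by auto
  qed
  moreover have "(norm (ip S x y))\<^sup>2 \<le> (\<Sum>i<card J. (norm (ip S x (e i)))\<^sup>2) * (\<Sum>k\<in>S. (norm (y k))\<^sup>2)"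
    if "\<exists>c. \<forall>k\<in>S. y k = (\<Sum>b\<in>J. c b * w b k)" for x y
  proof -
    have y: "\<forall>k\<in>S. y k = (\<Sum>i<card J. ip S y (e i) * e i k)" by (rule rep[OF that])
    have e1: "ip S z y = (\<Sum>i<card J. cnj (ip S y (e i)) * ip S z (e i))" for z
    proof -
      have "ip S z y = ip S z (\<lambda>k. \<Sum>i<card J. ip S y (e i) * e i k)" using y by (intro ip_cong) auto
      then show ?thesis unfolding ip_sum_right .
    qed
    have "complex_of_real (\<Sum>k\<in>S. (norm (y k))\<^sup>2) = ip S y y" by (rule ip_self[symmetric])
    also have "\<dots> = (\<Sum>i<card J. cnj (ip S y (e i)) * ip S y (e i))" by (rule e1)
    also have "\<dots> = of_real (\<Sum>i<card J. (norm (ip S y (e i)))\<^sup>2)"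
      by (simp add: complex_norm_square mult.commute del: of_real_power)
    finally have yy: "(\<Sum>k\<in>S. (norm (y k))\<^sup>2) = (\<Sum>i<card J. (norm (ip S y (e i)))\<^sup>2)" unfolding of_real_eq_iff .
    have "norm (ip S x y) \<le> (\<Sum>i<card J. norm (ip S y (e i)) * norm (ip S x (e i)))"
      unfolding e1[of x] by (rule order_trans[OF norm_sum]) (simp add: norm_mult)
    also have "\<dots> \<le> L2_set (\<lambda>i. norm (ip S y (e i))) {..<card J} * L2_set (\<lambda>i. norm (ip S x (e i))) {..<card J}"
      using L2_set_mult_ineq[of "\<lambda>i. norm (ip S y (e i))" "\<lambda>i. norm (ip S x (e i))" "{..<card J}"] by simp
    finally have "(norm (ip S x y))\<^sup>2 \<le> (L2_set (\<lambda>i. norm (ip S y (e i))) {..<card J} * L2_set (\<lambda>i. norm (ip S x (e i))) {..<card J})\<^sup>2"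
      by (intro power_mono) auto
    then show ?thesis unfolding yy by (simp add: L2_set_def power_mult_distrib sum_nonneg mult.commute)
  qed
  ultimately show ?thesis by blast
qed

section \<open>Lower bounds\<close>

definition levelset :: "nat \<Rightarrow> (nat ^ 'd) set" where
  "levelset j = {a. level a = j}"

lemma component_le_level: "m $ i \<le> level (m :: nat ^ 'd)"
  unfolding level_def by (rule member_le_sum) auto

lemma finite_levelset [simp]: "finite (levelset j :: (nat ^ 'd) set)"
proof (rule finite_subset)
  show "levelset j \<subseteq> {a :: nat ^ 'd. \<forall>i. a $ i \<in> {..j}}"
    using component_le_level by (auto simp: levelset_def)
  show "finite {a :: nat ^ 'd. \<forall>i. a $ i \<in> {..j}}" by (rule finite_vec_set) simp
qed

lemma level_remove: "level (a :: nat ^ 'd) = a $ i0 + (\<Sum>i\<in>UNIV - {i0}. a $ i)"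
  unfolding level_def by (simp add: sum.remove)

text \<open>Given the level, the coordinate \<open>i0\<close> is determined by the others, and these
  are at most j.\<close>

lemma card_levelset_le: "card (levelset j :: (nat ^ 'd) set) \<le> (j + 1) ^ (CARD('d) - 1)"
proof -
  define i0 :: 'd where "i0 = undefined"
  let ?f = "\<lambda>a :: nat ^ 'd. restrict (vec_nth a) (UNIV - {i0})"
  let ?P = "PiE (UNIV - {i0}) (\<lambda>_. {..j})"
  have inj: "inj_on ?f (levelset j)"
  proof (rule inj_onI)
    fix a b :: "nat ^ 'd" assume ab: "a \<in> levelset j" "b \<in> levelset j" and eq: "?f a = ?f b"
    have off: "a $ i = b $ i" if "i \<noteq> i0" for i using fun_cong[OF eq, of i] that by simp
    then have "(\<Sum>i\<in>UNIV - {i0}. a $ i) = (\<Sum>i\<in>UNIV - {i0}. b $ i)" by (intro sum.cong) auto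
    then have "a $ i0 = b $ i0" using ab level_remove[of a i0] level_remove[of b i0] by (simp add: levelset_def)
    then show "a = b" using off by (metis vec_eq_iff)
  qed
  have "card (levelset j :: (nat ^ 'd) set) \<le> card ?P"
  proof (rule card_inj_on_le[OF inj])
    show "?f ` levelset j \<subseteq> ?P"
      by (intro image_subsetI restrict_PiE_iff[THEN iffD2]) (auto simp: levelset_def intro: component_le_level)
    show "finite ?P" by (intro finite_PiE) auto
  qed
  also have "\<dots> = (j + 1) ^ (CARD('d) - 1)" by (subst card_PiE) (auto simp: card_Diff_singleton)
  finally show ?thesis .
qed

text \<open>All coordinates but \<open>i0\<close> may run freely up to j div d, where d is the
  dimension; \<open>i0\<close> makes up the rest of the level.\<close>

lemma card_levelset_ge:
  "((real j + 1) / real CARD('d)) ^ (CARD('d) - 1) \<le> real (card (levelset j :: (nat ^ 'd) set))"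
proof -
  define i0 :: 'd where "i0 = undefined"
  let ?h = "j div CARD('d)"
  let ?P = "PiE (UNIV - {i0}) (\<lambda>_. {..?h})"
  let ?f = "\<lambda>g. \<chi> i. if i = i0 then j - (\<Sum>i\<in>UNIV - {i0}. g i) else g i"
  have d: "CARD('d) > 0" by simp
  have sum_le: "(\<Sum>i\<in>UNIV - {i0}. g i) \<le> j" if "g \<in> ?P" for g
  proof -
    have "(\<Sum>i\<in>UNIV - {i0}. g i) \<le> (\<Sum>i\<in>UNIV - {i0}. ?h)" using that by (intro sum_mono) auto
    also have "\<dots> \<le> CARD('d) * ?h" by (simp add: card_Diff_singleton)
    also have "\<dots> \<le> j" by simp
    finally show ?thesis .
  qed
  have "card ?P \<le> card (levelset j :: (nat ^ 'd) set)"
  proof (rule card_inj_on_le[of ?f])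
    show "inj_on ?f ?P"
    proof (rule inj_onI)
      fix g g' assume g: "g \<in> ?P" "g' \<in> ?P" and eq: "?f g = ?f g'"
      show "g = g'"
      proof (rule PiE_ext[OF g])
        fix i assume "i \<in> UNIV - {i0}"
        then show "g i = g' i" using arg_cong[OF eq, of "\<lambda>v. v $ i"] by simp
      qed
    qed
    show "?f ` ?P \<subseteq> levelset j"
    proof
      fix a assume "a \<in> ?f ` ?P"
      then obtain g where g: "g \<in> ?P" and a: "a = ?f g" by auto
      have "(\<Sum>i\<in>UNIV - {i0}. a $ i) = (\<Sum>i\<in>UNIV - {i0}. g i)" unfolding a by (intro sum.cong) auto
      then have "level a = j" using sum_le[OF g] by (subst level_remove[of a i0]) (simp add: a)
      then show "a \<in> levelset j" by (simp add: levelset_def)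
    qed
  qed simp
  moreover have "card ?P = (?h + 1) ^ (CARD('d) - 1)" by (subst card_PiE) (auto simp: card_Diff_singleton)
  moreover have "(real j + 1) / real CARD('d) \<le> real (?h + 1)"
  proof -
    have "j < CARD('d) * (?h + 1)" using dividend_less_times_div[OF d, of j] by simp
    then have "j + 1 \<le> CARD('d) * (?h + 1)" by simp
    then have "real (j + 1) \<le> real (CARD('d) * (?h + 1))" by (simp only: of_nat_le_iff)
    then show ?thesis by (simp add: field_simps)
  qed
  then have "((real j + 1) / real CARD('d)) ^ (CARD('d) - 1) \<le> real (?h + 1) ^ (CARD('d) - 1)"
    by (intro power_mono) auto
  ultimately show ?thesis by (smt (verit) of_nat_le_iff of_nat_power)
qed

lemma levelset_nonempty: "card (levelset j :: (nat ^ 'd) set) \<ge> 1"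
proof -
  have "0 < ((real j + 1) / real CARD('d)) ^ (CARD('d) - 1)" by simp
  then have "0 < real (card (levelset j :: (nat ^ 'd) set))" using card_levelset_ge[where 'd = 'd, of j] by linarith
  then show ?thesis by simp
qed

text \<open>Hoelder's inequality up to the factor 2. The normalisation \<open>t\<close> is the size
  of each term when D powr \<sigma> is shared equally among K of them.\<close>

lemma sum_squares_le_powr:
  fixes b :: "'i \<Rightarrow> real"
  assumes F: "finite F" and s: "\<sigma> \<ge> 2" and b: "\<And>i. i \<in> F \<Longrightarrow> b i \<ge> 0" and D: "D > 0"
    and sum: "(\<Sum>i\<in>F. b i powr \<sigma>) \<le> D powr \<sigma>" and K: "real (card F) \<le> K" "K > 0"
  shows "(\<Sum>i\<in>F. (b i)\<^sup>2) \<le> 2 * D\<^sup>2 * K powr (1 - 2/\<sigma>)"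
proof -
  define t where "t = D * K powr (-1/\<sigma>)"
  have t: "t > 0" using D K by (simp add: t_def)
  have tp: "t powr \<sigma> = D powr \<sigma> / K" 
  proof -
    have "(K powr (-1/\<sigma>)) powr \<sigma> = K powr (-1)" unfolding powr_powr using s by simp
    also have "\<dots> = 1 / K" using K by (simp add: powr_minus_divide)
    finally show ?thesis using D K by (simp add: t_def powr_mult)
  qed
  have t2: "t\<^sup>2 = D\<^sup>2 * K powr (-2/\<sigma>)"
    using K by (simp add: t_def power_mult_distrib power2_eq_square[of "K powr _"] powr_add[symmetric])
  have "(b i)\<^sup>2 \<le> t\<^sup>2 * (1 + (b i powr \<sigma>) / t powr \<sigma>)" if "i \<in> F" for i
  proof -
    have "(b i / t) powr 2 \<le> 1 + (b i / t) powr \<sigma>" using b[OF that] t s by (intro powr_le_one_plus) auto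
    then have "(b i / t)\<^sup>2 \<le> 1 + (b i / t) powr \<sigma>" using b[OF that] t by simp
    then have "(b i / t)\<^sup>2 \<le> 1 + b i powr \<sigma> / t powr \<sigma>" using b[OF that] t by (simp add: powr_divide)
    then show ?thesis using t by (simp add: power_divide divide_le_eq mult.commute)
  qed
  then have "(\<Sum>i\<in>F. (b i)\<^sup>2) \<le> (\<Sum>i\<in>F. t\<^sup>2 * (1 + (b i powr \<sigma>) / t powr \<sigma>))" by (rule sum_mono)
  also have "\<dots> = t\<^sup>2 * (real (card F) + (\<Sum>i\<in>F. b i powr \<sigma>) / t powr \<sigma>)"
    by (simp add: sum_distrib_left[symmetric] sum.distrib sum_divide_distrib)
  also have "\<dots> \<le> t\<^sup>2 * (K + D powr \<sigma> / t powr \<sigma>)"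
    using sum K(1) by (intro mult_left_mono add_mono divide_right_mono) auto
  also have "D powr \<sigma> / t powr \<sigma> = K" using D K tp by simp
  also have "t\<^sup>2 * (K + K) = 2 * D\<^sup>2 * (K powr (-2/\<sigma>) * K powr 1)" using K by (simp add: t2)
  also have "K powr (-2/\<sigma>) * K powr 1 = K powr (1 - 2/\<sigma>)" by (subst powr_add[symmetric]) simp
  finally show ?thesis .
qed

lemma span_fun_scale:
  assumes "finite B" "y \<in> module.span fun_scale B"
  shows "\<exists>c. y = (\<lambda>x. \<Sum>b\<in>B. c b * b x)"
proof -
  interpret vector_space fun_scale by (rule vector_space_fun_scale)
  obtain c where "y = (\<Sum>b\<in>B. fun_scale (c b) b)" using assms by (auto simp: span_finite)
  moreover have "(\<Sum>b\<in>B. fun_scale (c b) b) x = (\<Sum>b\<in>B. c b * b x)" for x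
    using assms(1) by (induction B rule: finite_induct) (auto simp: fun_scale_def)
  ultimately show ?thesis by auto
qed

section \<open>Width bounds from test functions\<close>

context cutoff
begin

text \<open>\<open>la\<close> is the amplitude that puts the function into the set to be
  approximated, and \<open>u\<close> is the shift over which the lower bounds average.\<close>

definition test :: "real \<Rightarrow> (nat ^ 'd) set \<Rightarrow> real ^ 'd \<Rightarrow> real ^ 'd \<Rightarrow> complex" where
  "test la A u = (\<lambda>x. \<Sum>a\<in>A. of_real la * trig (freqs a) (rs_coeff a) (x + u))"

definition testc :: "real \<Rightarrow> real ^ 'd \<Rightarrow> nat ^ 'd \<Rightarrow> int ^ 'd \<Rightarrow> complex" where
  "testc la u a k = of_real la * rs_coeff a k * cis (real_vec k \<bullet> u)"

lemma continuous_test: "continuous_on UNIV (test la A u)"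
  unfolding test_def by (intro continuous_intros continuous_on_compose2[OF continuous_trig]) auto

lemma fourier_coeff_sum:
  assumes "finite B" "\<And>b. b \<in> B \<Longrightarrow> integrable torus_measure (f b :: real ^ 'd \<Rightarrow> complex)"
  shows "fourier_coeff (\<lambda>x. \<Sum>b\<in>B. c b * f b x) k = (\<Sum>b\<in>B. c b * fourier_coeff (f b) k)"
  using assms
proof (induction B rule: finite_induct)
  case empty
  then show ?case by (simp add: fourier_coeff_def)
next
  case (insert b B)
  have i: "integrable torus_measure (\<lambda>x. \<Sum>b\<in>B. c b * f b x)" using insert by auto
  have "fourier_coeff (\<lambda>x. \<Sum>b\<in>insert b B. c b * f b x) k = fourier_coeff (\<lambda>x. c b * f b x + 1 * (\<Sum>b\<in>B. c b * f b x)) k"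
    using insert by simp
  then show ?case using insert fourier_coeff_linear[OF _ i, of "f b" "c b" 1 k] by simp
qed

lemma fourier_coeff_test:
  fixes A :: "(nat ^ 'd) set"
  assumes A: "finite A" and k: "k \<in> freqs a"
  shows "fourier_coeff (test la A u) k = (if a \<in> A then testc la u a k else 0)"
proof -
  have "test la A u = (\<lambda>x. \<Sum>b\<in>A. 1 * trig (freqs b) (testc la u b) x)"
    unfolding test_def testc_def
    by (simp add: fun_eq_iff trig_def inner_add_right cis_mult[symmetric] sum_distrib_left mult_ac)
  then have "fourier_coeff (test la A u) k = (\<Sum>b\<in>A. 1 * fourier_coeff (trig (freqs b) (testc la u b)) k)"
    by (simp only:) (rule fourier_coeff_sum[OF A], rule continuous_integrable_torus, rule continuous_trig)
  also have "\<dots> = (\<Sum>b\<in>A. if b = a then testc la u a k else 0)"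
    using k freqs_disjoint by (intro sum.cong refl) (auto simp: fourier_coeff_trig)
  finally show ?thesis using A by simp
qed

text \<open>The Besov bound is read twice: every single term of the l_\<sigma> sum is bounded, and
  over all blocks of \<open>A\<close> the passage from l_\<sigma> to l_2 costs a power of card A.
  \<open>\<delta>\<close> removes the weight of the level of \<open>up a\<close> and includes the
  constant for passing from L_q to the coefficients.\<close>

lemma approx_coefficients:
  fixes A :: "(nat ^ 'd) set" and f y :: "real ^ 'd \<Rightarrow> complex"
  assumes A: "finite A" "A \<noteq> {}" "\<And>a. a \<in> A \<Longrightarrow> level a = j" and q: "q \<ge> 2" and s: "\<sigma> \<ge> 2" and D: "D > 0"
    and f: "integrable torus_measure f" and y: "integrable torus_measure y"
    and N: "bnorm l q \<sigma> (f - y) \<le> ennreal D"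
  defines "\<delta> \<equiv> ((2*pi) ^ CARD('d) + 1) * 2 powr (- (l * real (j + 2 * CARD('d)))) * D"
  shows "\<And>a. a \<in> A \<Longrightarrow> (\<Sum>k\<in>freqs a. (norm (fourier_coeff f k - fourier_coeff y k))\<^sup>2) \<le> \<delta>\<^sup>2"
    and "(\<Sum>k\<in>(\<Union>a\<in>A. freqs a). (norm (fourier_coeff f k - fourier_coeff y k))\<^sup>2)
      \<le> 2 * real (card A) powr (1 - 2/\<sigma>) * \<delta>\<^sup>2"
proof -
  let ?C = "(2*pi) ^ CARD('d) + 1"
  let ?w = "2 powr (- (l * real (j + 2 * CARD('d))))"
  have fy: "f - y = (\<lambda>x. 1 * f x + (-1) * y x)" by (simp add: fun_eq_iff)
  have fc: "fourier_coeff (f - y) k = fourier_coeff f k - fourier_coeff y k" for k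
    unfolding fy fourier_coeff_linear[OF f y] by simp
  have bl: "\<And>F. finite F \<Longrightarrow> (\<Sum>m\<in>F. bl l q m (f - y) powr \<sigma>) \<le> D powr \<sigma>"
    using N D q s by (subst (asm) besov_norm_le_iff) auto
  have C0: "?C \<ge> 0" by (simp add: add_nonneg_nonneg)
  have one: "(\<Sum>k\<in>freqs a. (norm (fourier_coeff f k - fourier_coeff y k))\<^sup>2) \<le> (?C * (?w * bl l q (up a) (f - y)))\<^sup>2"
    if a: "a \<in> A" for a
  proof -
    have "?w * bl l q (up a) (f - y) = (?w * 2 powr (l * real (level (up a)))) * Lnorm q (Delta \<eta>0 (up a) (f - y))"
      unfolding bl_def by simp
    also have "?w * 2 powr (l * real (level (up a))) = 1"
      by (subst powr_add[symmetric]) (simp add: level_up A(3)[OF a])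
    finally have e: "?w * bl l q (up a) (f - y) = Lnorm q (Delta \<eta>0 (up a) (f - y))" by (simp only: mult_1)
    show ?thesis unfolding e using fourier_le_Lnorm[OF q, where a = a and f = "f - y"] unfolding fc .
  qed
  {
    fix a assume a: "a \<in> A"
    have "bl l q (up a) (f - y) powr \<sigma> \<le> D powr \<sigma>" using bl[of "{up a}"] by simp
    then have "bl l q (up a) (f - y) \<le> D"
      using powr_less_mono2[of \<sigma> D "bl l q (up a) (f - y)"] D s by linarith
    then have "?C * (?w * bl l q (up a) (f - y)) \<le> ?C * (?w * D)" using C0 by (intro mult_left_mono) auto
    then have "(?C * (?w * bl l q (up a) (f - y)))\<^sup>2 \<le> \<delta>\<^sup>2"
      using C0 unfolding \<delta>_def mult.assoc by (intro power_mono mult_nonneg_nonneg) auto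
    then show "(\<Sum>k\<in>freqs a. (norm (fourier_coeff f k - fourier_coeff y k))\<^sup>2) \<le> \<delta>\<^sup>2" using one[OF a] by linarith
  }
  have K: "real (card A) > 0" using A by (simp add: card_gt_0_iff)
  have "(\<Sum>k\<in>(\<Union>a\<in>A. freqs a). (norm (fourier_coeff f k - fourier_coeff y k))\<^sup>2)
     = (\<Sum>a\<in>A. \<Sum>k\<in>freqs a. (norm (fourier_coeff f k - fourier_coeff y k))\<^sup>2)"
    by (rule sum.UNION_disjoint) (use A freqs_disjoint in auto)
  also have "\<dots> \<le> (\<Sum>a\<in>A. (?C * (?w * bl l q (up a) (f - y)))\<^sup>2)" by (intro sum_mono one)
  also have "\<dots> = (?C * ?w)\<^sup>2 * (\<Sum>a\<in>A. (bl l q (up a) (f - y))\<^sup>2)"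
    by (simp add: sum_distrib_left power_mult_distrib mult.assoc)
  also have "\<dots> \<le> (?C * ?w)\<^sup>2 * (2 * D\<^sup>2 * real (card A) powr (1 - 2/\<sigma>))"
  proof (intro mult_left_mono sum_squares_le_powr[OF A(1) s])
    have "(\<Sum>a\<in>A. bl l q (up a) (f - y) powr \<sigma>) = (\<Sum>m\<in>up ` A. bl l q m (f - y) powr \<sigma>)"
      by (subst sum.reindex) (auto intro: inj_on_subset[OF inj_up])
    then show "(\<Sum>a\<in>A. bl l q (up a) (f - y) powr \<sigma>) \<le> D powr \<sigma>" using bl[of "up ` A"] A by simp
  qed (use D K in auto)
  also have "\<dots> = 2 * real (card A) powr (1 - 2/\<sigma>) * \<delta>\<^sup>2"
    by (simp add: \<delta>_def power_mult_distrib)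
  finally show "(\<Sum>k\<in>(\<Union>a\<in>A. freqs a). (norm (fourier_coeff f k - fourier_coeff y k))\<^sup>2)
      \<le> 2 * real (card A) powr (1 - 2/\<sigma>) * \<delta>\<^sup>2" .
qed

text \<open>If the bound failed for some subspace, the strict inequality would produce an actual
  approximant of every \<open>x\<close>, written as a combination of the spanning set.\<close>

lemma besov_width_lowerI:
  fixes M :: "(real ^ 'd \<Rightarrow> complex) set"
  assumes q: "q \<ge> 1" and s: "\<sigma> > 0" and D: "D > 0"
    and step: "\<And>B. finite B \<Longrightarrow> card B \<le> n \<Longrightarrow> (\<And>b. b \<in> B \<Longrightarrow> integrable torus_measure b) \<Longrightarrow>
      (\<And>x. x \<in> M \<Longrightarrow> \<exists>c. bnorm l q \<sigma> (x - (\<lambda>t. \<Sum>b\<in>B. c b * b t)) \<le> ennreal D) \<Longrightarrow> False"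
  shows "ennreal D \<le> besov_width \<eta>0 (\<chi> i. l) (ennreal q) (ennreal \<sigma>) M n"
  unfolding besov_width_def kolmogorov_width_def
proof (rule INF_greatest, rule ccontr)
  interpret vector_space fun_scale by (rule vector_space_fun_scale)
  let ?N = "bnorm l q \<sigma>"
  fix L :: "(real ^ 'd \<Rightarrow> complex) set"
  assume L: "L \<in> {L. subspace L \<and> L \<subseteq> {y. ?N y < top} \<and> (\<exists>B. finite B \<and> card B \<le> n \<and> span B = L)}"
    and less: "\<not> ennreal D \<le> (SUP x\<in>M. INF y\<in>L. ?N (x - y))"
  obtain B where B: "finite B" "card B \<le> n" "span B = L" using L by auto
  have "integrable torus_measure b" if "b \<in> B" for b
  proof -
    have "b \<in> L" using that B(3) span_base by blast
    then have "?N b < top" using L by auto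
    then have "b \<in> torus_Lp (ennreal q)" by (auto simp: besov_norm_def split: if_splits)
    then show ?thesis using q by (rule torus_Lp_integrable)
  qed
  moreover have "\<exists>c. ?N (x - (\<lambda>t. \<Sum>b\<in>B. c b * b t)) \<le> ennreal D" if x: "x \<in> M" for x
  proof -
    have "(INF y\<in>L. ?N (x - y)) \<le> (SUP x\<in>M. INF y\<in>L. ?N (x - y))" by (rule SUP_upper[OF x])
    also have "\<dots> < ennreal D" using less by simp
    finally obtain y where y: "y \<in> L" "?N (x - y) < ennreal D" by (auto simp: INF_less_iff)
    then obtain c where "y = (\<lambda>t. \<Sum>b\<in>B. c b * b t)" using span_fun_scale[OF B(1), of y] B(3) by auto
    then show ?thesis using y by (auto intro: less_imp_le)
  qed
  ultimately show False using step[OF B(1,2)] by blast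
qed

text \<open>As all coefficients of a test polynomial have modulus \<open>la\<close>, averaging over
  the shift turns the squared inner product with \<open>e\<close> into the squared Euclidean norm of
  \<open>e\<close>.\<close>

lemma parseval_test:
  assumes "finite S"
  shows "(\<integral>u. (norm (ip S (testc la u a) (e :: int ^ 'd \<Rightarrow> complex)))\<^sup>2 \<partial>torus_measure)
      = (2*pi) ^ CARD('d) * (la\<^sup>2 * (\<Sum>k\<in>S. (norm (e k))\<^sup>2))"
    and "integrable torus_measure (\<lambda>u. (norm (ip S (testc la u a) e))\<^sup>2)"
proof -
  have e: "ip S (testc la u a) e = trig S (\<lambda>k. of_real la * rs_coeff a k * cnj (e k)) u" for u
    by (simp add: ip_def testc_def trig_def mult_ac)
  show "(\<integral>u. (norm (ip S (testc la u a) e))\<^sup>2 \<partial>torus_measure) = (2*pi) ^ CARD('d) * (la\<^sup>2 * (\<Sum>k\<in>S. (norm (e k))\<^sup>2))"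
    unfolding e parseval_trig[OF assms] by (simp add: norm_mult power_mult_distrib sum_distrib_left)
  show "integrable torus_measure (\<lambda>u. (norm (ip S (testc la u a) e))\<^sup>2)"
    unfolding e by (intro continuous_integrable_torus continuous_intros)
qed

text \<open>Single blocks: averaging the squared projections over all blocks and all shifts gives the
  dimension of the approximating space.\<close>

lemma width_ge_single_blocks:
  fixes M :: "(real ^ 'd \<Rightarrow> complex) set"
  assumes q: "q \<ge> 2" and s: "\<sigma> \<ge> 2" and la: "la > 0" and eps: "0 < \<epsilon>" "\<epsilon> \<le> 1/2"
    and M: "\<And>a u. a \<in> levelset j \<Longrightarrow> test la {a} u \<in> M"
  defines "K \<equiv> real (card (levelset j :: (nat ^ 'd) set))"
  assumes n: "4 * real n * (1 + 2 * K powr (1/2 - 1/\<sigma>) * \<epsilon>)\<^sup>2 < K * 2 ^ j"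
  shows "ennreal (\<epsilon> * la * sqrt (2 ^ j) * 2 powr (l * real (j + 2 * CARD('d))) / ((2*pi) ^ CARD('d) + 1))
     \<le> besov_width \<eta>0 (\<chi> i. l) (ennreal q) (ennreal \<sigma>) M n"
proof (rule besov_width_lowerI)
  let ?C = "(2*pi) ^ CARD('d) + 1 :: real"
  let ?D = "\<epsilon> * la * sqrt (2 ^ j) * 2 powr (l * real (j + 2 * CARD('d))) / ?C"
  let ?A = "levelset j :: (nat ^ 'd) set"
  \<comment> \<open>\<open>V\<close> is the Euclidean length of the coefficients of one test
    function, and V * Y will bound that of its approximant over all blocks.\<close>
  define Y where "Y = 1 + 2 * K powr (1/2 - 1/\<sigma>) * \<epsilon>"
  define V where "V = la * sqrt (2 ^ j)"
  have C0: "?C > 0" by (simp add: add_nonneg_pos)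
  have V: "V > 0" "V\<^sup>2 = la\<^sup>2 * 2 ^ j" using la by (simp_all add: V_def power_mult_distrib)
  have K: "K \<ge> 1" unfolding K_def using levelset_nonempty[where 'd = 'd, of j] by simp
  have Y: "Y \<ge> 1" using eps by (simp add: Y_def)
  show D: "?D > 0" using eps la C0 by simp
  fix B :: "(real ^ 'd \<Rightarrow> complex) set"
  assume B: "finite B" "card B \<le> n" and int: "\<And>b. b \<in> B \<Longrightarrow> integrable torus_measure b"
    and appr: "\<And>x. x \<in> M \<Longrightarrow> \<exists>c. bnorm l q \<sigma> (x - (\<lambda>t. \<Sum>b\<in>B. c b * b t)) \<le> ennreal ?D"
  define S where "S = (\<Union>a\<in>?A. freqs a)"
  have S: "finite S" by (auto simp: S_def)
  obtain e where e1: "\<And>i. (\<Sum>k\<in>S. (norm (e i k))\<^sup>2) \<le> 1"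
    and e2: "\<And>y x. (\<exists>c. \<forall>k\<in>S. y k = (\<Sum>b\<in>B. c b * fourier_coeff b k)) \<Longrightarrow>
        (norm (ip S x y))\<^sup>2 \<le> (\<Sum>i<card B. (norm (ip S x (e i)))\<^sup>2) * (\<Sum>k\<in>S. (norm (y k))\<^sup>2)"
    using projection_family[OF S B(1), of "\<lambda>b k. fourier_coeff b k"] by blast
  \<comment> \<open>In the block of \<open>x\<close> the approximant \<open>y\<close> is within
    \<epsilon> V of \<open>x\<close>, so their inner product is at least V^2/2 in modulus, while the
    whole of \<open>y\<close> has length at most V Y. Hence the projection of \<open>x\<close> onto
    the approximating space has length at least V / (2 Y).\<close>
  have point: "V\<^sup>2 \<le> 4 * Y\<^sup>2 * (\<Sum>i<card B. (norm (ip (freqs a) (testc la u a) (e i)))\<^sup>2)"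
    if a: "a \<in> ?A" for a u
  proof -
    let ?x = "test la {a} u"
    obtain c where c: "bnorm l q \<sigma> (?x - (\<lambda>t. \<Sum>b\<in>B. c b * b t)) \<le> ennreal ?D"
      using appr[OF M[OF a]] by blast
    let ?y = "\<lambda>t. \<Sum>b\<in>B. c b * b t"
    have iy: "integrable torus_measure ?y" using int by auto
    have ix: "integrable torus_measure ?x" by (rule continuous_integrable_torus[OF continuous_test])
    define X where "X = fourier_coeff ?x"
    define y where "y = fourier_coeff ?y"
    have y: "\<exists>c. \<forall>k\<in>S. y k = (\<Sum>b\<in>B. c b * fourier_coeff b k)"
      unfolding y_def by (intro exI[of _ c] ballI fourier_coeff_sum[OF B(1) int])
    have Xk: "X k = (if k \<in> freqs a then testc la u a k else 0)" if kS: "k \<in> S" for k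
    proof -
      obtain a' where a': "a' \<in> ?A" "k \<in> freqs a'" using kS by (auto simp: S_def)
      show ?thesis unfolding X_def using fourier_coeff_test[OF _ a'(2), of "{a}"] freqs_disjoint[of a a'] a'(2) by auto
    qed
    have ipX: "ip S X v = ip (freqs a) (testc la u a) v" for v
    proof -
      have "ip S X v = (\<Sum>k\<in>S. if k \<in> freqs a then testc la u a k * cnj (v k) else 0)"
        unfolding ip_def by (intro sum.cong refl) (simp add: Xk)
      also have "\<dots> = (\<Sum>k\<in>S \<inter> freqs a. testc la u a k * cnj (v k))" using S by (simp add: sum.inter_restrict)
      also have "S \<inter> freqs a = freqs a" using a by (auto simp: S_def)
      finally show ?thesis by (simp add: ip_def)
    qed
    have nt: "(\<Sum>k\<in>freqs a. (norm (testc la u a k))\<^sup>2) = V\<^sup>2"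
      using a la by (simp add: testc_def norm_mult card_freqs levelset_def V(2))
    have nX: "L2_set (\<lambda>k. norm (X k)) S = V"
    proof -
      have "(\<Sum>k\<in>S. (norm (X k))\<^sup>2) = (\<Sum>k\<in>S. if k \<in> freqs a then (norm (testc la u a k))\<^sup>2 else 0)"
        by (intro sum.cong refl) (simp add: Xk)
      also have "\<dots> = (\<Sum>k\<in>S \<inter> freqs a. (norm (testc la u a k))\<^sup>2)" using S by (simp add: sum.inter_restrict)
      also have "S \<inter> freqs a = freqs a" using a by (auto simp: S_def)
      finally show ?thesis using nt V(1) by (simp add: L2_set_def)
    qed
    define \<delta> where "\<delta> = ?C * 2 powr (- (l * real (j + 2 * CARD('d)))) * ?D"
    have delta: "\<delta> = \<epsilon> * V"
    proof -
      have "\<delta> = (2 powr (- (l * real (j + 2 * CARD('d)))) * 2 powr (l * real (j + 2 * CARD('d)))) * (\<epsilon> * V)"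
        using C0 by (simp add: \<delta>_def V_def)
      also have "2 powr (- (l * real (j + 2 * CARD('d)))) * 2 powr (l * real (j + 2 * CARD('d))) = (1::real)"
        by (subst powr_add[symmetric]) simp
      finally show ?thesis by simp
    qed
    have ne: "?A \<noteq> {}" using a by auto
    note ac = approx_coefficients[OF finite_levelset ne _ q s D ix iy c, of j]
    have z1: "(\<Sum>k\<in>freqs a. (norm (X k - y k))\<^sup>2) \<le> (\<epsilon> * V)\<^sup>2"
      unfolding X_def y_def delta[symmetric] \<delta>_def by (rule ac(1)) (use a in \<open>auto simp: levelset_def\<close>)
    have z2: "(\<Sum>k\<in>S. (norm (X k - y k))\<^sup>2) \<le> 2 * K powr (1 - 2/\<sigma>) * (\<epsilon> * V)\<^sup>2"
      unfolding X_def y_def delta[symmetric] \<delta>_def S_def K_def by (rule ac(2)) (auto simp: levelset_def)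
    have "norm (ip (freqs a) (testc la u a) (\<lambda>k. X k - y k)) \<le> V * (\<epsilon> * V)"
    proof -
      have "norm (ip (freqs a) (testc la u a) (\<lambda>k. X k - y k)) \<le> (\<Sum>k\<in>freqs a. norm (testc la u a k) * norm (X k - y k))"
        unfolding ip_def by (rule order_trans[OF norm_sum]) (simp add: norm_mult flip: complex_cnj_diff)
      also have "\<dots> \<le> L2_set (\<lambda>k. norm (testc la u a k)) (freqs a) * L2_set (\<lambda>k. norm (X k - y k)) (freqs a)"
        using L2_set_mult_ineq[of "\<lambda>k. norm (testc la u a k)" "\<lambda>k. norm (X k - y k)" "freqs a"] by simp
      also have "\<dots> \<le> V * (\<epsilon> * V)"
      proof (intro mult_mono)
        show "L2_set (\<lambda>k. norm (testc la u a k)) (freqs a) \<le> V" unfolding L2_set_def nt using V(1) by simp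
        show "L2_set (\<lambda>k. norm (X k - y k)) (freqs a) \<le> \<epsilon> * V"
          unfolding L2_set_def by (rule real_le_lsqrt) (use z1 eps V in \<open>auto intro: sum_nonneg\<close>)
      qed (use V in auto)
      finally show ?thesis .
    qed
    moreover have "V * (\<epsilon> * V) \<le> V\<^sup>2 / 2" 
      using mult_left_mono[OF eps(2), of "V\<^sup>2"] by (simp add: power2_eq_square mult_ac)
    moreover have "ip S X y = of_real (V\<^sup>2) - ip (freqs a) (testc la u a) (\<lambda>k. X k - y k)"
    proof -
      have "ip S X y = ip S X X - ip S X (\<lambda>k. X k - y k)" 
        unfolding ip_def sum_subtractf[symmetric] by (intro sum.cong refl) (simp add: algebra_simps)
      moreover have "ip S X X = of_real (V\<^sup>2)"
      proof -
        have "(\<Sum>k\<in>S. (norm (X k))\<^sup>2) = (L2_set (\<lambda>k. norm (X k)) S)\<^sup>2" by (simp add: L2_set_def sum_nonneg)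
        then show ?thesis unfolding ip_self nX by (simp only:)
      qed
      ultimately show ?thesis unfolding ipX by simp
    qed
    ultimately have big: "V\<^sup>2 / 2 \<le> norm (ip S X y)"
      using norm_triangle_ineq2[of "of_real (V\<^sup>2) :: complex" "ip (freqs a) (testc la u a) (\<lambda>k. X k - y k)"]
      by (simp add: norm_power)
    have ny: "L2_set (\<lambda>k. norm (y k)) S \<le> V * Y"
    proof -
      have "L2_set (\<lambda>k. norm (y k)) S \<le> L2_set (\<lambda>k. norm (X k) + norm (X k - y k)) S"
        by (rule L2_set_mono) (auto, metis norm_minus_commute norm_triangle_sub)
      also have "\<dots> \<le> V + L2_set (\<lambda>k. norm (X k - y k)) S"
        using L2_set_triangle_ineq[of "\<lambda>k. norm (X k)" "\<lambda>k. norm (X k - y k)" S] nX by simp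
      also have "L2_set (\<lambda>k. norm (X k - y k)) S \<le> 2 * K powr (1/2 - 1/\<sigma>) * (\<epsilon> * V)"
        unfolding L2_set_def
      proof (rule real_le_lsqrt)
        have "(K powr (1/2 - 1/\<sigma>))\<^sup>2 = K powr (1 - 2/\<sigma>)"
          using K by (simp add: power2_eq_square powr_add[symmetric])
        then have "(2 * K powr (1/2 - 1/\<sigma>) * (\<epsilon> * V))\<^sup>2 = 4 * K powr (1 - 2/\<sigma>) * (\<epsilon> * V)\<^sup>2"
          by (simp add: power_mult_distrib)
        moreover have "2 * K powr (1 - 2/\<sigma>) * (\<epsilon> * V)\<^sup>2 \<le> 4 * K powr (1 - 2/\<sigma>) * (\<epsilon> * V)\<^sup>2"
          by (intro mult_right_mono) auto
        ultimately show "(\<Sum>k\<in>S. (norm (X k - y k))\<^sup>2) \<le> (2 * K powr (1/2 - 1/\<sigma>) * (\<epsilon> * V))\<^sup>2" using z2 by linarith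
      qed (use eps V in \<open>auto intro: sum_nonneg\<close>)
      finally show ?thesis by (simp add: Y_def algebra_simps)
    qed
    have "(\<Sum>k\<in>S. (norm (y k))\<^sup>2) = (L2_set (\<lambda>k. norm (y k)) S)\<^sup>2" by (simp add: L2_set_def sum_nonneg)
    also have "\<dots> \<le> (V * Y)\<^sup>2" using ny by (intro power_mono) auto
    finally have ny2: "(\<Sum>k\<in>S. (norm (y k))\<^sup>2) \<le> (V * Y)\<^sup>2" .
    let ?T = "\<Sum>i<card B. (norm (ip (freqs a) (testc la u a) (e i)))\<^sup>2"
    have "(V\<^sup>2 / 2)\<^sup>2 \<le> (norm (ip S X y))\<^sup>2" using big by (intro power_mono) auto
    also have "\<dots> \<le> ?T * (\<Sum>k\<in>S. (norm (y k))\<^sup>2)" using e2[OF y, of X] unfolding ipX .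
    also have "\<dots> \<le> ?T * (V * Y)\<^sup>2" using ny2 by (intro mult_left_mono) (auto intro: sum_nonneg)
    finally have "V\<^sup>2 * V\<^sup>2 \<le> V\<^sup>2 * (4 * Y\<^sup>2 * ?T)" by (simp add: power_divide power_mult_distrib power2_eq_square mult_ac)
    then show ?thesis using V(1) by (subst (asm) mult_le_cancel_left_pos) auto
  qed
  let ?I = "(2*pi) ^ CARD('d) :: real"
  have I: "?I > 0" by simp
  have avg: "?I * V\<^sup>2 \<le> 4 * Y\<^sup>2 * (?I * (la\<^sup>2 * (\<Sum>i<card B. \<Sum>k\<in>freqs a. (norm (e i k))\<^sup>2)))" if a: "a \<in> ?A" for a
  proof -
    have "(\<integral>u. V\<^sup>2 \<partial>(torus_measure :: (real ^ 'd) measure))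
      \<le> (\<integral>u. 4 * Y\<^sup>2 * (\<Sum>i<card B. (norm (ip (freqs a) (testc la u a) (e i)))\<^sup>2) \<partial>torus_measure)"
      by (intro integral_mono point[OF a] integrable_mult_right Bochner_Integration.integrable_sum parseval_test(2))
         (auto intro!: continuous_integrable_torus continuous_intros)
    also have "\<dots> = 4 * Y\<^sup>2 * (\<Sum>i<card B. \<integral>u. (norm (ip (freqs a) (testc la u a) (e i)))\<^sup>2 \<partial>torus_measure)"
      by (subst integral_mult_right_zero, subst Bochner_Integration.integral_sum) (auto intro!: parseval_test(2))
    also have "\<dots> = 4 * Y\<^sup>2 * (?I * (la\<^sup>2 * (\<Sum>i<card B. \<Sum>k\<in>freqs a. (norm (e i k))\<^sup>2)))"
      by (subst parseval_test(1)) (auto simp: sum_distrib_left)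
    finally show ?thesis by (simp add: measure_torus)
  qed
  have "K * (?I * V\<^sup>2) = (\<Sum>a\<in>?A. ?I * V\<^sup>2)" by (simp add: K_def)
  also have "\<dots> \<le> (\<Sum>a\<in>?A. 4 * Y\<^sup>2 * (?I * (la\<^sup>2 * (\<Sum>i<card B. \<Sum>k\<in>freqs a. (norm (e i k))\<^sup>2))))"
    by (rule sum_mono) (rule avg)
  also have "\<dots> = 4 * Y\<^sup>2 * (?I * (la\<^sup>2 * (\<Sum>a\<in>?A. \<Sum>i<card B. \<Sum>k\<in>freqs a. (norm (e i k))\<^sup>2)))"
    by (simp add: sum_distrib_left)
  \<comment> \<open>The frequency sets are disjoint, so the sum over the blocks restores the full
    squared norm of each \<open>e i\<close>, which is at most 1.\<close>
  also have "(\<Sum>a\<in>?A. \<Sum>i<card B. \<Sum>k\<in>freqs a. (norm (e i k))\<^sup>2) = (\<Sum>i<card B. \<Sum>k\<in>S. (norm (e i k))\<^sup>2)"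
    unfolding S_def by (subst sum.swap) (intro sum.cong refl, subst sum.UNION_disjoint, use freqs_disjoint in auto)
  also have "4 * Y\<^sup>2 * (?I * (la\<^sup>2 * \<dots>)) \<le> 4 * Y\<^sup>2 * (?I * (la\<^sup>2 * real n))"
  proof -
    have "(\<Sum>i<card B. \<Sum>k\<in>S. (norm (e i k))\<^sup>2) \<le> real (card {..<card B}) * 1" by (rule sum_bounded_above) (rule e1)
    also have "\<dots> \<le> real n" using B by simp
    finally show ?thesis using I by (intro mult_left_mono) auto
  qed
  finally have "(?I * la\<^sup>2) * (K * 2 ^ j) \<le> (?I * la\<^sup>2) * (4 * real n * Y\<^sup>2)" by (simp add: V(2) mult_ac)
  then have "K * 2 ^ j \<le> 4 * real n * Y\<^sup>2" using I la by (subst (asm) mult_le_cancel_left_pos) auto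
  then show False using n by (simp add: Y_def)
qed (use q s in auto)

lemma width_ge_full_blocks:
  fixes M :: "(real ^ 'd \<Rightarrow> complex) set"
  assumes q: "q \<ge> 2" and s: "\<sigma> \<ge> 2" and la: "la > 0"
    and M: "\<And>u. test la (levelset j) u \<in> M"
  defines "K \<equiv> real (card (levelset j :: (nat ^ 'd) set))"
  assumes n: "2 * real n \<le> K * 2 ^ j"
  shows "ennreal (la * sqrt (2 ^ j) * K powr (1/\<sigma>) * 2 powr (l * real (j + 2 * CARD('d))) / (3 * ((2*pi) ^ CARD('d) + 1)))
     \<le> besov_width \<eta>0 (\<chi> i. l) (ennreal q) (ennreal \<sigma>) M n"
proof (rule besov_width_lowerI)
  let ?C = "(2*pi) ^ CARD('d) + 1 :: real"
  let ?D = "la * sqrt (2 ^ j) * K powr (1/\<sigma>) * 2 powr (l * real (j + 2 * CARD('d))) / (3 * ?C)"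
  let ?A = "levelset j :: (nat ^ 'd) set"
  define V where "V = la * sqrt (2 ^ j)"
  have C0: "?C > 0" by (simp add: add_nonneg_pos)
  have V: "V > 0" "V\<^sup>2 = la\<^sup>2 * 2 ^ j" using la by (simp_all add: V_def power_mult_distrib)
  have K: "K \<ge> 1" unfolding K_def using levelset_nonempty[where 'd = 'd, of j] by simp
  show D: "?D > 0" using la C0 K by simp
  fix B :: "(real ^ 'd \<Rightarrow> complex) set"
  assume B: "finite B" "card B \<le> n" and int: "\<And>b. b \<in> B \<Longrightarrow> integrable torus_measure b"
    and appr: "\<And>x. x \<in> M \<Longrightarrow> \<exists>c. bnorm l q \<sigma> (x - (\<lambda>t. \<Sum>b\<in>B. c b * b t)) \<le> ennreal ?D"
  define S where "S = (\<Union>a\<in>?A. freqs a)"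
  have S: "finite S" by (auto simp: S_def)
  have cardS: "real (card S) = K * 2 ^ j"
  proof -
    have "card S = (\<Sum>a\<in>?A. card (freqs a))"
      unfolding S_def by (rule card_UN_disjoint) (use freqs_disjoint in auto)
    also have "\<dots> = card ?A * 2 ^ j" by (simp add: card_freqs levelset_def)
    finally show ?thesis by (simp add: K_def)
  qed
  obtain e where e1: "\<And>i. (\<Sum>k\<in>S. (norm (e i k))\<^sup>2) \<le> 1"
    and e2: "\<And>y x. (\<exists>c. \<forall>k\<in>S. y k = (\<Sum>b\<in>B. c b * fourier_coeff b k)) \<Longrightarrow>
        (norm (ip S x y))\<^sup>2 \<le> (\<Sum>i<card B. (norm (ip S x (e i)))\<^sup>2) * (\<Sum>k\<in>S. (norm (y k))\<^sup>2)"
    using projection_family[OF S B(1), of "\<lambda>b k. fourier_coeff b k"] by blast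
  \<comment> \<open>The sets \<open>freqs a\<close> are disjoint, so the block of a frequency in
    \<open>S\<close> is unique and the description denotes it.\<close>
  define cc where "cc = (\<lambda>k. if k \<in> S then rs_coeff (THE a. a \<in> ?A \<and> k \<in> freqs a) k else 0)"
  have the: "(THE a. a \<in> ?A \<and> k \<in> freqs a) = a" if "a \<in> ?A" "k \<in> freqs a" for a k
    by (rule the_equality) (use that freqs_disjoint in auto)
  define XX where "XX u k = of_real la * cc k * cis (real_vec k \<bullet> u)" for u k
  have nc: "norm (cc k) = 1" if "k \<in> S" for k using that by (simp add: cc_def)
  have XXtest: "fourier_coeff (test la ?A u) k = XX u k" if kS: "k \<in> S" for k u
  proof -
    obtain a where a: "a \<in> ?A" "k \<in> freqs a" using kS by (auto simp: S_def)
    show ?thesis using fourier_coeff_test[OF finite_levelset a(2), of la j u] a kS the[OF a]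
      by (simp add: XX_def testc_def cc_def)
  qed
  have ipX: "ip S (XX u) v = trig S (\<lambda>k. of_real la * cc k * cnj (v k)) u" for u v
    by (simp add: ip_def XX_def trig_def mult_ac)
  have nX: "(\<Sum>k\<in>S. (norm (XX u k))\<^sup>2) = K * V\<^sup>2" for u
    using la by (simp add: XX_def norm_mult nc cardS V(2))
  have point: "K * V\<^sup>2 - 2/9 * (K * V\<^sup>2) \<le> (\<Sum>i<card B. (norm (ip S (XX u) (e i)))\<^sup>2)" for u
  proof -
    let ?x = "test la ?A u"
    obtain c where c: "bnorm l q \<sigma> (?x - (\<lambda>t. \<Sum>b\<in>B. c b * b t)) \<le> ennreal ?D"
      using appr[OF M] by blast
    let ?y = "\<lambda>t. \<Sum>b\<in>B. c b * b t"
    have iy: "integrable torus_measure ?y" using int by auto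
    have ix: "integrable torus_measure ?x" by (rule continuous_integrable_torus[OF continuous_test])
    define y where "y = fourier_coeff ?y"
    have y: "\<exists>c. \<forall>k\<in>S. y k = (\<Sum>b\<in>B. c b * fourier_coeff b k)"
      unfolding y_def by (intro exI[of _ c] ballI fourier_coeff_sum[OF B(1) int])
    have ne: "?A \<noteq> {}" using levelset_nonempty[where 'd = 'd, of j] by auto
    define \<delta> where "\<delta> = ?C * 2 powr (- (l * real (j + 2 * CARD('d)))) * ?D"
    have delta: "\<delta> = V * K powr (1/\<sigma>) / 3"
    proof -
      have "\<delta> = (2 powr (- (l * real (j + 2 * CARD('d)))) * 2 powr (l * real (j + 2 * CARD('d)))) * (V * K powr (1/\<sigma>) / 3)"
      proof -
        have "C * w * (v * W / (3 * C)) = (w * W) * (v / 3)" if "C > 0" for C w v W :: real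
          using that by simp
        from this[OF C0] show ?thesis unfolding \<delta>_def V_def .
      qed
      also have "2 powr (- (l * real (j + 2 * CARD('d)))) * 2 powr (l * real (j + 2 * CARD('d))) = (1::real)"
        by (subst powr_add[symmetric]) simp
      finally show ?thesis by simp
    qed
    have "(\<Sum>k\<in>S. (norm (fourier_coeff ?x k - y k))\<^sup>2) \<le> 2 * K powr (1 - 2/\<sigma>) * \<delta>\<^sup>2"
      unfolding y_def \<delta>_def S_def K_def
      by (rule approx_coefficients(2)[OF finite_levelset ne _ q s D[unfolded K_def] ix iy c[unfolded K_def]]) (auto simp: levelset_def)
    also have "(\<Sum>k\<in>S. (norm (fourier_coeff ?x k - y k))\<^sup>2) = (\<Sum>k\<in>S. (norm (XX u k - y k))\<^sup>2)"
      by (intro sum.cong refl) (simp add: XXtest)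
    also have "2 * K powr (1 - 2/\<sigma>) * \<delta>\<^sup>2 = 2/9 * (K powr (1 - 2/\<sigma>) * (K powr (1/\<sigma>))\<^sup>2 * V\<^sup>2)"
      by (simp add: delta power_mult_distrib power_divide)
    also have "K powr (1 - 2/\<sigma>) * (K powr (1/\<sigma>))\<^sup>2 = K"
      using K by (simp add: power2_eq_square powr_add[symmetric])
    finally have z: "(\<Sum>k\<in>S. (norm (XX u k - y k))\<^sup>2) \<le> 2/9 * (K * V\<^sup>2)" .
    \<comment> \<open>Expanding |x - y|^2 and using 2 |<x, y>| <= ?T + |y|^2 cancels |y|^2 and
      leaves |x|^2 - ?T <= |x - y|^2.\<close>
    let ?T = "\<Sum>i<card B. (norm (ip S (XX u) (e i)))\<^sup>2" and ?Y = "\<Sum>k\<in>S. (norm (y k))\<^sup>2"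
    have T0: "?T \<ge> 0" "?Y \<ge> 0" by (auto intro: sum_nonneg)
    have "(norm (ip S (XX u) y))\<^sup>2 \<le> ?T * ?Y" by (rule e2[OF y])
    then have "norm (ip S (XX u) y) \<le> sqrt (?T * ?Y)" by (rule real_le_rsqrt)
    also have "\<dots> = sqrt ?T * sqrt ?Y" by (rule real_sqrt_mult)
    finally have "2 * norm (ip S (XX u) y) \<le> 2 * sqrt ?T * sqrt ?Y" by simp
    also have "\<dots> \<le> (sqrt ?T)\<^sup>2 + (sqrt ?Y)\<^sup>2" by (rule sum_squares_bound)
    also have "\<dots> = ?T + ?Y" using T0 by simp
    finally have ipb: "2 * norm (ip S (XX u) y) \<le> ?T + ?Y" .
    have "(\<Sum>k\<in>S. (norm (XX u k - y k))\<^sup>2) = K * V\<^sup>2 - 2 * Re (ip S (XX u) y) + ?Y"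
    proof -
      have "(norm (v - w))\<^sup>2 = (norm v)\<^sup>2 - 2 * Re (v * cnj w) + (norm w)\<^sup>2" for v w :: complex
        unfolding cmod_power2 by (simp add: power2_eq_square algebra_simps)
      then show ?thesis by (simp add: sum.distrib sum_subtractf nX ip_def Re_sum sum_distrib_left)
    qed
    moreover have "Re (ip S (XX u) y) \<le> norm (ip S (XX u) y)" by (rule complex_Re_le_cmod)
    ultimately show ?thesis using z ipb by linarith
  qed
  let ?I = "(2*pi) ^ CARD('d) :: real"
  have I: "?I > 0" by simp
  have int2: "integrable torus_measure (\<lambda>u. (norm (ip S (XX u) (e i)))\<^sup>2)" for i
    unfolding ipX by (intro continuous_integrable_torus continuous_intros)
  have "?I * (7/9 * (K * V\<^sup>2)) = (\<integral>u. K * V\<^sup>2 - 2/9 * (K * V\<^sup>2) \<partial>(torus_measure :: (real ^ 'd) measure))"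
    by (simp add: measure_torus)
  also have "\<dots> \<le> (\<integral>u. (\<Sum>i<card B. (norm (ip S (XX u) (e i)))\<^sup>2) \<partial>torus_measure)"
    by (intro integral_mono point Bochner_Integration.integrable_sum int2)
       (auto intro!: continuous_integrable_torus continuous_intros)
  also have "\<dots> = (\<Sum>i<card B. \<integral>u. (norm (ip S (XX u) (e i)))\<^sup>2 \<partial>torus_measure)"
    by (rule Bochner_Integration.integral_sum) (rule int2)
  also have "\<dots> = (\<Sum>i<card B. ?I * (la\<^sup>2 * (\<Sum>k\<in>S. (norm (e i k))\<^sup>2)))"
    unfolding ipX parseval_trig[OF S] by (simp add: norm_mult nc power_mult_distrib sum_distrib_left)
  also have "\<dots> \<le> (\<Sum>i<card B. ?I * (la\<^sup>2 * 1))"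
    using I e1 by (intro sum_mono mult_left_mono) auto
  also have "\<dots> \<le> real n * (?I * la\<^sup>2)" using B I by (simp add: mult_right_mono)
  finally have "(?I * la\<^sup>2) * (7/9 * (K * 2 ^ j)) \<le> (?I * la\<^sup>2) * real n" by (simp add: V(2) mult_ac)
  then have "7/9 * (K * 2 ^ j) \<le> real n" using I la by (subst (asm) mult_le_cancel_left_pos) auto
  moreover have "K * 2 ^ j > 0" using K by simp
  ultimately show False using n by linarith
qed (use q s in auto)

end

section \<open>Lower bounds for the intersection of the balls\<close>

lemma polynomial_exponential_bound:
  assumes "\<delta> > 0" "b \<ge> 0"
  shows "\<exists>C>0. \<forall>x\<ge>0. (x + 1) powr b * 2 powr (- \<delta> * x) \<le> (C::real)"
proof -
  obtain C where C: "C > 0" "\<And>y. y \<ge> 0 \<Longrightarrow> y powr b \<le> C * exp (y::real)"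
    using powr_le_exp[OF assms(2)] by blast
  define t where "t = \<delta> * ln 2"
  have t: "t > 0" using assms by (simp add: t_def)
  have "(x + 1) powr b * 2 powr (- \<delta> * x) \<le> (1/t) powr b * C * exp t" if x: "x \<ge> 0" for x
  proof -
    have e2: "2 powr (- \<delta> * x) = exp (- (t * x))" by (simp add: powr_def t_def mult_ac)
    have "(x + 1) powr b = (1/t) powr b * (t * (x + 1)) powr b"
      using t x by (simp flip: powr_mult)
    also have "\<dots> \<le> (1/t) powr b * (C * exp (t * (x + 1)))" using t x by (intro mult_left_mono C) auto
    finally have "(x + 1) powr b * 2 powr (- \<delta> * x) \<le> (1/t) powr b * (C * exp (t * (x + 1))) * exp (- (t * x))"
      unfolding e2 by (rule mult_right_mono) simp
    also have "(1/t) powr b * (C * exp (t * (x + 1))) * exp (- (t * x)) = (1/t) powr b * C * (exp (t * (x + 1)) * exp (- (t * x)))"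
      by simp
    also have "exp (t * (x + 1)) * exp (- (t * x)) = exp t" by (simp add: exp_add[symmetric] algebra_simps)
    finally show ?thesis .
  qed
  moreover have "(1/t) powr b * C * exp t > 0" using t C by simp
  ultimately show ?thesis by blast
qed

lemma recip_range: "1 \<le> \<theta> \<Longrightarrow> 0 \<le> recip \<theta>" "1 \<le> \<theta> \<Longrightarrow> recip \<theta> \<le> 1"
proof -
  assume "1 \<le> \<theta>"
  then have "ennreal 1 \<le> \<theta>" by simp
  then have "0 \<le> recip \<theta> \<and> recip \<theta> \<le> 1"
    by (rule ennreal_ge_cases) (simp, simp add: recip_def, auto simp: recip_ennreal)
  then show "0 \<le> recip \<theta>" "recip \<theta> \<le> 1" by auto
qed

locale besov_data = cutoff +
  fixes s :: nat and q \<sigma> l :: real and r :: "nat \<Rightarrow> real" and p \<theta> :: "nat \<Rightarrow> ennreal"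
    and M :: "(real ^ 'd \<Rightarrow> complex) set"
  assumes s1: "s \<ge> 1" and q2: "q > 2" and s2: "\<sigma> > 2"
    and pq: "\<And>j. j \<in> {1..s} \<Longrightarrow> ennreal q \<le> p j"
    and th1: "\<And>j. j \<in> {1..s} \<Longrightarrow> 1 \<le> \<theta> j"
    and r_less: "\<And>j. j \<in> {1..<s} \<Longrightarrow> r j < r s"
    and l_pos: "l > 0" and alpha_pos: "r s - l > 0"
    and M_def: "M = (\<Inter>j\<in>{1..s}. besov_ball \<eta>0 (\<chi> i. r j) (p j) (\<theta> j))"
begin

abbreviation width :: "nat \<Rightarrow> ennreal" where
  "width n \<equiv> besov_width \<eta>0 (\<chi> i. l) (ennreal q) (ennreal \<sigma>) M n"

abbreviation \<alpha> :: real where "\<alpha> \<equiv> r s - l"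

abbreviation decay :: "nat \<Rightarrow> real" where "decay j \<equiv> 2 powr (- \<alpha> * real j)"

abbreviation blocks :: "nat \<Rightarrow> (nat ^ 'd) set" where "blocks j \<equiv> levelset j"

lemma p_ge_1: "j \<in> {1..s} \<Longrightarrow> 1 \<le> p j"
proof -
  assume "j \<in> {1..s}"
  then have "ennreal 1 \<le> p j" using q2 by (intro order_trans[OF ennreal_leI pq]) auto
  then show ?thesis by simp
qed

lemma r_le: "j \<in> {1..s} \<Longrightarrow> r j \<le> r s"
  using r_less[of j] by (cases "j = s") auto

lemma nblocks_ge_1: "real (card (blocks j)) \<ge> 1"
  using levelset_nonempty[where 'd = 'd, of j] by simp

lemma test_in_M:
  fixes A :: "(nat ^ 'd) set"
  assumes A: "A \<subseteq> levelset j" "A \<noteq> {}" and la: "la \<ge> 0"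
    and bd: "\<And>i. i \<in> {1..s} \<Longrightarrow> 2 powr (r i * real (j + 2 * CARD('d))) * ((2*pi) ^ CARD('d) * (la * sqrt (2 ^ (j + CARD('d)))))
        * real (card A) powr recip (\<theta> i) \<le> 1"
  shows "test la A u \<in> M"
proof -
  have "finite A" using A finite_subset finite_levelset by blast
  have "besov_norm \<eta>0 (\<chi> k. r i) (p i) (\<theta> i) (test la A u) \<le> 1" if i: "i \<in> {1..s}" for i
  proof -
    have "besov_norm \<eta>0 (\<chi> k. r i) (p i) (\<theta> i) (test la A u) \<le> ennreal 1"
      unfolding test_def
      by (rule order_trans[OF besov_norm_test ennreal_leI[OF bd[OF i]]])
         (use A \<open>finite A\<close> p_ge_1[OF i] th1[OF i] la in \<open>auto simp: levelset_def\<close>)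
    then show ?thesis by simp
  qed
  then show ?thesis by (simp add: M_def besov_ball_def)
qed

text \<open>The amplitude is normalised for the ball with index \<open>s\<close>. A single block is
  insensitive to \<theta>, and r i <= r s takes care of the other balls.\<close>

lemma width_lower_single:
  "\<exists>c>0. \<forall>j n \<epsilon>. 0 < \<epsilon> \<longrightarrow> \<epsilon> \<le> 1/2 \<longrightarrow> 4 * real n * (1 + 2 * real (card (blocks j)) powr (1/2 - 1/\<sigma>) * \<epsilon>)\<^sup>2 < real (card (blocks j)) * 2 ^ j \<longrightarrow>
     ennreal (c * \<epsilon> * decay j) \<le> width n"
proof -
  let ?I = "(2*pi) ^ CARD('d) :: real"
  let ?c = "2 powr (- \<alpha> * real (2 * CARD('d))) / (sqrt (2 ^ CARD('d)) * ?I * (?I + 1))"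
  have I: "?I > 0" by simp
  have c: "?c > 0" using I by (intro divide_pos_pos mult_pos_pos) (auto simp: add_pos_pos)
  have "ennreal (?c * \<epsilon> * decay j) \<le> width n"
    if eps: "0 < \<epsilon>" "\<epsilon> \<le> 1/2" and n: "4 * real n * (1 + 2 * real (card (blocks j)) powr (1/2 - 1/\<sigma>) * \<epsilon>)\<^sup>2 < real (card (blocks j)) * 2 ^ j" for j n \<epsilon>
  proof -
    let ?J = "real (j + 2 * CARD('d))"
    define la where "la = 1 / (?I * sqrt (2 ^ (j + CARD('d))) * 2 powr (r s * ?J))"
    have la: "la > 0" using I by (simp add: la_def)
    have "I * (1 / (I * S * R) * S) = 1 / R" if "I > 0" "S > 0" for I S R :: real
      using that by simp
    then have lam: "?I * (la * sqrt (2 ^ (j + CARD('d)))) = 2 powr (- r s * ?J)"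
      unfolding la_def using I by (simp add: powr_minus_divide)
    have mem: "test la {a} u \<in> M" if a: "a \<in> levelset j" for a u
    proof (rule test_in_M)
      fix i assume i: "i \<in> {1..s}"
      have "2 powr (r i * ?J) * 2 powr (- r s * ?J) = 2 powr ((r i - r s) * ?J)"
        by (subst powr_add[symmetric]) (simp only: left_diff_distrib, simp)
      also have "\<dots> \<le> 2 powr 0" using r_le[OF i] by (intro powr_mono) (auto simp: mult_le_0_iff)
      finally show "2 powr (r i * ?J) * (?I * (la * sqrt (2 ^ (j + CARD('d))))) * real (card {a}) powr recip (\<theta> i) \<le> 1"
        unfolding lam by simp
    qed (use a la in auto)
    have "ennreal (\<epsilon> * la * sqrt (2 ^ j) * 2 powr (l * ?J) / (?I + 1)) \<le> width n"
      by (rule width_ge_single_blocks[OF _ _ la eps mem n]) (use q2 s2 in auto)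
    also have "\<epsilon> * la * sqrt (2 ^ j) * 2 powr (l * ?J) / (?I + 1) = ?c * \<epsilon> * decay j"
    proof -
      have "2 powr (l * ?J) / 2 powr (r s * ?J) = decay j * 2 powr (- \<alpha> * real (2 * CARD('d)))"
        unfolding powr_diff[symmetric] powr_add[symmetric] by (rule arg_cong[where f = "(powr) 2"]) (simp add: algebra_simps)
      moreover have "sqrt (2 ^ j) / sqrt (2 ^ (j + CARD('d))) = 1 / sqrt (2 ^ CARD('d))"
        by (simp add: power_add real_sqrt_mult)
      moreover have "\<epsilon> * (1 / (I * S * R)) * s * L / (I + 1) = \<epsilon> * (L / R) * (s / S) / (I * (I + 1))" for I S R s L :: real
        by (simp add: mult_ac)
      ultimately show ?thesis unfolding la_def by (simp only:) (simp add: mult_ac)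
    qed
    finally show ?thesis .
  qed
  then show ?thesis using c by blast
qed

text \<open>The amplitude is again normalised for index \<open>s\<close>, now with the factor
  K^(-1/\<theta>) because K blocks occur. In another ball the factor K^(1/\<theta>) may be larger,
  but it is at most a power of j and is beaten by the exponential gain from r i < r s;
  \<open>c1\<close> absorbs the finitely many constants.\<close>

lemma width_lower_full:
  "\<exists>c>0. \<forall>j n. 2 * real n \<le> real (card (blocks j)) * 2 ^ j \<longrightarrow>
     ennreal (c * decay j * real (card (blocks j)) powr (1/\<sigma> - recip (\<theta> s))) \<le> width n"
proof -
  let ?I = "(2*pi) ^ CARD('d) :: real"
  have I: "?I > 0" by simp
  have "\<forall>i\<in>{1..<s}. \<exists>C>0. \<forall>x\<ge>0. (x + 1) powr (real CARD('d)) * 2 powr (- (r s - r i) * x) \<le> (C::real)"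
    using r_less by (intro ballI polynomial_exponential_bound) auto
  then obtain Ci where Ci: "\<And>i. i \<in> {1..<s} \<Longrightarrow> Ci i > 0"
     "\<And>i x. i \<in> {1..<s} \<Longrightarrow> x \<ge> 0 \<Longrightarrow> (x + 1) powr (real CARD('d)) * 2 powr (- (r s - r i) * x) \<le> Ci i"
    by metis
  define c1 where "c1 = 1 / (1 + (\<Sum>i\<in>{1..<s}. Ci i))"
  have cs: "(\<Sum>i\<in>{1..<s}. Ci i) \<ge> 0" using Ci by (intro sum_nonneg) (auto intro: less_imp_le)
  have c1: "c1 > 0" "c1 \<le> 1" using cs by (auto simp: c1_def)
  have c1i: "c1 * Ci i \<le> 1" if "i \<in> {1..<s}" for i
  proof -
    have "Ci i \<le> (\<Sum>i\<in>{1..<s}. Ci i)" using Ci that by (intro member_le_sum) (auto intro: less_imp_le)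
    then show ?thesis using cs by (simp add: c1_def)
  qed
  let ?c = "c1 * 2 powr (- \<alpha> * real (2 * CARD('d))) / (sqrt (2 ^ CARD('d)) * ?I * (3 * (?I + 1)))"
  have c: "?c > 0" using I c1 by (intro divide_pos_pos mult_pos_pos) (auto simp: add_pos_pos)
  have "ennreal (?c * decay j * real (card (blocks j)) powr (1/\<sigma> - recip (\<theta> s))) \<le> width n"
    if n: "2 * real n \<le> real (card (blocks j)) * 2 ^ j" for j n
  proof -
    let ?J = "real (j + 2 * CARD('d))" and ?K = "real (card (blocks j))"
    have K1: "?K \<ge> 1" by (rule nblocks_ge_1)
    have s_in: "s \<in> {1..s}" using s1 by simp
    define la where "la = c1 / (?I * sqrt (2 ^ (j + CARD('d))) * 2 powr (r s * ?J) * ?K powr recip (\<theta> s))"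
    have la: "la > 0" unfolding la_def using I c1 K1 by (intro divide_pos_pos mult_pos_pos) auto
    have lam: "?I * (la * sqrt (2 ^ (j + CARD('d)))) = c1 * 2 powr (- r s * ?J) / ?K powr recip (\<theta> s)"
    proof -
      have "I * (c1 / (I * S * R * T) * S) = c1 * (1 / R) / T" if "I > 0" "S > 0" for I S R T :: real
        using that by simp
      from this[OF I, of "sqrt (2 ^ (j + CARD('d)))"] show ?thesis
        unfolding la_def by (simp add: powr_minus_divide)
    qed
    have mem: "test la (levelset j) u \<in> M" for u
    proof (rule test_in_M)
      fix i assume i: "i \<in> {1..s}"
      have Kp: "?K powr recip (\<theta> s) \<ge> 1" using K1 recip_range[OF th1[OF s_in]] by (intro ge_one_powr_ge_zero) auto
      have pw: "2 powr (r i * ?J) * 2 powr (- r s * ?J) = 2 powr (- (r s - r i) * ?J)"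
        by (subst powr_add[symmetric]) (simp only: left_diff_distrib mult_minus_left minus_diff_eq, simp)
      have "c1 * 2 powr (- (r s - r i) * ?J) * ?K powr recip (\<theta> i) \<le> ?K powr recip (\<theta> s)"
      proof (cases "i = s")
        case True
        then show ?thesis using c1 mult_right_mono[of c1 1 "?K powr recip (\<theta> s)"] by simp
      next
        case False
        then have i': "i \<in> {1..<s}" using i by auto
        have "?K powr recip (\<theta> i) \<le> ?K powr 1" using K1 recip_range[OF th1[OF i]] by (intro powr_mono) auto
        also have "\<dots> = ?K" using K1 by simp
        also have "\<dots> \<le> real ((j + 1) ^ (CARD('d) - 1))" using card_levelset_le[where 'd = 'd, of j] by (simp only: of_nat_le_iff)
        also have "\<dots> = (real j + 1) ^ (CARD('d) - 1)" by (simp add: add.commute)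
        also have "\<dots> \<le> (?J + 1) ^ (CARD('d) - 1)" by (intro power_mono) auto
        also have "\<dots> \<le> (?J + 1) ^ CARD('d)" by (intro power_increasing) auto
        also have "\<dots> = (?J + 1) powr (real CARD('d))" by (subst powr_realpow) auto
        finally have "c1 * (2 powr (- (r s - r i) * ?J) * ?K powr recip (\<theta> i))
            \<le> c1 * (2 powr (- (r s - r i) * ?J) * (?J + 1) powr (real CARD('d)))"
          using c1 by (intro mult_left_mono) auto
        also have "\<dots> \<le> c1 * Ci i" using c1 Ci(2)[OF i', of ?J] by (intro mult_left_mono) (auto simp: mult.commute)
        also have "\<dots> \<le> 1" by (rule c1i[OF i'])
        finally show ?thesis using Kp by (simp add: mult.assoc)
      qed
      then have "c1 * (2 powr (r i * ?J) * 2 powr (- r s * ?J)) * ?K powr recip (\<theta> i) / ?K powr recip (\<theta> s) \<le> 1"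
        unfolding pw using Kp by (simp add: divide_le_eq)
      then show "2 powr (r i * ?J) * (?I * (la * sqrt (2 ^ (j + CARD('d))))) * real (card (blocks j)) powr recip (\<theta> i) \<le> 1"
        unfolding lam by (simp only: times_divide_eq_left times_divide_eq_right mult_ac)
    qed (use la K1 in auto)
    have "ennreal (la * sqrt (2 ^ j) * ?K powr (1/\<sigma>) * 2 powr (l * ?J) / (3 * (?I + 1))) \<le> width n"
      by (rule width_ge_full_blocks[OF _ _ la mem n]) (use q2 s2 in auto)
    also have "la * sqrt (2 ^ j) * ?K powr (1/\<sigma>) * 2 powr (l * ?J) / (3 * (?I + 1))
      = ?c * decay j * ?K powr (1/\<sigma> - recip (\<theta> s))"
    proof -
      have "2 powr (l * ?J) / 2 powr (r s * ?J) = decay j * 2 powr (- \<alpha> * real (2 * CARD('d)))"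
        unfolding powr_diff[symmetric] powr_add[symmetric] by (rule arg_cong[where f = "(powr) 2"]) (simp add: algebra_simps)
      moreover have "sqrt (2 ^ j) / sqrt (2 ^ (j + CARD('d))) = 1 / sqrt (2 ^ CARD('d))"
        by (simp add: power_add real_sqrt_mult)
      moreover have "?K powr (1/\<sigma>) / ?K powr recip (\<theta> s) = ?K powr (1/\<sigma> - recip (\<theta> s))" by (simp add: powr_diff)
      moreover have "(c / (I * S * R * T)) * s * U * L / (3 * (I + 1)) = c * (L / R) * (s / S) * (U / T) / (I * (3 * (I + 1)))"
        for I S R s L T U c :: real by (simp add: mult_ac)
      ultimately show ?thesis unfolding la_def by (simp only:) (simp add: mult_ac)
    qed
    finally show ?thesis .
  qed
  then show ?thesis using c by blast
qed

end

section \<open>Approximation of blocks\<close>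

context cutoff
begin

lemma torus_Lp_add:
  fixes f g :: "real ^ 'd \<Rightarrow> complex"
  assumes f: "f \<in> torus_Lp (ennreal q)" and g: "g \<in> torus_Lp (ennreal q)" and q: "q \<ge> 1"
  shows "(\<lambda>x. f x + g x) \<in> torus_Lp (ennreal q)"
proof -
  have [measurable]: "f \<in> borel_measurable torus_measure" "g \<in> borel_measurable torus_measure"
    and int: "integrable torus_measure (\<lambda>x. norm (f x) powr q)" "integrable torus_measure (\<lambda>x. norm (g x) powr q)"
    using f g q by (auto simp: torus_Lp_iff)
  have "integrable torus_measure (\<lambda>x. norm (f x + g x) powr q)"
  proof (rule Bochner_Integration.integrable_bound)
    show "integrable torus_measure (\<lambda>x. (1/2) powr (1 - q) * norm (f x) powr q + (1 - 1/2) powr (1 - q) * norm (g x) powr q)"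
      using int by auto
    show "AE x in torus_measure. norm (norm (f x + g x) powr q)
       \<le> norm ((1/2) powr (1 - q) * norm (f x) powr q + (1 - 1/2) powr (1 - q) * norm (g x) powr q)"
    proof (rule AE_I2)
      fix x
      have "norm (f x + g x) powr q \<le> (norm (f x) + norm (g x)) powr q"
        using q by (intro powr_mono2 norm_triangle_ineq) auto
      also have "\<dots> \<le> (1/2) powr (1 - q) * norm (f x) powr q + (1 - 1/2) powr (1 - q) * norm (g x) powr q"
        using q by (intro add_powr_le) auto
      finally show "norm (norm (f x + g x) powr q)
       \<le> norm ((1/2) powr (1 - q) * norm (f x) powr q + (1 - 1/2) powr (1 - q) * norm (g x) powr q)" by simp
    qed
  qed auto
  then show ?thesis using q by (simp add: torus_Lp_iff)
qed

lemma bl_triangle: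
  fixes f g :: "real ^ 'd \<Rightarrow> complex"
  assumes f: "integrable torus_measure f" and g: "integrable torus_measure g" and q: "q \<ge> 1"
  shows "bl l q m (\<lambda>x. f x + g x) \<le> bl l q m f + bl l q m g"
proof -
  have "Delta \<eta>0 m (\<lambda>x. f x + g x) = (\<lambda>x. Delta \<eta>0 m f x + Delta \<eta>0 m g x)"
    using Delta_linear[OF f g, of m 1 1] by simp
  then have "Lnorm q (Delta \<eta>0 m (\<lambda>x. f x + g x)) \<le> Lnorm q (Delta \<eta>0 m f) + Lnorm q (Delta \<eta>0 m g)"
    using Lnorm_triangle[OF continuous_Delta continuous_Delta q] by simp
  then show ?thesis unfolding bl_def distrib_left[symmetric] by (rule mult_left_mono) simp
qed

lemma besov_norm_triangle:
  fixes f g :: "real ^ 'd \<Rightarrow> complex"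
  assumes f: "bnorm l q \<sigma> f \<le> ennreal a"
    and g: "bnorm l q \<sigma> g \<le> ennreal b"
    and q: "q \<ge> 1" "\<sigma> \<ge> 1" and ab: "a \<ge> 0" "b \<ge> 0"
  shows "bnorm l q \<sigma> (f + g) \<le> ennreal (a + b)"
proof -
  have f': "f \<in> torus_Lp (ennreal q)" "\<And>F. finite F \<Longrightarrow> (\<Sum>m\<in>F. bl l q m f powr \<sigma>) \<le> a powr \<sigma>"
    using f q ab by (subst (asm) besov_norm_le_iff, auto)+
  have g': "g \<in> torus_Lp (ennreal q)" "\<And>F. finite F \<Longrightarrow> (\<Sum>m\<in>F. bl l q m g powr \<sigma>) \<le> b powr \<sigma>"
    using g q ab by (subst (asm) besov_norm_le_iff, auto)+
  have "(\<Sum>m\<in>F. bl l q m (\<lambda>x. f x + g x) powr \<sigma>) \<le> (a + b) powr \<sigma>" if F: "finite F" for F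
  proof -
    have root: "S powr (1/\<sigma>) \<le> c" if "S \<le> c powr \<sigma>" "S \<ge> 0" "c \<ge> 0" for S c
    proof -
      have "S powr (1/\<sigma>) \<le> (c powr \<sigma>) powr (1/\<sigma>)" using that q by (intro powr_mono2) auto
      then show ?thesis using that q by (simp add: powr_powr)
    qed
    have "(\<Sum>m\<in>F. bl l q m (\<lambda>x. f x + g x) powr \<sigma>) \<le> (\<Sum>m\<in>F. (bl l q m f + bl l q m g) powr \<sigma>)"
      using q by (intro sum_mono powr_mono2 bl_triangle torus_Lp_integrable[OF f'(1)] torus_Lp_integrable[OF g'(1)]) auto
    also have "\<dots> = ((\<Sum>m\<in>F. (bl l q m f + bl l q m g) powr \<sigma>) powr (1/\<sigma>)) powr \<sigma>"
      using q by (simp add: powr_powr sum_nonneg)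
    also have "\<dots> \<le> ((\<Sum>m\<in>F. bl l q m f powr \<sigma>) powr (1/\<sigma>) + (\<Sum>m\<in>F. bl l q m g powr \<sigma>) powr (1/\<sigma>)) powr \<sigma>"
      using q by (intro powr_mono2 Minkowski_sum[OF F]) auto
    also have "\<dots> \<le> (a + b) powr \<sigma>"
      using q ab f'(2)[OF F] g'(2)[OF F] by (intro powr_mono2 add_mono root) (auto intro: sum_nonneg add_nonneg_nonneg)
    finally show ?thesis .
  qed
  moreover have "f + g = (\<lambda>x. f x + g x)" by (simp add: fun_eq_iff)
  ultimately show ?thesis using q ab torus_Lp_add[OF f'(1) g'(1) q(1)] by (subst besov_norm_le_iff) auto
qed

definition act :: "(int ^ 'd) set \<Rightarrow> (nat ^ 'd) set" where
  "act S = {m. \<exists>k\<in>S. ev m k \<noteq> 0}"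

lemma finite_act: "finite S \<Longrightarrow> finite (act S)"
proof -
  assume S: "finite S"
  have "finite {m. ev m k \<noteq> 0}" for k
  proof (cases "\<exists>m. ev m k \<noteq> 0")
    case True
    then obtain m where "ev m k \<noteq> 0" by blast
    then have "{m. ev m k \<noteq> 0} \<subseteq> near m" using ev_near by blast
    then show ?thesis by (rule finite_subset) simp
  qed auto
  then have "finite (\<Union>k\<in>S. {m. ev m k \<noteq> 0})" using S by blast
  moreover have "act S = (\<Union>k\<in>S. {m. ev m k \<noteq> 0})" by (auto simp: act_def)
  ultimately show ?thesis by simp
qed

text \<open>The Besov norm as a real-valued function of the coefficients: finitely many blocks see
  the set \<open>S\<close>, and only they are summed. Restricted to real coefficients it is a
  seminorm to which \<open>Euclidean_ball_approx\<close> applies.\<close>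

definition trig_besov :: "real \<Rightarrow> real \<Rightarrow> real \<Rightarrow> (int ^ 'd) set \<Rightarrow> (int ^ 'd \<Rightarrow> complex) \<Rightarrow> real" where
  "trig_besov l q \<sigma> S w = (\<Sum>m\<in>act S. bl l q m (trig S w) powr \<sigma>) powr (1/\<sigma>)"

lemma besov_norm_trig:
  assumes S: "finite S" and q: "q > 0" "\<sigma> > 0"
  shows "bnorm l q \<sigma> (trig S w) \<le> ennreal (trig_besov l q \<sigma> S w)"
proof -
  have z: "bl l q m (trig S w) = 0" if "m \<notin> act S" for m
    unfolding bl_def Delta_trig[OF S] using that by (subst trig_eq_zero) (auto simp: act_def)
  have "(\<Sum>m\<in>F. bl l q m (trig S w) powr \<sigma>) \<le> trig_besov l q \<sigma> S w powr \<sigma>" if F: "finite F" for F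
  proof -
    have "(\<Sum>m\<in>F. bl l q m (trig S w) powr \<sigma>) = (\<Sum>m\<in>F \<inter> act S. bl l q m (trig S w) powr \<sigma>)"
      by (rule sum.mono_neutral_right) (use F z in auto)
    also have "\<dots> \<le> (\<Sum>m\<in>act S. bl l q m (trig S w) powr \<sigma>)"
      by (rule sum_mono2) (use finite_act[OF S] in auto)
    also have "\<dots> = trig_besov l q \<sigma> S w powr \<sigma>" using q by (simp add: trig_besov_def powr_powr sum_nonneg)
    finally show ?thesis .
  qed
  then show ?thesis using q continuous_torus_Lp[OF continuous_trig, of q S w]
    by (subst besov_norm_le_iff) (auto simp: trig_besov_def)
qed

lemma trig_besov_triangle:
  assumes S: "finite S" and q: "q \<ge> 1" "\<sigma> \<ge> 1"
  shows "trig_besov l q \<sigma> S (\<lambda>k. u k + v k) \<le> trig_besov l q \<sigma> S u + trig_besov l q \<sigma> S v"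
proof -
  have t: "trig S (\<lambda>k. u k + v k) = (\<lambda>x. trig S u x + trig S v x)" by (simp add: fun_eq_iff trig_add)
  have "(\<Sum>m\<in>act S. bl l q m (trig S (\<lambda>k. u k + v k)) powr \<sigma>) powr (1/\<sigma>)
    \<le> (\<Sum>m\<in>act S. (bl l q m (trig S u) + bl l q m (trig S v)) powr \<sigma>) powr (1/\<sigma>)"
    unfolding t using q
    by (intro powr_mono2 sum_mono bl_triangle continuous_integrable_torus continuous_trig) (auto intro: sum_nonneg)
  also have "\<dots> \<le> trig_besov l q \<sigma> S u + trig_besov l q \<sigma> S v"
    unfolding trig_besov_def by (intro Minkowski_sum finite_act S q) auto
  finally show ?thesis unfolding trig_besov_def .
qed

lemma trig_besov_scale:
  assumes S: "finite S" and q: "q \<ge> 1" "\<sigma> \<ge> 1"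
  shows "trig_besov l q \<sigma> S (\<lambda>k. c * u k) = norm c * trig_besov l q \<sigma> S u"
proof -
  have "bl l q m (trig S (\<lambda>k. c * u k)) = norm c * bl l q m (trig S u)" for m
  proof -
    have "Delta \<eta>0 m (trig S (\<lambda>k. c * u k)) = (\<lambda>x. c * Delta \<eta>0 m (trig S u) x)"
      unfolding Delta_trig[OF S] trig_scale by (simp add: mult.left_commute)
    then show ?thesis using q by (simp add: bl_def Lnorm_scale)
  qed
  then show ?thesis using q
    by (simp add: trig_besov_def powr_mult sum_distrib_left[symmetric] powr_powr sum_nonneg)
qed

lemma trig_besov_cong: "(\<And>k. k \<in> S \<Longrightarrow> u k = v k) \<Longrightarrow> trig_besov l q \<sigma> S u = trig_besov l q \<sigma> S v"
proof -
  assume "\<And>k. k \<in> S \<Longrightarrow> u k = v k"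
  then have "trig S u = trig S v" by (auto simp: trig_def)
  then show ?thesis by (simp add: trig_besov_def)
qed

lemma seminorm_trig_besov:
  fixes S :: "(int ^ 'd) set"
  assumes S: "finite S" and q: "q \<ge> 1" "\<sigma> \<ge> 1"
  shows "seminorm_on S (\<lambda>v. trig_besov l q \<sigma> S (\<lambda>k. of_real (v k)))"
  unfolding seminorm_on_def
proof (intro conjI allI impI)
  fix u v :: "int ^ 'd \<Rightarrow> real" and c :: real
  show "trig_besov l q \<sigma> S (\<lambda>k. of_real (u k + v k)) \<le> trig_besov l q \<sigma> S (\<lambda>k. of_real (u k)) + trig_besov l q \<sigma> S (\<lambda>k. of_real (v k))"
    using trig_besov_triangle[OF S q, of l "\<lambda>k. of_real (u k)" "\<lambda>k. of_real (v k)"] by simp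
  show "trig_besov l q \<sigma> S (\<lambda>k. of_real (c * u k)) = \<bar>c\<bar> * trig_besov l q \<sigma> S (\<lambda>k. of_real (u k))"
    using trig_besov_scale[OF S q, of l "of_real c" "\<lambda>k. of_real (u k)"] by simp
  show "trig_besov l q \<sigma> S (\<lambda>k. of_real (u k)) = trig_besov l q \<sigma> S (\<lambda>k. of_real (v k))" if "\<forall>k\<in>S. u k = v k"
    using that by (intro trig_besov_cong) auto
qed

section \<open>Mean norms of random polynomials\<close>

lemma avgs_integral:
  fixes F :: "'a set list \<Rightarrow> real ^ 'd \<Rightarrow> real"
  assumes I: "finite I" and int: "\<And>As. integrable torus_measure (F As)"
  shows "avgs I n (\<lambda>As. \<integral>x. F As x \<partial>torus_measure) = (\<integral>x. avgs I n (\<lambda>As. F As x) \<partial>torus_measure)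
     \<and> integrable torus_measure (\<lambda>x. avgs I n (\<lambda>As. F As x))"
  using int
proof (induction n arbitrary: F)
  case (Suc n)
  have IH: "avgs I n (\<lambda>As. \<integral>x. F (A # As) x \<partial>torus_measure) = (\<integral>x. avgs I n (\<lambda>As. F (A # As) x) \<partial>torus_measure)"
     "integrable torus_measure (\<lambda>x. avgs I n (\<lambda>As. F (A # As) x))" for A
    using Suc.IH[of "\<lambda>As. F (A # As)"] Suc.prems by auto
  show ?case
    unfolding avgs.simps avg_def IH(1) using IH(2) I
    by (simp add: Bochner_Integration.integral_sum)
qed simp

text \<open>Mean and integral are interchanged. At each point the real and imaginary parts are sign
  sums whose coefficients are b k times a cosine or sine; their squares sum to at most
  \<open>B\<close>, so Khinchine's bound holds uniformly in the point.\<close>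

lemma avgs_Lnorm_powr:
  assumes \<rho>: "\<rho> \<ge> 1"
  shows "\<exists>C>0. \<forall>(S :: (int ^ 'd) set) n (b :: int ^ 'd \<Rightarrow> real) B. finite S \<longrightarrow> (\<Sum>k\<in>S. (b k)\<^sup>2) \<le> B \<longrightarrow>
    avgs S n (\<lambda>As. Lnorm \<rho> (trig S (\<lambda>k. of_real (b k * (\<Sum>A\<leftarrow>As. sgn_of A k)))) powr \<rho>) \<le> C * (real n * B) powr (\<rho>/2)"
proof -
  obtain C where C: "C > 0" "\<And>I n (z :: int ^ 'd \<Rightarrow> real). finite I \<Longrightarrow>
    avgs I n (\<lambda>As. \<bar>\<Sum>A\<leftarrow>As. lin I z A\<bar> powr \<rho>) \<le> C * (real n * (\<Sum>k\<in>I. (z k)\<^sup>2)) powr (\<rho>/2)"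
    using avgs_powr_lin[of \<rho>, where 'a = "int ^ 'd"] \<rho> by auto
  define C' where "C' = (2 * pi) ^ CARD('d) * ((1/2) powr (1 - \<rho>) * (C + C))"
  have C': "C' > 0" using C by (simp add: C'_def)
  have "avgs S n (\<lambda>As. Lnorm \<rho> (trig S (\<lambda>k. of_real (b k * (\<Sum>A\<leftarrow>As. sgn_of A k)))) powr \<rho>) \<le> C' * (real n * B) powr (\<rho>/2)"
    if S: "finite S" and B: "(\<Sum>k\<in>S. (b k)\<^sup>2) \<le> B" for S :: "(int ^ 'd) set" and n b B
  proof -
    let ?f = "\<lambda>As. trig S (\<lambda>k. of_real (b k * (\<Sum>A\<leftarrow>As. sgn_of A k)))"
    have pt: "avgs S n (\<lambda>As. norm (?f As x) powr \<rho>) \<le> (1/2) powr (1 - \<rho>) * (C + C) * (real n * B) powr (\<rho>/2)" for x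
    proof -
      let ?zc = "\<lambda>k. b k * cos (real_vec k \<bullet> x)" and ?zs = "\<lambda>k. b k * sin (real_vec k \<bullet> x)"
      have re: "Re (?f As x) = (\<Sum>A\<leftarrow>As. lin S ?zc A)" for As
        by (simp add: trig_def lin_sum_list mult_ac)
      have im: "Im (?f As x) = (\<Sum>A\<leftarrow>As. lin S ?zs A)" for As
        by (simp add: trig_def lin_sum_list mult_ac)
      have z: "(\<Sum>k\<in>S. (?zc k)\<^sup>2) \<le> B" "(\<Sum>k\<in>S. (?zs k)\<^sup>2) \<le> B"
      proof -
        have "(\<Sum>k\<in>S. (?zc k)\<^sup>2) \<le> (\<Sum>k\<in>S. (b k)\<^sup>2)" "(\<Sum>k\<in>S. (?zs k)\<^sup>2) \<le> (\<Sum>k\<in>S. (b k)\<^sup>2)"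
          by (intro sum_mono, simp add: power_mult_distrib mult_left_le abs_square_le_1)+
        then show "(\<Sum>k\<in>S. (?zc k)\<^sup>2) \<le> B" "(\<Sum>k\<in>S. (?zs k)\<^sup>2) \<le> B" using B by linarith+
      qed
      have zz: "avgs S n (\<lambda>As. \<bar>\<Sum>A\<leftarrow>As. lin S z A\<bar> powr \<rho>) \<le> C * (real n * B) powr (\<rho>/2)"
        if "(\<Sum>k\<in>S. (z k)\<^sup>2) \<le> B" for z
      proof -
        have "avgs S n (\<lambda>As. \<bar>\<Sum>A\<leftarrow>As. lin S z A\<bar> powr \<rho>) \<le> C * (real n * (\<Sum>k\<in>S. (z k)\<^sup>2)) powr (\<rho>/2)" by (rule C(2)[OF S])
        also have "\<dots> \<le> C * (real n * B) powr (\<rho>/2)"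
          using C(1) that \<rho> by (intro mult_left_mono powr_mono2) (auto intro!: mult_nonneg_nonneg sum_nonneg)
        finally show ?thesis .
      qed
      have "avgs S n (\<lambda>As. norm (?f As x) powr \<rho>)
        \<le> avgs S n (\<lambda>As. (1/2) powr (1 - \<rho>) * (\<bar>\<Sum>A\<leftarrow>As. lin S ?zc A\<bar> powr \<rho> + \<bar>\<Sum>A\<leftarrow>As. lin S ?zs A\<bar> powr \<rho>))"
      proof (rule avgs_mono)
        fix As
        have "norm (?f As x) powr \<rho> \<le> (\<bar>Re (?f As x)\<bar> + \<bar>Im (?f As x)\<bar>) powr \<rho>"
          using \<rho> by (intro powr_mono2 cmod_le) auto
        also have "\<dots> \<le> (1/2) powr (1 - \<rho>) * \<bar>Re (?f As x)\<bar> powr \<rho> + (1 - 1/2) powr (1 - \<rho>) * \<bar>Im (?f As x)\<bar> powr \<rho>"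
          using \<rho> by (intro add_powr_le) auto
        finally show "norm (?f As x) powr \<rho> \<le> (1/2) powr (1 - \<rho>) * (\<bar>\<Sum>A\<leftarrow>As. lin S ?zc A\<bar> powr \<rho> + \<bar>\<Sum>A\<leftarrow>As. lin S ?zs A\<bar> powr \<rho>)"
          unfolding re im by (simp add: distrib_left)
      qed
      also have "\<dots> \<le> (1/2) powr (1 - \<rho>) * (C * (real n * B) powr (\<rho>/2) + C * (real n * B) powr (\<rho>/2))"
        unfolding avgs_cmult avgs_add by (intro mult_left_mono add_mono zz z) auto
      finally show ?thesis by (simp add: algebra_simps)
    qed
    have int: "integrable torus_measure (\<lambda>x. norm (?f As x) powr \<rho>)" for As
      using \<rho> by (intro integrable_powr_torus continuous_trig) auto
    have "avgs S n (\<lambda>As. Lnorm \<rho> (?f As) powr \<rho>) = avgs S n (\<lambda>As. \<integral>x. norm (?f As x) powr \<rho> \<partial>torus_measure)"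
      using \<rho> by (simp add: Lnorm_powr)
    also have "\<dots> = (\<integral>x. avgs S n (\<lambda>As. norm (?f As x) powr \<rho>) \<partial>torus_measure)"
      using avgs_integral[OF S, of "\<lambda>As x. norm (?f As x) powr \<rho>" n, OF int] by blast
    also have "\<dots> \<le> (\<integral>x. (1/2) powr (1 - \<rho>) * (C + C) * (real n * B) powr (\<rho>/2) \<partial>(torus_measure :: (real ^ 'd) measure))"
      using avgs_integral[OF S, of "\<lambda>As x. norm (?f As x) powr \<rho>" n, OF int] pt
      by (intro integral_mono) (auto intro!: continuous_integrable_torus continuous_intros)
    also have "\<dots> = C' * (real n * B) powr (\<rho>/2)"
      unfolding C'_def by (simp add: measure_torus)
    finally show ?thesis .
  qed
  then show ?thesis using C' by blast
qed

text \<open>The moment of order \<rho> = max q \<sigma> dominates both the L_q norm on the torus and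
  the l_\<sigma> sum over the blocks, so one moment bound per block suffices.\<close>

lemma avgs_trig_besov:
  assumes q: "q \<ge> 1" "\<sigma> \<ge> 1" and l: "l \<ge> 0"
  shows "\<exists>C>0. \<forall>(S :: (int ^ 'd) set) n J h. finite S \<longrightarrow> n \<ge> 1 \<longrightarrow> (\<forall>m\<in>act S. level m \<le> J) \<longrightarrow> real (card (act S)) \<le> h \<longrightarrow> h > 0 \<longrightarrow>
    avgs S n (\<lambda>As. trig_besov l q \<sigma> S (\<lambda>k. of_real (\<Sum>A\<leftarrow>As. sgn_of A k)))
      \<le> C * (2 powr (l * real J) * sqrt (real n * 2 ^ J) * h powr (1/\<sigma>))"
proof -
  define \<rho> where "\<rho> = max q \<sigma>"
  have \<rho>: "\<rho> \<ge> 1" "q \<le> \<rho>" "\<sigma> \<le> \<rho>" using q by (auto simp: \<rho>_def)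
  obtain C where C: "C > 0" "\<And>(S :: (int ^ 'd) set) n (b :: int ^ 'd \<Rightarrow> real) B. finite S \<Longrightarrow> (\<Sum>k\<in>S. (b k)\<^sup>2) \<le> B \<Longrightarrow>
    avgs S n (\<lambda>As. Lnorm \<rho> (trig S (\<lambda>k. of_real (b k * (\<Sum>A\<leftarrow>As. sgn_of A k)))) powr \<rho>) \<le> C * (real n * B) powr (\<rho>/2)"
    using avgs_Lnorm_powr[OF \<rho>(1), where 'd = 'd] by blast
  define C1 :: real where "C1 = (2*pi) ^ CARD('d) + 1"
  have C1: "C1 > 0" by (simp add: C1_def add_nonneg_pos)
  define C2 where "C2 = C1 * C powr (1/\<rho>) * sqrt (5 ^ CARD('d))"
  have C2: "C2 > 0" using C1 C by (simp add: C2_def)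
  have "avgs S n (\<lambda>As. trig_besov l q \<sigma> S (\<lambda>k. of_real (\<Sum>A\<leftarrow>As. sgn_of A k)))
      \<le> (2 * C2) * (2 powr (l * real J) * sqrt (real n * 2 ^ J) * h powr (1/\<sigma>))"
    if S: "finite S" and n: "n \<ge> 1" and J: "\<forall>m\<in>act S. level m \<le> J" and h: "real (card (act S)) \<le> h" "h > 0"
    for S :: "(int ^ 'd) set" and n J h
  proof -
    \<comment> \<open>The typical weighted norm of a block of level at most \<open>J\<close>: it has
      at most 5^d 2^J frequencies, d being the dimension, each with a sum of n signs. Division by
      \<open>t\<close> brings the \<rho>-th moment down to at most 1.\<close>
    define t where "t = 2 powr (l * real J) * C2 * sqrt (real n * 2 ^ J)"
    have t: "t > 0" using C2 n by (simp add: t_def)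
    let ?f = "\<lambda>As. trig S (\<lambda>k. complex_of_real (\<Sum>A\<leftarrow>As. sgn_of A k))"
    let ?b = "\<lambda>m As. bl l q m (?f As)"
    have mom: "avgs S n (\<lambda>As. (?b m As / t) powr \<rho>) \<le> 1" if m: "m \<in> act S" for m
    proof -
      have lev: "level m \<le> J" using J m by blast
      have "(\<Sum>k\<in>S. (ev m k)\<^sup>2) = (\<Sum>k\<in>S \<inter> box m. (ev m k)\<^sup>2)"
        by (rule sum.mono_neutral_right) (use S ev_zero in auto)
      also have "\<dots> \<le> (\<Sum>k\<in>box m. (ev m k)\<^sup>2)" by (rule sum_mono2) auto
      also have "\<dots> \<le> real (card (box m)) * 1"
        using abs_ev_le[of m] by (intro sum_bounded_above) (simp add: abs_square_le_1)
      also have "\<dots> \<le> 5 ^ CARD('d) * 2 ^ level m" using card_box[of m] by simp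
      also have "\<dots> \<le> 5 ^ CARD('d) * 2 ^ J" using lev by (intro mult_left_mono power_increasing) auto
      finally have B: "(\<Sum>k\<in>S. (ev m k)\<^sup>2) \<le> 5 ^ CARD('d) * 2 ^ J" .
      have bm: "?b m As \<le> 2 powr (l * real J) * (C1 * Lnorm \<rho> (trig S (\<lambda>k. of_real (ev m k * (\<Sum>A\<leftarrow>As. sgn_of A k)))))" for As
      proof -
        have "Delta \<eta>0 m (?f As) = trig S (\<lambda>k. of_real (ev m k * (\<Sum>A\<leftarrow>As. sgn_of A k)))"
          unfolding Delta_trig[OF S] by simp
        moreover have "Lnorm q (trig S (\<lambda>k. of_real (ev m k * (\<Sum>A\<leftarrow>As. sgn_of A k))))
          \<le> C1 * Lnorm \<rho> (trig S (\<lambda>k. of_real (ev m k * (\<Sum>A\<leftarrow>As. sgn_of A k))))"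
          unfolding C1_def by (rule Lnorm_mono[OF continuous_trig q(1) \<rho>(2)])
        moreover have "2 powr (l * real (level m)) \<le> (2::real) powr (l * real J)"
          using lev l by (intro powr_mono mult_left_mono) auto
        ultimately show ?thesis unfolding bl_def using C1 by (intro mult_mono) auto
      qed
      have "avgs S n (\<lambda>As. (?b m As / t) powr \<rho>)
         \<le> avgs S n (\<lambda>As. (2 powr (l * real J) * C1 / t) powr \<rho> * Lnorm \<rho> (trig S (\<lambda>k. of_real (ev m k * (\<Sum>A\<leftarrow>As. sgn_of A k)))) powr \<rho>)"
      proof (rule avgs_mono)
        fix As
        let ?L = "Lnorm \<rho> (trig S (\<lambda>k. of_real (ev m k * (\<Sum>A\<leftarrow>As. sgn_of A k))))"
        have "?b m As / t \<le> (2 powr (l * real J) * C1 / t) * ?L"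
          using bm[of As] t by (simp add: divide_right_mono mult.assoc)
        then have "(?b m As / t) powr \<rho> \<le> ((2 powr (l * real J) * C1 / t) * ?L) powr \<rho>"
          using \<rho> t by (intro powr_mono2) auto
        also have "\<dots> = (2 powr (l * real J) * C1 / t) powr \<rho> * ?L powr \<rho>"
          by (rule powr_mult)
        finally show "(?b m As / t) powr \<rho> \<le> (2 powr (l * real J) * C1 / t) powr \<rho> * ?L powr \<rho>" .
      qed
      also have "\<dots> \<le> (2 powr (l * real J) * C1 / t) powr \<rho> * (C * (real n * (5 ^ CARD('d) * 2 ^ J)) powr (\<rho>/2))"
        unfolding avgs_cmult by (intro mult_left_mono C(2) S B) auto
      also have "C * (real n * (5 ^ CARD('d) * 2 ^ J)) powr (\<rho>/2)
        = (C powr (1/\<rho>) * sqrt (real n * (5 ^ CARD('d) * 2 ^ J))) powr \<rho>"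
        using C \<rho> by (simp add: powr_mult powr_powr powr_half_sqrt[symmetric])
      also have "(2 powr (l * real J) * C1 / t) powr \<rho> * \<dots>
        = (2 powr (l * real J) * C1 / t * (C powr (1/\<rho>) * sqrt (real n * (5 ^ CARD('d) * 2 ^ J)))) powr \<rho>"
        by (rule powr_mult[symmetric])
      also have "2 powr (l * real J) * C1 / t * (C powr (1/\<rho>) * sqrt (real n * (5 ^ CARD('d) * 2 ^ J))) = 1"
        using C1 C n by (simp add: t_def C2_def real_sqrt_mult)
      finally show ?thesis by simp
    qed
    have pt: "trig_besov l q \<sigma> S (\<lambda>k. of_real (\<Sum>A\<leftarrow>As. sgn_of A k))
      \<le> t * h powr (1/\<sigma>) * (1 + (1/h) * (\<Sum>m\<in>act S. (?b m As / t) powr \<rho>))" for As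
    proof -
      have "?b m As powr \<sigma> \<le> t powr \<sigma> * (1 + (?b m As / t) powr \<rho>)" for m
      proof -
        have "(?b m As / t) powr \<sigma> \<le> 1 + (?b m As / t) powr \<rho>" using t q \<rho> by (intro powr_le_one_plus) auto
        then have "t powr \<sigma> * (?b m As / t) powr \<sigma> \<le> t powr \<sigma> * (1 + (?b m As / t) powr \<rho>)" by (intro mult_left_mono) auto
        then show ?thesis using t by (simp add: powr_divide)
      qed
      then have "(\<Sum>m\<in>act S. ?b m As powr \<sigma>) \<le> (\<Sum>m\<in>act S. t powr \<sigma> * (1 + (?b m As / t) powr \<rho>))" by (intro sum_mono)
      also have "\<dots> = t powr \<sigma> * (real (card (act S)) + (\<Sum>m\<in>act S. (?b m As / t) powr \<rho>))"
        by (simp add: sum_distrib_left[symmetric] sum.distrib)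
      also have "\<dots> \<le> t powr \<sigma> * (h + (\<Sum>m\<in>act S. (?b m As / t) powr \<rho>))" using h by (intro mult_left_mono) auto
      also have "\<dots> = t powr \<sigma> * (h * (1 + (1/h) * (\<Sum>m\<in>act S. (?b m As / t) powr \<rho>)))" using h by (simp add: field_simps)
      finally have le: "(\<Sum>m\<in>act S. ?b m As powr \<sigma>) \<le> t powr \<sigma> * (h * (1 + (1/h) * (\<Sum>m\<in>act S. (?b m As / t) powr \<rho>)))" .
      let ?Z = "1 + (1/h) * (\<Sum>m\<in>act S. (?b m As / t) powr \<rho>)"
      have Z: "?Z \<ge> 1" using h by (simp add: sum_nonneg)
      have "trig_besov l q \<sigma> S (\<lambda>k. of_real (\<Sum>A\<leftarrow>As. sgn_of A k)) \<le> (t powr \<sigma> * (h * ?Z)) powr (1/\<sigma>)"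
        unfolding trig_besov_def using q le by (intro powr_mono2) (auto intro: sum_nonneg)
      also have "\<dots> = t * h powr (1/\<sigma>) * ?Z powr (1/\<sigma>)"
        using t h Z q by (simp add: powr_mult powr_powr)
      \<comment> \<open>As \<open>?Z\<close> is at least 1, dropping the root makes the bound linear
        in the \<rho>-th powers, and the mean can be taken term by term.\<close>
      also have "?Z powr (1/\<sigma>) \<le> ?Z powr 1" using Z q by (intro powr_mono) auto
      finally show ?thesis using Z t h by (simp add: mult_left_mono)
    qed
    have "avgs S n (\<lambda>As. trig_besov l q \<sigma> S (\<lambda>k. of_real (\<Sum>A\<leftarrow>As. sgn_of A k)))
      \<le> avgs S n (\<lambda>As. t * h powr (1/\<sigma>) * (1 + (1/h) * (\<Sum>m\<in>act S. (?b m As / t) powr \<rho>)))"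
      by (rule avgs_mono) (rule pt)
    also have "\<dots> = t * h powr (1/\<sigma>) * (1 + (1/h) * (\<Sum>m\<in>act S. avgs S n (\<lambda>As. (?b m As / t) powr \<rho>)))"
      unfolding avgs_cmult avgs_add avgs_const[OF S] avgs_sum[OF finite_act[OF S]] ..
    also have "\<dots> \<le> t * h powr (1/\<sigma>) * (1 + (1/h) * h)"
    proof -
      have "(\<Sum>m\<in>act S. avgs S n (\<lambda>As. (?b m As / t) powr \<rho>)) \<le> real (card (act S)) * 1"
        by (rule sum_bounded_above) (rule mom)
      then show ?thesis using t h by (intro mult_left_mono add_mono) auto
    qed
    finally show ?thesis using h by (simp add: t_def mult_ac)
  qed
  then show ?thesis using C2 by (intro exI[of _ "2 * C2"]) auto
qed

section \<open>Approximation within one level\<close>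

definition freqs_level :: "nat \<Rightarrow> (int ^ 'd) set" where
  "freqs_level j = {k. \<exists>m\<in>levelset j. ev m k \<noteq> 0}"

lemma finite_freqs_level [simp]: "finite (freqs_level j :: (int ^ 'd) set)"
proof (rule finite_subset)
  show "freqs_level j \<subseteq> (\<Union>m\<in>levelset j. box m)" using ev_zero by (fastforce simp: freqs_level_def)
qed auto

lemma act_freqs_level:
  assumes "m' \<in> act (freqs_level j :: (int ^ 'd) set)"
  shows "level m' \<le> j + CARD('d)" "\<exists>m\<in>levelset j. m' \<in> near m"
proof -
  show *: "\<exists>m\<in>levelset j. m' \<in> near m" using assms ev_near by (fastforce simp: act_def freqs_level_def)
  then show "level m' \<le> j + CARD('d)" using level_near by (force simp: levelset_def)
qed

lemma card_act_freqs_level: "card (act (freqs_level j :: (int ^ 'd) set)) \<le> 3 ^ CARD('d) * (j + 1) ^ (CARD('d) - 1)"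
proof -
  have "card (act (freqs_level j :: (int ^ 'd) set)) \<le> card (\<Union>m\<in>(levelset j :: (nat ^ 'd) set). near m)"
    by (rule card_mono) (use act_freqs_level(2) in auto)
  also have "\<dots> \<le> (\<Sum>m\<in>(levelset j :: (nat ^ 'd) set). card (near m))" by (rule card_UN_le) simp
  also have "\<dots> \<le> card (levelset j :: (nat ^ 'd) set) * 3 ^ CARD('d)"
    using sum_bounded_above[of "levelset j :: (nat ^ 'd) set" "\<lambda>m. card (near m)" "3 ^ CARD('d)", OF card_near] by simp
  also have "\<dots> \<le> (j + 1) ^ (CARD('d) - 1) * 3 ^ CARD('d)" by (intro mult_right_mono card_levelset_le) auto
  finally show ?thesis by (simp add: mult.commute)
qed

text \<open>The vectors \<open>g\<close> come before \<open>v\<close>: a single system serves all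
  coefficient vectors of the level. The power of j + 1 stands for the number of blocks to the power
  1/\<sigma>.\<close>

abbreviation level_vectors :: "real \<Rightarrow> real \<Rightarrow> real \<Rightarrow> real \<Rightarrow> nat \<Rightarrow> nat \<Rightarrow> (nat \<Rightarrow> int ^ 'd \<Rightarrow> complex) \<Rightarrow> bool" where
  "level_vectors l q \<sigma> C j n g \<equiv> \<forall>v V. V \<ge> 0 \<longrightarrow> (\<Sum>k\<in>freqs_level j. (norm (v k))\<^sup>2) \<le> V\<^sup>2 \<longrightarrow>
    (\<exists>c. trig_besov l q \<sigma> (freqs_level j) (\<lambda>k. v k - (\<Sum>i<n. c i * g i k))
      \<le> C * (V * (2 powr (l * real j) * sqrt (2 ^ j / real n) * (real j + 1) powr ((real CARD('d) - 1) / \<sigma>))))"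

text \<open>Real and imaginary parts of the coefficients are approximated separately by the same vectors.\<close>

lemma level_approx:
  assumes q: "q \<ge> 1" "\<sigma> \<ge> 1" and l: "l \<ge> 0"
  shows "\<exists>C>0. \<forall>j n. n \<ge> 1 \<longrightarrow> (\<exists>g :: nat \<Rightarrow> int ^ 'd \<Rightarrow> complex. level_vectors l q \<sigma> C j n g)"
proof -
  let ?d = "CARD('d)"
  obtain C where C: "C > 0" "\<And>(S :: (int ^ 'd) set) n J h. finite S \<Longrightarrow> n \<ge> 1 \<Longrightarrow> (\<forall>m\<in>act S. level m \<le> J) \<Longrightarrow>
     real (card (act S)) \<le> h \<Longrightarrow> h > 0 \<Longrightarrow>
    avgs S n (\<lambda>As. trig_besov l q \<sigma> S (\<lambda>k. of_real (\<Sum>A\<leftarrow>As. sgn_of A k)))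
      \<le> C * (2 powr (l * real J) * sqrt (real n * 2 ^ J) * h powr (1/\<sigma>))"
    using avgs_trig_besov[OF q l, where 'd = 'd] by blast
  define C' where "C' = C * 2 powr (l * real ?d) * sqrt (2 ^ ?d) * (3 ^ ?d) powr (1/\<sigma>)"
  have C': "C' > 0" using C by (simp add: C'_def)
  have "\<exists>g :: nat \<Rightarrow> int ^ 'd \<Rightarrow> complex. level_vectors l q \<sigma> (18 * C') j n g"
    if n: "n \<ge> 1" for j n
  proof -
    let ?S = "freqs_level j :: (int ^ 'd) set"
    let ?N = "\<lambda>v :: int ^ 'd \<Rightarrow> real. trig_besov l q \<sigma> ?S (\<lambda>k. of_real (v k))"
    define R where "R = 2 powr (l * real j) * sqrt (2 ^ j) * (real j + 1) powr ((real ?d - 1) / \<sigma>)"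
    have R: "R > 0" by (simp add: R_def)
    \<comment> \<open>The mean norm grows like sqrt n, so that 9 * E / n yields the factor 1 / sqrt
      n.\<close>
    define E where "E = C' * sqrt (real n) * R"
    have E0: "E > 0" using C' R n by (simp add: E_def)
    let ?h = "3 ^ ?d * (real j + 1) ^ (?d - 1)"
    have h1: "?h powr (1/\<sigma>) = (3 ^ ?d) powr (1/\<sigma>) * (real j + 1) powr ((real ?d - 1) / \<sigma>)"
    proof -
      have "(real j + 1) ^ (?d - 1) = (real j + 1) powr (real (?d - 1))" by (subst powr_realpow) auto
      moreover have "real (?d - 1) = real ?d - 1" by (simp add: of_nat_diff)
      ultimately show ?thesis by (simp add: powr_mult powr_powr)
    qed
    have "real (card (act ?S)) \<le> real (3 ^ ?d * (j + 1) ^ (?d - 1))"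
      using card_act_freqs_level[where 'd = 'd, of j] by (simp only: of_nat_le_iff)
    also have "\<dots> = ?h" by (simp add: add.commute)
    finally have "avgs ?S n (\<lambda>As. ?N (\<lambda>k. \<Sum>A\<leftarrow>As. sgn_of A k))
       \<le> C * (2 powr (l * real (j + ?d)) * sqrt (real n * 2 ^ (j + ?d)) * ?h powr (1/\<sigma>))"
      by (intro C(2)[OF _ n]) (use act_freqs_level(1) in auto)
    also have "\<dots> = E"
      unfolding h1 E_def C'_def R_def by (simp add: powr_add distrib_left power_add real_sqrt_mult mult_ac)
    finally have E: "avgs ?S n (\<lambda>As. ?N (\<lambda>k. \<Sum>A\<leftarrow>As. sgn_of A k)) \<le> E" .
    obtain As where As: "\<And>v. l2 ?S v \<le> 1 \<Longrightarrow> \<exists>c. ?N (\<lambda>k. v k - (\<Sum>i<n. c i * sgn_of (As ! i) k)) \<le> 9 * E / real n"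
      using Euclidean_ball_approx[OF finite_freqs_level seminorm_trig_besov[OF finite_freqs_level q] n E E0] by blast
    have scaled: "\<exists>c. ?N (\<lambda>k. v k - (\<Sum>i<n. c i * sgn_of (As ! i) k)) \<le> V * (9 * E / real n)"
      if V: "V \<ge> 0" and v: "(\<Sum>k\<in>?S. (v k)\<^sup>2) \<le> V\<^sup>2" for v V
    proof (cases "V = 0")
      case True
      then have "(\<Sum>k\<in>?S. (v k)\<^sup>2) = 0" using v by (simp add: sum_nonneg antisym)
      then have z: "\<forall>k\<in>?S. v k = 0" by (simp add: sum_nonneg_eq_0_iff)
      have "?N (\<lambda>k. v k - (\<Sum>i<n. 0 * sgn_of (As ! i) k)) = ?N (\<lambda>k. 0 * v k)"
        using z by (intro trig_besov_cong) auto
      also have "\<dots> = 0" using seminorm_onD(2)[OF seminorm_trig_besov[OF finite_freqs_level q], where c = 0 and u = v] by simp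
      finally show ?thesis using True by (intro exI[of _ "\<lambda>_. 0"]) simp
    next
      case False
      then have V: "V > 0" using V by simp
      have "l2 ?S (\<lambda>k. (1/V) * v k) \<le> 1"
      proof -
        have "l2 ?S v \<le> V" unfolding l2_def by (rule real_le_lsqrt) (use v V in \<open>auto intro: sum_nonneg\<close>)
        then show ?thesis using V unfolding l2_scale by simp
      qed
      then obtain c where c: "?N (\<lambda>k. (1/V) * v k - (\<Sum>i<n. c i * sgn_of (As ! i) k)) \<le> 9 * E / real n" using As by blast
      have "?N (\<lambda>k. v k - (\<Sum>i<n. (V * c i) * sgn_of (As ! i) k)) = ?N (\<lambda>k. V * ((1/V) * v k - (\<Sum>i<n. c i * sgn_of (As ! i) k)))"
        using V by (intro arg_cong[where f = ?N] ext) (simp add: right_diff_distrib sum_distrib_left mult.assoc)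
      also have "\<dots> = \<bar>V\<bar> * ?N (\<lambda>k. (1/V) * v k - (\<Sum>i<n. c i * sgn_of (As ! i) k))"
        by (rule seminorm_onD(2)[OF seminorm_trig_besov[OF finite_freqs_level q]])
      also have "\<dots> \<le> V * (9 * E / real n)" using mult_left_mono[OF c, of V] V by (simp only: abs_of_pos)
      finally show ?thesis by (rule exI[of _ "\<lambda>i. V * c i"])
    qed
    show ?thesis
    proof (intro exI[of _ "\<lambda>i k. complex_of_real (sgn_of (As ! i) k)"] allI impI)
      fix v :: "int ^ 'd \<Rightarrow> complex" and V :: real
      assume V: "V \<ge> 0" and v: "(\<Sum>k\<in>?S. (norm (v k))\<^sup>2) \<le> V\<^sup>2"
      have "(\<Sum>k\<in>?S. (Re (v k))\<^sup>2) \<le> (\<Sum>k\<in>?S. (norm (v k))\<^sup>2)" "(\<Sum>k\<in>?S. (Im (v k))\<^sup>2) \<le> (\<Sum>k\<in>?S. (norm (v k))\<^sup>2)"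
        by (intro sum_mono, simp add: cmod_power2)+
      then obtain c c' where
        c: "?N (\<lambda>k. Re (v k) - (\<Sum>i<n. c i * sgn_of (As ! i) k)) \<le> V * (9 * E / real n)" and
        c': "?N (\<lambda>k. Im (v k) - (\<Sum>i<n. c' i * sgn_of (As ! i) k)) \<le> V * (9 * E / real n)"
        using scaled[OF V, of "\<lambda>k. Re (v k)"] scaled[OF V, of "\<lambda>k. Im (v k)"] v by (meson order_trans)
      let ?cc = "\<lambda>i. complex_of_real (c i) + \<i> * complex_of_real (c' i)"
      let ?u = "\<lambda>k. complex_of_real (Re (v k) - (\<Sum>i<n. c i * sgn_of (As ! i) k))"
      let ?u' = "\<lambda>k. complex_of_real (Im (v k) - (\<Sum>i<n. c' i * sgn_of (As ! i) k))"
      have "trig_besov l q \<sigma> ?S (\<lambda>k. v k - (\<Sum>i<n. ?cc i * complex_of_real (sgn_of (As ! i) k)))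
        = trig_besov l q \<sigma> ?S (\<lambda>k. ?u k + \<i> * ?u' k)"
        by (intro arg_cong[where f = "trig_besov l q \<sigma> ?S"] ext) (simp add: complex_eq_iff)
      also have "\<dots> \<le> trig_besov l q \<sigma> ?S ?u + trig_besov l q \<sigma> ?S (\<lambda>k. \<i> * ?u' k)"
        by (rule trig_besov_triangle[OF finite_freqs_level q])
      also have "trig_besov l q \<sigma> ?S (\<lambda>k. \<i> * ?u' k) = trig_besov l q \<sigma> ?S ?u'"
        using trig_besov_scale[OF finite_freqs_level q, of l j \<i> ?u'] by simp
      also have "trig_besov l q \<sigma> ?S ?u + trig_besov l q \<sigma> ?S ?u' \<le> 2 * (V * (9 * E / real n))" using add_mono[OF c c'] by (simp only: mult_2)
      also have "\<dots> = (18 * C') * (V * (R * (sqrt (real n) / real n)))" by (simp add: E_def)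
      also have "sqrt (real n) / real n = 1 / sqrt (real n)" using n by (simp add: field_simps)
      also have "R * (1 / sqrt (real n)) = 2 powr (l * real j) * sqrt (2 ^ j / real n) * (real j + 1) powr ((real ?d - 1) / \<sigma>)"
        by (simp add: R_def real_sqrt_divide)
      finally show "\<exists>c. trig_besov l q \<sigma> ?S (\<lambda>k. v k - (\<Sum>i<n. c i * complex_of_real (sgn_of (As ! i) k)))
      \<le> (18 * C') * (V * (2 powr (l * real j) * sqrt (2 ^ j / real n) * (real j + 1) powr ((real ?d - 1) / \<sigma>)))"
        by (intro exI[of _ ?cc])
    qed
  qed
  then show ?thesis using C' by (intro exI[of _ "18 * C'"]) auto
qed

end

section \<open>Upper bounds\<close>

lemma sum_powr_le:
  fixes b :: "'i \<Rightarrow> real"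
  assumes N: "finite N" and P: "real (card N) \<le> P" and b: "\<And>i. i \<in> N \<Longrightarrow> b i \<ge> 0" and s: "s > 0"
  shows "(\<Sum>i\<in>N. b i) powr s \<le> P powr s * (\<Sum>i\<in>N. b i powr s)"
proof (cases "N = {}")
  case False
  define mx where "mx = Max (b ` N)"
  have "mx \<in> b ` N" unfolding mx_def using N False by (intro Max_in) auto
  then obtain i0 where i0: "i0 \<in> N" "mx = b i0" by auto
  have "(\<Sum>i\<in>N. b i) \<le> real (card N) * mx"
    by (rule sum_bounded_above) (use N in \<open>auto simp: mx_def\<close>)
  also have "\<dots> \<le> P * mx" using P b[OF i0(1)] i0(2) by (intro mult_right_mono) auto
  finally have "(\<Sum>i\<in>N. b i) powr s \<le> (P * mx) powr s" using s b by (intro powr_mono2) (auto intro: sum_nonneg)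
  also have "\<dots> = P powr s * b i0 powr s" by (simp add: powr_mult i0)
  also have "b i0 powr s \<le> (\<Sum>i\<in>N. b i powr s)" by (rule member_le_sum[OF i0(1)]) (use N in auto)
  finally show ?thesis by (simp add: mult_left_mono)
qed simp

lemma powr_sum_le_sum_powr:
  fixes b :: "'i \<Rightarrow> real"
  assumes N: "finite N" and b: "\<And>i. i \<in> N \<Longrightarrow> b i \<ge> 0" and s: "s \<ge> 1"
  shows "(\<Sum>i\<in>N. b i powr s) \<le> (\<Sum>i\<in>N. b i) powr s"
proof -
  define T where "T = (\<Sum>i\<in>N. b i)"
  show ?thesis
  proof (cases "T = 0")
    case True
    then have "\<forall>i\<in>N. b i = 0" using N b unfolding T_def by (subst (asm) sum_nonneg_eq_0_iff) auto
    then show ?thesis by simp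
  next
    case False
    then have T: "T > 0" using b unfolding T_def by (simp add: less_le sum_nonneg)
    have "b i powr s \<le> T powr s * (b i / T)" if "i \<in> N" for i
    proof -
      have bi: "0 \<le> b i / T" "b i / T \<le> 1" using b[OF that] T member_le_sum[OF that, of b] N b by (auto simp: T_def)
      have "(b i / T) powr s \<le> (b i / T) powr 1" using bi s by (intro powr_mono') auto
      also have "\<dots> = b i / T" by (rule powr_one[OF bi(1)])
      finally have "T powr s * (b i / T) powr s \<le> T powr s * (b i / T)" by (intro mult_left_mono) auto
      then show ?thesis using T by (simp add: powr_divide)
    qed
    then have "(\<Sum>i\<in>N. b i powr s) \<le> (\<Sum>i\<in>N. T powr s * (b i / T))" by (rule sum_mono)
    also have "\<dots> = T powr s * (T / T)" by (simp add: sum_distrib_left[symmetric] sum_divide_distrib[symmetric] T_def)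
    finally show ?thesis using T by (simp add: T_def)
  qed
qed

lemma sum_polynomial_exponential_bound:
  assumes "\<delta> > 0" "b \<ge> 0"
  shows "\<exists>C>0. \<forall>J. finite J \<longrightarrow> (\<Sum>i\<in>J. (real i + 1) powr b * 2 powr (- \<delta> * real i)) \<le> C"
proof -
  obtain C where C: "C > 0" "\<And>x. x \<ge> 0 \<Longrightarrow> (x + 1) powr b * 2 powr (- (\<delta>/2) * x) \<le> (C::real)"
    using polynomial_exponential_bound[of "\<delta>/2" b] assms by auto
  define z where "z = 2 powr (- (\<delta>/2))"
  have z: "0 < z" "z < 1" using assms powr_less_mono[of "- (\<delta>/2)" 0 2] by (simp_all add: z_def)
  have "(\<Sum>i\<in>J. (real i + 1) powr b * 2 powr (- \<delta> * real i)) \<le> C * (1 / (1 - z))" if J: "finite J" for J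
  proof -
    have "(real i + 1) powr b * 2 powr (- \<delta> * real i) \<le> C * z ^ i" for i
    proof -
      have "2 powr (- \<delta> * real i) = 2 powr (- (\<delta>/2) * real i) * z ^ i"
      proof -
        have "z ^ i = 2 powr (- (\<delta>/2) * real i)" unfolding z_def by (simp add: powr_power mult.commute)
        then show ?thesis by (simp add: powr_add[symmetric])
      qed
      then have "(real i + 1) powr b * 2 powr (- \<delta> * real i) = ((real i + 1) powr b * 2 powr (- (\<delta>/2) * real i)) * z ^ i" by simp
      also have "\<dots> \<le> C * z ^ i" using C(2)[of "real i"] z by (intro mult_right_mono) auto
      finally show ?thesis .
    qed
    then have "(\<Sum>i\<in>J. (real i + 1) powr b * 2 powr (- \<delta> * real i)) \<le> (\<Sum>i\<in>J. C * z ^ i)" by (rule sum_mono)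
    also have "\<dots> = C * (\<Sum>i\<in>J. z ^ i)" by (simp add: sum_distrib_left)
    also have "(\<Sum>i\<in>J. z ^ i) \<le> suminf (\<lambda>i. z ^ i)"
      using z J by (intro sum_le_suminf summable_geometric) auto
    also have "suminf (\<lambda>i. z ^ i) = 1 / (1 - z)" using z by (intro suminf_geometric) auto
    finally show ?thesis using C by simp
  qed
  moreover have "C * (1 / (1 - z)) > 0" using C z by simp
  ultimately show ?thesis by blast
qed

lemma sum_by_level:
  fixes f :: "nat ^ 'd \<Rightarrow> real"
  assumes "finite G"
  shows "(\<Sum>m\<in>G. f m) = (\<Sum>j\<in>level ` G. \<Sum>m\<in>G \<inter> levelset j. f m)"
proof -
  have "G \<inter> levelset j = {x \<in> G. level x = j}" for j by (auto simp: levelset_def)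
  then show ?thesis using sum.image_gen[OF assms, of f level] by simp
qed

context cutoff
begin

lemma Delta_sum:
  assumes "finite T" "\<And>m. m \<in> T \<Longrightarrow> integrable torus_measure (f m :: real ^ 'd \<Rightarrow> complex)"
  shows "Delta \<eta>0 m' (\<lambda>x. \<Sum>m\<in>T. f m x) = (\<lambda>x. \<Sum>m\<in>T. Delta \<eta>0 m' (f m) x)"
  unfolding Delta_trig_form trig_sum
  using fourier_coeff_sum[OF assms, where c = "\<lambda>_. 1"] assms by (simp add: sum_distrib_left)

text \<open>Subtracting the blocks of \<open>T\<close> does not remove them exactly, since blocks
  overlap. But in block m' the pieces coming from near members of \<open>T\<close> cancel, so only
  near blocks outside \<open>T\<close> remain. At most 3^d of these occur, and each of them is met
  by at most 3^d indices m', where d is the dimension; both counts enter \<open>C'\<close>.\<close>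

lemma rest_bound:
  assumes q: "q \<ge> 1" "\<sigma> \<ge> 1" and l: "l \<ge> 0"
  shows "\<exists>C>0. \<forall>(x :: real ^ 'd \<Rightarrow> complex) T R. x \<in> torus_Lp (ennreal q) \<longrightarrow> finite T \<longrightarrow> R \<ge> 0 \<longrightarrow>
    (\<forall>G. finite G \<longrightarrow> G \<inter> T = {} \<longrightarrow> (\<Sum>m\<in>G. bl l q m x powr \<sigma>) \<le> R powr \<sigma>) \<longrightarrow>
    bnorm l q \<sigma> (x - (\<lambda>t. \<Sum>m\<in>T. Delta \<eta>0 m x t)) \<le> ennreal (C * R)"
proof -
  let ?d = "CARD('d)"
  obtain C where C: "C \<ge> 1" "\<And>(m :: nat ^ 'd) m' f. Lnorm q (Delta \<eta>0 m' (Delta \<eta>0 m f)) \<le> C * Lnorm q (Delta \<eta>0 m f)"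
    using Delta_Delta_bound[where 'd = 'd] q by blast
  define C1 where "C1 = C * 2 powr (l * real ?d) * 3 ^ ?d"
  have C1: "C1 > 0" using C by (simp add: C1_def)
  define C' where "C' = C1 * (3 ^ ?d) powr (1/\<sigma>)"
  have C': "C' > 0" using C1 by (simp add: C'_def)
  have "bnorm l q \<sigma> (x - (\<lambda>t. \<Sum>m\<in>T. Delta \<eta>0 m x t)) \<le> ennreal (C' * R)"
    if x: "x \<in> torus_Lp (ennreal q)" and T: "finite T" and R: "R \<ge> 0"
      and rest: "\<forall>G. finite G \<longrightarrow> G \<inter> T = {} \<longrightarrow> (\<Sum>m\<in>G. bl l q m x powr \<sigma>) \<le> R powr \<sigma>"
    for x :: "real ^ 'd \<Rightarrow> complex" and T R
  proof -
    let ?w = "x - (\<lambda>t. \<Sum>m\<in>T. Delta \<eta>0 m x t)"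
    have ix: "integrable torus_measure x" by (rule torus_Lp_integrable[OF x q(1)])
    have iD: "integrable torus_measure (Delta \<eta>0 m x)" for m
      by (rule continuous_integrable_torus[OF continuous_Delta])
    have iS: "integrable torus_measure (\<lambda>t. \<Sum>m\<in>T. Delta \<eta>0 m x t)" using iD by auto
    have w: "?w = (\<lambda>t. 1 * x t + (-1) * (\<Sum>m\<in>T. Delta \<eta>0 m x t))" by (simp add: fun_eq_iff)
    have w': "?w = (\<lambda>t. x t + (\<Sum>m\<in>T. (-1) * Delta \<eta>0 m x t))" by (simp add: fun_eq_iff sum_negf)
    have wL: "?w \<in> torus_Lp (ennreal q)"
      unfolding w' using q by (intro torus_Lp_add x continuous_torus_Lp continuous_intros) auto
    have Dw: "Delta \<eta>0 m' ?w = (\<lambda>t. \<Sum>m\<in>near m' - T. Delta \<eta>0 m' (Delta \<eta>0 m x) t)" for m'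
    proof
      fix t
      have "Delta \<eta>0 m' ?w t = Delta \<eta>0 m' x t - (\<Sum>m\<in>T. Delta \<eta>0 m' (Delta \<eta>0 m x) t)"
        unfolding w Delta_linear[OF ix iS] Delta_sum[OF T iD] by simp
      also have "Delta \<eta>0 m' x t = (\<Sum>m\<in>near m'. Delta \<eta>0 m' (Delta \<eta>0 m x) t)"
        by (subst Delta_reproducing) simp
      also have "(\<Sum>m\<in>T. Delta \<eta>0 m' (Delta \<eta>0 m x) t) = (\<Sum>m\<in>near m' \<inter> T. Delta \<eta>0 m' (Delta \<eta>0 m x) t)"

      proof -
        have z: "Delta \<eta>0 m' (Delta \<eta>0 m x) t = 0" if "m \<notin> near m'" for m
          using Delta_Delta_zero[of m' m x] that near_sym[of m' m] by simp
        show ?thesis by (rule sum.mono_neutral_right) (use T z in auto)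
      qed
      also have "(\<Sum>m\<in>near m'. Delta \<eta>0 m' (Delta \<eta>0 m x) t) - (\<Sum>m\<in>near m' \<inter> T. Delta \<eta>0 m' (Delta \<eta>0 m x) t)
        = (\<Sum>m\<in>near m' - T. Delta \<eta>0 m' (Delta \<eta>0 m x) t)"
        using sum.Int_Diff[OF finite_near, of "\<lambda>m. Delta \<eta>0 m' (Delta \<eta>0 m x) t" m' T] by simp
      finally show "Delta \<eta>0 m' ?w t = (\<Sum>m\<in>near m' - T. Delta \<eta>0 m' (Delta \<eta>0 m x) t)" .
    qed
    have blw: "bl l q m' ?w \<le> C * 2 powr (l * real ?d) * (\<Sum>m\<in>near m' - T. bl l q m x)" for m'
    proof -
      have "Lnorm q (Delta \<eta>0 m' ?w) \<le> (\<Sum>m\<in>near m' - T. Lnorm q (Delta \<eta>0 m' (Delta \<eta>0 m x)))"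
        unfolding Dw using q by (intro Lnorm_sum continuous_Delta) auto
      also have "\<dots> \<le> (\<Sum>m\<in>near m' - T. C * Lnorm q (Delta \<eta>0 m x))" by (intro sum_mono C)
      finally have "bl l q m' ?w \<le> 2 powr (l * real (level m')) * (\<Sum>m\<in>near m' - T. C * Lnorm q (Delta \<eta>0 m x))"
        unfolding bl_def by (intro mult_left_mono) auto
      also have "\<dots> = (\<Sum>m\<in>near m' - T. 2 powr (l * real (level m')) * (C * Lnorm q (Delta \<eta>0 m x)))"
        by (simp add: sum_distrib_left)
      also have "\<dots> \<le> (\<Sum>m\<in>near m' - T. C * 2 powr (l * real ?d) * bl l q m x)"
      proof (rule sum_mono)
        fix m assume m: "m \<in> near m' - T"
        then have "m' \<in> near m" using near_sym by blast
        then have "real (level m') \<le> real (level m) + real ?d" using level_near[of m' m] by simp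
        then have "l * real (level m') \<le> l * real ?d + l * real (level m)"
          using mult_left_mono[OF _ l] by (fastforce simp: distrib_left)
        then have "2 powr (l * real (level m')) \<le> (2::real) powr (l * real ?d + l * real (level m))" by (intro powr_mono) auto
        then have "2 powr (l * real (level m')) * (C * Lnorm q (Delta \<eta>0 m x))
          \<le> (2 powr (l * real ?d) * 2 powr (l * real (level m))) * (C * Lnorm q (Delta \<eta>0 m x))"
          using C unfolding powr_add by (intro mult_right_mono) auto
        then show "2 powr (l * real (level m')) * (C * Lnorm q (Delta \<eta>0 m x)) \<le> C * 2 powr (l * real ?d) * bl l q m x"
          by (simp add: bl_def mult_ac)
      qed
      finally show ?thesis by (simp add: sum_distrib_left)
    qed
    have "(\<Sum>m'\<in>F. bl l q m' ?w powr \<sigma>) \<le> (C' * R) powr \<sigma>" if F: "finite F" for F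
    proof -
      define G where "G = (\<Union>m'\<in>F. near m') - T"
      have G: "finite G" "G \<inter> T = {}" using F by (auto simp: G_def)
      have "(\<Sum>m'\<in>F. bl l q m' ?w powr \<sigma>) \<le> (\<Sum>m'\<in>F. C1 powr \<sigma> * (\<Sum>m\<in>near m' - T. bl l q m x powr \<sigma>))"
      proof (rule sum_mono)
        fix m'
        have "bl l q m' ?w powr \<sigma> \<le> (C * 2 powr (l * real ?d) * (\<Sum>m\<in>near m' - T. bl l q m x)) powr \<sigma>"
          using q blw by (intro powr_mono2) auto
        also have "\<dots> = (C * 2 powr (l * real ?d)) powr \<sigma> * (\<Sum>m\<in>near m' - T. bl l q m x) powr \<sigma>"
          by (rule powr_mult)
        also have "\<dots> \<le> (C * 2 powr (l * real ?d)) powr \<sigma> * ((3 ^ ?d) powr \<sigma> * (\<Sum>m\<in>near m' - T. bl l q m x powr \<sigma>))"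
        proof (intro mult_left_mono sum_powr_le)
          have "card (near m' - T) \<le> card (near m')" by (intro card_mono) auto
          also have "\<dots> \<le> 3 ^ ?d" by (rule card_near)
          finally have "real (card (near m' - T)) \<le> real (3 ^ ?d)" by (simp only: of_nat_le_iff)
          then show "real (card (near m' - T)) \<le> 3 ^ ?d" by simp
        qed (use q in auto)
        also have "\<dots> = C1 powr \<sigma> * (\<Sum>m\<in>near m' - T. bl l q m x powr \<sigma>)"
          by (simp add: C1_def powr_mult mult.assoc)
        finally show "bl l q m' ?w powr \<sigma> \<le> C1 powr \<sigma> * (\<Sum>m\<in>near m' - T. bl l q m x powr \<sigma>)" .
      qed
      also have "\<dots> = C1 powr \<sigma> * (\<Sum>m'\<in>F. \<Sum>m\<in>near m' - T. bl l q m x powr \<sigma>)" by (simp add: sum_distrib_left)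
      finally have step1: "(\<Sum>m'\<in>F. bl l q m' ?w powr \<sigma>) \<le> C1 powr \<sigma> * (\<Sum>m'\<in>F. \<Sum>m\<in>near m' - T. bl l q m x powr \<sigma>)" .
      have "(\<Sum>m'\<in>F. \<Sum>m\<in>near m' - T. bl l q m x powr \<sigma>) = (\<Sum>m'\<in>F. \<Sum>m | m \<in> G \<and> m \<in> near m'. bl l q m x powr \<sigma>)"
        by (intro sum.cong) (auto simp: G_def)
      also have "\<dots> = (\<Sum>m\<in>G. \<Sum>m' | m' \<in> F \<and> m \<in> near m'. bl l q m x powr \<sigma>)"
        by (rule sum.swap_restrict[OF F G(1)])
      also have "\<dots> \<le> (\<Sum>m\<in>G. 3 ^ ?d * bl l q m x powr \<sigma>)"
      proof (rule sum_mono)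
        fix m
        have "card {m' \<in> F. m \<in> near m'} \<le> card (near m)" by (rule card_mono) (use near_sym in auto)
        also have "\<dots> \<le> 3 ^ ?d" by (rule card_near)
        finally have "real (card {m' \<in> F. m \<in> near m'}) \<le> real (3 ^ ?d)" by (simp only: of_nat_le_iff)
        then show "(\<Sum>m' | m' \<in> F \<and> m \<in> near m'. bl l q m x powr \<sigma>) \<le> 3 ^ ?d * bl l q m x powr \<sigma>"
          by (simp add: mult_right_mono)
      qed
      also have "\<dots> = 3 ^ ?d * (\<Sum>m\<in>G. bl l q m x powr \<sigma>)" by (simp add: sum_distrib_left)
      also have "\<dots> \<le> 3 ^ ?d * R powr \<sigma>" using rest G by (intro mult_left_mono) auto
      finally have "C1 powr \<sigma> * (\<Sum>m'\<in>F. \<Sum>m\<in>near m' - T. bl l q m x powr \<sigma>) \<le> C1 powr \<sigma> * (3 ^ ?d * R powr \<sigma>)"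
        by (intro mult_left_mono) auto
      with step1 have "(\<Sum>m'\<in>F. bl l q m' ?w powr \<sigma>) \<le> C1 powr \<sigma> * (3 ^ ?d * R powr \<sigma>)" by (rule order_trans)
      also have "\<dots> = (C' * R) powr \<sigma>" using q by (simp add: C'_def powr_mult powr_powr)
      finally show ?thesis .
    qed
    then show ?thesis using q C' R wL by (subst besov_norm_le_iff) auto
  qed
  then show ?thesis using C' by blast
qed

lemma span_trig:
  fixes B :: "(real ^ 'd \<Rightarrow> complex) set"
  assumes "\<And>b. b \<in> B \<Longrightarrow> \<exists>w. b = trig S w" "y \<in> module.span fun_scale B"
  shows "\<exists>w. y = trig S w"
proof -
  interpret vector_space fun_scale by (rule vector_space_fun_scale)
  have "subspace (range (trig S))"
  proof (rule subspaceI)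
    have "trig S (\<lambda>_. 0) = 0" by (simp add: trig_def fun_eq_iff)
    then show "0 \<in> range (trig S)" by (metis rangeI)
    fix u v c assume "u \<in> range (trig S)"
    then obtain a where a: "u = trig S a" by auto
    have "fun_scale c u = trig S (\<lambda>k. c * a k)" by (simp add: a fun_scale_def fun_eq_iff trig_scale)
    then show "fun_scale c u \<in> range (trig S)" by simp
    assume "v \<in> range (trig S)"
    then obtain b where b: "v = trig S b" by auto
    have "u + v = trig S (\<lambda>k. a k + b k)" by (simp add: a b fun_eq_iff trig_add)
    then show "u + v \<in> range (trig S)" by simp
  qed
  moreover have "B \<subseteq> range (trig S)" using assms(1) by auto
  ultimately have "span B \<subseteq> range (trig S)" by (rule span_minimal[rotated])
  then show ?thesis using assms(2) by auto
qed

text \<open>The common finite spectrum \<open>S\<close> of the spanning set ensures that the span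
  lies in the Besov space.\<close>

lemma besov_width_le:
  fixes M :: "(real ^ 'd \<Rightarrow> complex) set"
  assumes q: "q > 0" "\<sigma> > 0" and B: "finite B" "card B \<le> n" and S: "finite S" "\<And>b. b \<in> B \<Longrightarrow> \<exists>w. b = trig S w"
    and appr: "\<And>x. x \<in> M \<Longrightarrow> \<exists>y\<in>module.span fun_scale B. bnorm l q \<sigma> (x - y) \<le> ennreal E"
  shows "besov_width \<eta>0 (\<chi> i. l) (ennreal q) (ennreal \<sigma>) M n \<le> ennreal E"
  unfolding besov_width_def kolmogorov_width_def
proof (rule INF_lower2)
  interpret vector_space fun_scale by (rule vector_space_fun_scale)
  let ?N = "bnorm l q \<sigma>"
  have "?N y < top" if y: "y \<in> span B" for y
  proof -
    obtain w where "y = trig S w" using span_trig[OF S(2) y] by blast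
    then show ?thesis using besov_norm_trig[OF S(1) q, of l w] by (simp add: le_less_trans)
  qed
  then show "span B \<in> {L. subspace L \<and> L \<subseteq> {y. ?N y < top} \<and> (\<exists>B. finite B \<and> card B \<le> n \<and> span B = L)}"
    using B by auto
  show "(SUP x\<in>M. INF y\<in>span B. ?N (x - y)) \<le> ennreal E"
    using appr by (intro SUP_least) (meson INF_lower2)
qed

lemma span_sum_scale:
  assumes "\<And>i. i \<in> J \<Longrightarrow> f i \<in> module.span fun_scale B"
  shows "(\<lambda>x. \<Sum>i\<in>J. c i * f i x) \<in> module.span fun_scale B"
proof -
  interpret vector_space fun_scale by (rule vector_space_fun_scale)
  have e: "(\<Sum>i\<in>J. fun_scale (c i) (f i)) x = (\<Sum>i\<in>J. c i * f i x)" for x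
    by (induction J rule: infinite_finite_induct) (auto simp: fun_scale_def)
  have "(\<Sum>i\<in>J. fun_scale (c i) (f i)) \<in> span B" using assms by (intro span_sum span_scale) auto
  moreover have "(\<Sum>i\<in>J. fun_scale (c i) (f i)) = (\<lambda>x. \<Sum>i\<in>J. c i * f i x)" using e by auto
  ultimately show ?thesis by simp
qed

end

section \<open>Block sizes of the elements of M\<close>

context besov_data
begin

definition Cq :: real where "Cq = (2*pi) ^ CARD('d) + 1"

lemma Cq_ge_1: "Cq \<ge> 1" by (simp add: Cq_def)

lemma bl_shift: "bl l q m x = decay (level m) * bl (r s) q m x"
proof -
  have "2 powr (l * real (level m)) = decay (level m) * 2 powr (r s * real (level m))"
    by (subst powr_add[symmetric]) (simp add: algebra_simps)
  then show ?thesis by (simp add: bl_def)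
qed

text \<open>\<open>b m\<close> is the size of block \<open>m\<close> in the ball with index
  \<open>s\<close>, a sequence in the unit ball of l_\<theta>. The second clause is the inclusion of
  that ball in the unit ball of l_t, the third is Hoelder's inequality from l_\<theta> to l_\<sigma>
  on finite sets, up to the factor 2.\<close>

abbreviation profile :: "(real ^ 'd \<Rightarrow> complex) \<Rightarrow> (nat ^ 'd \<Rightarrow> real) \<Rightarrow> bool" where
  "profile x b \<equiv> (\<forall>m. 0 \<le> b m \<and> b m \<le> 1 \<and> bl (r s) q m x \<le> Cq * b m) \<and>
       (\<forall>t F. t > 0 \<longrightarrow> \<theta> s \<le> ennreal t \<longrightarrow> finite F \<longrightarrow> (\<Sum>m\<in>F. b m powr t) \<le> 1) \<and>
       (\<forall>F K. ennreal \<sigma> \<le> \<theta> s \<longrightarrow> finite F \<longrightarrow> real (card F) \<le> K \<longrightarrow> K \<ge> 1 \<longrightarrow> (\<Sum>m\<in>F. b m powr \<sigma>) \<le> 2 * K powr (1 - \<sigma> * recip (\<theta> s)))"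

lemma M_blocks:
  assumes x: "x \<in> M"
  shows "x \<in> torus_Lp (ennreal q)"
    and "\<exists>b. profile x b"
proof -
  have s_in: "s \<in> {1..s}" using s1 by simp
  have N: "besov_norm \<eta>0 (\<chi> i. r s) (p s) (\<theta> s) x \<le> 1" using x s_in by (auto simp: M_def besov_ball_def)
  define g where "g m = ennreal (2 powr (r s * real (level m))) * torus_Lp_norm (p s) (Delta \<eta>0 m x)" for m
  have xp: "x \<in> torus_Lp (p s)" and lg: "enn_lseq_norm (\<theta> s) g \<le> 1"
    using N unfolding besov_norm_def weight_eq g_def[symmetric] by (auto split: if_splits simp: top_unique)
  show "x \<in> torus_Lp (ennreal q)" using torus_Lp_mono[OF xp pq[OF s_in]] q2 by simp
  have th: "1 \<le> \<theta> s" by (rule th1[OF s_in])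
  have th_cases: "\<theta> s = top \<or> (\<exists>t0\<ge>1. \<theta> s = ennreal t0)"
    using th by (cases "\<theta> s") auto
  have sum0: "(\<Sum>m\<in>F. ennreal_powr (g m) t0) \<le> 1" if "\<theta> s = ennreal t0" "t0 \<ge> 1" "finite F" for t0 F
  proof -
    have "ennreal_powr (\<integral>\<^sup>+m. ennreal_powr (g m) t0 \<partial>count_space UNIV) (1/t0) \<le> ennreal 1"
      using lg that by (simp add: enn_Lp_norm_def recip_ennreal)
    then have "(\<integral>\<^sup>+m. ennreal_powr (g m) t0 \<partial>count_space UNIV) \<le> 1"
      using that by (subst (asm) ennreal_powr_le_iff) auto
    then show ?thesis using that unfolding nn_integral_count_space_le_iff by blast
  qed
  have g1: "g m \<le> 1" for m
    using th_cases
  proof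
    assume "\<theta> s = top"
    then have "(SUP m. g m) \<le> 1" using lg by (simp add: enn_lseq_norm_top)
    then show ?thesis by (meson SUP_le_iff UNIV_I)
  next
    assume "\<exists>t0\<ge>1. \<theta> s = ennreal t0"
    then obtain t0 where t0: "\<theta> s = ennreal t0" "t0 \<ge> 1" by blast
    have le: "ennreal_powr (g m) t0 \<le> 1" using sum0[OF t0, of "{m}"] by simp
    show ?thesis
    proof (cases "g m")
      case (real y)
      then have "y powr t0 \<le> 1" using le by (simp add: ennreal_powr_ennreal)
      then have "y \<le> 1" using powr_less_mono2[of t0 1 y] t0 by fastforce
      then show ?thesis using real by simp
    qed (use le in \<open>simp add: ennreal_powr_def top_unique\<close>)
  qed
  define b where "b m = enn2real (g m)" for m
  have gb: "g m = ennreal (b m)" for m using g1[of m] by (simp add: b_def less_top[symmetric] le_less_trans)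
     (metis ennreal_enn2real_if ennreal_one_neq_top top_unique)
  have b01: "0 \<le> b m" "b m \<le> 1" for m using g1[of m] unfolding gb by (auto simp: b_def)
  have blb: "bl (r s) q m x \<le> Cq * b m" for m
  proof -
    let ?w = "2 powr (r s * real (level m)) :: real"
    have w: "?w > 0" by simp
    have "torus_Lp_norm (p s) (Delta \<eta>0 m x) = ennreal (b m / ?w)"
    proof -
      have "ennreal (1 / ?w) * (ennreal ?w * torus_Lp_norm (p s) (Delta \<eta>0 m x)) = ennreal (1 / ?w) * ennreal (b m)"
        using gb[of m] unfolding g_def by simp
      moreover have "ennreal (1 / ?w) * ennreal ?w = 1" by (subst ennreal_mult[symmetric]) auto
      ultimately show ?thesis using b01(1)[of m] by (simp add: mult.assoc[symmetric] ennreal_mult[symmetric])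
    qed
    then have "Lnorm q (Delta \<eta>0 m x) \<le> Cq * (b m / ?w)"
      unfolding Cq_def using q2 b01(1)[of m] by (intro Lnorm_le_of_torus_Lp_norm[OF continuous_Delta pq[OF s_in]]) auto
    then have "?w * Lnorm q (Delta \<eta>0 m x) \<le> ?w * (Cq * (b m / ?w))" using w by (intro mult_left_mono) auto
    then show ?thesis by (simp add: bl_def)
  qed
  have bsum0: "(\<Sum>m\<in>F. b m powr t0) \<le> 1" if "\<theta> s = ennreal t0" "t0 \<ge> 1" "finite F" for t0 F
    using sum0[OF that] b01(1) unfolding gb by (simp add: ennreal_powr_ennreal sum_ennreal)
  have p2: "(\<Sum>m\<in>F. b m powr t) \<le> 1" if t: "t > 0" "\<theta> s \<le> ennreal t" and F: "finite F" for t F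
  proof -
    obtain t0 where t0: "\<theta> s = ennreal t0" "t0 \<ge> 1" using th_cases t by (auto simp: top_unique)
    then have tt: "t0 \<le> t" using t by simp
    have "(\<Sum>m\<in>F. b m powr t) \<le> (\<Sum>m\<in>F. b m powr t0)"
      using b01 tt by (intro sum_mono powr_mono') auto
    then show ?thesis using bsum0[OF t0 F] by linarith
  qed
  have p3: "(\<Sum>m\<in>F. b m powr \<sigma>) \<le> 2 * K powr (1 - \<sigma> * recip (\<theta> s))"
    if th: "ennreal \<sigma> \<le> \<theta> s" and F: "finite F" "real (card F) \<le> K" "K \<ge> 1" for F K
    using th_cases
  proof
    assume "\<theta> s = top"
    then have rc: "recip (\<theta> s) = 0" by (simp add: recip_def)
    have "(\<Sum>m\<in>F. b m powr \<sigma>) \<le> real (card F) * 1"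
      using b01 s2 by (intro sum_bounded_above) (auto intro!: powr_le1)
    then show ?thesis using F unfolding rc by simp
  next
    assume "\<exists>t0\<ge>1. \<theta> s = ennreal t0"
    then obtain t0 where t0: "\<theta> s = ennreal t0" "t0 \<ge> 1" by blast
    have st: "\<sigma> \<le> t0" using th t0 s2 by (simp add: ennreal_le_iff)
    \<comment> \<open>The common size of K terms whose t0-th powers sum to 1; relative to it the
      powers of orders \<sigma> and t0 are compared.\<close>
    define \<tau> where "\<tau> = K powr (- (1/t0))"
    have tau: "\<tau> > 0" using F by (simp add: \<tau>_def)
    have "\<tau> powr t0 = K powr (- 1)" unfolding \<tau>_def powr_powr using t0 by simp
    also have "\<dots> = 1 / K" using F by (simp add: powr_minus_divide)
    finally have tau2: "\<tau> powr t0 = 1 / K" .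
    have "b m powr \<sigma> \<le> \<tau> powr \<sigma> * (1 + K * b m powr t0)" for m
    proof -
      have "(b m / \<tau>) powr \<sigma> \<le> 1 + (b m / \<tau>) powr t0" using b01 tau s2 st by (intro powr_le_one_plus) auto
      also have "(b m / \<tau>) powr t0 = K * b m powr t0" using tau tau2 b01 F by (simp add: powr_divide)
      finally have "\<tau> powr \<sigma> * (b m / \<tau>) powr \<sigma> \<le> \<tau> powr \<sigma> * (1 + K * b m powr t0)" by (intro mult_left_mono) auto
      then show ?thesis using tau by (simp add: powr_divide)
    qed
    then have "(\<Sum>m\<in>F. b m powr \<sigma>) \<le> (\<Sum>m\<in>F. \<tau> powr \<sigma> * (1 + K * b m powr t0))" by (intro sum_mono)
    also have "\<dots> = \<tau> powr \<sigma> * (real (card F) + K * (\<Sum>m\<in>F. b m powr t0))"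
      by (simp add: sum_distrib_left[symmetric] sum.distrib)
    also have "\<dots> \<le> \<tau> powr \<sigma> * (K + K * 1)"
      using F bsum0[OF t0 F(1)] by (intro mult_left_mono add_mono) auto
    also have "\<tau> powr \<sigma> = K powr (- (\<sigma> * recip (\<theta> s)))"
      using t0 by (simp add: \<tau>_def powr_powr recip_ennreal)
    also have "K powr (- (\<sigma> * recip (\<theta> s))) * (K + K * 1) = 2 * (K powr (- (\<sigma> * recip (\<theta> s))) * K powr 1)" using F by simp
    also have "K powr (- (\<sigma> * recip (\<theta> s))) * K powr 1 = K powr (1 - \<sigma> * recip (\<theta> s))" by (subst powr_add[symmetric]) simp
    finally show ?thesis .
  qed
  show "\<exists>b. profile x b"
    using b01 blb p2 p3 by (intro exI[of _ b]) auto
qed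

text \<open>Choice fixes the constant of \<open>rest_bound\<close>, so that it can enter later
  constants.\<close>

definition Crest :: real where
  "Crest = (SOME C. C > 0 \<and> (\<forall>(x :: real ^ 'd \<Rightarrow> complex) T R. x \<in> torus_Lp (ennreal q) \<longrightarrow> finite T \<longrightarrow> R \<ge> 0 \<longrightarrow>
    (\<forall>G. finite G \<longrightarrow> G \<inter> T = {} \<longrightarrow> (\<Sum>m\<in>G. bl l q m x powr \<sigma>) \<le> R powr \<sigma>) \<longrightarrow>
    bnorm l q \<sigma> (x - (\<lambda>t. \<Sum>m\<in>T. Delta \<eta>0 m x t)) \<le> ennreal (C * R)))"

lemma Crest_bounds: "Crest > 0 \<and> (\<forall>(x :: real ^ 'd \<Rightarrow> complex) T R. x \<in> torus_Lp (ennreal q) \<longrightarrow> finite T \<longrightarrow> R \<ge> 0 \<longrightarrow>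
    (\<forall>G. finite G \<longrightarrow> G \<inter> T = {} \<longrightarrow> (\<Sum>m\<in>G. bl l q m x powr \<sigma>) \<le> R powr \<sigma>) \<longrightarrow>
    bnorm l q \<sigma> (x - (\<lambda>t. \<Sum>m\<in>T. Delta \<eta>0 m x t)) \<le> ennreal (Crest * R))"
  unfolding Crest_def by (rule someI_ex[OF rest_bound]) (use q2 s2 l_pos in auto)

lemmas Crest_pos = Crest_bounds[THEN conjunct1]
  and Crest_bound = Crest_bounds[THEN conjunct2, THEN spec, THEN spec, THEN spec, THEN mp, THEN mp, THEN mp, THEN mp]

definition lowfreqs :: "nat \<Rightarrow> (int ^ 'd) set" where
  "lowfreqs j = (\<Union>m\<in>{m. level m \<le> j}. box m)"

lemma low_levels: "{m :: nat ^ 'd. level m \<le> j} = (\<Union>i\<in>{..j}. levelset i)"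
  by (auto simp: levelset_def)

lemma finite_low_levels [simp]: "finite {m :: nat ^ 'd. level m \<le> j}"
  unfolding low_levels by (rule finite_UN_I) simp_all

lemma finite_lowfreqs [simp]: "finite (lowfreqs j)"
  unfolding lowfreqs_def by auto

lemma card_lowfreqs: "real (card (lowfreqs j)) \<le> (2 * 5 ^ CARD('d)) * (2 ^ j * (real j + 1) ^ (CARD('d) - 1))"
proof -
  let ?P = "(real j + 1) ^ (CARD('d) - 1)"
  have "real (card (lowfreqs j)) \<le> real (\<Sum>m | level m \<le> j. card (box (m :: nat ^ 'd)))"
    unfolding lowfreqs_def by (subst of_nat_le_iff) (rule card_UN_le, simp)
  also have "\<dots> = (\<Sum>m | level m \<le> j. real (card (box (m :: nat ^ 'd))))" by simp
  also have "\<dots> = (\<Sum>i\<le>j. \<Sum>m\<in>levelset i. real (card (box (m :: nat ^ 'd))))"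
    unfolding low_levels by (rule sum.UNION_disjoint) (simp, simp, auto simp: levelset_def)
  also have "\<dots> \<le> (\<Sum>i\<le>j. 5 ^ CARD('d) * 2 ^ i * ?P)"
  proof (rule sum_mono)
    fix i assume i: "i \<in> {..j}"
    have "(\<Sum>m\<in>levelset i. real (card (box (m :: nat ^ 'd)))) \<le> real (card (levelset i :: (nat ^ 'd) set)) * (5 ^ CARD('d) * 2 ^ i)"
      using card_box by (intro sum_bounded_above) (auto simp: levelset_def)
    also have "\<dots> \<le> ?P * (5 ^ CARD('d) * 2 ^ i)"
    proof (rule mult_right_mono)
      have "real (card (levelset i :: (nat ^ 'd) set)) \<le> real ((i + 1) ^ (CARD('d) - 1))"
        using card_levelset_le[where 'd = 'd, of i] by (simp only: of_nat_le_iff)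
      also have "\<dots> \<le> ?P" using i by (simp add: power_mono add.commute)
      finally show "real (card (levelset i :: (nat ^ 'd) set)) \<le> ?P" .
    qed simp
    finally show "(\<Sum>m\<in>levelset i. real (card (box (m :: nat ^ 'd)))) \<le> 5 ^ CARD('d) * 2 ^ i * ?P" by (simp add: mult_ac)
  qed
  also have "\<dots> = 5 ^ CARD('d) * ?P * (\<Sum>i\<le>j. 2 ^ i)"
    unfolding sum_distrib_left by (rule sum.cong) simp_all
  also have "(\<Sum>i\<le>j. (2::real) ^ i) \<le> 2 * 2 ^ j"
    by (induction j) auto
  finally show ?thesis by (simp add: mult_ac)
qed

lemma Delta_in_lowfreqs:
  assumes "level m \<le> j"
  shows "Delta \<eta>0 m (x :: real ^ 'd \<Rightarrow> complex) = (\<lambda>t. \<Sum>k\<in>lowfreqs j. (of_real (ev m k) * fourier_coeff x k) * cis (real_vec k \<bullet> t))"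
proof -
  have "Delta \<eta>0 m x = trig (lowfreqs j) (\<lambda>k. of_real (ev m k) * fourier_coeff x k)"
    unfolding Delta_trig_form by (rule trig_support) (use assms ev_zero in \<open>auto simp: lowfreqs_def\<close>)
  then show ?thesis by (simp add: trig_def fun_eq_iff)
qed

text \<open>\<open>Y i\<close> bounds the l_\<sigma> norm of \<open>b\<close> on level i. Across
  levels the l_\<sigma> norm is replaced by the larger l_1 norm; this is harmless because the
  contributions of the levels will be summed geometrically.\<close>

lemma levels_bound:
  assumes G: "finite G" and Y: "\<And>i. Y i \<ge> 0" and bl: "\<And>m. bl l q m x \<le> decay (level m) * (Cq * b m)"
    and b: "\<And>i. i \<in> level ` G \<Longrightarrow> (\<Sum>m\<in>G \<inter> levelset i. b m powr \<sigma>) \<le> Y i powr \<sigma>"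
  shows "(\<Sum>m\<in>G. bl l q m x powr \<sigma>) \<le> (Cq * (\<Sum>i\<in>level ` G. decay i * Y i)) powr \<sigma>"
proof -
  have s0: "\<sigma> > 0" "\<sigma> \<ge> 1" using s2 by auto
  have lev: "(\<Sum>m\<in>G \<inter> levelset i. bl l q m x powr \<sigma>) \<le> (Cq * (decay i * Y i)) powr \<sigma>" if i: "i \<in> level ` G" for i
  proof -
    have "(\<Sum>m\<in>G \<inter> levelset i. bl l q m x powr \<sigma>) \<le> (\<Sum>m\<in>G \<inter> levelset i. (Cq * decay i) powr \<sigma> * b m powr \<sigma>)"
    proof (rule sum_mono)
      fix m assume "m \<in> G \<inter> levelset i"
      then have "bl l q m x \<le> (Cq * decay i) * b m" using bl[of m] by (simp add: levelset_def mult_ac)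
      then have "bl l q m x powr \<sigma> \<le> ((Cq * decay i) * b m) powr \<sigma>" using s0 by (intro powr_mono2) auto
      then show "bl l q m x powr \<sigma> \<le> (Cq * decay i) powr \<sigma> * b m powr \<sigma>" by (simp only: powr_mult)
    qed
    also have "\<dots> \<le> (Cq * decay i) powr \<sigma> * Y i powr \<sigma>"
      unfolding sum_distrib_left[symmetric] by (rule mult_left_mono[OF b[OF i]]) simp
    finally show ?thesis by (simp only: powr_mult mult.assoc)
  qed
  have "(\<Sum>m\<in>G. bl l q m x powr \<sigma>) = (\<Sum>i\<in>level ` G. \<Sum>m\<in>G \<inter> levelset i. bl l q m x powr \<sigma>)" by (rule sum_by_level[OF G])
  also have "\<dots> \<le> (\<Sum>i\<in>level ` G. (Cq * (decay i * Y i)) powr \<sigma>)" by (intro sum_mono lev)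
  also have "\<dots> \<le> (\<Sum>i\<in>level ` G. Cq * (decay i * Y i)) powr \<sigma>"
    by (rule powr_sum_le_sum_powr) (use G s0 Cq_ge_1 Y in auto)
  finally show ?thesis by (simp only: sum_distrib_left)
qed

lemma profile_bl: "profile x b \<Longrightarrow> bl l q m x \<le> decay (level m) * (Cq * b m)"
  unfolding bl_shift by (intro mult_left_mono) auto

lemma card_levelset_Int_le: "real (card (G \<inter> blocks i)) \<le> (real i + 1) powr (real CARD('d) - 1)"
proof -
  have "card (G \<inter> blocks i) \<le> card (blocks i)" by (intro card_mono) auto
  also have "\<dots> \<le> (i + 1) ^ (CARD('d) - 1)" by (rule card_levelset_le)
  finally have "real (card (G \<inter> blocks i)) \<le> real ((i + 1) ^ (CARD('d) - 1))" by (simp only: of_nat_le_iff)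
  also have "\<dots> = (real i + 1) powr real (CARD('d) - 1)" by (subst powr_realpow) (auto simp: add.commute)
  finally show ?thesis by (simp add: of_nat_diff)
qed

text \<open>All levels up to j are kept. On a higher level i Hoelder's inequality costs a power of i
  + 1, and as \<alpha> > 0 the sum over i > j is at most of the order of the term at j.\<close>

lemma width_upper_direct:
  assumes th: "ennreal \<sigma> \<le> \<theta> s"
  shows "\<exists>C>0. \<forall>n j. C * (2 ^ j * (real j + 1) ^ (CARD('d) - 1)) \<le> real n \<longrightarrow>
    width n \<le> ennreal (C * (decay j * (real j + 1) powr ((real CARD('d) - 1) * (1/\<sigma> - recip (\<theta> s)))))"
proof -
  let ?d1 = "real CARD('d) - 1"
  define e where "e = 1 - \<sigma> * recip (\<theta> s)"
  have s0: "\<sigma> > 0" using s2 by simp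
  have e: "e \<ge> 0"
  proof (rule ennreal_ge_cases[OF th s0])
    assume "\<theta> s = top" then show ?thesis by (simp add: e_def recip_def)
  next
    fix t assume "\<theta> s = ennreal t" "\<sigma> \<le> t"
    then show ?thesis using s0 by (simp add: e_def recip_ennreal)
  qed
  have d1: "?d1 \<ge> 0" by (simp add: Suc_leI)
  obtain C2 where C2: "C2 > 0" "\<And>J. finite J \<Longrightarrow> (\<Sum>i\<in>J. (real i + 1) powr (?d1 * e / \<sigma>) * decay i) \<le> C2"
    using sum_polynomial_exponential_bound[OF alpha_pos, of "?d1 * e / \<sigma>"] d1 e s0 by auto
  define R0 where "R0 = Cq * (2 powr (1/\<sigma>) * C2)"
  have R0: "R0 > 0" using Cq_ge_1 C2 by (simp add: R0_def)
  define C where "C = Crest * R0 + 2 * 5 ^ CARD('d)"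
  have C: "C > 0" using Crest_pos R0 by (simp add: C_def add_pos_pos)
  have "width n \<le> ennreal (C * (decay j * (real j + 1) powr (?d1 * (1/\<sigma> - recip (\<theta> s)))))"
    if n: "C * (2 ^ j * (real j + 1) ^ (CARD('d) - 1)) \<le> real n" for n j
  proof -
    let ?B = "(\<lambda>k x. cis (real_vec k \<bullet> x)) ` lowfreqs j :: (real ^ 'd \<Rightarrow> complex) set"
    let ?T = "{m :: nat ^ 'd. level m \<le> j}"
    define Q where "Q = decay j * (real j + 1) powr (?d1 * (1/\<sigma> - recip (\<theta> s)))"
    have Q: "Q > 0" by (simp add: Q_def)
    have "width n \<le> ennreal (Crest * (R0 * Q))"
    proof (rule besov_width_le)
      show "q > 0" "\<sigma> > 0" using q2 s2 by auto
      show "finite ?B" by simp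
      have "real (card ?B) \<le> real (card (lowfreqs j))" by (simp add: card_image_le)
      also have "\<dots> \<le> (2 * 5 ^ CARD('d)) * (2 ^ j * (real j + 1) ^ (CARD('d) - 1))" by (rule card_lowfreqs)
      also have "\<dots> \<le> C * (2 ^ j * (real j + 1) ^ (CARD('d) - 1))"
        using Crest_pos R0 by (intro mult_right_mono) (auto simp: C_def)
      finally show "card ?B \<le> n" using n by linarith
      show "finite (lowfreqs j)" by simp
      show "\<exists>w. b = trig (lowfreqs j) w" if b: "b \<in> ?B" for b
      proof -
        obtain k where k: "k \<in> lowfreqs j" "b = (\<lambda>x. cis (real_vec k \<bullet> x))" using b by auto
        have "b = trig {k} (\<lambda>_. 1)" by (simp add: k trig_def fun_eq_iff)
        also have "\<dots> = trig (lowfreqs j) (\<lambda>k'. if k' = k then 1 else 0)" by (rule trig_support) (use k in auto)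
        finally show ?thesis by blast
      qed
      fix x assume x: "x \<in> M"
      obtain b where B: "profile x b"
        using M_blocks(2)[OF x] by (elim exE)
      have bs: "(\<Sum>m\<in>F. b m powr \<sigma>) \<le> 2 * K powr e" if "finite F" "real (card F) \<le> K" "K \<ge> 1" for F K
        unfolding e_def by (rule conjunct2[OF conjunct2[OF B], rule_format, OF th that])
      have rest: "(\<Sum>m\<in>G. bl l q m x powr \<sigma>) \<le> (R0 * Q) powr \<sigma>" if G: "finite G" "G \<inter> ?T = {}" for G
      proof -
        have gt: "j < i" if "i \<in> level ` G" for i using that G(2) by fastforce
        have inj: "inj_on (\<lambda>i. i - j) (level ` G)" using gt by (intro inj_onI) (metis eq_diff_iff less_imp_le)
        define Y where "Y i = (2 * (real i + 1) powr (?d1 * e)) powr (1/\<sigma>)" for i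
        have "(\<Sum>m\<in>G. bl l q m x powr \<sigma>) \<le> (Cq * (\<Sum>i\<in>level ` G. decay i * Y i)) powr \<sigma>"
        proof (rule levels_bound[OF G(1) _ profile_bl[OF B]])
          fix i
          have "(\<Sum>m\<in>G \<inter> levelset i. b m powr \<sigma>) \<le> 2 * ((real i + 1) powr ?d1) powr e"
            by (rule bs) (use G card_levelset_Int_le d1 in \<open>auto intro: ge_one_powr_ge_zero\<close>)
          then show "(\<Sum>m\<in>G \<inter> levelset i. b m powr \<sigma>) \<le> Y i powr \<sigma>" using s0 by (simp add: Y_def powr_powr)
        qed (simp add: Y_def)
        also have "\<dots> \<le> (R0 * Q) powr \<sigma>"
        proof (rule powr_mono2)
          have "decay i * Y i \<le> 2 powr (1/\<sigma>) * Q * ((real (i - j) + 1) powr (?d1 * e / \<sigma>) * decay (i - j))" if "i \<in> level ` G" for i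
          proof -
            define k where "k = i - j"
            have i: "i = j + k" using gt[OF that] by (simp add: k_def)
            \<comment> \<open>This separates the power at j from a power at i - j, which the
              exponential decay makes summable.\<close>
            have "real i + 1 \<le> (real j + 1) * (real k + 1)" unfolding i by (simp add: algebra_simps)
            then have "(real i + 1) powr (?d1 * e / \<sigma>) \<le> ((real j + 1) * (real k + 1)) powr (?d1 * e / \<sigma>)"
              using d1 e s0 by (intro powr_mono2) auto
            then have "2 powr (1/\<sigma>) * decay i * (real i + 1) powr (?d1 * e / \<sigma>)
              \<le> 2 powr (1/\<sigma>) * decay i * ((real j + 1) * (real k + 1)) powr (?d1 * e / \<sigma>)" by (intro mult_left_mono) auto
            moreover have "decay i = decay j * decay k" by (simp add: i powr_add[symmetric] algebra_simps)
            moreover have "Y i = 2 powr (1/\<sigma>) * (real i + 1) powr (?d1 * e / \<sigma>)" by (simp add: Y_def powr_mult powr_powr)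
            moreover have "Q = decay j * (real j + 1) powr (?d1 * e / \<sigma>)"
            proof -
              have "a * (1 / u - c) = a * (1 - u * c) / u" if "u > 0" for a c u :: real using that by (simp add: field_simps)
              from this[OF s0] show ?thesis unfolding Q_def e_def by (simp only:)
            qed
            ultimately show ?thesis unfolding k_def[symmetric] by (simp only: powr_mult mult_ac)
          qed
          then have "(\<Sum>i\<in>level ` G. decay i * Y i) \<le> 2 powr (1/\<sigma>) * Q * (\<Sum>i\<in>level ` G. (real (i - j) + 1) powr (?d1 * e / \<sigma>) * decay (i - j))"
            unfolding sum_distrib_left by (rule sum_mono)
          also have "(\<Sum>i\<in>level ` G. (real (i - j) + 1) powr (?d1 * e / \<sigma>) * decay (i - j))
             = (\<Sum>i\<in>(\<lambda>i. i - j) ` level ` G. (real i + 1) powr (?d1 * e / \<sigma>) * decay i)"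
            by (simp only: sum.reindex[OF inj] o_def)
          also have "2 powr (1/\<sigma>) * Q * \<dots> \<le> 2 powr (1/\<sigma>) * Q * C2" using G Q by (intro mult_left_mono C2) auto
          finally show "Cq * (\<Sum>i\<in>level ` G. decay i * Y i) \<le> R0 * Q"
            using Cq_ge_1 by (simp add: R0_def mult_ac mult_left_mono)
        qed (use s0 Cq_ge_1 in \<open>auto simp: Y_def intro!: mult_nonneg_nonneg sum_nonneg\<close>)
        finally show ?thesis .
      qed
      have "bnorm l q \<sigma> (x - (\<lambda>t. \<Sum>m\<in>?T. Delta \<eta>0 m x t)) \<le> ennreal (Crest * (R0 * Q))"
        using rest R0 Q by (intro Crest_bound M_blocks(1)[OF x]) auto
      moreover have "(\<lambda>t. \<Sum>m\<in>?T. Delta \<eta>0 m x t) \<in> module.span fun_scale ?B"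
      proof -
        interpret vector_space fun_scale by (rule vector_space_fun_scale)
        have "Delta \<eta>0 m x \<in> span ?B" if "m \<in> ?T" for m
          unfolding Delta_in_lowfreqs[OF that[unfolded mem_Collect_eq]]
          by (rule span_sum_scale) (auto intro: span_base)
        then have "(\<lambda>t. \<Sum>m\<in>?T. 1 * Delta \<eta>0 m x t) \<in> span ?B" by (rule span_sum_scale)
        then show ?thesis by simp
      qed
      ultimately show "\<exists>y\<in>module.span fun_scale ?B. bnorm l q \<sigma> (x - y) \<le> ennreal (Crest * (R0 * Q))"
        by blast
    qed
    also have "\<dots> \<le> ennreal (C * Q)"
      using Q by (intro ennreal_leI) (simp add: C_def algebra_simps)
    finally show ?thesis by (simp add: Q_def)
  qed
  then show ?thesis using C by blast
qed

end

text \<open>Exchanging the exponent t for u costs the largest value of b^(u - t). With u <= t this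
  bounds entries above a threshold, as needed for the Euclidean norm of large blocks; with u >= t it
  bounds entries below one, as needed for the l_\<sigma> norm of the dropped blocks.\<close>

lemma sum_powr_compare:
  fixes b :: "'i \<Rightarrow> real"
  assumes "\<And>i. i \<in> N \<Longrightarrow> b i powr (u - t) \<le> T" "(\<Sum>i\<in>N. b i powr t) \<le> 1" "T \<ge> 0"
  shows "(\<Sum>i\<in>N. b i powr u) \<le> T"
proof -
  have "b i powr u \<le> T * b i powr t" if "i \<in> N" for i
    using mult_right_mono[OF assms(1)[OF that], of "b i powr t"] by (simp add: powr_add[symmetric])
  then have "(\<Sum>i\<in>N. b i powr u) \<le> T * (\<Sum>i\<in>N. b i powr t)" unfolding sum_distrib_left by (rule sum_mono)
  also have "\<dots> \<le> T" using mult_left_mono[OF assms(2,3)] by simp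
  finally show ?thesis .
qed

lemma sum_powr_ge_threshold:
  fixes b :: "'i \<Rightarrow> real"
  assumes "\<And>i. i \<in> N \<Longrightarrow> \<tau> \<le> b i" "\<tau> > 0" "u \<le> t" "(\<Sum>i\<in>N. b i powr t) \<le> 1"
  shows "(\<Sum>i\<in>N. b i powr u) \<le> \<tau> powr (u - t)"
  by (rule sum_powr_compare[OF powr_mono2']) (use assms in auto)

lemma sum_powr_le_threshold:
  fixes b :: "'i \<Rightarrow> real"
  assumes "\<And>i. i \<in> N \<Longrightarrow> 0 \<le> b i \<and> b i \<le> \<tau>" "t \<le> u" "(\<Sum>i\<in>N. b i powr t) \<le> 1"
  shows "(\<Sum>i\<in>N. b i powr u) \<le> \<tau> powr (u - t)"
  by (rule sum_powr_compare[OF powr_mono2]) (use assms in auto)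

lemma geometric_tail_bound:
  assumes "\<delta> > 0"
  shows "\<exists>C>0. \<forall>J j. finite J \<longrightarrow> (\<forall>i\<in>J. j \<le> i) \<longrightarrow> (\<Sum>i\<in>J. 2 powr (- \<delta> * real i)) \<le> C * 2 powr (- \<delta> * real j)"
proof -
  obtain C where C: "C > 0" "\<And>J. finite J \<Longrightarrow> (\<Sum>i\<in>J. (real i + 1) powr 0 * 2 powr (- \<delta> * real i)) \<le> C"
    using sum_polynomial_exponential_bound[OF assms order_refl] by blast
  have "(\<Sum>i\<in>J. 2 powr (- \<delta> * real i)) \<le> C * 2 powr (- \<delta> * real j)" if J: "finite J" "\<forall>i\<in>J. j \<le> i" for J j
  proof -
    have inj: "inj_on (\<lambda>i. i - j) J" using J(2) by (intro inj_onI) (metis eq_diff_iff)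
    have "(\<Sum>i\<in>J. 2 powr (- \<delta> * real i)) = (\<Sum>i\<in>J. 2 powr (- \<delta> * real j) * ((real (i - j) + 1) powr 0 * 2 powr (- \<delta> * real (i - j))))"
    proof (rule sum.cong[OF refl])
      fix i assume "i \<in> J"
      then have e: "- \<delta> * real i = - \<delta> * real j + - \<delta> * real (i - j)" using J(2) by (simp add: of_nat_diff algebra_simps)
      have "real (i - j) + 1 \<noteq> 0" by linarith
      then show "2 powr (- \<delta> * real i) = 2 powr (- \<delta> * real j) * ((real (i - j) + 1) powr 0 * 2 powr (- \<delta> * real (i - j)))"
        unfolding e powr_add by simp
    qed
    also have "\<dots> = 2 powr (- \<delta> * real j) * (\<Sum>i\<in>(\<lambda>i. i - j) ` J. (real i + 1) powr 0 * 2 powr (- \<delta> * real i))"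
      by (simp only: sum_distrib_left[symmetric] sum.reindex[OF inj] o_def)
    also have "\<dots> \<le> 2 powr (- \<delta> * real j) * C" using J by (intro mult_left_mono C) auto
    finally show ?thesis by (simp add: mult.commute)
  qed
  then show ?thesis using C(1) by blast
qed

context cutoff
begin

lemma besov_norm_sum:
  fixes f :: "'i \<Rightarrow> real ^ 'd \<Rightarrow> complex"
  assumes q: "q \<ge> 1" "\<sigma> \<ge> 1" and J: "finite J"
    and f: "\<And>j. j \<in> J \<Longrightarrow> a j \<ge> 0 \<and> bnorm l q \<sigma> (f j) \<le> ennreal (a j)"
  shows "bnorm l q \<sigma> (\<lambda>x. \<Sum>j\<in>J. f j x) \<le> ennreal (\<Sum>j\<in>J. a j)"
  using J f
proof (induction J rule: finite_induct)
  case empty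
  have "(\<lambda>x :: real ^ 'd. 0 :: complex) = trig {} (\<lambda>_. 0)" by (simp add: trig_def fun_eq_iff)
  moreover have "trig_besov l q \<sigma> ({} :: (int ^ 'd) set) (\<lambda>_. 0) = 0" by (simp add: trig_besov_def act_def)
  ultimately show ?case using besov_norm_trig[of "{} :: (int ^ 'd) set" q \<sigma> l "\<lambda>_. 0"] q by simp
next
  case (insert j J)
  have "bnorm l q \<sigma> (f j + (\<lambda>x. \<Sum>j\<in>J. f j x)) \<le> ennreal (a j + (\<Sum>j\<in>J. a j))"
    by (rule besov_norm_triangle) (use q insert in \<open>auto intro!: sum_nonneg\<close>)
  also have "f j + (\<lambda>x. \<Sum>j\<in>J. f j x) = (\<lambda>x. \<Sum>j\<in>insert j J. f j x)" using insert by (simp add: fun_eq_iff)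
  finally show ?case using insert by simp
qed

text \<open>The blocks that see a given frequency are all near to any one of them, so there are at
  most 3^d, d being the dimension, and the square of the sum costs only this factor.\<close>

lemma block_sum_coefficients:
  fixes x :: "real ^ 'd \<Rightarrow> complex"
  assumes q: "q \<ge> 2" and S: "finite S" and G: "finite G"
  shows "(\<Sum>k\<in>S. (norm (\<Sum>m\<in>G. of_real (ev m k) * fourier_coeff x k))\<^sup>2)
    \<le> 3 ^ CARD('d) * (\<Sum>m\<in>G. (((2*pi) ^ CARD('d) + 1) * Lnorm q (Delta \<eta>0 m x))\<^sup>2)"
proof -
  let ?w = "\<lambda>m k. of_real (ev m k) * fourier_coeff x k"
  have pt: "(norm (\<Sum>m\<in>G. ?w m k))\<^sup>2 \<le> 3 ^ CARD('d) * (\<Sum>m\<in>G. (norm (?w m k))\<^sup>2)" for k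
  proof -
    let ?H = "{m\<in>G. ev m k \<noteq> 0}"
    have H: "real (card ?H) \<le> 3 ^ CARD('d)"
    proof (cases "?H = {}")
      case False
      then obtain m0 where "m0 \<in> ?H" by blast
      then have "?H \<subseteq> near m0" using ev_near by blast
      then have "card ?H \<le> 3 ^ CARD('d)" using card_mono[OF finite_near] card_near order_trans by blast
      then have "real (card ?H) \<le> real (3 ^ CARD('d))" by (simp only: of_nat_le_iff)
      then show ?thesis by simp
    next
      case True
      show ?thesis unfolding True by simp
    qed
    have "(\<Sum>m\<in>G. ?w m k) = (\<Sum>m\<in>?H. ?w m k)" by (rule sum.mono_neutral_right) (use G in auto)
    then have "(norm (\<Sum>m\<in>G. ?w m k))\<^sup>2 \<le> (\<Sum>m\<in>?H. norm (?w m k))\<^sup>2"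
      by (intro power_mono) (simp_all only: norm_sum norm_ge_zero)
    also have "\<dots> \<le> (\<Sum>m\<in>?H. (norm (?w m k))\<^sup>2) * real (card ?H)" by (rule sum_squared_le_sum_of_squares)
    also have "\<dots> \<le> (\<Sum>m\<in>G. (norm (?w m k))\<^sup>2) * 3 ^ CARD('d)"
      by (rule mult_mono[OF sum_mono2 H]) (use G in \<open>auto intro: sum_nonneg\<close>)
    finally show ?thesis by (simp only: mult.commute)
  qed
  have bl: "(\<Sum>k\<in>S. (norm (?w m k))\<^sup>2) \<le> (((2*pi) ^ CARD('d) + 1) * Lnorm q (Delta \<eta>0 m x))\<^sup>2" for m
  proof -
    have "(\<Sum>k\<in>S. (norm (?w m k))\<^sup>2) \<le> (\<Sum>k\<in>S \<union> box m. (norm (?w m k))\<^sup>2)"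
      by (rule sum_mono2) (use S in auto)
    also have "\<dots> = (\<Sum>k\<in>box m. (norm (?w m k))\<^sup>2)"
      by (rule sum.mono_neutral_right) (use S ev_zero in auto)
    also have "\<dots> \<le> (2*pi) ^ CARD('d) * (\<Sum>k\<in>box m. (norm (?w m k))\<^sup>2)"
      using mult_right_mono[OF two_pi_power_ge_1[of "CARD('d)"], of "\<Sum>k\<in>box m. (norm (?w m k))\<^sup>2"]
      by (simp add: sum_nonneg)
    also have "\<dots> = (Lnorm 2 (Delta \<eta>0 m x))\<^sup>2"
      unfolding Delta_trig_form by (rule Lnorm_2[symmetric]) simp
    also have "\<dots> \<le> (((2*pi) ^ CARD('d) + 1) * Lnorm q (Delta \<eta>0 m x))\<^sup>2"
      using q by (intro power_mono Lnorm_mono continuous_Delta) auto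
    finally show ?thesis .
  qed
  have "(\<Sum>k\<in>S. (norm (\<Sum>m\<in>G. ?w m k))\<^sup>2) \<le> (\<Sum>k\<in>S. 3 ^ CARD('d) * (\<Sum>m\<in>G. (norm (?w m k))\<^sup>2))"
    by (intro sum_mono pt)
  also have "\<dots> = 3 ^ CARD('d) * (\<Sum>m\<in>G. \<Sum>k\<in>S. (norm (?w m k))\<^sup>2)"
    unfolding sum_distrib_left[symmetric] by (subst sum.swap) (rule refl)
  also have "\<dots> \<le> 3 ^ CARD('d) * (\<Sum>m\<in>G. (((2*pi) ^ CARD('d) + 1) * Lnorm q (Delta \<eta>0 m x))\<^sup>2)"
    by (intro mult_left_mono sum_mono bl) auto
  finally show ?thesis .
qed

lemma blocks_trig:
  assumes "G \<subseteq> levelset j"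
  shows "(\<lambda>t :: real ^ 'd. \<Sum>m\<in>G. Delta \<eta>0 m x t) = trig (freqs_level j) (\<lambda>k. \<Sum>m\<in>G. of_real (ev m k) * fourier_coeff x k)"
proof -
  have "Delta \<eta>0 m x = trig (freqs_level j) (\<lambda>k. of_real (ev m k) * fourier_coeff x k)" if "m \<in> G" for m
    unfolding Delta_trig_form
  proof (rule trig_support)
    fix k
    have "m \<in> levelset j" using that assms by auto
    then have "k \<notin> freqs_level j \<Longrightarrow> ev m k = 0" by (auto simp: freqs_level_def)
    moreover have "k \<notin> box m \<Longrightarrow> ev m k = 0" by (rule ev_zero)
    ultimately show "(if k \<in> box m then of_real (ev m k) * fourier_coeff x k else 0)
      = (if k \<in> freqs_level j then of_real (ev m k) * fourier_coeff x k else 0)" by simp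
  qed simp_all
  then show ?thesis by (simp add: trig_sum fun_eq_iff)
qed

end

context besov_data
begin

text \<open>The error factor of n vectors on level j. For n >= 1 it is at most 1 exactly when n is
  at least 2^j (j+1)^(2(d-1)/\<sigma>), d being the dimension; this determines the critical level
  for small smoothness.\<close>

definition gain :: "nat \<Rightarrow> nat \<Rightarrow> real" where
  "gain j n = sqrt (2 ^ j / real n) * (real j + 1) powr ((real CARD('d) - 1) / \<sigma>)"

lemma gain_pos: "n \<ge> 1 \<Longrightarrow> gain j n > 0" by (simp add: gain_def)

text \<open>\<open>g\<close> is chosen for the level and n alone, before the function and the set
  \<open>G\<close> of its large blocks. This reconciles a selection that depends on the function
  with a fixed subspace.\<close>

abbreviation block_vectors :: "real \<Rightarrow> real \<Rightarrow> nat \<Rightarrow> nat \<Rightarrow> (nat \<Rightarrow> int ^ 'd \<Rightarrow> complex) \<Rightarrow> bool" where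
  "block_vectors t C j n g \<equiv> \<forall>(x :: real ^ 'd \<Rightarrow> complex) b G \<tau>. finite G \<longrightarrow> G \<subseteq> levelset j \<longrightarrow> \<tau> > 0 \<longrightarrow>
    (\<forall>m\<in>G. \<tau> \<le> b m \<and> bl (r s) q m x \<le> Cq * b m) \<longrightarrow> (\<Sum>m\<in>G. b m powr t) \<le> 1 \<longrightarrow>
    (\<exists>c. bnorm l q \<sigma>
       ((\<lambda>y. \<Sum>m\<in>G. Delta \<eta>0 m x y) - (\<lambda>y. \<Sum>i<n. c i * trig (freqs_level j) (g i) y))
       \<le> ennreal (C * (decay j * (\<tau> powr (1 - t/2) * gain j n))))"

text \<open>Sizes of at least \<tau> with l_t norm at most 1 have Euclidean norm at most \<tau>^(1 -
  t/2), as t >= 2. The system of \<open>level_approx\<close> is applied to the coefficients of the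
  sum of these blocks.\<close>

lemma large_blocks_approx:
  assumes t: "t \<ge> 2"
  shows "\<exists>C>0. \<forall>j n. n \<ge> 1 \<longrightarrow> (\<exists>g :: nat \<Rightarrow> int ^ 'd \<Rightarrow> complex. block_vectors t C j n g)"
proof -
  obtain C0 where C0: "C0 > 0" "\<And>j n. n \<ge> 1 \<Longrightarrow> (\<exists>g :: nat \<Rightarrow> int ^ 'd \<Rightarrow> complex. level_vectors l q \<sigma> C0 j n g)"
  proof -
    have "q \<ge> 1" "\<sigma> \<ge> 1" "l \<ge> 0" using q2 s2 l_pos by auto
    from level_approx[OF this, where 'd = 'd] show ?thesis using that by blast
  qed
  define W where "W = sqrt (3 ^ CARD('d)) * Cq\<^sup>2"
  have W: "W > 0" using Cq_ge_1 by (simp add: W_def)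
  have "\<exists>g :: nat \<Rightarrow> int ^ 'd \<Rightarrow> complex. block_vectors t (C0 * W) j n g" if n: "n \<ge> 1" for j n
  proof -
    obtain g :: "nat \<Rightarrow> int ^ 'd \<Rightarrow> complex" where g: "level_vectors l q \<sigma> C0 j n g"
      using C0(2)[OF n] by blast
    have "\<exists>c. bnorm l q \<sigma>
       ((\<lambda>y. \<Sum>m\<in>G. Delta \<eta>0 m x y) - (\<lambda>y. \<Sum>i<n. c i * trig (freqs_level j) (g i) y))
       \<le> ennreal (C0 * W * (decay j * (\<tau> powr (1 - t/2) * gain j n)))"
      if G: "finite G" "G \<subseteq> levelset j" and \<tau>: "\<tau> > 0" and b: "\<forall>m\<in>G. \<tau> \<le> b m \<and> bl (r s) q m x \<le> Cq * b m"
        and bt: "(\<Sum>m\<in>G. b m powr t) \<le> 1" for x b G \<tau>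
    proof -
      let ?v = "\<lambda>k. \<Sum>m\<in>G. of_real (ev m k) * fourier_coeff x k"
      define V where "V = W * 2 powr (- r s * real j) * \<tau> powr (1 - t/2)"
      have V0: "V \<ge> 0" using W by (simp add: V_def)
      have ln: "(((2*pi) ^ CARD('d) + 1) * Lnorm q (Delta \<eta>0 m x))\<^sup>2 \<le> (Cq\<^sup>2 * 2 powr (- r s * real j))\<^sup>2 * b m powr 2" if m: "m \<in> G" for m
      proof -
        have lv: "level m = j" using G(2) m by (auto simp: levelset_def)
        have bm: "b m > 0" using b m \<tau> by force
        have "bl (r s) q m x \<le> Cq * b m" using b m by blast
        then have "2 powr (r s * real j) * Lnorm q (Delta \<eta>0 m x) \<le> Cq * b m" by (simp only: bl_def lv)
        then have "2 powr (- r s * real j) * (2 powr (r s * real j) * Lnorm q (Delta \<eta>0 m x)) \<le> 2 powr (- r s * real j) * (Cq * b m)"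
          by (intro mult_left_mono) auto
        moreover have "2 powr (- r s * real j) * (2 powr (r s * real j) * Lnorm q (Delta \<eta>0 m x)) = Lnorm q (Delta \<eta>0 m x)"
          by (simp add: mult.assoc[symmetric] powr_add[symmetric])
        ultimately have "Lnorm q (Delta \<eta>0 m x) \<le> 2 powr (- r s * real j) * (Cq * b m)" by linarith
        then have "Cq * Lnorm q (Delta \<eta>0 m x) \<le> Cq * (2 powr (- r s * real j) * (Cq * b m))"
          using Cq_ge_1 by (intro mult_left_mono) auto
        then have "(Cq * Lnorm q (Delta \<eta>0 m x))\<^sup>2 \<le> (Cq * (2 powr (- r s * real j) * (Cq * b m)))\<^sup>2"
          using Cq_ge_1 by (intro power_mono) auto
        also have "\<dots> = (Cq\<^sup>2 * 2 powr (- r s * real j))\<^sup>2 * b m powr 2"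
          using bm by (simp add: power2_eq_square mult_ac)
        finally show ?thesis unfolding Cq_def .
      qed
      have "(\<Sum>k\<in>freqs_level j. (norm (?v k))\<^sup>2) \<le> 3 ^ CARD('d) * (\<Sum>m\<in>G. (((2*pi) ^ CARD('d) + 1) * Lnorm q (Delta \<eta>0 m x))\<^sup>2)"
        by (rule block_sum_coefficients) (use q2 G in auto)
      moreover have "3 ^ CARD('d) * (\<Sum>m\<in>G. (((2*pi) ^ CARD('d) + 1) * Lnorm q (Delta \<eta>0 m x))\<^sup>2) \<le> 3 ^ CARD('d) * (\<Sum>m\<in>G. (Cq\<^sup>2 * 2 powr (- r s * real j))\<^sup>2 * b m powr 2)"
        by (intro mult_left_mono sum_mono ln) auto
      moreover have "(\<Sum>m\<in>G. (Cq\<^sup>2 * 2 powr (- r s * real j))\<^sup>2 * b m powr 2) \<le> (Cq\<^sup>2 * 2 powr (- r s * real j))\<^sup>2 * \<tau> powr (2 - t)"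
        unfolding sum_distrib_left[symmetric] by (intro mult_left_mono sum_powr_ge_threshold) (use b \<tau> t bt in auto)
      then have "3 ^ CARD('d) * (\<Sum>m\<in>G. (Cq\<^sup>2 * 2 powr (- r s * real j))\<^sup>2 * b m powr 2) \<le> 3 ^ CARD('d) * ((Cq\<^sup>2 * 2 powr (- r s * real j))\<^sup>2 * \<tau> powr (2 - t))"
        by (intro mult_left_mono) auto
      moreover have "3 ^ CARD('d) * ((Cq\<^sup>2 * 2 powr (- r s * real j))\<^sup>2 * \<tau> powr (2 - t)) = V\<^sup>2"
      proof -
        have "\<tau> powr (2 - t) = (\<tau> powr (1 - t/2))\<^sup>2" by (simp add: power2_eq_square powr_add[symmetric])
        then show ?thesis by (simp only: V_def W_def power_mult_distrib real_sqrt_pow2 zero_le_power zero_le_numeral mult.assoc)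
      qed
      ultimately have v: "(\<Sum>k\<in>freqs_level j. (norm (?v k))\<^sup>2) \<le> V\<^sup>2" by linarith
      obtain c where c: "trig_besov l q \<sigma> (freqs_level j) (\<lambda>k. ?v k - (\<Sum>i<n. c i * g i k))
      \<le> C0 * (V * (2 powr (l * real j) * sqrt (2 ^ j / real n) * (real j + 1) powr ((real CARD('d) - 1) / \<sigma>)))"
        using g[rule_format, OF V0 v] by (elim exE)
      have "(\<lambda>y. \<Sum>m\<in>G. Delta \<eta>0 m x y) - (\<lambda>y. \<Sum>i<n. c i * trig (freqs_level j) (g i) y)
        = trig (freqs_level j) (\<lambda>k. ?v k - (\<Sum>i<n. c i * g i k))"
        unfolding blocks_trig[OF G(2)] trig_scale trig_sum
        by (simp add: fun_eq_iff trig_def sum_subtractf left_diff_distrib)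
      then have "bnorm l q \<sigma>
       ((\<lambda>y. \<Sum>m\<in>G. Delta \<eta>0 m x y) - (\<lambda>y. \<Sum>i<n. c i * trig (freqs_level j) (g i) y))
        \<le> ennreal (trig_besov l q \<sigma> (freqs_level j) (\<lambda>k. ?v k - (\<Sum>i<n. c i * g i k)))"
        using q2 s2 by (simp only:) (intro besov_norm_trig, auto)
      also have "\<dots> \<le> ennreal (C0 * (V * (2 powr (l * real j) * sqrt (2 ^ j / real n) * (real j + 1) powr ((real CARD('d) - 1) / \<sigma>))))"
        by (rule ennreal_leI[OF c])
      also have "C0 * (V * (2 powr (l * real j) * sqrt (2 ^ j / real n) * (real j + 1) powr ((real CARD('d) - 1) / \<sigma>)))
        = C0 * W * ((2 powr (- r s * real j) * 2 powr (l * real j)) * (\<tau> powr (1 - t/2) * gain j n))"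
        by (simp only: V_def gain_def mult_ac)
      also have "2 powr (- r s * real j) * 2 powr (l * real j) = decay j"
        by (simp add: powr_add[symmetric] algebra_simps)
      finally show ?thesis by (intro exI[of _ c])
    qed
    then show ?thesis by (intro exI[of _ g] allI impI)
  qed
  then show ?thesis using C0(1) W by (intro exI[of _ "C0 * W"]) auto
qed

text \<open>Entries up to \<tau> with l_t norm at most 1 have l_\<sigma> norm at most \<tau>^(1 -
  t/\<sigma>), so the threshold is written as that power of Y which makes the bound equal to Y. The
  alternative Y = 1 is meant for levels that are dropped entirely.\<close>

lemma small_blocks_bound:
  assumes t: "t > 0" "t \<le> \<sigma>" and G: "finite G" and Y: "\<And>i. Y i \<ge> 0"
    and b: "\<And>m. m \<in> G \<Longrightarrow> 0 \<le> b m \<and> b m \<le> Y (level m) powr (1 / (1 - t/\<sigma>)) \<or> 0 \<le> b m \<and> b m \<le> 1 \<and> Y (level m) = 1"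
    and bl: "\<And>m. bl l q m x \<le> decay (level m) * (Cq * b m)" and bt: "(\<Sum>m\<in>G. b m powr t) \<le> 1" and ts: "t < \<sigma>"
  shows "(\<Sum>m\<in>G. bl l q m x powr \<sigma>) \<le> (Cq * (\<Sum>i\<in>level ` G. decay i * Y i)) powr \<sigma>"
proof -
  have s0: "\<sigma> > 0" using s2 by simp
  show ?thesis
  proof (rule levels_bound[OF G Y bl])
    fix i
    let ?H = "G \<inter> levelset i"
    have li: "level m = i" if "m \<in> ?H" for m using that by (simp add: levelset_def)
    have "(\<Sum>m\<in>?H. b m powr t) \<le> (\<Sum>m\<in>G. b m powr t)" by (rule sum_mono2) (use G in auto)
    then have bt': "(\<Sum>m\<in>?H. b m powr t) \<le> 1" using bt by linarith
    show "(\<Sum>m\<in>?H. b m powr \<sigma>) \<le> Y i powr \<sigma>"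
    proof (cases "Y i = 1")
      case True
      have "(\<Sum>m\<in>?H. b m powr \<sigma>) \<le> 1 powr (\<sigma> - t)"
        by (rule sum_powr_le_threshold[OF _ t(2) bt']) (use b li True in fastforce)
      then show ?thesis using True by simp
    next
      case False
      have "(\<Sum>m\<in>?H. b m powr \<sigma>) \<le> (Y i powr (1 / (1 - t/\<sigma>))) powr (\<sigma> - t)"
        by (rule sum_powr_le_threshold[OF _ t(2) bt']) (use b li False in fastforce)
      also have "\<dots> = Y i powr (1 / (1 - t/\<sigma>) * (\<sigma> - t))" by (rule powr_powr)
      also have "1 / (1 - t/\<sigma>) * (\<sigma> - t) = \<sigma>" using ts s0 by (simp add: field_simps)
      finally show ?thesis .
    qed
  qed
qed

text \<open>With X the gain on level j, the large blocks cost \<tau>^(1 - t/2) X and the dropped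
  ones \<tau>^(1 - t/\<sigma>). The threshold X^\<kappa> makes both equal to X^\<omega>. Levels
  above j1 are dropped entirely, at the cost of a multiple of \<open>decay j1\<close>.\<close>

lemma width_upper_rand:
  assumes t: "2 \<le> t" "t < \<sigma>" and th: "\<theta> s \<le> ennreal t"
  defines "\<omega> \<equiv> (1/t - 1/\<sigma>) / (1/2 - 1/\<sigma>)"
  shows "\<exists>C>0. \<forall>n j0 j1 (nn :: nat \<Rightarrow> nat). j0 \<le> j1 \<longrightarrow> (\<forall>j\<in>{j0<..j1}. nn j \<ge> 1) \<longrightarrow>
     C * (2 ^ j0 * (real j0 + 1) ^ (CARD('d) - 1)) + (\<Sum>j\<in>{j0<..j1}. real (nn j)) \<le> real n \<longrightarrow>
     width n \<le> ennreal (C * ((\<Sum>j\<in>{j0<..j1}. decay j * gain j (nn j) powr \<omega>) + decay j1))"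
proof -
  have s0: "\<sigma> > 0" "\<sigma> \<ge> 1" "q > 0" "q \<ge> 1" using s2 q2 by auto
  define \<kappa> where "\<kappa> = 1 / (t * (1/2 - 1/\<sigma>))"
  have h: "1/2 - 1/\<sigma> > 0" using s2 by (simp add: field_simps)
  have k1: "\<kappa> * (1 - t/2) + 1 = \<omega>" "\<omega> * (1 / (1 - t/\<sigma>)) = \<kappa>"
  proof -
    have "\<kappa> * (1 - t/2) + 1 = (1/t - 1/2) / (1/2 - 1/\<sigma>) + (1/2 - 1/\<sigma>) / (1/2 - 1/\<sigma>)"
    proof -
      have "(1 / (t * u)) * (1 - t/2) + 1 = (1/t - 1/2) / u + u / u" if "u > 0" for u :: real
        using t that by (simp add: field_simps)
      from this[OF h] show ?thesis by (simp only: \<kappa>_def)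
    qed
    also have "\<dots> = \<omega>" by (subst add_divide_distrib[symmetric]) (simp add: \<omega>_def)
    finally show "\<kappa> * (1 - t/2) + 1 = \<omega>" .
    have "1/t - 1/\<sigma> = (1 - t/\<sigma>) / t" using t s0 by (simp add: field_simps)
    moreover have "1 - t/\<sigma> \<noteq> 0" using t s0 by (simp add: field_simps)
    ultimately show "\<omega> * (1 / (1 - t/\<sigma>)) = \<kappa>" by (simp add: \<omega>_def \<kappa>_def)
  qed
  obtain C0 where C0: "C0 > 0" "\<And>j n. n \<ge> 1 \<Longrightarrow> (\<exists>g :: nat \<Rightarrow> int ^ 'd \<Rightarrow> complex. block_vectors t C0 j n g)"
    using large_blocks_approx[OF t(1)] by blast
  obtain C2 where C2: "C2 > 0" "\<And>J j. finite J \<Longrightarrow> (\<forall>i\<in>J. j \<le> i) \<Longrightarrow> (\<Sum>i\<in>J. decay i) \<le> C2 * decay j"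
    using geometric_tail_bound[OF alpha_pos] by blast
  define C where "C = Crest * (Cq * (1 + C2)) + C0 + 2 * 5 ^ CARD('d)"
  have R0: "Crest * (Cq * (1 + C2)) > 0" using Crest_pos C2 Cq_ge_1 by simp
  have C: "C > 0" "Crest * (Cq * (1 + C2)) + C0 \<le> C" "2 * 5 ^ CARD('d) \<le> C"
    using R0 C0(1) by (auto simp: C_def intro!: add_pos_nonneg)
  have "width n \<le> ennreal (C * ((\<Sum>j\<in>{j0<..j1}. decay j * gain j (nn j) powr \<omega>) + decay j1))"
    if j01: "j0 \<le> j1" and nn: "\<forall>j\<in>{j0<..j1}. nn j \<ge> 1"
      and n: "C * (2 ^ j0 * (real j0 + 1) ^ (CARD('d) - 1)) + (\<Sum>j\<in>{j0<..j1}. real (nn j)) \<le> real n"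
    for n j0 j1 and nn :: "nat \<Rightarrow> nat"
  proof -
    let ?I = "{j0<..j1}"
    define X where "X = (\<lambda>j. gain j (nn j))"
    have X: "X j > 0" if "j \<in> ?I" for j using nn that by (simp add: X_def gain_pos)
    define A where "A = (\<Sum>j\<in>?I. decay j * X j powr \<omega>)"
    define E where "E = A + decay j1"
    have A: "A \<ge> 0" by (simp add: A_def sum_nonneg)
    have "\<forall>j. \<exists>g :: nat \<Rightarrow> int ^ 'd \<Rightarrow> complex. j \<in> ?I \<longrightarrow> block_vectors t C0 j (nn j) g" (is "\<forall>j. \<exists>g. ?P j g")
    proof
      fix j show "\<exists>g. ?P j g"
      proof (cases "j \<in> ?I")
        case True
        then have "nn j \<ge> 1" using nn by blast
        from C0(2)[OF this, of j] show ?thesis by blast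
      qed blast
    qed
    from choice[OF this] obtain g :: "nat \<Rightarrow> nat \<Rightarrow> int ^ 'd \<Rightarrow> complex" where "\<forall>j. ?P j (g j)" ..
    then have g: "\<exists>c. bnorm l q \<sigma>
         ((\<lambda>y. \<Sum>m\<in>G. Delta \<eta>0 m x y) - (\<lambda>y. \<Sum>i<nn j. c i * trig (freqs_level j) (g j i) y))
         \<le> ennreal (C0 * (decay j * (\<tau> powr (1 - t/2) * X j)))"
      if "j \<in> ?I" "finite G" "G \<subseteq> levelset j" "\<tau> > 0" "\<forall>m\<in>G. \<tau> \<le> b m \<and> bl (r s) q m x \<le> Cq * b m" "(\<Sum>m\<in>G. b m powr t) \<le> 1"
      for j x b G \<tau> using that unfolding X_def by blast
    define S where "S = lowfreqs j0 \<union> (\<Union>j\<in>?I. freqs_level j)"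
    define B1 where "B1 = (\<lambda>k x. cis (real_vec k \<bullet> x)) ` (lowfreqs j0 :: (int ^ 'd) set)"
    define B2 where "B2 = (\<Union>j\<in>?I. (\<lambda>i. trig (freqs_level j) (g j i)) ` {..<nn j})"
    have S: "finite S" "lowfreqs j0 \<subseteq> S" "\<And>j. j \<in> ?I \<Longrightarrow> freqs_level j \<subseteq> S" by (auto simp: S_def)
    have "width n \<le> ennreal (Crest * (Cq * ((1 + C2) * E)) + C0 * A)"
    proof (rule besov_width_le)
      show "q > 0" "\<sigma> > 0" by fact+
      show "finite (B1 \<union> B2)" by (simp add: B1_def B2_def)
      have "real (card B1) \<le> real (card (lowfreqs j0))" by (simp add: card_image_le B1_def)
      also have "\<dots> \<le> (2 * 5 ^ CARD('d)) * (2 ^ j0 * (real j0 + 1) ^ (CARD('d) - 1))" by (rule card_lowfreqs)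
      also have "\<dots> \<le> C * (2 ^ j0 * (real j0 + 1) ^ (CARD('d) - 1))" using C(3) by (intro mult_right_mono) auto
      finally have c1: "real (card B1) \<le> C * (2 ^ j0 * (real j0 + 1) ^ (CARD('d) - 1))" .
      have "card B2 \<le> (\<Sum>j\<in>?I. card ((\<lambda>i. trig (freqs_level j) (g j i)) ` {..<nn j}))"
        unfolding B2_def by (rule card_UN_le) simp
      also have "\<dots> \<le> (\<Sum>j\<in>?I. nn j)" by (rule sum_mono) (use card_image_le[OF finite_lessThan] in force)
      finally have "real (card B2) \<le> (\<Sum>j\<in>?I. real (nn j))" by (simp flip: of_nat_sum)
      then show "card (B1 \<union> B2) \<le> n" using c1 n card_Un_le[of B1 B2] by linarith
      show "finite S" by (rule S)
      show "\<exists>w. b = trig S w" if "b \<in> B1 \<union> B2" for b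
        using that
      proof
        assume "b \<in> B1"
        then obtain k where k: "k \<in> lowfreqs j0" "b = (\<lambda>x. cis (real_vec k \<bullet> x))" by (auto simp: B1_def)
        have "b = trig {k} (\<lambda>_. 1)" by (simp add: k trig_def fun_eq_iff)
        also have "\<dots> = trig S (\<lambda>k'. if k' = k then 1 else 0)" by (rule trig_support) (use k S in auto)
        finally show ?thesis by blast
      next
        assume "b \<in> B2"
        then obtain j i where j: "j \<in> ?I" "b = trig (freqs_level j) (g j i)" unfolding B2_def by blast
        have "b = trig S (\<lambda>k. if k \<in> freqs_level j then g j i k else 0)"
          unfolding j(2) by (rule trig_support) (use S(1) S(3)[OF j(1)] in auto)
        then show ?thesis by blast
      qed
      fix x assume x: "x \<in> M"
      obtain b where Bb: "profile x b"
        using M_blocks(2)[OF x] by (elim exE)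
      have b: "0 \<le> b m" "b m \<le> 1" "bl (r s) q m x \<le> Cq * b m" for m using conjunct1[OF Bb] by auto
      have bt: "(\<Sum>m\<in>F. b m powr t) \<le> 1" if "finite F" for F
        using conjunct1[OF conjunct2[OF Bb], rule_format, of t F] th t that by simp
      define \<tau> where "\<tau> = (\<lambda>j. X j powr \<kappa>)"
      define Bg where "Bg = (\<lambda>j. {m \<in> levelset j. b m > \<tau> j})"
      define T0 where "T0 = {m :: nat ^ 'd. level m \<le> j0}"
      define T where "T = T0 \<union> (\<Union>j\<in>?I. Bg j)"
      have fin: "finite T0" "\<And>j. finite (Bg j)" "finite T" by (simp_all add: T_def T0_def Bg_def)
      have "\<exists>c. \<forall>j\<in>?I. bnorm l q \<sigma>
         ((\<lambda>y. \<Sum>m\<in>Bg j. Delta \<eta>0 m x y) - (\<lambda>y. \<Sum>i<nn j. c j i * trig (freqs_level j) (g j i) y))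
         \<le> ennreal (C0 * (decay j * X j powr \<omega>))"
      proof (rule bchoice, rule ballI)
        fix j assume j: "j \<in> ?I"
        have "\<tau> j powr (1 - t/2) * X j = X j powr (\<kappa> * (1 - t/2)) * X j powr 1" using X[OF j] by (simp add: \<tau>_def powr_powr)
        also have "\<dots> = X j powr \<omega>" by (simp only: powr_add[symmetric] k1)
        finally have e: "\<tau> j powr (1 - t/2) * X j = X j powr \<omega>" .
        have "\<exists>c. bnorm l q \<sigma>
         ((\<lambda>y. \<Sum>m\<in>Bg j. Delta \<eta>0 m x y) - (\<lambda>y. \<Sum>i<nn j. c i * trig (freqs_level j) (g j i) y))
         \<le> ennreal (C0 * (decay j * (\<tau> j powr (1 - t/2) * X j)))"
        proof (rule g[OF j fin(2) _ _ _ bt[OF fin(2)]])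
          show "\<forall>m\<in>Bg j. \<tau> j \<le> b m \<and> bl (r s) q m x \<le> Cq * b m" using b by (auto simp: Bg_def)
        qed (use X[OF j] in \<open>auto simp: Bg_def \<tau>_def\<close>)
        then show "\<exists>c. bnorm l q \<sigma>
         ((\<lambda>y. \<Sum>m\<in>Bg j. Delta \<eta>0 m x y) - (\<lambda>y. \<Sum>i<nn j. c i * trig (freqs_level j) (g j i) y))
         \<le> ennreal (C0 * (decay j * X j powr \<omega>))" unfolding e .
      qed
      then obtain c where c: "\<And>j. j \<in> ?I \<Longrightarrow> bnorm l q \<sigma>
         ((\<lambda>y. \<Sum>m\<in>Bg j. Delta \<eta>0 m x y) - (\<lambda>y. \<Sum>i<nn j. c j i * trig (freqs_level j) (g j i) y))
         \<le> ennreal (C0 * (decay j * X j powr \<omega>))" by blast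
      let ?u = "\<lambda>j y. \<Sum>m\<in>Bg j. Delta \<eta>0 m x y"
      let ?a = "\<lambda>j y. \<Sum>i<nn j. c j i * trig (freqs_level j) (g j i) y"
      define y where "y = (\<lambda>z. (\<Sum>m\<in>T0. Delta \<eta>0 m x z) + (\<Sum>j\<in>?I. ?a j z))"
      have yspan: "y \<in> module.span fun_scale (B1 \<union> B2)"
      proof -
        interpret vector_space fun_scale by (rule vector_space_fun_scale)
        have "Delta \<eta>0 m x \<in> span (B1 \<union> B2)" if "m \<in> T0" for m
          unfolding Delta_in_lowfreqs[OF that[unfolded T0_def mem_Collect_eq]]
          by (rule span_sum_scale) (auto intro!: span_base simp: B1_def)
        then have 1: "(\<lambda>z. \<Sum>m\<in>T0. 1 * Delta \<eta>0 m x z) \<in> span (B1 \<union> B2)" by (rule span_sum_scale)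
        have "?a j \<in> span (B1 \<union> B2)" if "j \<in> ?I" for j
          by (rule span_sum_scale) (use that in \<open>auto intro!: span_base simp: B2_def\<close>)
        then have 2: "(\<lambda>z. \<Sum>j\<in>?I. 1 * ?a j z) \<in> span (B1 \<union> B2)" by (rule span_sum_scale)
        show ?thesis using span_add[OF 1 2] by (simp add: y_def plus_fun_def)
      qed
      have split: "(\<Sum>m\<in>T. Delta \<eta>0 m x z) = (\<Sum>m\<in>T0. Delta \<eta>0 m x z) + (\<Sum>j\<in>?I. ?u j z)" for z
      proof -
        have "(\<Sum>m\<in>T. Delta \<eta>0 m x z) = (\<Sum>m\<in>T0. Delta \<eta>0 m x z) + (\<Sum>m\<in>(\<Union>j\<in>?I. Bg j). Delta \<eta>0 m x z)"
          unfolding T_def by (rule sum.union_disjoint) (use fin in \<open>auto simp: T0_def Bg_def levelset_def\<close>)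
        also have "(\<Sum>m\<in>(\<Union>j\<in>?I. Bg j). Delta \<eta>0 m x z) = (\<Sum>j\<in>?I. ?u j z)"
          by (rule sum.UNION_disjoint) (use fin in \<open>auto simp: Bg_def levelset_def\<close>)
        finally show ?thesis .
      qed
      \<comment> \<open>The error consists of the blocks outside \<open>T\<close>, which are
        dropped, and of the approximation errors of the large blocks on the critical levels.\<close>
      have xy: "x - y = (x - (\<lambda>z. \<Sum>m\<in>T. Delta \<eta>0 m x z)) + (\<lambda>z. \<Sum>j\<in>?I. (?u j - ?a j) z)"
        by (simp add: fun_eq_iff y_def split sum_subtractf)
      have rest: "(\<Sum>m\<in>G. bl l q m x powr \<sigma>) \<le> (Cq * ((1 + C2) * E)) powr \<sigma>" if G: "finite G" "G \<inter> T = {}" for G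
      proof -
        \<comment> \<open>Up to j1 this is the l_\<sigma> norm left by the threshold; beyond j1 only
          the trivial bound 1 is available.\<close>
        define Y where "Y = (\<lambda>i. if i \<le> j1 then X i powr \<omega> else 1)"
        have gt: "j0 < level m" if "m \<in> G" for m using that G(2) by (force simp: T_def T0_def)
        have small: "b m \<le> \<tau> (level m)" if "m \<in> G" "level m \<le> j1" for m
        proof (rule ccontr)
          assume "\<not> b m \<le> \<tau> (level m)"
          then have "m \<in> Bg (level m)" by (simp add: Bg_def levelset_def)
          then have "m \<in> T" using gt[OF that(1)] that(2) by (auto simp: T_def)
          then show False using that(1) G(2) by blast
        qed
        have "(\<Sum>m\<in>G. bl l q m x powr \<sigma>) \<le> (Cq * (\<Sum>i\<in>level ` G. decay i * Y i)) powr \<sigma>"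
        proof (rule small_blocks_bound[where t = t and b = b, OF _ _ _ _ _ profile_bl[OF Bb]])
          fix m assume m: "m \<in> G"
          show "0 \<le> b m \<and> b m \<le> Y (level m) powr (1 / (1 - t/\<sigma>)) \<or> 0 \<le> b m \<and> b m \<le> 1 \<and> Y (level m) = 1"
          proof (cases "level m \<le> j1")
            case True
            then have "Y (level m) powr (1 / (1 - t/\<sigma>)) = \<tau> (level m)" by (simp only: Y_def powr_powr k1 \<tau>_def if_True)
            then show ?thesis using small[OF m True] b(1) by simp
          next
            case False
            then show ?thesis using b by (simp add: Y_def)
          qed
        qed (use t G b bt in \<open>auto simp: Y_def\<close>)
        moreover have "(\<Sum>i\<in>level ` G. decay i * Y i) \<le> (1 + C2) * E"
        proof -
          let ?L = "level ` G \<inter> {..j1}" and ?U = "level ` G - {..j1}"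
          have "(\<Sum>i\<in>level ` G. decay i * Y i) = (\<Sum>i\<in>?L. decay i * Y i) + (\<Sum>i\<in>?U. decay i * Y i)"
            using G(1) by (intro sum.Int_Diff) simp
          also have "(\<Sum>i\<in>?L. decay i * Y i) = (\<Sum>i\<in>?L. decay i * X i powr \<omega>)"
            by (rule sum.cong) (auto simp: Y_def)
          also have "(\<Sum>i\<in>?U. decay i * Y i) = (\<Sum>i\<in>?U. decay i)"
            by (rule sum.cong) (auto simp: Y_def)
          finally have e: "(\<Sum>i\<in>level ` G. decay i * Y i) = (\<Sum>i\<in>?L. decay i * X i powr \<omega>) + (\<Sum>i\<in>?U. decay i)" .
          have "(\<Sum>i\<in>?L. decay i * X i powr \<omega>) \<le> A"
            unfolding A_def by (rule sum_mono2) (use gt in auto)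
          moreover have "(\<Sum>i\<in>?U. decay i) \<le> C2 * decay j1"
            by (rule C2(2)) (use G(1) in auto)
          moreover have "A + C2 * decay j1 \<le> (1 + C2) * E"
          proof -
            have "(1 + C2) * E = A + C2 * decay j1 + (C2 * A + decay j1)"
              unfolding E_def by (simp only: distrib_left distrib_right mult_1_left ac_simps)
            moreover have "0 \<le> C2 * A + decay j1" using A C2(1) by simp
            ultimately show ?thesis by linarith
          qed
          ultimately show ?thesis using e by linarith
        qed
        then have "Cq * (\<Sum>i\<in>level ` G. decay i * Y i) \<le> Cq * ((1 + C2) * E)"
          using Cq_ge_1 by (intro mult_left_mono) auto
        then have "(Cq * (\<Sum>i\<in>level ` G. decay i * Y i)) powr \<sigma> \<le> (Cq * ((1 + C2) * E)) powr \<sigma>"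
          using s0 Cq_ge_1 by (intro powr_mono2) (auto simp: Y_def intro!: mult_nonneg_nonneg sum_nonneg)
        ultimately show ?thesis by linarith
      qed
      have E0: "0 \<le> Cq * ((1 + C2) * E)" using A C2(1) Cq_ge_1 by (simp add: E_def)
      have n1: "bnorm l q \<sigma> (x - (\<lambda>z. \<Sum>m\<in>T. Delta \<eta>0 m x z)) \<le> ennreal (Crest * (Cq * ((1 + C2) * E)))"
        using rest E0 by (intro Crest_bound M_blocks(1)[OF x] fin) auto
      have n2: "bnorm l q \<sigma> (\<lambda>z. \<Sum>j\<in>?I. (?u j - ?a j) z) \<le> ennreal (\<Sum>j\<in>?I. C0 * (decay j * X j powr \<omega>))"
      proof (rule besov_norm_sum[OF s0(4,2)], simp, rule conjI)
        fix j assume j: "j \<in> ?I"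
        show "0 \<le> C0 * (decay j * X j powr \<omega>)" using C0(1) by simp
        show "bnorm l q \<sigma> (?u j - ?a j) \<le> ennreal (C0 * (decay j * X j powr \<omega>))"
          by (rule c[OF j])
      qed
      have "bnorm l q \<sigma> (x - y) \<le> ennreal (Crest * (Cq * ((1 + C2) * E)) + (\<Sum>j\<in>?I. C0 * (decay j * X j powr \<omega>)))"
        unfolding xy by (rule besov_norm_triangle) (use n1 n2 s0 E0 C0(1) Crest_pos in \<open>auto intro!: sum_nonneg mult_nonneg_nonneg\<close>)
      also have "(\<Sum>j\<in>?I. C0 * (decay j * X j powr \<omega>)) = C0 * A" by (simp only: A_def sum_distrib_left)
      finally show "\<exists>y\<in>module.span fun_scale (B1 \<union> B2). bnorm l q \<sigma> (x - y) \<le> ennreal (Crest * (Cq * ((1 + C2) * E)) + C0 * A)"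
        using yspan by blast
    qed
    also have "\<dots> \<le> ennreal (C * E)"
    proof (rule ennreal_leI)
      have "C0 * A \<le> C0 * E" using C0(1) by (intro mult_left_mono) (auto simp: E_def)
      moreover have "(Crest * (Cq * (1 + C2)) + C0) * E \<le> C * E" using C(2) A by (intro mult_right_mono) (auto simp: E_def)
      ultimately show "Crest * (Cq * ((1 + C2) * E)) + C0 * A \<le> C * E" by (simp add: distrib_right mult.assoc)
    qed
    finally show ?thesis by (simp only: E_def A_def X_def)
  qed
  then show ?thesis using C(1) by blast
qed

end

section \<open>Choice of the levels\<close>

text \<open>Exponents of both signs occur, so both end points are taken into account.\<close>

lemma powr_between:
  fixes y :: real
  assumes "0 < c" "c \<le> y" "y \<le> C"
  shows "min (c powr \<nu>) (C powr \<nu>) \<le> y powr \<nu>" "y powr \<nu> \<le> max (c powr \<nu>) (C powr \<nu>)"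
proof -
  have "c powr \<nu> \<le> y powr \<nu> \<and> y powr \<nu> \<le> C powr \<nu> \<or> C powr \<nu> \<le> y powr \<nu> \<and> y powr \<nu> \<le> c powr \<nu>"
  proof (cases "\<nu> \<ge> 0")
    case True
    then show ?thesis using assms powr_mono2[of \<nu> c y] powr_mono2[of \<nu> y C] by simp
  next
    case False
    then show ?thesis using assms powr_mono2'[of \<nu> c y] powr_mono2'[of \<nu> y C] by simp
  qed
  then show "min (c powr \<nu>) (C powr \<nu>) \<le> y powr \<nu>" "y powr \<nu> \<le> max (c powr \<nu>) (C powr \<nu>)" by auto
qed

text \<open>The factor 2 * 2 powr \<gamma> bounds the growth of 2^j (j+1)^\<gamma> from one level to
  the next, so such a level exists for every large n.\<close>

abbreviation at_level :: "real \<Rightarrow> real \<Rightarrow> nat \<Rightarrow> nat \<Rightarrow> bool" where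
  "at_level A \<gamma> n j \<equiv> A * (2 ^ j * (real j + 1) powr \<gamma>) \<le> real n \<and> real n \<le> 2 * 2 powr \<gamma> * A * (2 ^ j * (real j + 1) powr \<gamma>)"

lemma exists_level:
  assumes A: "A > 0" and \<gamma>: "\<gamma> \<ge> 0" and n: "A \<le> real n"
  shows "\<exists>j. at_level A \<gamma> n j"
proof -
  let ?F = "\<lambda>j::nat. A * (2 ^ j * (real j + 1) powr \<gamma>)"
  have "\<exists>i. real n < A * 2 ^ i" using real_arch_pow[of 2 "real n / A"] A by (auto simp: field_simps)
  then obtain i where i: "real n < A * 2 ^ i" by blast
  have "(real i + 1) powr \<gamma> \<ge> 1" using \<gamma> by (intro ge_one_powr_ge_zero) auto
  then have "(A * 2 ^ i) * 1 \<le> (A * 2 ^ i) * (real i + 1) powr \<gamma>" using A by (intro mult_left_mono) auto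
  then have ex: "\<exists>i. real n < ?F i" using i by (intro exI[of _ i]) (simp add: mult.assoc)
  define m where "m = (LEAST i. real n < ?F i)"
  have m: "real n < ?F m" unfolding m_def by (rule LeastI_ex[OF ex])
  have "m \<noteq> 0"
  proof
    assume "m = 0"
    then have "real n < A" using m by simp
    then show False using n by simp
  qed
  then obtain j where j: "m = Suc j" by (cases m) auto
  have 1: "?F j \<le> real n" using not_less_Least[of j "\<lambda>i. real n < ?F i"] j by (simp add: m_def not_less)
  have "(real (Suc j) + 1) powr \<gamma> \<le> (2 * (real j + 1)) powr \<gamma>" using \<gamma> by (intro powr_mono2) auto
  then have "?F m \<le> A * (2 ^ m * (2 * (real j + 1)) powr \<gamma>)" unfolding j using A by (intro mult_left_mono) auto
  also have "\<dots> = 2 * 2 powr \<gamma> * A * (2 ^ j * (real j + 1) powr \<gamma>)" by (simp only: j powr_mult power_Suc mult_ac)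
  finally show ?thesis using 1 m by (intro exI[of _ j]) auto
qed

lemma log_level:
  assumes A: "A > 0" and \<gamma>: "\<gamma> \<ge> 0"
  shows "\<exists>c>0. \<exists>C>0. \<forall>n j. 2 \<le> n \<longrightarrow> A * (2 ^ j * (real j + 1) powr \<gamma>) \<le> real n \<longrightarrow> real n \<le> 2 * 2 powr \<gamma> * A * (2 ^ j * (real j + 1) powr \<gamma>) \<longrightarrow>
    c \<le> (real j + 1) / log 2 (real n) \<and> (real j + 1) / log 2 (real n) \<le> C"
proof -
  define a where "a = \<bar>log 2 A\<bar> + 2 + 2 * \<gamma>"
  have a: "a > 0" using \<gamma> by (simp add: a_def)
  have "1 / a \<le> (real j + 1) / log 2 (real n) \<and> (real j + 1) / log 2 (real n) \<le> a"
    if n: "2 \<le> n" and lo: "A * (2 ^ j * (real j + 1) powr \<gamma>) \<le> real n" and hi: "real n \<le> 2 * 2 powr \<gamma> * A * (2 ^ j * (real j + 1) powr \<gamma>)" for n j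
  proof -
    let ?L = "log 2 (real n)"
    have L1: "?L \<ge> 1" using n by (simp add: le_log_iff)
    have lj: "log 2 (2 ^ j * (real j + 1) powr \<gamma>) = real j + \<gamma> * log 2 (real j + 1)"
      by (simp add: log_mult_pos log_powr)
    have l0: "0 \<le> log 2 (real j + 1)" by simp
    have "real j + 1 \<le> 2 ^ j" by (induction j) auto
    then have lx: "log 2 (real j + 1) \<le> real j" by (simp add: log_le_iff powr_realpow)
    have "log 2 (A * (2 ^ j * (real j + 1) powr \<gamma>)) \<le> ?L" using lo A n by simp
    then have "log 2 A + (real j + \<gamma> * log 2 (real j + 1)) \<le> ?L" using A by (subst (asm) log_mult_pos) (auto simp: lj)
    moreover have "0 \<le> \<gamma> * log 2 (real j + 1)" using \<gamma> l0 by simp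
    ultimately have "real j + 1 \<le> ?L + (\<bar>log 2 A\<bar> + 1)" by linarith
    also have "\<dots> \<le> ?L + (\<bar>log 2 A\<bar> + 1) * ?L" using mult_left_mono[OF L1, of "\<bar>log 2 A\<bar> + 1"] by simp
    also have "\<dots> = (\<bar>log 2 A\<bar> + 2) * ?L" by (simp add: algebra_simps)
    also have "\<dots> \<le> a * ?L" using L1 \<gamma> by (intro mult_right_mono) (auto simp: a_def)
    finally have 1: "real j + 1 \<le> a * ?L" .
    have "?L \<le> log 2 (2 * 2 powr \<gamma> * A * (2 ^ j * (real j + 1) powr \<gamma>))"
      using hi n by (intro log_mono) auto
    also have "\<dots> = log 2 (2 * 2 powr \<gamma> * A) + (real j + \<gamma> * log 2 (real j + 1))" using A by (subst log_mult_pos) (auto simp: lj)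
    also have "log 2 (2 * 2 powr \<gamma> * A) = 1 + \<gamma> + log 2 A" using A by (simp add: log_mult_pos log_powr)
    finally have "?L \<le> 1 + \<gamma> + log 2 A + (real j + \<gamma> * log 2 (real j + 1))" .
    moreover have "\<gamma> * log 2 (real j + 1) \<le> \<gamma> * (real j + 1)" using \<gamma> lx by (intro mult_left_mono) auto
    ultimately have "?L \<le> (1 + \<gamma> + \<bar>log 2 A\<bar>) * 1 + (1 + \<gamma>) * (real j + 1)" by (simp add: algebra_simps)
    also have "\<dots> \<le> (1 + \<gamma> + \<bar>log 2 A\<bar>) * (real j + 1) + (1 + \<gamma>) * (real j + 1)" using \<gamma> by (intro add_right_mono mult_left_mono) auto
    also have "\<dots> = a * (real j + 1)" by (simp add: a_def algebra_simps)
    finally have "?L \<le> a * (real j + 1)" .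
    then show ?thesis using 1 L1 a by (simp add: field_simps)
  qed
  then show ?thesis using a by (intro exI[of _ "1/a"] exI[of _ a] conjI allI impI) auto
qed

text \<open>With P = 2^j (j+1)^\<gamma> comparable to n one has 2^(-\<alpha> j) = P^(-\<alpha>)
  (j+1)^(\<alpha> \<gamma>), and j + 1 is comparable to log n. This is why the exponent of j + 1 is
  shifted by \<alpha> \<gamma>.\<close>

lemma rate_at_level:
  assumes A: "A > 0" and \<gamma>: "\<gamma> \<ge> 0" and \<alpha>: "\<alpha> > 0"
  shows "\<exists>n0. \<exists>c>0. \<exists>C>0. \<forall>n\<ge>n0. \<exists>j. at_level A \<gamma> n j \<and>
    c * (real n powr (- \<alpha>) * log 2 (real n) powr \<nu>) \<le> 2 powr (- \<alpha> * real j) * (real j + 1) powr (\<nu> - \<alpha> * \<gamma>) \<and>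
    2 powr (- \<alpha> * real j) * (real j + 1) powr (\<nu> - \<alpha> * \<gamma>) \<le> C * (real n powr (- \<alpha>) * log 2 (real n) powr \<nu>)"
proof -
  obtain c C where c: "c > 0" "C > 0" and cC: "\<And>n j. 2 \<le> n \<Longrightarrow> A * (2 ^ j * (real j + 1) powr \<gamma>) \<le> real n \<Longrightarrow> real n \<le> 2 * 2 powr \<gamma> * A * (2 ^ j * (real j + 1) powr \<gamma>) \<Longrightarrow>
    c \<le> (real j + 1) / log 2 (real n) \<and> (real j + 1) / log 2 (real n) \<le> C"
    using log_level[OF A \<gamma>] by blast
  define A' where "A' = 2 * 2 powr \<gamma> * A"
  have A': "A' > 0" using A by (simp add: A'_def)
  define m where "m = min (c powr \<nu>) (C powr \<nu>)"
  define mx where "mx = max (c powr \<nu>) (C powr \<nu>)"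
  have m: "m > 0" "mx > 0" using c by (simp_all add: m_def mx_def less_max_iff_disj)
  have "\<exists>j. A * (2 ^ j * (real j + 1) powr \<gamma>) \<le> real n \<and> real n \<le> A' * (2 ^ j * (real j + 1) powr \<gamma>) \<and>
    (A powr \<alpha> * m) * (real n powr (- \<alpha>) * log 2 (real n) powr \<nu>) \<le> 2 powr (- \<alpha> * real j) * (real j + 1) powr (\<nu> - \<alpha> * \<gamma>) \<and>
    2 powr (- \<alpha> * real j) * (real j + 1) powr (\<nu> - \<alpha> * \<gamma>) \<le> (A' powr \<alpha> * mx) * (real n powr (- \<alpha>) * log 2 (real n) powr \<nu>)"
    if n: "n \<ge> max 2 (nat \<lceil>A\<rceil>)" for n
  proof -
    have n2: "n \<ge> 2" and nA: "A \<le> real n" using n by linarith+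
    obtain j where lo: "A * (2 ^ j * (real j + 1) powr \<gamma>) \<le> real n" and hi: "real n \<le> A' * (2 ^ j * (real j + 1) powr \<gamma>)"
      using exists_level[OF A \<gamma> nA] unfolding A'_def by blast
    define P where "P = 2 ^ j * (real j + 1) powr \<gamma>"
    define L where "L = log 2 (real n)"
    define y where "y = (real j + 1) / L"
    have P: "P > 0" by (simp add: P_def)
    have L: "L > 0" using n2 by (simp add: L_def)
    have y: "c \<le> y" "y \<le> C" using cC[OF n2 lo hi[unfolded A'_def]] by (auto simp: y_def L_def)
    have "2 powr (- \<alpha> * real j) * (real j + 1) powr (\<nu> - \<alpha> * \<gamma>) = P powr (- \<alpha>) * (real j + 1) powr \<nu>"
    proof -
      have "P powr (- \<alpha>) = (2 ^ j) powr (- \<alpha>) * (real j + 1) powr (\<gamma> * - \<alpha>)" by (simp add: P_def powr_mult powr_powr)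
      also have "(2 ^ j :: real) powr (- \<alpha>) = 2 powr (- \<alpha> * real j)" by (simp add: powr_powr mult.commute flip: powr_realpow)
      finally have "P powr (- \<alpha>) * (real j + 1) powr \<nu> = 2 powr (- \<alpha> * real j) * ((real j + 1) powr (\<gamma> * - \<alpha>) * (real j + 1) powr \<nu>)" by simp
      also have "(real j + 1) powr (\<gamma> * - \<alpha>) * (real j + 1) powr \<nu> = (real j + 1) powr (\<nu> - \<alpha> * \<gamma>)"
        by (simp add: powr_add[symmetric] algebra_simps)
      finally show ?thesis by simp
    qed
    also have "real j + 1 = y * L" using L by (simp add: y_def)
    also have "(y * L) powr \<nu> = y powr \<nu> * L powr \<nu>" by (rule powr_mult)
    finally have e: "2 powr (- \<alpha> * real j) * (real j + 1) powr (\<nu> - \<alpha> * \<gamma>) = P powr (- \<alpha>) * (y powr \<nu> * L powr \<nu>)"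
      using \<open>real j + 1 = y * L\<close> by simp
    have yb: "m \<le> y powr \<nu>" "y powr \<nu> \<le> mx" using powr_between[OF c(1) y] by (simp_all add: m_def mx_def)
    have "(real n / A) powr (- \<alpha>) \<le> P powr (- \<alpha>)" "P powr (- \<alpha>) \<le> (real n / A') powr (- \<alpha>)"
      using lo hi A A' P \<alpha> n2 by (auto intro!: powr_mono2' simp: P_def field_simps)
    then have Pb: "A powr \<alpha> * real n powr (- \<alpha>) \<le> P powr (- \<alpha>)" "P powr (- \<alpha>) \<le> A' powr \<alpha> * real n powr (- \<alpha>)"
      using A A' by (auto simp: powr_divide powr_minus field_simps)
    have "(A powr \<alpha> * real n powr (- \<alpha>)) * (m * L powr \<nu>) \<le> P powr (- \<alpha>) * (y powr \<nu> * L powr \<nu>)"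
      using Pb(1) yb(1) m by (intro mult_mono) auto
    moreover have "P powr (- \<alpha>) * (y powr \<nu> * L powr \<nu>) \<le> (A' powr \<alpha> * real n powr (- \<alpha>)) * (mx * L powr \<nu>)"
      using Pb(2) yb(2) m by (intro mult_mono) auto
    ultimately show ?thesis using lo hi by (intro exI[of _ j]) (unfold e L_def[symmetric], simp add: mult_ac)
  qed
  moreover have "A powr \<alpha> * m > 0" "A' powr \<alpha> * mx > 0" using A A' m by simp_all
  ultimately show ?thesis unfolding A'_def[symmetric] by blast
qed

text \<open>The finitely many small n inherit the bound at N by monotonicity; dividing by the sum of
  their rates makes the constant small enough for all of them.\<close>

lemma extend_lower_bound:
  fixes f :: "nat \<Rightarrow> ennreal" and \<rho> :: "nat \<Rightarrow> real"
  assumes f: "antimono f" and \<rho>: "\<And>n. n \<ge> 2 \<Longrightarrow> \<rho> n > 0" and c: "c > 0" "\<And>n. n \<ge> n0 \<Longrightarrow> ennreal (c * \<rho> n) \<le> f n"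
  shows "\<exists>c>0. \<forall>n\<ge>2. ennreal (c * \<rho> n) \<le> f n"
proof -
  define N where "N = max n0 2"
  define S where "S = (\<Sum>i\<in>{2..N}. \<rho> i)"
  have le: "\<rho> n \<le> S" if "n \<in> {2..N}" for n
    unfolding S_def by (rule member_le_sum[OF that]) (use \<rho> in \<open>auto intro: less_imp_le\<close>)
  have rN: "\<rho> N > 0" using \<rho> by (simp add: N_def)
  have S: "S > 0" using le[of N] rN by (simp add: N_def)
  let ?c = "min c (c * \<rho> N / S)"
  have "ennreal (?c * \<rho> n) \<le> f n" if n: "n \<ge> 2" for n
  proof (cases "n \<ge> N")
    case True
    have "?c * \<rho> n \<le> c * \<rho> n" using \<rho>[OF n] by (intro mult_right_mono) auto
    then have "ennreal (?c * \<rho> n) \<le> ennreal (c * \<rho> n)" by (rule ennreal_leI)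
    also have "\<dots> \<le> f n" using True by (intro c) (simp add: N_def)
    finally show ?thesis .
  next
    case False
    have "?c * \<rho> n \<le> c * \<rho> N / S * S" using le[of n] n False rN S c(1) \<rho>[OF n] by (intro mult_mono) auto
    also have "\<dots> = c * \<rho> N" using S by simp
    finally have "ennreal (?c * \<rho> n) \<le> ennreal (c * \<rho> N)" by (rule ennreal_leI)
    also have "\<dots> \<le> f N" by (intro c) (simp add: N_def)
    also have "\<dots> \<le> f n" using f False by (auto simp: antimono_def)
    finally show ?thesis .
  qed
  moreover have "?c > 0" using c(1) rN S by simp
  ultimately show ?thesis by blast
qed

text \<open>For small n the global bound D suffices, since the finitely many rates are
  positive.\<close>

lemma extend_upper_bound:
  fixes f :: "nat \<Rightarrow> ennreal" and \<rho> :: "nat \<Rightarrow> real"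
  assumes f: "\<And>n. f n \<le> ennreal D" and D: "D \<ge> 0" and \<rho>: "\<And>n. n \<ge> 2 \<Longrightarrow> \<rho> n > 0"
    and C: "C > 0" "\<And>n. n \<ge> n0 \<Longrightarrow> f n \<le> ennreal (C * \<rho> n)"
  shows "\<exists>C>0. \<forall>n\<ge>2. f n \<le> ennreal (C * \<rho> n)"
proof -
  define S where "S = (\<Sum>i\<in>{2..n0}. D / \<rho> i)"
  have D\<rho>: "D / \<rho> i \<ge> 0" if "i \<in> {2..n0}" for i using D \<rho>[of i] that by (simp add: less_imp_le)
  then have S0: "S \<ge> 0" unfolding S_def by (rule sum_nonneg)
  have "f n \<le> ennreal ((C + S) * \<rho> n)" if n: "n \<ge> 2" for n
  proof (cases "n \<ge> n0")
    case True
    have "f n \<le> ennreal (C * \<rho> n)" by (rule C(2)[OF True])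
    also have "\<dots> \<le> ennreal ((C + S) * \<rho> n)" using S0 \<rho>[OF n] by (intro ennreal_leI mult_right_mono) auto
    finally show ?thesis .
  next
    case False
    have "D / \<rho> n \<le> S" unfolding S_def
      by (rule member_le_sum) (use n False D\<rho> in auto)
    then have "D / \<rho> n * \<rho> n \<le> (C + S) * \<rho> n" using C(1) \<rho>[OF n] by (intro mult_right_mono) auto
    then have "D \<le> (C + S) * \<rho> n" using \<rho>[OF n] by simp
    then show ?thesis using f[of n] ennreal_leI order_trans by blast
  qed
  then show ?thesis using S0 C(1) by (intro exI[of _ "C + S"]) auto
qed

lemma antimono_kolmogorov_width: "antimono (kolmogorov_width smul N M)"
  unfolding antimono_def kolmogorov_width_def by (intro allI impI INF_superset_mono) (auto intro: order_trans)

section \<open>Rates for all n\<close>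

context besov_data
begin

text \<open>Approximation by the zero subspace: the number of blocks of a level is at most a power
  of the level, which the decay makes summable.\<close>

lemma width_bounded: "\<exists>D\<ge>0. \<forall>n. width n \<le> ennreal D"
proof -
  have s0: "\<sigma> > 0" "\<sigma> \<ge> 1" "q > 0" "q \<ge> 1" using s2 q2 by auto
  obtain C2 where C2: "C2 > 0" "\<And>J. finite J \<Longrightarrow> (\<Sum>i\<in>J. (real i + 1) powr ((real CARD('d) - 1) / \<sigma>) * decay i) \<le> C2"
    using sum_polynomial_exponential_bound[OF alpha_pos, of "(real CARD('d) - 1) / \<sigma>"] s0 by (auto simp: Suc_leI)
  have "width n \<le> ennreal (Crest * (Cq * C2))" for n
  proof (rule besov_width_le[where B = "{}" and S = "{}"])
    fix x assume x: "x \<in> M"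
    obtain b where Bb: "profile x b"
      using M_blocks(2)[OF x] by (elim exE)
    have "(\<Sum>m\<in>G. bl l q m x powr \<sigma>) \<le> (Cq * C2) powr \<sigma>" if G: "finite G" for G
    proof -
      have "(\<Sum>m\<in>G. bl l q m x powr \<sigma>) \<le> (Cq * (\<Sum>i\<in>level ` G. decay i * (real i + 1) powr ((real CARD('d) - 1) / \<sigma>))) powr \<sigma>"
      proof (rule levels_bound[OF G _ profile_bl[OF Bb]])
        fix i
        have "(\<Sum>m\<in>G \<inter> blocks i. b m powr \<sigma>) \<le> real (card (G \<inter> blocks i)) * 1"
          by (rule sum_bounded_above) (use Bb s0 in \<open>auto intro: powr_le1\<close>)
        also have "\<dots> \<le> ((real i + 1) powr ((real CARD('d) - 1) / \<sigma>)) powr \<sigma>"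
          using card_levelset_Int_le[of G i] s0 by (simp add: powr_powr)
        finally show "(\<Sum>m\<in>G \<inter> blocks i. b m powr \<sigma>) \<le> ((real i + 1) powr ((real CARD('d) - 1) / \<sigma>)) powr \<sigma>" .
      qed simp
      also have "\<dots> \<le> (Cq * C2) powr \<sigma>"
        using C2(2)[of "level ` G"] G s0 Cq_ge_1
        by (intro powr_mono2 mult_left_mono) (auto simp: mult.commute intro!: mult_nonneg_nonneg sum_nonneg)
      finally show ?thesis .
    qed
    then have "bnorm l q \<sigma> (x - (\<lambda>t. \<Sum>m\<in>{}. Delta \<eta>0 m x t)) \<le> ennreal (Crest * (Cq * C2))"
      using C2 Cq_ge_1 by (intro Crest_bound M_blocks(1)[OF x]) auto
    moreover have "(\<lambda>t :: real ^ 'd. \<Sum>m\<in>{}. Delta \<eta>0 m x t) \<in> module.span fun_scale {}"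
    proof -
      interpret vector_space fun_scale by (rule vector_space_fun_scale)
      show ?thesis using span_zero[of "{}"] by (simp add: zero_fun_def)
    qed
    ultimately show "\<exists>y\<in>module.span fun_scale {}. bnorm l q \<sigma> (x - y) \<le> ennreal (Crest * (Cq * C2))" by blast
  qed (use s0 in auto)
  then show ?thesis using Crest_pos C2 Cq_ge_1 by (intro exI[of _ "Crest * (Cq * C2)"]) auto
qed

definition rate :: "real \<Rightarrow> nat \<Rightarrow> real" where
  "rate \<nu> n = real n powr (- \<alpha>) * log 2 (real n) powr \<nu>"

lemma rate_pos: "n \<ge> 2 \<Longrightarrow> rate \<nu> n > 0"
proof -
  assume "n \<ge> 2"
  then have "log 2 (real n) > 0" "real n > 0" by simp_all
  then show ?thesis unfolding rate_def by (intro mult_pos_pos) (simp_all only: powr_gt_zero)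
qed

lemma upper_rate:
  assumes A: "A > 0" "\<gamma> \<ge> 0" and K: "K > 0"
    and up: "\<And>j n. A * (2 ^ j * (real j + 1) powr \<gamma>) \<le> real n \<Longrightarrow>
       width n \<le> ennreal (K * (decay j * (real j + 1) powr (\<nu> - \<alpha> * \<gamma>)))"
  shows "\<exists>C>0. \<forall>n\<ge>2. width n \<le> ennreal (C * rate \<nu> n)"
proof -
  obtain n0 c C where "C > 0" and j: "\<And>n. n \<ge> n0 \<Longrightarrow> \<exists>j. at_level A \<gamma> n j \<and>
    c * rate \<nu> n \<le> decay j * (real j + 1) powr (\<nu> - \<alpha> * \<gamma>) \<and>
    decay j * (real j + 1) powr (\<nu> - \<alpha> * \<gamma>) \<le> C * rate \<nu> n"
    using rate_at_level[OF A alpha_pos, of \<nu>] unfolding rate_def by blast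
  obtain D where D: "D \<ge> 0" "\<And>n. width n \<le> ennreal D" using width_bounded by blast
  show ?thesis
  proof (rule extend_upper_bound[OF D(2,1) rate_pos])
    show "K * C > 0" using K \<open>C > 0\<close> by simp
    fix n assume "n \<ge> n0"
    then obtain i where i: "A * (2 ^ i * (real i + 1) powr \<gamma>) \<le> real n" "decay i * (real i + 1) powr (\<nu> - \<alpha> * \<gamma>) \<le> C * rate \<nu> n"
      using j by blast
    have "width n \<le> ennreal (K * (decay i * (real i + 1) powr (\<nu> - \<alpha> * \<gamma>)))" by (rule up[OF i(1)])
    also have "\<dots> \<le> ennreal (K * (C * rate \<nu> n))" using K by (intro ennreal_leI mult_left_mono i) auto
    finally show "width n \<le> ennreal (K * C * rate \<nu> n)" by (simp only: mult.assoc)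
  qed
qed

lemma lower_rate:
  assumes A: "A > 0" "\<gamma> \<ge> 0" and K: "K > 0"
    and lo: "\<And>j n. real n \<le> A * (2 ^ j * (real j + 1) powr \<gamma>) \<Longrightarrow>
       ennreal (K * (decay j * (real j + 1) powr (\<nu> - \<alpha> * \<gamma>))) \<le> width n"
  shows "\<exists>c>0. \<forall>n\<ge>2. ennreal (c * rate \<nu> n) \<le> width n"
proof -
  \<comment> \<open>Division by the growth factor of \<open>at_level\<close> turns the upper
    estimate there into the hypothesis of \<open>lo\<close>.\<close>
  have A': "A / (2 * 2 powr \<gamma>) > 0" using A by simp
  obtain n0 c C where "c > 0" and j: "\<And>n. n \<ge> n0 \<Longrightarrow> \<exists>j. at_level (A / (2 * 2 powr \<gamma>)) \<gamma> n j \<and>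
    c * rate \<nu> n \<le> decay j * (real j + 1) powr (\<nu> - \<alpha> * \<gamma>) \<and>
    decay j * (real j + 1) powr (\<nu> - \<alpha> * \<gamma>) \<le> C * rate \<nu> n"
    using rate_at_level[OF A' A(2) alpha_pos, of \<nu>] unfolding rate_def by blast
  show ?thesis
  proof (rule extend_lower_bound[OF _ rate_pos])
    show "antimono width" unfolding besov_width_def by (rule antimono_kolmogorov_width)
    show "K * c > 0" using K \<open>c > 0\<close> by simp
    fix n assume "n \<ge> n0"
    then obtain i where i: "real n \<le> 2 * 2 powr \<gamma> * (A / (2 * 2 powr \<gamma>)) * (2 ^ i * (real i + 1) powr \<gamma>)"
      "c * rate \<nu> n \<le> decay i * (real i + 1) powr (\<nu> - \<alpha> * \<gamma>)"
      using j by blast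
    have "ennreal (K * (c * rate \<nu> n)) \<le> ennreal (K * (decay i * (real i + 1) powr (\<nu> - \<alpha> * \<gamma>)))"
      using K by (intro ennreal_leI mult_left_mono i) auto
    also have "\<dots> \<le> width n" by (rule lo) (use i(1) in simp)
    finally show "ennreal (K * c * rate \<nu> n) \<le> width n" by (simp only: mult.assoc)
  qed
qed

text \<open>Since Z >= 1, its integer part is at least Z/2, the source of the factor 2^(\<omega>/2).
  The distance \<open>k\<close> from the critical level j is left free because it is i - j in one
  regime and j - i in the other.\<close>

lemma gain_floor_powr_le:
  assumes Z: "Z = 2 powr real j * (real j + 1) powr \<gamma> * 2 powr (- e * k)" "Z \<ge> 1" and \<omega>: "\<omega> \<ge> 0"
  shows "gain i (nat \<lfloor>Z\<rfloor>) powr \<omega> \<le> 2 powr (\<omega>/2) * 2 powr ((real i - real j + e * k) * \<omega>/2) * (real j + 1) powr (- \<gamma> * \<omega>/2)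
     * (real i + 1) powr ((real CARD('d) - 1) * \<omega> / \<sigma>)"
proof -
  have "\<lfloor>Z\<rfloor> \<ge> 1" "real_of_int \<lfloor>Z\<rfloor> > Z - 1" using Z(2) by linarith+
  moreover from this have "real (nat \<lfloor>Z\<rfloor>) = real_of_int \<lfloor>Z\<rfloor>" "real_of_int \<lfloor>Z\<rfloor> \<ge> 1" by simp_all
  ultimately have n: "real (nat \<lfloor>Z\<rfloor>) \<ge> Z / 2" by linarith
  have Z0: "Z > 0" using Z(2) by linarith
  have "real (nat \<lfloor>Z\<rfloor>) * (Z/2) > 0" using n Z0 by (intro mult_pos_pos) linarith+
  then have "2 ^ i / real (nat \<lfloor>Z\<rfloor>) \<le> 2 ^ i / (Z/2)" using n by (intro divide_left_mono) auto
  also have "\<dots> = 2 * (2 powr (real i - real j + e * k) * (real j + 1) powr (- \<gamma>))"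
  proof -
    have "2 powr real i / 2 powr real j / 2 powr (- e * k) = 2 powr (real i - real j - - e * k)" by (simp only: powr_diff)
    moreover have "real i - real j - - e * k = real i - real j + e * k" by simp
    ultimately have e: "2 powr real i / 2 powr real j / 2 powr (- e * k) = 2 powr (real i - real j + e * k)" by (simp only:)
    have "2 ^ i / (Z/2) = 2 * ((2 powr real i / 2 powr real j / 2 powr (- e * k)) / (real j + 1) powr \<gamma>)"
      by (simp add: Z(1) powr_realpow mult_ac)
    then show ?thesis unfolding e by (simp only: powr_minus_divide times_divide_eq_right mult_1_right)
  qed
  finally have le: "2 ^ i / real (nat \<lfloor>Z\<rfloor>) \<le> 2 * (2 powr (real i - real j + e * k) * (real j + 1) powr (- \<gamma>))" .
  have "gain i (nat \<lfloor>Z\<rfloor>) powr \<omega> = (2 ^ i / real (nat \<lfloor>Z\<rfloor>)) powr (\<omega>/2) * (real i + 1) powr ((real CARD('d) - 1) * \<omega> / \<sigma>)"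
  proof -
    have "sqrt u powr \<omega> = u powr (\<omega>/2)" if "u \<ge> 0" for u using that by (simp add: powr_half_sqrt[symmetric] powr_powr)
    then show ?thesis by (simp add: gain_def powr_mult powr_powr)
  qed
  also have "\<dots> \<le> (2 * (2 powr (real i - real j + e * k) * (real j + 1) powr (- \<gamma>))) powr (\<omega>/2) * (real i + 1) powr ((real CARD('d) - 1) * \<omega> / \<sigma>)"
    using le \<omega> by (intro mult_right_mono powr_mono2) auto
  also have "\<dots> = 2 powr (\<omega>/2) * 2 powr ((real i - real j + e * k) * \<omega>/2) * (real j + 1) powr (- \<gamma> * \<omega>/2)
     * (real i + 1) powr ((real CARD('d) - 1) * \<omega> / \<sigma>)"
    by (simp add: powr_mult powr_powr)
  finally show ?thesis .
qed

text \<open>The level \<open>j\<close> carries about \<open>n\<close> frequencies. Lower levels are kept, and the numbers of vectors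
  spent on the levels between \<open>j\<close> and \<open>2 j\<close> decrease geometrically.\<close>

lemma width_upper_large_smoothness:
  assumes t: "2 \<le> t" "t < \<sigma>" and th: "\<theta> s \<le> ennreal t"
    and \<alpha>\<omega>: "\<alpha> > (1/t - 1/\<sigma>) / (1/2 - 1/\<sigma>) / 2"
  shows "\<exists>C>0. \<forall>n\<ge>2. width n \<le> ennreal (C * rate ((real CARD('d) - 1) * (\<alpha> + 1/\<sigma> - 1/t)) n)"
proof -
  define \<omega> where "\<omega> = (1/t - 1/\<sigma>) / (1/2 - 1/\<sigma>)"
  define B where "B = real CARD('d) - 1"
  have B: "B \<ge> 0" by (simp add: B_def)
  have h: "1/2 - 1/\<sigma> > 0" "1/t - 1/\<sigma> > 0" using s2 t by (auto simp: field_simps)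
  have \<omega>: "\<omega> > 0" "\<omega> * (1/2 - 1/\<sigma>) = 1/t - 1/\<sigma>" using h unfolding \<omega>_def by (auto intro: divide_pos_pos)
  \<comment> \<open>The geometric rate at which the numbers of vectors decrease. e <= 1/2 ensures at
    least one vector on each level up to 2 j, and e * \<omega> <= \<alpha> - \<omega>/2 leaves the
    errors a positive rate of decay \<delta>.\<close>
  define e where "e = min (1/2) ((\<alpha> - \<omega>/2) / \<omega>)"
  define \<delta> where "\<delta> = \<alpha> - \<omega>/2 - e * \<omega>/2"
  have e0: "e > 0" using \<alpha>\<omega> \<omega>(1) unfolding e_def \<omega>_def[symmetric] by auto
  have e1: "e \<le> 1/2" unfolding e_def by (rule min.cobounded1)
  have \<delta>: "\<delta> > 0"
  proof -
    have "e * \<omega> \<le> (\<alpha> - \<omega>/2) / \<omega> * \<omega>" unfolding e_def using \<omega> by (intro mult_right_mono) auto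
    also have "\<dots> = \<alpha> - \<omega>/2" using \<omega>(1) by simp
    finally show ?thesis using \<alpha>\<omega> unfolding \<omega>_def[symmetric] \<delta>_def by linarith
  qed
  obtain C0 where C0: "C0 > 0" "\<And>n j0 j1 (nn :: nat \<Rightarrow> nat). j0 \<le> j1 \<Longrightarrow> (\<forall>j\<in>{j0<..j1}. nn j \<ge> 1) \<Longrightarrow>
     C0 * (2 ^ j0 * (real j0 + 1) ^ (CARD('d) - 1)) + (\<Sum>j\<in>{j0<..j1}. real (nn j)) \<le> real n \<Longrightarrow>
     width n \<le> ennreal (C0 * ((\<Sum>j\<in>{j0<..j1}. decay j * gain j (nn j) powr \<omega>) + decay j1))"
    using width_upper_rand[OF t th] unfolding \<omega>_def by blast
  obtain G1 where G1: "G1 > 0" "\<And>J. finite J \<Longrightarrow> (\<Sum>i\<in>J. (real i + 1) powr 0 * 2 powr (- e * real i)) \<le> G1"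
    using sum_polynomial_exponential_bound[OF e0 order_refl] by blast
  have Bw: "B * \<omega> / \<sigma> \<ge> 0" using B \<omega> s2 by simp
  obtain G2 where G2: "G2 > 0" "\<And>J. finite J \<Longrightarrow> (\<Sum>i\<in>J. (real i + 1) powr (B * \<omega> / \<sigma>) * 2 powr (- \<delta> * real i)) \<le> G2"
    using sum_polynomial_exponential_bound[OF \<delta> Bw] by blast
  have Bt: "B * (1/t - 1/\<sigma>) \<ge> 0" using B h by simp
  obtain G3 where G3: "G3 > 0" "\<And>x. x \<ge> 0 \<Longrightarrow> (x + 1) powr (B * (1/t - 1/\<sigma>)) * 2 powr (- \<alpha> * x) \<le> G3"
    using polynomial_exponential_bound[OF alpha_pos Bt] by blast
  define K where "K = C0 * (2 powr (\<omega>/2) * G2 + G3)"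
  have K: "K > 0" using C0 G2 G3 by (simp add: K_def add_pos_pos)
  show ?thesis
  proof (rule upper_rate[OF _ B K])
    show "C0 + G1 > 0" using C0 G1 by simp
    fix j n
    assume n: "(C0 + G1) * (2 ^ j * (real j + 1) powr B) \<le> real n"
    define P where "P = 2 powr real j * (real j + 1) powr B"
    have P: "P \<ge> 2 powr real j"
    proof -
      have "(real j + 1) powr B \<ge> 1" using B by (intro ge_one_powr_ge_zero) auto
      from mult_left_mono[OF this, of "2 powr real j"] show ?thesis by (simp add: P_def)
    qed
    have P0: "P > 0" by (simp add: P_def)
    define Z where "Z = (\<lambda>i. P * 2 powr (- e * (real i - real j)))"
    define nn where "nn = (\<lambda>i. nat \<lfloor>Z i\<rfloor>)"
    \<comment> \<open>The range ends at 2 j because the decay there is the square of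
      \<open>decay j\<close>, so that the second factor beats every power of j.\<close>
    let ?I = "{j<..2*j}"
    have Z1: "Z i \<ge> 1" if i: "i \<in> ?I" for i
    proof -
      have "e * (real i - real j) \<le> 1/2 * real j" using i e0 e1 by (intro mult_mono) auto
      then have "0 \<le> real j + - e * (real i - real j)" by simp
      then have "2 powr 0 \<le> 2 powr (real j + - e * (real i - real j))" by (intro powr_mono) auto
      also have "\<dots> = 2 powr real j * 2 powr (- e * (real i - real j))" by (rule powr_add)
      also have "\<dots> \<le> Z i" unfolding Z_def using P by (intro mult_right_mono) auto
      finally show ?thesis by simp
    qed
    have inj: "inj_on (\<lambda>i. i - j) ?I" by (intro inj_onI) (metis eq_diff_iff greaterThanAtMost_iff less_imp_le)
    have "(\<Sum>i\<in>?I. real (nn i)) \<le> (\<Sum>i\<in>?I. P * ((real (i - j) + 1) powr 0 * 2 powr (- e * real (i - j))))"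
    proof (rule sum_mono)
      fix i assume i: "i \<in> ?I"
      have "real (nn i) \<le> Z i" using Z1[OF i] unfolding nn_def by linarith
      also have "Z i = P * ((real (i - j) + 1) powr 0 * 2 powr (- e * real (i - j)))" using i by (simp add: Z_def of_nat_diff)
      finally show "real (nn i) \<le> P * ((real (i - j) + 1) powr 0 * 2 powr (- e * real (i - j)))" .
    qed
    also have "\<dots> = P * (\<Sum>i\<in>(\<lambda>i. i - j) ` ?I. (real i + 1) powr 0 * 2 powr (- e * real i))"
      by (simp only: sum_distrib_left[symmetric] sum.reindex[OF inj] o_def)
    also have "\<dots> \<le> P * G1" using P0 by (intro mult_left_mono G1) auto
    finally have c1: "(\<Sum>i\<in>?I. real (nn i)) \<le> P * G1" .
    have Pn: "2 ^ j * (real j + 1) powr B = P" by (simp add: P_def powr_realpow)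
    have "(real j + 1) ^ (CARD('d) - 1) = (real j + 1) powr B"
      by (simp add: B_def of_nat_diff flip: powr_realpow)
    then have c0: "C0 * (2 ^ j * (real j + 1) ^ (CARD('d) - 1)) = C0 * P" by (simp only: Pn)
    have "C0 * P + P * G1 \<le> real n" using n unfolding Pn by (simp add: algebra_simps)
    then have cnt: "C0 * (2 ^ j * (real j + 1) ^ (CARD('d) - 1)) + (\<Sum>i\<in>?I. real (nn i)) \<le> real n"
      using c1 unfolding c0 by linarith
    have "width n \<le> ennreal (C0 * ((\<Sum>i\<in>?I. decay i * gain i (nn i) powr \<omega>) + decay (2*j)))"
      by (rule C0(2)[OF _ _ cnt]) (use Z1 in \<open>force simp: nn_def le_nat_iff\<close>)+
    also have "\<dots> \<le> ennreal (C0 * ((2 powr (\<omega>/2) * G2 + G3) * (decay j * (real j + 1) powr (- B * (1/t - 1/\<sigma>)))))"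
    proof (intro ennreal_leI mult_left_mono)
      have "(\<Sum>i\<in>?I. decay i * gain i (nn i) powr \<omega>)
        \<le> (\<Sum>i\<in>?I. (2 powr (\<omega>/2) * (decay j * (real j + 1) powr (- B * (1/t - 1/\<sigma>)))) * ((real (i - j) + 1) powr (B * \<omega> / \<sigma>) * 2 powr (- \<delta> * real (i - j))))"
      proof (rule sum_mono)
        fix i assume i: "i \<in> ?I"
        define k where "k = real (i - j)"
        have k: "k \<ge> 0" "real i = real j + k" "real i - real j = k" using i by (auto simp: k_def of_nat_diff)
        have "gain i (nn i) powr \<omega> \<le> 2 powr (\<omega>/2) * 2 powr ((real i - real j + e * (real i - real j)) * \<omega>/2) * (real j + 1) powr (- B * \<omega>/2)
           * (real i + 1) powr (B * \<omega> / \<sigma>)"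
          unfolding nn_def B_def by (rule gain_floor_powr_le) (use Z1[OF i] \<omega> in \<open>auto simp: Z_def P_def B_def\<close>)
        also have "\<dots> \<le> 2 powr (\<omega>/2) * 2 powr ((real i - real j + e * (real i - real j)) * \<omega>/2) * (real j + 1) powr (- B * \<omega>/2)
           * ((real j + 1) * (k + 1)) powr (B * \<omega> / \<sigma>)"
        proof (intro mult_left_mono powr_mono2 Bw)
          show "real i + 1 \<le> (real j + 1) * (k + 1)" using k by (simp add: algebra_simps)
        qed auto
        also have "\<dots> = 2 powr (\<omega>/2) * 2 powr ((k + e * k) * \<omega>/2) * ((real j + 1) powr (- B * \<omega>/2) * (real j + 1) powr (B * \<omega> / \<sigma>))
           * (k + 1) powr (B * \<omega> / \<sigma>)" by (simp only: k(3) powr_mult mult.assoc)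
        \<comment> \<open>By the definition of \<omega>, \<omega> (1/2 - 1/\<sigma>) = 1/t -
          1/\<sigma>, which combines the two powers into the logarithmic exponent of the
          rate.\<close>
        also have "(real j + 1) powr (- B * \<omega>/2) * (real j + 1) powr (B * \<omega> / \<sigma>) = (real j + 1) powr (- B * (1/t - 1/\<sigma>))"
          by (subst powr_add[symmetric]) (simp add: \<omega>(2)[symmetric] algebra_simps)
        finally have g: "gain i (nn i) powr \<omega> \<le> 2 powr (\<omega>/2) * 2 powr ((k + e * k) * \<omega>/2) * (real j + 1) powr (- B * (1/t - 1/\<sigma>)) * (k + 1) powr (B * \<omega> / \<sigma>)" .
        have ex: "decay i * 2 powr ((k + e * k) * \<omega>/2) = decay j * 2 powr (- \<delta> * k)"
          by (simp add: k(2) \<delta>_def powr_add[symmetric] algebra_simps add_divide_distrib diff_divide_distrib)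
        have "decay i * gain i (nn i) powr \<omega>
          \<le> decay i * (2 powr (\<omega>/2) * 2 powr ((k + e * k) * \<omega>/2) * (real j + 1) powr (- B * (1/t - 1/\<sigma>)) * (k + 1) powr (B * \<omega> / \<sigma>))"
          by (rule mult_left_mono[OF g]) simp
        also have "\<dots> = (decay i * 2 powr ((k + e * k) * \<omega>/2)) * (2 powr (\<omega>/2) * (real j + 1) powr (- B * (1/t - 1/\<sigma>)) * (k + 1) powr (B * \<omega> / \<sigma>))"
          by (simp only: mult_ac)
        also have "\<dots> = (2 powr (\<omega>/2) * (decay j * (real j + 1) powr (- B * (1/t - 1/\<sigma>)))) * ((k + 1) powr (B * \<omega> / \<sigma>) * 2 powr (- \<delta> * k))"
          unfolding ex by (simp only: mult_ac)
        finally show "decay i * gain i (nn i) powr \<omega> \<le> (2 powr (\<omega>/2) * (decay j * (real j + 1) powr (- B * (1/t - 1/\<sigma>)))) * ((real (i - j) + 1) powr (B * \<omega> / \<sigma>) * 2 powr (- \<delta> * real (i - j)))"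
          unfolding k_def .
      qed
      also have "\<dots> = (2 powr (\<omega>/2) * (decay j * (real j + 1) powr (- B * (1/t - 1/\<sigma>)))) * (\<Sum>i\<in>(\<lambda>i. i - j) ` ?I. (real i + 1) powr (B * \<omega> / \<sigma>) * 2 powr (- \<delta> * real i))"
        by (simp only: sum_distrib_left[symmetric] sum.reindex[OF inj] o_def)
      also have "\<dots> \<le> (2 powr (\<omega>/2) * (decay j * (real j + 1) powr (- B * (1/t - 1/\<sigma>)))) * G2"
        by (intro mult_left_mono G2) auto
      finally have 1: "(\<Sum>i\<in>?I. decay i * gain i (nn i) powr \<omega>) \<le> (2 powr (\<omega>/2) * G2) * (decay j * (real j + 1) powr (- B * (1/t - 1/\<sigma>)))"
        by (simp only: mult_ac)
      have g3: "decay j \<le> G3 * (real j + 1) powr (- B * (1/t - 1/\<sigma>))"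
      proof -
        have "decay j \<le> G3 / (real j + 1) powr (B * (1/t - 1/\<sigma>))"
          using G3(2)[of "real j"] by (subst pos_le_divide_eq) (simp_all add: mult.commute)
        also have "\<dots> = G3 * (real j + 1) powr (- (B * (1/t - 1/\<sigma>)))" by (simp only: powr_minus divide_inverse)
        finally show ?thesis by simp
      qed
      have "decay (2*j) = decay j * decay j"
        by (simp add: powr_add[symmetric] algebra_simps)
      also have "\<dots> \<le> decay j * (G3 * (real j + 1) powr (- B * (1/t - 1/\<sigma>)))"
        by (rule mult_left_mono[OF g3]) simp
      finally have 2: "decay (2*j) \<le> G3 * (decay j * (real j + 1) powr (- B * (1/t - 1/\<sigma>)))" by (simp only: mult_ac)
      show "(\<Sum>i\<in>?I. decay i * gain i (nn i) powr \<omega>) + decay (2*j)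
        \<le> (2 powr (\<omega>/2) * G2 + G3) * (decay j * (real j + 1) powr (- B * (1/t - 1/\<sigma>)))"
        using add_mono[OF 1 2] by (simp only: distrib_right)
    qed (use C0 in simp)
    also have "- B * (1/t - 1/\<sigma>) = (real CARD('d) - 1) * (\<alpha> + 1/\<sigma> - 1/t) - \<alpha> * B"
      by (simp add: B_def algebra_simps)
    finally show "width n \<le> ennreal (K * (decay j * (real j + 1) powr ((real CARD('d) - 1) * (\<alpha> + 1/\<sigma> - 1/t) - \<alpha> * B)))"
      by (simp only: K_def mult.assoc)
  qed
qed

text \<open>Now the levels up to half the critical one are kept, and the numbers of vectors increase
  geometrically up to the critical level, whose index is chosen so that the error is still of order
  \<open>decay j\<close>.\<close>

lemma width_upper_small_smoothness:
  assumes t: "2 \<le> t" "t < \<sigma>" and th: "\<theta> s \<le> ennreal t"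
    and \<alpha>\<omega>: "\<alpha> < (1/t - 1/\<sigma>) / (1/2 - 1/\<sigma>) / 2"
  shows "\<exists>C>0. \<forall>n\<ge>2. width n \<le> ennreal (C * rate ((real CARD('d) - 1) * (2 * \<alpha> / \<sigma>)) n)"
proof -
  define \<omega> where "\<omega> = (1/t - 1/\<sigma>) / (1/2 - 1/\<sigma>)"
  define B where "B = real CARD('d) - 1"
  \<comment> \<open>With this exponent the powers of j + 1 in the gain cancel, so that the gain on
    the critical level is of constant order.\<close>
  define \<gamma> where "\<gamma> = 2 * B / \<sigma>"
  have B: "B \<ge> 0" by (simp add: B_def)
  have \<gamma>: "\<gamma> \<ge> 0" using B s2 by (simp add: \<gamma>_def)
  have \<omega>: "\<omega> > 0" using \<alpha>\<omega> alpha_pos unfolding \<omega>_def[symmetric] by linarith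
  \<comment> \<open>With levels counted downwards from j, e <= 1 keeps at least one vector on each
    level above j div 2, and the second bound keeps \<delta> positive.\<close>
  define e where "e = min 1 ((\<omega>/2 - \<alpha>) / \<omega>)"
  define \<delta> where "\<delta> = \<omega>/2 - \<alpha> - e * \<omega>/2"
  have e0: "e > 0" using \<alpha>\<omega> \<omega> unfolding e_def \<omega>_def[symmetric] by auto
  have e1: "e \<le> 1" unfolding e_def by (rule min.cobounded1)
  have \<delta>: "\<delta> > 0"
  proof -
    have "e * \<omega> \<le> (\<omega>/2 - \<alpha>) / \<omega> * \<omega>" unfolding e_def using \<omega> by (intro mult_right_mono) auto
    also have "\<dots> = \<omega>/2 - \<alpha>" using \<omega> by simp
    finally show ?thesis using \<alpha>\<omega> unfolding \<omega>_def[symmetric] \<delta>_def by linarith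
  qed
  obtain C0 where C0: "C0 > 0" "\<And>n j0 j1 (nn :: nat \<Rightarrow> nat). j0 \<le> j1 \<Longrightarrow> (\<forall>j\<in>{j0<..j1}. nn j \<ge> 1) \<Longrightarrow>
     C0 * (2 ^ j0 * (real j0 + 1) ^ (CARD('d) - 1)) + (\<Sum>j\<in>{j0<..j1}. real (nn j)) \<le> real n \<Longrightarrow>
     width n \<le> ennreal (C0 * ((\<Sum>j\<in>{j0<..j1}. decay j * gain j (nn j) powr \<omega>) + decay j1))"
    using width_upper_rand[OF t th] unfolding \<omega>_def by blast
  obtain G1 where G1: "G1 > 0" "\<And>J. finite J \<Longrightarrow> (\<Sum>i\<in>J. (real i + 1) powr 0 * 2 powr (- e * real i)) \<le> G1"
    using sum_polynomial_exponential_bound[OF e0 order_refl] by blast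
  obtain G2 where G2: "G2 > 0" "\<And>J. finite J \<Longrightarrow> (\<Sum>i\<in>J. (real i + 1) powr 0 * 2 powr (- \<delta> * real i)) \<le> G2"
    using sum_polynomial_exponential_bound[OF \<delta> order_refl] by blast
  obtain G3 where G3: "G3 > 0" "\<And>x. x \<ge> 0 \<Longrightarrow> (x + 1) powr B * 2 powr (- (1/2) * x) \<le> G3"
    using polynomial_exponential_bound[OF _ B, of "1/2"] by auto
  define K where "K = C0 * (2 powr (\<omega>/2) * G2 + 1)"
  have K: "K > 0" using C0 G2 by (simp add: K_def add_pos_pos)
  show ?thesis
  proof (rule upper_rate[OF _ \<gamma> K])
    show "C0 * G3 + G1 > 0" using C0 G1 G3 by (simp add: add_pos_pos)
    fix j n
    assume n: "(C0 * G3 + G1) * (2 ^ j * (real j + 1) powr \<gamma>) \<le> real n"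
    define P where "P = 2 powr real j * (real j + 1) powr \<gamma>"
    have P: "P \<ge> 2 powr real j"
    proof -
      have "(real j + 1) powr \<gamma> \<ge> 1" using \<gamma> by (intro ge_one_powr_ge_zero) auto
      from mult_left_mono[OF this, of "2 powr real j"] show ?thesis by (simp add: P_def)
    qed
    have P0: "P > 0" by (simp add: P_def)
    define Z where "Z = (\<lambda>i. P * 2 powr (- e * (real j - real i)))"
    define nn where "nn = (\<lambda>i. nat \<lfloor>Z i\<rfloor>)"
    \<comment> \<open>Keeping the levels up to j div 2 takes about 2^(j/2) frequencies up to a power
      of j, which is a negligible part of n.\<close>
    let ?j0 = "j div 2"
    let ?I = "{?j0<..j}"
    have Z1: "Z i \<ge> 1" if i: "i \<in> ?I" for i
    proof -
      have "e * (real j - real i) \<le> 1 * real j" using i e0 e1 by (intro mult_mono) auto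
      then have "0 \<le> real j + - e * (real j - real i)" by simp
      then have "2 powr 0 \<le> 2 powr (real j + - e * (real j - real i))" by (intro powr_mono) auto
      also have "\<dots> = 2 powr real j * 2 powr (- e * (real j - real i))" by (rule powr_add)
      also have "\<dots> \<le> Z i" unfolding Z_def using P by (intro mult_right_mono) auto
      finally show ?thesis by simp
    qed
    have inj: "inj_on (\<lambda>i. j - i) ?I" by (intro inj_onI) auto
    have "(\<Sum>i\<in>?I. real (nn i)) \<le> (\<Sum>i\<in>?I. P * ((real (j - i) + 1) powr 0 * 2 powr (- e * real (j - i))))"
    proof (rule sum_mono)
      fix i assume i: "i \<in> ?I"
      have "real (nn i) \<le> Z i" using Z1[OF i] unfolding nn_def by linarith
      also have "Z i = P * ((real (j - i) + 1) powr 0 * 2 powr (- e * real (j - i)))" using i by (simp add: Z_def of_nat_diff)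
      finally show "real (nn i) \<le> P * ((real (j - i) + 1) powr 0 * 2 powr (- e * real (j - i)))" .
    qed
    also have "\<dots> = P * (\<Sum>i\<in>(\<lambda>i. j - i) ` ?I. (real i + 1) powr 0 * 2 powr (- e * real i))"
      by (simp only: sum_distrib_left[symmetric] sum.reindex[OF inj] o_def)
    also have "\<dots> \<le> P * G1" using P0 by (intro mult_left_mono G1) auto
    finally have c1: "(\<Sum>i\<in>?I. real (nn i)) \<le> P * G1" .
    have low: "2 ^ ?j0 * (real ?j0 + 1) ^ (CARD('d) - 1) \<le> G3 * P"
    proof -
      have "(real ?j0 + 1) ^ (CARD('d) - 1) = (real ?j0 + 1) powr B"
        by (simp add: B_def of_nat_diff flip: powr_realpow)
      also have "\<dots> \<le> (real j + 1) powr B" using B by (intro powr_mono2) (auto simp: of_nat_mono)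
      finally have "2 ^ ?j0 * (real ?j0 + 1) ^ (CARD('d) - 1) \<le> 2 powr real ?j0 * (real j + 1) powr B"
        by (simp add: powr_realpow)
      also have "\<dots> \<le> 2 powr (real j / 2) * (real j + 1) powr B"
      proof (intro mult_right_mono powr_mono)
        have "2 * (j div 2) \<le> j" by simp
        then show "real ?j0 \<le> real j / 2" by linarith
      qed auto
      also have "\<dots> = 2 powr real j * ((real j + 1) powr B * 2 powr (- (1/2) * real j))"
        by (simp add: mult.commute mult.left_commute powr_add[symmetric])
      also have "\<dots> \<le> 2 powr real j * G3" by (intro mult_left_mono G3) auto
      also have "\<dots> \<le> G3 * P" using P G3(1) by (simp add: mult.commute mult_left_mono)
      finally show ?thesis .
    qed
    have "C0 * (2 ^ ?j0 * (real ?j0 + 1) ^ (CARD('d) - 1)) \<le> C0 * (G3 * P)" using C0(1) by (intro mult_left_mono low) auto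
    moreover have "C0 * (G3 * P) + P * G1 \<le> real n" using n by (simp add: P_def powr_realpow algebra_simps)
    ultimately have cnt: "C0 * (2 ^ ?j0 * (real ?j0 + 1) ^ (CARD('d) - 1)) + (\<Sum>i\<in>?I. real (nn i)) \<le> real n"
      using c1 by linarith
    have "width n \<le> ennreal (C0 * ((\<Sum>i\<in>?I. decay i * gain i (nn i) powr \<omega>) + decay j))"
      by (rule C0(2)[OF _ _ cnt]) (use Z1 in \<open>force simp: nn_def le_nat_iff\<close>)+
    also have "\<dots> \<le> ennreal (C0 * ((2 powr (\<omega>/2) * G2 + 1) * decay j))"
    proof (intro ennreal_leI mult_left_mono)
      have "(\<Sum>i\<in>?I. decay i * gain i (nn i) powr \<omega>)
        \<le> (\<Sum>i\<in>?I. (2 powr (\<omega>/2) * decay j) * ((real (j - i) + 1) powr 0 * 2 powr (- \<delta> * real (j - i))))"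
      proof (rule sum_mono)
        fix i assume i: "i \<in> ?I"
        define k where "k = real (j - i)"
        have k: "k \<ge> 0" "real i = real j - k" "real j - real i = k" "real i - real j = - k" using i by (auto simp: k_def of_nat_diff)
        have "gain i (nn i) powr \<omega> \<le> 2 powr (\<omega>/2) * 2 powr ((real i - real j + e * (real j - real i)) * \<omega>/2) * (real j + 1) powr (- \<gamma> * \<omega>/2)
           * (real i + 1) powr (B * \<omega> / \<sigma>)"
          unfolding nn_def B_def by (rule gain_floor_powr_le) (use Z1[OF i] \<omega> in \<open>auto simp: Z_def P_def B_def\<close>)
        also have "\<dots> \<le> 2 powr (\<omega>/2) * 2 powr ((real i - real j + e * (real j - real i)) * \<omega>/2) * (real j + 1) powr (- \<gamma> * \<omega>/2)
           * (real j + 1) powr (B * \<omega> / \<sigma>)"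
          using i B \<omega> s2 by (intro mult_left_mono powr_mono2) auto
        also have "\<dots> = 2 powr (\<omega>/2) * 2 powr ((- k + e * k) * \<omega>/2) * ((real j + 1) powr (- \<gamma> * \<omega>/2) * (real j + 1) powr (B * \<omega> / \<sigma>))"
          by (simp only: k(3,4) mult.assoc)
        also have "(real j + 1) powr (- \<gamma> * \<omega>/2) * (real j + 1) powr (B * \<omega> / \<sigma>) = 1"
          by (subst powr_add[symmetric]) (simp add: \<gamma>_def)
        finally have g: "gain i (nn i) powr \<omega> \<le> 2 powr (\<omega>/2) * 2 powr ((- k + e * k) * \<omega>/2)" by simp
        have ex: "decay i * 2 powr ((- k + e * k) * \<omega>/2) = decay j * 2 powr (- \<delta> * k)"
          by (simp add: k(2) \<delta>_def powr_add[symmetric] algebra_simps add_divide_distrib diff_divide_distrib)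
        have "decay i * gain i (nn i) powr \<omega> \<le> decay i * (2 powr (\<omega>/2) * 2 powr ((- k + e * k) * \<omega>/2))"
          by (rule mult_left_mono[OF g]) simp
        also have "\<dots> = (decay i * 2 powr ((- k + e * k) * \<omega>/2)) * 2 powr (\<omega>/2)" by (simp only: mult_ac)
        also have "\<dots> = (2 powr (\<omega>/2) * decay j) * ((k + 1) powr 0 * 2 powr (- \<delta> * k))"
          unfolding ex using k(1) by (simp add: mult_ac)
        finally show "decay i * gain i (nn i) powr \<omega> \<le> (2 powr (\<omega>/2) * decay j) * ((real (j - i) + 1) powr 0 * 2 powr (- \<delta> * real (j - i)))"
          unfolding k_def .
      qed
      also have "\<dots> = (2 powr (\<omega>/2) * decay j) * (\<Sum>i\<in>(\<lambda>i. j - i) ` ?I. (real i + 1) powr 0 * 2 powr (- \<delta> * real i))"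
        by (simp only: sum_distrib_left[symmetric] sum.reindex[OF inj] o_def)
      also have "\<dots> \<le> (2 powr (\<omega>/2) * decay j) * G2"
        by (intro mult_left_mono G2) auto
      finally have "(\<Sum>i\<in>?I. decay i * gain i (nn i) powr \<omega>) \<le> (2 powr (\<omega>/2) * G2) * decay j"
        by (simp only: mult_ac)
      then show "(\<Sum>i\<in>?I. decay i * gain i (nn i) powr \<omega>) + decay j \<le> (2 powr (\<omega>/2) * G2 + 1) * decay j"
        by (simp only: distrib_right mult_1_left add_right_mono)
    qed (use C0 in simp)
    also have "decay j = decay j * (real j + 1) powr ((real CARD('d) - 1) * (2 * \<alpha> / \<sigma>) - \<alpha> * \<gamma>)"
    proof -
      have "b * (2 * a / u) - a * (2 * b / u) = 0" for a b u :: real by simp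
      then have "(real CARD('d) - 1) * (2 * \<alpha> / \<sigma>) - \<alpha> * \<gamma> = 0" unfolding \<gamma>_def B_def .
      moreover have "real j + 1 \<noteq> 0" by linarith
      ultimately show ?thesis by (simp only: powr_zero_eq_one if_False mult_1_right)
    qed
    finally show "width n \<le> ennreal (K * (decay j * (real j + 1) powr ((real CARD('d) - 1) * (2 * \<alpha> / \<sigma>) - \<alpha> * \<gamma>)))"
      by (simp only: K_def mult.assoc)
  qed
qed

lemma width_upper_weak_summability:
  assumes th: "ennreal \<sigma> \<le> \<theta> s"
  shows "\<exists>C>0. \<forall>n\<ge>2. width n \<le> ennreal (C * rate ((real CARD('d) - 1) * (\<alpha> + 1/\<sigma> - recip (\<theta> s))) n)"
proof -
  let ?B = "real CARD('d) - 1"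
  obtain C where C: "C > 0" "\<And>n j. C * (2 ^ j * (real j + 1) ^ (CARD('d) - 1)) \<le> real n \<Longrightarrow>
    width n \<le> ennreal (C * (decay j * (real j + 1) powr (?B * (1/\<sigma> - recip (\<theta> s)))))"
    using width_upper_direct[OF th] by blast
  have e: "?B * (\<alpha> + 1/\<sigma> - recip (\<theta> s)) - \<alpha> * ?B = ?B * (1/\<sigma> - recip (\<theta> s))" by (simp add: algebra_simps)
  have p: "(real j + 1) powr ?B = (real j + 1) ^ (CARD('d) - 1)" for j
    by (simp add: of_nat_diff flip: powr_realpow)
  show ?thesis
    by (rule upper_rate[OF C(1) _ C(1), where \<gamma> = ?B]) (simp, unfold e p, rule C(2))
qed

section \<open>Matching lower bounds\<close>

lemma levelset_not_empty [simp]: "(blocks j) \<noteq> {}"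
  using levelset_nonempty[where 'd = 'd, of j] by (metis card.empty not_one_le_zero)

lemma nblocks_bounds:
  "real (card (blocks j)) \<le> (real j + 1) powr (real CARD('d) - 1)"
  "real CARD('d) powr (- (real CARD('d) - 1)) * (real j + 1) powr (real CARD('d) - 1) \<le> real (card (blocks j))"
proof -
  have p: "u ^ (CARD('d) - 1) = u powr (real CARD('d) - 1)" if "u > 0" for u :: real
    using that by (simp add: of_nat_diff flip: powr_realpow)
  have "real (card (blocks j)) \<le> real ((j + 1) ^ (CARD('d) - 1))"
    using card_levelset_le[where 'd = 'd, of j] by (simp only: of_nat_le_iff)
  then show "real (card (blocks j)) \<le> (real j + 1) powr (real CARD('d) - 1)"
    by (simp add: p[symmetric] add.commute)
  have "((real j + 1) / real CARD('d)) ^ (CARD('d) - 1) \<le> real (card (blocks j))" by (rule card_levelset_ge)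
  then show "real CARD('d) powr (- (real CARD('d) - 1)) * (real j + 1) powr (real CARD('d) - 1) \<le> real (card (blocks j))"
  proof (subst (asm) p)
    have "(a / b) powr u = b powr (- u) * a powr u" if "a > 0" "b > 0" for a b u :: real
      using that by (simp add: powr_divide powr_minus_divide)
    from this[of "real j + 1" "real CARD('d)" "real CARD('d) - 1"]
    have "((real j + 1) / real CARD('d)) powr (real CARD('d) - 1) = real CARD('d) powr (- (real CARD('d) - 1)) * (real j + 1) powr (real CARD('d) - 1)"
      by simp
    then show "((real j + 1) / real CARD('d)) powr (real CARD('d) - 1) \<le> real (card (blocks j)) \<Longrightarrow> ?thesis" by (simp only:)
  qed simp
qed

lemma nblocks_powr_ge:
  "\<exists>c>0. \<forall>j. c * (real j + 1) powr ((real CARD('d) - 1) * e) \<le> real (card (blocks j)) powr e"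
proof -
  let ?B = "real CARD('d) - 1"
  define c where "c = real CARD('d) powr (- ?B)"
  have c: "c > 0" by (simp add: c_def)
  have "min (c powr e) (1 powr e) * (real j + 1) powr (?B * e) \<le> real (card (blocks j)) powr e" for j
  proof -
    let ?K = "real (card (blocks j))" and ?x = "(real j + 1) powr ?B"
    have x: "?x > 0" by simp
    have y: "c \<le> ?K / ?x" "?K / ?x \<le> 1" using nblocks_bounds[of j] x by (auto simp: c_def field_simps)
    have "min (c powr e) (1 powr e) * ?x powr e \<le> (?K / ?x) powr e * ?x powr e"
      by (intro mult_right_mono powr_between(1)[OF c y]) simp
    also have "\<dots> = ?K powr e" using x by (simp add: powr_mult[symmetric])
    finally show ?thesis by (simp add: powr_powr)
  qed
  moreover have "min (c powr e) (1 powr e) > 0" using c by simp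
  ultimately show ?thesis by blast
qed

text \<open>For \<theta> <= 2 single blocks give the bound, for \<theta> > 2 all blocks of a level
  together; this explains max \<theta> 2. In both cases j is a level with about n
  frequencies.\<close>

lemma width_lower_large_smoothness:
  "\<exists>c>0. \<forall>n\<ge>2. ennreal (c * rate ((real CARD('d) - 1) * (\<alpha> + 1/\<sigma> - recip (max (\<theta> s) 2))) n) \<le> width n"
proof -
  let ?B = "real CARD('d) - 1" and ?e = "1/\<sigma> - recip (max (\<theta> s) 2)"
  let ?K = "\<lambda>j. real (card (blocks j))"
  have B: "?B \<ge> 0" by simp
  have e: "?B * (\<alpha> + 1/\<sigma> - recip (max (\<theta> s) 2)) - \<alpha> * ?B = ?B * ?e" by (simp add: algebra_simps)
  obtain c0 where c0: "c0 > 0" "\<And>j n. 16 * real n < ?K j * 2 ^ j \<Longrightarrow> ennreal (c0 * decay j * ?K j powr ?e) \<le> width n"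
  proof (cases "\<theta> s \<le> 2")
    case True
    obtain c where c: "c > 0" "\<And>j n \<epsilon>. 0 < \<epsilon> \<Longrightarrow> \<epsilon> \<le> 1/2 \<Longrightarrow> 4 * real n * (1 + 2 * ?K j powr (1/2 - 1/\<sigma>) * \<epsilon>)\<^sup>2 < ?K j * 2 ^ j \<Longrightarrow>
      ennreal (c * \<epsilon> * decay j) \<le> width n" using width_lower_single by blast
    have r: "?e = 1/\<sigma> - 1/2" using True recip_ennreal[of 2] by (simp add: max_absorb2)
    have "ennreal (c / 2 * decay j * ?K j powr ?e) \<le> width n" if n: "16 * real n < ?K j * 2 ^ j" for j n
    proof -
      \<comment> \<open>The value for which 1 + 2 K^(1/2 - 1/\<sigma>) \<epsilon> = 2, so that n may
        be a constant multiple of the number of frequencies.\<close>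
      let ?\<epsilon> = "1/2 * ?K j powr (1/\<sigma> - 1/2)"
      have K1: "?K j \<ge> 1" by (rule nblocks_ge_1)
      have "x powr u \<le> 1" if "x \<ge> 1" "u \<le> 0" for x u :: real using powr_mono[of u 0 x] that by simp
      from this[OF K1, of "1/\<sigma> - 1/2"] have h: "?\<epsilon> \<le> 1/2" using s2 by (simp add: field_simps)
      have "?K j powr (1/2 - 1/\<sigma>) * ?K j powr (1/\<sigma> - 1/2) = 1" using K1 by (simp add: powr_add[symmetric])
      then have "1 + 2 * ?K j powr (1/2 - 1/\<sigma>) * ?\<epsilon> = 2" by simp
      then have "4 * real n * (1 + 2 * ?K j powr (1/2 - 1/\<sigma>) * ?\<epsilon>)\<^sup>2 < ?K j * 2 ^ j" using n by (simp only:) simp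
      from c(2)[OF _ h this] show ?thesis using K1 by (simp add: r mult_ac)
    qed
    then show ?thesis using c(1) by (intro that[of "c/2"]) simp_all
  next
    case False
    obtain c where c: "c > 0" "\<And>j n. 2 * real n \<le> ?K j * 2 ^ j \<Longrightarrow> ennreal (c * decay j * ?K j powr (1/\<sigma> - recip (\<theta> s))) \<le> width n"
      using width_lower_full by blast
    have r: "max (\<theta> s) 2 = \<theta> s" using False by (simp add: max_absorb1)
    show ?thesis by (rule that[OF c(1)]) (unfold r, rule c(2), simp)
  qed
  obtain c1 where c1: "c1 > 0" "\<And>j. c1 * (real j + 1) powr (?B * ?e) \<le> ?K j powr ?e" using nblocks_powr_ge by blast
  obtain c2 where c2: "c2 > 0" "\<And>j. c2 * (real j + 1) powr (?B * 1) \<le> ?K j powr 1" using nblocks_powr_ge by blast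
  show ?thesis
  \<comment> \<open>17 in place of 16 makes the required inequality strict, also for n = 0.\<close>
  proof (rule lower_rate[OF _ B, of "c2 / 17" "c0 * c1"])
    fix j n assume n: "real n \<le> c2 / 17 * (2 ^ j * (real j + 1) powr ?B)"
    have K1: "?K j \<ge> 1" by (rule nblocks_ge_1)
    have "2 ^ j * (c2 * (real j + 1) powr ?B) \<le> 2 ^ j * ?K j" using c2(2)[of j] K1 by (intro mult_left_mono) auto
    moreover have "17 * real n \<le> 2 ^ j * (c2 * (real j + 1) powr ?B)" using n by (simp add: mult_ac)
    ultimately have "17 * real n \<le> 2 ^ j * ?K j" by linarith
    then have "17 * real n \<le> ?K j * 2 ^ j" by (subst mult.commute)
    moreover have "?K j * 2 ^ j > 0" using K1 by simp
    ultimately have "16 * real n < ?K j * 2 ^ j" by linarith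
    then have w: "ennreal (c0 * decay j * ?K j powr ?e) \<le> width n" by (rule c0(2))
    have "c0 * decay j * (c1 * (real j + 1) powr (?B * ?e)) \<le> c0 * decay j * ?K j powr ?e"
      using c0(1) by (intro mult_left_mono c1) auto
    moreover have "c0 * decay j * (c1 * (real j + 1) powr (?B * ?e)) = c0 * c1 * (decay j * (real j + 1) powr (?B * ?e))"
      by (simp only: mult_ac)
    ultimately have "c0 * c1 * (decay j * (real j + 1) powr (?B * ?e)) \<le> c0 * decay j * ?K j powr ?e" by linarith
    from order_trans[OF ennreal_leI[OF this] w]
    show "ennreal (c0 * c1 * (decay j * (real j + 1) powr (?B * (\<alpha> + 1/\<sigma> - recip (max (\<theta> s) 2)) - \<alpha> * ?B))) \<le> width n"
      unfolding e .
  qed (use c0 c1 c2 in simp_all)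
qed

text \<open>Single blocks with the constant \<epsilon> = 1/2: then (1 + 2 K^(1/2 - 1/\<sigma>)
  \<epsilon>)^2 is of order K^(1 - 2/\<sigma>), so n may be of order 2^j K^(2/\<sigma>), while the
  error 2^(-\<alpha> j) carries no power of j.\<close>

lemma width_lower_small_smoothness:
  "\<exists>c>0. \<forall>n\<ge>2. ennreal (c * rate ((real CARD('d) - 1) * (2 * \<alpha> / \<sigma>)) n) \<le> width n"
proof -
  let ?B = "real CARD('d) - 1"
  let ?K = "\<lambda>j. real (card (blocks j))"
  define \<gamma> where "\<gamma> = ?B * (2 / \<sigma>)"
  have \<gamma>: "\<gamma> \<ge> 0" using s2 by (simp add: \<gamma>_def)
  have "b * (2 * a / u) - a * (b * (2 / u)) = 0" for a b u :: real by simp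
  then have e: "?B * (2 * \<alpha> / \<sigma>) - \<alpha> * \<gamma> = 0" unfolding \<gamma>_def .
  obtain c0 where c0: "c0 > 0" "\<And>j n \<epsilon>. 0 < \<epsilon> \<Longrightarrow> \<epsilon> \<le> 1/2 \<Longrightarrow> 4 * real n * (1 + 2 * ?K j powr (1/2 - 1/\<sigma>) * \<epsilon>)\<^sup>2 < ?K j * 2 ^ j \<Longrightarrow>
    ennreal (c0 * \<epsilon> * decay j) \<le> width n" using width_lower_single by blast
  obtain c2 where c2: "c2 > 0" "\<And>j. c2 * (real j + 1) powr (?B * (2/\<sigma>)) \<le> ?K j powr (2/\<sigma>)" using nblocks_powr_ge by blast
  show ?thesis
  proof (rule lower_rate[OF _ \<gamma>, of "c2 / 17" "c0 / 2"])
    fix j n assume n: "real n \<le> c2 / 17 * (2 ^ j * (real j + 1) powr \<gamma>)"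
    have K1: "?K j \<ge> 1" by (rule nblocks_ge_1)
    let ?X = "?K j powr (1/2 - 1/\<sigma>)"
    have X: "?X \<ge> 1" using K1 s2 by (intro ge_one_powr_ge_zero) (auto simp: field_simps)
    have "2 ^ j * (c2 * (real j + 1) powr \<gamma>) \<le> 2 ^ j * ?K j powr (2/\<sigma>)" unfolding \<gamma>_def using c2(2)[of j] by (intro mult_left_mono) auto
    moreover have "17 * real n \<le> 2 ^ j * (c2 * (real j + 1) powr \<gamma>)" using n by (simp add: mult_ac)
    ultimately have "17 * real n \<le> 2 ^ j * ?K j powr (2/\<sigma>)" by linarith
    moreover have "2 ^ j * ?K j powr (2/\<sigma>) > 0" using K1 by simp
    ultimately have lt: "16 * real n < 2 ^ j * ?K j powr (2/\<sigma>)" by linarith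
    have "?K j powr (2/\<sigma>) * ?X\<^sup>2 = ?K j"
    proof -
      have "?X\<^sup>2 = ?K j powr (1 - 2/\<sigma>)" by (simp add: power2_eq_square powr_add[symmetric])
      then have "?K j powr (2/\<sigma>) * ?X\<^sup>2 = ?K j powr (2/\<sigma> + (1 - 2/\<sigma>))" by (simp only: powr_add)
      then show ?thesis using K1 by simp
    qed
    then have KX: "2 ^ j * ?K j powr (2/\<sigma>) * ?X\<^sup>2 = ?K j * 2 ^ j" by (simp add: mult.assoc mult.commute)
    have "4 * real n * (1 + 2 * ?X * (1/2))\<^sup>2 \<le> 4 * real n * (2 * ?X)\<^sup>2"
      using X by (intro mult_left_mono power_mono) auto
    also have "\<dots> = 16 * real n * ?X\<^sup>2" by (simp add: power2_eq_square)
    also have "\<dots> < 2 ^ j * ?K j powr (2/\<sigma>) * ?X\<^sup>2" using X by (intro mult_strict_right_mono lt) auto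
    finally have "4 * real n * (1 + 2 * ?X * (1/2))\<^sup>2 < ?K j * 2 ^ j" unfolding KX .
    from c0(2)[OF _ _ this] have "ennreal (c0 * (1/2) * decay j) \<le> width n" by simp
    moreover have "(real j + 1) powr 0 = 1" by simp
    ultimately show "ennreal (c0 / 2 * (decay j * (real j + 1) powr (?B * (2 * \<alpha> / \<sigma>) - \<alpha> * \<gamma>))) \<le> width n"
      unfolding e by simp
  qed (use c0 c2 in simp_all)
qed

end

theorem theorem1:
  fixes \<eta>0 :: "real \<Rightarrow> real"
    and s :: nat
    and q \<sigma> l :: real
    and r :: "nat \<Rightarrow> real"
    and p \<theta> :: "nat \<Rightarrow> ennreal"
  assumes "smooth_cutoff \<eta>0"
    and "s \<ge> 1" and "q > 2" and "\<sigma> > 2" and "l > 0"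
    and "\<And>j. j \<in> {1..s} \<Longrightarrow> r j > 0"
    and "\<And>j. j \<in> {1..s} \<Longrightarrow> ennreal q \<le> p j"
    and "\<And>j. j \<in> {1..s} \<Longrightarrow> 1 \<le> \<theta> j"
    and "r s - l > 0"
    and "strict_mono_on {1..s} (\<lambda>j. r j - l)"
    and "strict_antimono_on {1..s} (\<lambda>j. r j - l - recip (p j))"
    and "\<theta> s < ennreal \<sigma> \<Longrightarrow> r s - l \<noteq> omega (\<theta> s) \<sigma> / 2"
  shows "\<exists>c C :: real. 0 < c \<and> c \<le> C \<and>
    (\<forall>n::nat \<ge> 2.
       let rate = real n powr (- (r s - l)) *
                  log 2 (real n) powr ((real CARD('d) - 1) * beta_exponent (r s - l) (\<theta> s) \<sigma>);
           width = besov_width \<eta>0 (\<chi> i. l) (ennreal q) (ennreal \<sigma>)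
                     (\<Inter>j\<in>{1..s}. besov_ball \<eta>0 (\<chi> i. r j) (p j) (\<theta> j) :: (real ^ 'd \<Rightarrow> complex) set) n
       in ennreal (c * rate) \<le> width \<and> width \<le> ennreal (C * rate))"
proof -
  define M :: "(real ^ 'd \<Rightarrow> complex) set" where "M = (\<Inter>j\<in>{1..s}. besov_ball \<eta>0 (\<chi> i. r j) (p j) (\<theta> j))"
  interpret besov_data \<eta>0 s q \<sigma> l r p \<theta> M
  proof
    fix j assume "j \<in> {1..<s}"
    then show "r j < r s" using strict_mono_onD[OF assms(10), of j s] by simp
  qed (use assms in \<open>simp_all add: M_def\<close>)
  let ?B = "real CARD('d) - 1" and ?\<beta> = "beta_exponent \<alpha> (\<theta> s) \<sigma>" and ?\<omega> = "omega (\<theta> s) \<sigma>"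
  have th1': "1 \<le> \<theta> s" using assms(8)[of s] assms(2) by simp
  have lower: "\<exists>c>0. \<forall>n\<ge>2. ennreal (c * rate (?B * ?\<beta>) n) \<le> width n"
    using width_lower_large_smoothness width_lower_small_smoothness by (simp add: beta_exponent_def)
  have upper: "\<exists>C>0. \<forall>n\<ge>2. width n \<le> ennreal (C * rate (?B * ?\<beta>) n)"
  proof (cases "ennreal \<sigma> \<le> \<theta> s")
    case True
    have two: "(2::ennreal) \<le> ennreal \<sigma>" using ennreal_leI[of 2 \<sigma>] s2 by simp
    have two': "(2::ennreal) < ennreal \<sigma>" using ennreal_lessI[of \<sigma> 2] s2 by simp
    \<comment> \<open>At \<theta> = \<sigma> the interpolation formula vanishes as well. As \<alpha>
      > 0, the first case of \<open>beta_exponent\<close> applies.\<close>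
    have "?\<omega> = 0"
    proof (cases "\<theta> s = ennreal \<sigma>")
      case True
      then show ?thesis using s2 two' by (simp add: omega_def recip_ennreal)
    next
      case False
      then have "\<theta> s > ennreal \<sigma>" using True by simp
      then show ?thesis by (simp add: omega_def)
    qed
    moreover have "max (\<theta> s) 2 = \<theta> s" using two True by (intro max_absorb1) (rule order_trans)
    ultimately have "?\<beta> = \<alpha> + 1/\<sigma> - recip (\<theta> s)" using alpha_pos by (simp add: beta_exponent_def)
    then show ?thesis using width_upper_weak_summability[OF True] by simp
  next
    case False
    \<comment> \<open>The unit ball of l_\<theta> lies in that of l_t, and t >= 2 is what the
      passage to the Euclidean norm of the large blocks requires. The value of \<omega> is the same
      for t as for \<theta>.\<close>
    define t where "t = max (enn2real (\<theta> s)) 2"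
    have fin: "\<theta> s < top" using False by (simp add: not_le) (metis ennreal_less_top less_trans)
    then have thr: "\<theta> s = ennreal (enn2real (\<theta> s))" by simp
    have lt: "enn2real (\<theta> s) < \<sigma>" using False by (subst (asm) thr) (simp add: not_le ennreal_less_iff)
    have t: "2 \<le> t" "t < \<sigma>" "\<theta> s \<le> ennreal t"
      using lt s2 by (auto simp: t_def) (subst thr, rule ennreal_leI, simp)
    have mx: "recip (max (\<theta> s) 2) = 1/t" and om: "?\<omega> = (1/t - 1/\<sigma>) / (1/2 - 1/\<sigma>)"
    proof -
      have m2: "max (\<theta> s) 2 = ennreal t"
        using thr by (metis ennreal_numeral max_of_mono mono_def ennreal_leI t_def)
      then show mx: "recip (max (\<theta> s) 2) = 1/t" using t by (simp add: recip_ennreal)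
      show "?\<omega> = (1/t - 1/\<sigma>) / (1/2 - 1/\<sigma>)"
      proof (cases "\<theta> s > 2")
        case True
        moreover have "\<not> ennreal \<sigma> < \<theta> s" using False by simp
        ultimately show ?thesis using mx by (simp add: omega_def max_absorb1 less_imp_le)
      next
        case h: False
        then have "ennreal t = ennreal 2" using m2 by (simp add: max_absorb2 not_less)
        then have "t = 2" using t by (subst (asm) ennreal_inj) auto
        moreover have "1/2 - 1/\<sigma> \<noteq> 0" using s2 by (simp add: field_simps)
        moreover have "\<not> ennreal \<sigma> < \<theta> s" using False by simp
        ultimately show ?thesis using h by (simp add: omega_def)
      qed
    qed
    show ?thesis
    proof (cases "\<alpha> > ?\<omega> / 2")
      case True
      then show ?thesis using width_upper_large_smoothness[OF t] by (simp add: beta_exponent_def mx om)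
    next
      case h: False
      \<comment> \<open>The excluded borderline case; here \<theta> < \<sigma>, so the exclusion
        applies.\<close>
      have "\<alpha> \<noteq> ?\<omega> / 2" using assms(12) False by simp
      then show ?thesis using h width_upper_small_smoothness[OF t] by (simp add: beta_exponent_def om)
    qed
  qed
  obtain c C where c: "c > 0" "\<And>n. n \<ge> 2 \<Longrightarrow> ennreal (c * rate (?B * ?\<beta>) n) \<le> width n"
    and C: "C > 0" "\<And>n. n \<ge> 2 \<Longrightarrow> width n \<le> ennreal (C * rate (?B * ?\<beta>) n)"
    using lower upper by blast
  have "width n \<le> ennreal (max c C * rate (?B * ?\<beta>) n)" if "n \<ge> 2" for n
  proof -
    have "width n \<le> ennreal (C * rate (?B * ?\<beta>) n)" by (rule C(2)[OF that])
    also have "\<dots> \<le> ennreal (max c C * rate (?B * ?\<beta>) n)"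
      using rate_pos[OF that, of "?B * ?\<beta>"] by (intro ennreal_leI mult_right_mono) auto
    finally show ?thesis .
  qed
  then show ?thesis using c by (intro exI[of _ c] exI[of _ "max c C"]) (simp add: Let_def rate_def M_def)
qed

end
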